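(* Let $d\ge 1$, let $P\in\mathbb{C}[z_1,\dots,z_d]$ with $P\ne 0$, and let $\Omega\subset\mathbb{R}^d$ be open and $P(\theta)$-convex. Then $P(\theta)$ is surjective on $\mathscr{D}'_F(\Omega)$, i.e. for every $T\in\mathscr{D}'_F(\Omega)$ there is $S\in\mathscr{D}'_F(\Omega)$ with $P(\theta)S=T$ on $\Omega$.
   Context: Put $\theta_j=x_j\,\partial/\partial x_j$ for $j=1,\dots,d$ and $\theta^\alpha=\theta_1^{\alpha_1}\cdots\theta_d^{\alpha_d}$ for $\alpha\in\mathbb{N}_0^d$. For a polynomial $P(z)=\sum_\alpha c_\alpha z^\alpha$ with complex coefficients, the Euler operator is $P(\theta)=\sum_\alpha c_\alpha\theta^\alpha$, acting on distributions. Its transpose is $P(\theta^* )$, where $\theta_j^*\varphi=-\partial_j(x_j\varphi)=-\varphi-\theta_j\varphi$; thus $P(\theta^* )\varphi=P(-1-\theta_1,\dots,-1-\theta_d)\varphi$, and $(P(\theta)T)(\varphi)=T(P(\theta^* )\varphi)$ for distributions $T$ and test functions $\varphi$. $H^k$ ($k\in\mathbb{N}$) is the $L^2$-Sobolev space of order $k$ on $\mathbb{R}^d$, and for open $\omega\subset\mathbb{R}^d$, $H_0^k(\omega)$ is the closure of $\mathscr{D}(\omega)=C_c^\infty(\omega)$ in $H^k$. For functions in $H_0^k(\omega)$ (regarded as functions on $\mathbb{R}^d$), $P(\theta^* )$ acts in the sense of distributions on $\mathbb{R}^d$. The notation $\omega\subset\subset\Omega$ means that $\omega$ is open with compact closure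 contained in $\Omega$. An open set $\Omega\subset\mathbb{R}^d$ is called $P(\theta)$-convex if for every $k\in\mathbb{N}$ the following holds: for every $\omega_1\subset\subset\Omega$ there is $\omega_2\subset\subset\Omega$ such that for every $\omega\subset\subset\Omega$ and every $\varphi\in H_0^k(\omega)$ with $P(\theta^* )\varphi\in H_0^k(\omega_1)$ we have $\varphi\in H_0^k(\omega_2)$. $\mathscr{D}'_F(\Omega)$ is the space of distributions of finite order on $\Omega$. Equivalently $\mathscr{D}'_F(\Omega)=\bigcup_{k\in\mathbb{N}}\mathscr{D}'_k(\Omega)$, where $\mathscr{D}'_k(\Omega)$ is the set of $T\in\mathscr{D}'(\Omega)$ such that for all open $\omega\subset\subset\Omega$ the restriction $T|_\omega$ extends to a continuous linear functional on $H_0^k(\omega)$. *)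

theory Defs
  imports "HOL-Analysis.Analysis" "HOL-Library.Poly_Mapping"
begin

section \<open>Multi-indices and polynomials in commuting operators\<close>

text \<open>Multi-indices are \<open>'n \<Rightarrow>\<^sub>0 nat\<close>, and polynomials in \<open>CARD('n)\<close> variables are
  \<open>('n \<Rightarrow>\<^sub>0 nat) \<Rightarrow>\<^sub>0 complex\<close> (coefficients indexed by exponent vectors).\<close>

definition mdegree :: "('n::finite \<Rightarrow>\<^sub>0 nat) \<Rightarrow> nat" where
  "mdegree \<alpha> = (\<Sum>i\<in>UNIV. Poly_Mapping.lookup \<alpha> i)"

definition index_list :: "'n::finite list" where
  "index_list = (SOME is. distinct is \<and> set is = UNIV)"

text \<open>The operators \<open>A i\<close> to which this is applied commute on smooth functions, respectively
  on functionals tested against smooth functions, so the choice of enumeration is immaterial.\<close>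

definition op_monom :: "('n::finite \<Rightarrow> 'a \<Rightarrow> 'a) \<Rightarrow> ('n \<Rightarrow>\<^sub>0 nat) \<Rightarrow> 'a \<Rightarrow> 'a" where
  "op_monom A \<alpha> = fold (\<lambda>i. A i ^^ Poly_Mapping.lookup \<alpha> i) index_list"

lemma index_list: "distinct (index_list :: 'n::finite list)" "set (index_list :: 'n list) = UNIV"
proof -
  have "\<exists>is :: 'n list. distinct is \<and> set is = UNIV"
    using finite_distinct_list[of "UNIV :: 'n set"] by auto
  from someI_ex[OF this]
  show "distinct (index_list :: 'n list)" "set (index_list :: 'n list) = UNIV"
    by (auto simp: index_list_def)
qed

lemma finite_mdegree_le: "finite {\<alpha> :: 'n::finite \<Rightarrow>\<^sub>0 nat. mdegree \<alpha> \<le> k}"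
proof (rule finite_imageD)
  have "Poly_Mapping.lookup ` {\<alpha> :: 'n \<Rightarrow>\<^sub>0 nat. mdegree \<alpha> \<le> k} \<subseteq> UNIV \<rightarrow>\<^sub>E {..k}"
  proof (clarsimp simp: PiE_UNIV_domain)
    fix \<alpha> :: "'n \<Rightarrow>\<^sub>0 nat" and i :: 'n
    assume "mdegree \<alpha> \<le> k"
    moreover have "Poly_Mapping.lookup \<alpha> i \<le> mdegree \<alpha>"
      unfolding mdegree_def by (rule member_le_sum) auto
    ultimately show "Poly_Mapping.lookup \<alpha> i \<le> k" by simp
  qed
  moreover have "finite ((UNIV :: 'n set) \<rightarrow>\<^sub>E {..k})"
    by (rule finite_PiE) auto
  ultimately show "finite (Poly_Mapping.lookup ` {\<alpha> :: 'n \<Rightarrow>\<^sub>0 nat. mdegree \<alpha> \<le> k})"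
    by (rule finite_subset)
  show "inj_on Poly_Mapping.lookup {\<alpha> :: 'n \<Rightarrow>\<^sub>0 nat. mdegree \<alpha> \<le> k}"
    by (auto simp: inj_on_def lookup_inject)
qed


section \<open>Test functions and distributions\<close>

definition partial_deriv :: "'n::finite \<Rightarrow> (real^'n \<Rightarrow> complex) \<Rightarrow> real^'n \<Rightarrow> complex" where
  "partial_deriv i f = (\<lambda>x. frechet_derivative f (at x) (axis i 1))"

definition smooth :: "(real^'n::finite \<Rightarrow> complex) \<Rightarrow> bool" where
  "smooth f \<longleftrightarrow> (\<forall>is. fold partial_deriv is f differentiable_on UNIV)"

definition test_functions :: "(real^'n::finite) set \<Rightarrow> (real^'n \<Rightarrow> complex) set" where
  "test_functions \<Omega> = {\<phi>. smooth \<phi> \<and> compact (closure {x. \<phi> x \<noteq> 0}) \<and> closure {x. \<phi> x \<noteq> 0} \<subseteq> \<Omega>}"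

text \<open>A distribution on \<open>\<Omega>\<close> is represented by a functional on all functions; only its
  values on \<open>test_functions \<Omega>\<close> are meaningful.\<close>

type_synonym 'n functional = "(real^'n \<Rightarrow> complex) \<Rightarrow> complex"

definition linear_on_test_functions :: "(real^'n::finite) set \<Rightarrow> 'n functional \<Rightarrow> bool" where
  "linear_on_test_functions \<Omega> T \<longleftrightarrow>
     (\<forall>\<phi>\<in>test_functions \<Omega>. \<forall>\<psi>\<in>test_functions \<Omega>. T (\<lambda>x. \<phi> x + \<psi> x) = T \<phi> + T \<psi>) \<and>
     (\<forall>c. \<forall>\<phi>\<in>test_functions \<Omega>. T (\<lambda>x. c * \<phi> x) = c * T \<phi>)"

text \<open>One order \<open>N\<close> serves all compact \<open>K \<subseteq> \<Omega>\<close>; for a general distribution \<open>N\<close> may depend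
  on \<open>K\<close>.\<close>

definition finite_order_distributions :: "(real^'n::finite) set \<Rightarrow> 'n functional set" where
  "finite_order_distributions \<Omega> = {T. linear_on_test_functions \<Omega> T \<and>
     (\<exists>N. \<forall>K. compact K \<and> K \<subseteq> \<Omega> \<longrightarrow> (\<exists>C. \<forall>\<phi>\<in>test_functions \<Omega>. closure {x. \<phi> x \<noteq> 0} \<subseteq> K \<longrightarrow>
        norm (T \<phi>) \<le> C * (\<Sum>\<alpha> | mdegree \<alpha> \<le> N. SUP x. norm (op_monom partial_deriv \<alpha> \<phi> x))))}"

definition dist_deriv :: "'n::finite \<Rightarrow> 'n functional \<Rightarrow> 'n functional" where
  "dist_deriv i T = (\<lambda>\<phi>. - T (partial_deriv i \<phi>))"

definition dist_coord :: "'n::finite \<Rightarrow> 'n functional \<Rightarrow> 'n functional" where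
  "dist_coord i T = (\<lambda>\<phi>. T (\<lambda>x. complex_of_real (x $ i) * \<phi> x))"

definition dist_theta :: "'n::finite \<Rightarrow> 'n functional \<Rightarrow> 'n functional" where
  "dist_theta i T = dist_coord i (dist_deriv i T)"

definition dist_theta_star :: "'n::finite \<Rightarrow> 'n functional \<Rightarrow> 'n functional" where
  "dist_theta_star i T = (\<lambda>\<phi>. - dist_deriv i (dist_coord i T) \<phi>)"

definition op_poly :: "('n::finite \<Rightarrow> 'n functional \<Rightarrow> 'n functional) \<Rightarrow>
    (('n \<Rightarrow>\<^sub>0 nat) \<Rightarrow>\<^sub>0 complex) \<Rightarrow> 'n functional \<Rightarrow> 'n functional" where
  "op_poly A P T = (\<lambda>\<phi>. \<Sum>\<alpha>\<in>Poly_Mapping.keys P. Poly_Mapping.lookup P \<alpha> * op_monom A \<alpha> T \<phi>)"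

definition euler_op :: "(('n::finite \<Rightarrow>\<^sub>0 nat) \<Rightarrow>\<^sub>0 complex) \<Rightarrow> 'n functional \<Rightarrow> 'n functional" where
  "euler_op = op_poly dist_theta"

definition euler_op_transpose ::
    "(('n::finite \<Rightarrow>\<^sub>0 nat) \<Rightarrow>\<^sub>0 complex) \<Rightarrow> 'n functional \<Rightarrow> 'n functional" where
  "euler_op_transpose = op_poly dist_theta_star"

definition dist_eq_on :: "(real^'n::finite) set \<Rightarrow> 'n functional \<Rightarrow> 'n functional \<Rightarrow> bool" where
  "dist_eq_on \<Omega> S T \<longleftrightarrow> (\<forall>\<phi>\<in>test_functions \<Omega>. S \<phi> = T \<phi>)"

definition dist_of :: "(real^'n::finite \<Rightarrow> complex) \<Rightarrow> 'n functional" where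
  "dist_of f = (\<lambda>\<phi>. LINT x|lborel. f x * \<phi> x)"


section \<open>Sobolev spaces\<close>

text \<open>Elements of \<open>L\<^sup>2\<close> and of the Sobolev spaces are functions rather than classes modulo
  null sets.\<close>

definition L2 :: "(real^'n::finite \<Rightarrow> complex) set" where
  "L2 = {f. f \<in> borel_measurable lborel \<and> integrable lborel (\<lambda>x. (norm (f x))\<^sup>2)}"

definition is_weak_deriv ::
    "('n::finite \<Rightarrow>\<^sub>0 nat) \<Rightarrow> (real^'n \<Rightarrow> complex) \<Rightarrow> (real^'n \<Rightarrow> complex) \<Rightarrow> bool" where
  "is_weak_deriv \<alpha> f g \<longleftrightarrow> dist_eq_on UNIV (op_monom dist_deriv \<alpha> (dist_of f)) (dist_of g)"

definition sobolev :: "nat \<Rightarrow> (real^'n::finite \<Rightarrow> complex) set" where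
  "sobolev k = {f\<in>L2. \<forall>\<alpha>. mdegree \<alpha> \<le> k \<longrightarrow> (\<exists>g\<in>L2. is_weak_deriv \<alpha> f g)}"

definition weak_deriv :: "('n::finite \<Rightarrow>\<^sub>0 nat) \<Rightarrow> (real^'n \<Rightarrow> complex) \<Rightarrow> real^'n \<Rightarrow> complex" where
  "weak_deriv \<alpha> f = (SOME g. g \<in> L2 \<and> is_weak_deriv \<alpha> f g)"

definition sobolev_norm :: "nat \<Rightarrow> (real^'n::finite \<Rightarrow> complex) \<Rightarrow> real" where
  "sobolev_norm k f =
     sqrt (\<Sum>\<alpha> | mdegree \<alpha> \<le> k. LINT x|lborel. (norm (weak_deriv \<alpha> f x))\<^sup>2)"

definition sobolev0 :: "nat \<Rightarrow> (real^'n::finite) set \<Rightarrow> (real^'n \<Rightarrow> complex) set" where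
  "sobolev0 k \<omega> = {f\<in>sobolev k. \<exists>\<Phi>. (\<forall>n. \<Phi> n \<in> test_functions \<omega>) \<and>
     (\<lambda>n. sobolev_norm k (\<lambda>x. f x - \<Phi> n x)) \<longlonglongrightarrow> 0}"


section \<open>Convexity with respect to an Euler operator\<close>

definition rel_compact_in :: "(real^'n::finite) set \<Rightarrow> (real^'n) set \<Rightarrow> bool"
    (infix \<open>\<subset>\<subset>\<close> 50) where
  "\<omega> \<subset>\<subset> \<Omega> \<longleftrightarrow> open \<omega> \<and> compact (closure \<omega>) \<and> closure \<omega> \<subseteq> \<Omega>"

definition euler_convex ::
    "(('n::finite \<Rightarrow>\<^sub>0 nat) \<Rightarrow>\<^sub>0 complex) \<Rightarrow> (real^'n) set \<Rightarrow> bool" where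
  "euler_convex P \<Omega> \<longleftrightarrow>
     (\<forall>k\<ge>1. \<forall>\<omega>\<^sub>1. \<omega>\<^sub>1 \<subset>\<subset> \<Omega> \<longrightarrow> (\<exists>\<omega>\<^sub>2. \<omega>\<^sub>2 \<subset>\<subset> \<Omega> \<and>
       (\<forall>\<omega>. \<omega> \<subset>\<subset> \<Omega> \<longrightarrow> (\<forall>\<phi>\<in>sobolev0 k \<omega>.
          (\<exists>\<psi>\<in>sobolev0 k \<omega>\<^sub>1. dist_eq_on UNIV (euler_op_transpose P (dist_of \<phi>)) (dist_of \<psi>)) \<longrightarrow>
          \<phi> \<in> sobolev0 k \<omega>\<^sub>2))))"

end

theory Submission
  imports Defs "HOL-Complex_Analysis.Cauchy_Integral_Formula"
begin

text \<open>Weigh \<open>L\<^sup>2\<close> by \<open>\<Prod>\<^sub>i |x\<^sub>i| powr a\<^sub>i\<close>. Then the adjoint of \<open>\<theta>\<^sub>i\<^sup>*\<close> is a constant minus \<open>\<theta>\<^sub>i\<^sup>*\<close>, so the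
  operators \<open>P(\<theta>\<^sup>*)\<close> are normal, and multiplying by \<open>|x\<^sub>j| powr s\<close> shifts the \<open>j\<close>-th variable of \<open>P\<close>. A mean
  value argument in \<open>s\<close> as in Malgrange's lemma bounds all Hasse derivatives of \<open>P(\<theta>\<^sup>*) f\<close>, and in
  particular \<open>f\<close> itself, by \<open>P(\<theta>\<^sup>*) f\<close> for test functions supported in a fixed compact set, with an
  arbitrarily small loss in the exponent of the weight. Derivatives only shift \<open>P\<close>, so the same holds for
  the Sobolev type norms \<open>qnorm L b\<close>.

  Given an exhaustion adapted to the convexity condition, one builds functionals \<open>S\<^sub>n\<close> with
  \<open>S\<^sub>n (P(\<theta>\<^sup>*) f) = T f\<close> on the \<open>n\<close>-th set by Hahn-Banach, each close to its predecessor on the set before.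
  The required estimate is proved by contradiction: a sequence violating it can be chosen to converge,
  the support of its limit is controlled by convexity, and a cutoff moves it to where \<open>S\<^sub>n\<close> is defined. The
  loss of weight is harmless as the exponents of the \<open>qnorm L b\<^sub>n\<close> decrease to \<open>1/4\<close>, and \<open>S = lim S\<^sub>n\<close>
  has order \<open>L\<close>.\<close>

section \<open>Calculus of smooth functions\<close>

text \<open>Multiplying by a power of \<open>|x $ j|\<close> destroys smoothness on the hyperplane
  \<open>x $ j = 0\<close>, so such factors are absorbed into the weight. Its exponents must be
  positive, which makes the weight continuous and leaves no boundary terms on the hyperplanes, and
  below 1, which makes the inverse weight locally integrable, so that weighted norms control L^1
  norms and, after \<open>CARD('n)\<close> further derivatives, suprema. All exponents of the
  construction lie in this window. The circle argument moves exponents down as well as up, hence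
  each estimate has a strictly smaller exponent on its right-hand side. A fixed norm could therefore
  not be carried along the exhaustion, and a decreasing sequence of exponents is spent instead. No
  Hilbert space is completed: limits are uniform limits, and \<open>qnorm_closable\<close> turns
  weak convergence to 0 of a Cauchy sequence into convergence in norm. A cutoff does not commute
  with the operator, but the Leibniz rule brings in only Hasse derivatives; this is why the a priori
  estimate has to cover all of them and not just the function.\<close>

lemma smooth_coinduct:
  assumes "f \<in> S" and "\<And>g. g \<in> S \<Longrightarrow> g differentiable_on UNIV"
    and "\<And>g i. g \<in> S \<Longrightarrow> partial_deriv i g \<in> S"
  shows "smooth f"
proof -
  have "fold partial_deriv is f \<in> S" if "f \<in> S" for "is" f
    using that by (induction "is" arbitrary: f) (auto intro: assms(3))
  then show ?thesis using assms(1,2) unfolding smooth_def by blast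
qed

lemma smooth_partial_deriv: "smooth f \<Longrightarrow> smooth (partial_deriv i f)"
  unfolding smooth_def by (metis fold_simps(2))

lemma smooth_fold: "smooth f \<Longrightarrow> smooth (fold partial_deriv w f)"
  by (induction w arbitrary: f) (auto intro: smooth_partial_deriv)

lemma smooth_differentiable: "smooth f \<Longrightarrow> f differentiable (at x)"
  unfolding smooth_def by (metis fold_simps(1) differentiable_on_def UNIV_I)

lemma smooth_has_derivative:
  "smooth f \<Longrightarrow> (f has_derivative frechet_derivative f (at x)) (at x)"
  using frechet_derivative_works smooth_differentiable by blast

lemma smooth_continuous_on: "smooth f \<Longrightarrow> continuous_on S f"
  by (meson continuous_at_imp_continuous_on differentiable_imp_continuous_within smooth_differentiable)

lemma partial_deriv_eq:
  "(f has_derivative D) (at x) \<Longrightarrow> partial_deriv i f x = D (axis i 1)"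
  unfolding partial_deriv_def by (metis frechet_derivative_at)

lemma partial_deriv_const [simp]: "partial_deriv i (\<lambda>x. c) = (\<lambda>x. 0)"
  by (rule ext, subst partial_deriv_eq[of _ "\<lambda>_. 0"]) auto

lemma partial_deriv_add':
  assumes "f differentiable (at x)" "g differentiable (at x)"
  shows "partial_deriv i (\<lambda>x. f x + g x) x = partial_deriv i f x + partial_deriv i g x"
  using partial_deriv_eq[OF has_derivative_add[OF assms[unfolded frechet_derivative_works]]]
  by (simp add: partial_deriv_def)

lemma partial_deriv_mult':
  assumes "f differentiable (at x)" "g differentiable (at x)"
  shows "partial_deriv i (\<lambda>x. f x * g x) x = partial_deriv i f x * g x + f x * partial_deriv i g x"
  using partial_deriv_eq[OF has_derivative_mult[OF assms[unfolded frechet_derivative_works]]]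
  by (simp add: partial_deriv_def)

text \<open>The derivative of a product is a sum of products, so products of smooth functions are
  not stable under \<open>partial_deriv\<close>. The generated algebra is, and
  \<open>smooth_coinduct\<close> applies to it.\<close>

inductive_set smooth_alg :: "(real^'n::finite \<Rightarrow> complex) set" where
  base: "smooth f \<Longrightarrow> f \<in> smooth_alg"
| add: "f \<in> smooth_alg \<Longrightarrow> g \<in> smooth_alg \<Longrightarrow> (\<lambda>x. f x + g x) \<in> smooth_alg"
| mult: "f \<in> smooth_alg \<Longrightarrow> g \<in> smooth_alg \<Longrightarrow> (\<lambda>x. f x * g x) \<in> smooth_alg"

lemma smooth_alg_deriv:
  "f \<in> smooth_alg \<Longrightarrow> f differentiable_on UNIV \<and> (\<forall>i. partial_deriv i f \<in> smooth_alg)"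
proof (induction rule: smooth_alg.induct)
  case (base f)
  then show ?case
    by (auto simp: differentiable_on_def smooth_differentiable differentiable_at_withinI
        intro: smooth_alg.base smooth_partial_deriv)
next
  case (add f g)
  have "partial_deriv i (\<lambda>x. f x + g x) = (\<lambda>x. partial_deriv i f x + partial_deriv i g x)" for i
    using add by (intro ext partial_deriv_add') (auto simp: differentiable_on_def)
  with add show ?case by (auto intro: smooth_alg.intros)
next
  case (mult f g)
  have "partial_deriv i (\<lambda>x. f x * g x) = (\<lambda>x. partial_deriv i f x * g x + f x * partial_deriv i g x)" for i
    using mult by (intro ext partial_deriv_mult') (auto simp: differentiable_on_def)
  moreover have "(\<lambda>x. partial_deriv i f x * g x + f x * partial_deriv i g x) \<in> smooth_alg" for i
    using mult by (intro smooth_alg.add smooth_alg.mult) auto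
  ultimately show ?case using mult by auto
qed

lemma smooth_alg_smooth: "f \<in> smooth_alg \<Longrightarrow> smooth f"
  using smooth_coinduct[of f smooth_alg] smooth_alg_deriv by blast

lemma smooth_add: "smooth f \<Longrightarrow> smooth g \<Longrightarrow> smooth (\<lambda>x. f x + g x)"
  and smooth_mult: "smooth f \<Longrightarrow> smooth g \<Longrightarrow> smooth (\<lambda>x. f x * g x)"
  by (auto intro!: smooth_alg_smooth intro: smooth_alg.intros)

lemma smooth_const: "smooth (\<lambda>x. c)"
  by (rule smooth_coinduct[of _ "range (\<lambda>c x. c)"]) auto

lemma partial_deriv_coord:
  "partial_deriv i (\<lambda>x. complex_of_real (x $ j)) = (\<lambda>x. if i = j then 1 else 0)"
proof
  fix x :: "real^'a"
  have "((\<lambda>x. complex_of_real (x $ j)) has_derivative (\<lambda>x. complex_of_real (x $ j))) (at x)"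
    by (intro bounded_linear_imp_has_derivative bounded_linear_compose[OF bounded_linear_of_real bounded_linear_vec_nth])
  then show "partial_deriv i (\<lambda>x. complex_of_real (x $ j)) x = (if i = j then 1 else 0)"
    by (auto dest: partial_deriv_eq[of _ _ _ i] simp: axis_def)
qed

lemma smooth_coord: "smooth (\<lambda>x. complex_of_real (x $ j))"
proof (rule smooth_coinduct[of _ "insert (\<lambda>x. complex_of_real (x $ j)) (range (\<lambda>c x. c))"])
  fix g :: "real^'a \<Rightarrow> complex"
  assume "g \<in> insert (\<lambda>x. complex_of_real (x $ j)) (range (\<lambda>c x. c))"
  moreover have "(\<lambda>x::real^'a. complex_of_real (x $ j)) differentiable_on UNIV"
    by (intro differentiable_at_imp_differentiable_on bounded_linear_imp_differentiable
        bounded_linear_compose[OF bounded_linear_of_real bounded_linear_vec_nth])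
  ultimately show "g differentiable_on UNIV" by auto
qed (auto simp: partial_deriv_coord)

lemma partial_deriv_cnj':
  assumes "f differentiable (at x)"
  shows "partial_deriv i (\<lambda>x. cnj (f x)) x = cnj (partial_deriv i f x)"
  using partial_deriv_eq[OF has_derivative_compose[OF assms[unfolded frechet_derivative_works]
        bounded_linear_imp_has_derivative[OF bounded_linear_cnj]]]
  by (simp add: partial_deriv_def)

lemma partial_deriv_cnj: "smooth f \<Longrightarrow> partial_deriv i (\<lambda>x. cnj (f x)) = (\<lambda>x. cnj (partial_deriv i f x))"
  by (auto intro!: partial_deriv_cnj' smooth_differentiable)

lemma smooth_cnj:
  assumes "smooth f" shows "smooth (\<lambda>x. cnj (f x))"
proof (rule smooth_coinduct[of _ "(\<lambda>f x. cnj (f x)) ` {f. smooth f}"])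
  fix g :: "real^'a \<Rightarrow> complex"
  assume "g \<in> (\<lambda>f x. cnj (f x)) ` {f. smooth f}"
  then obtain f where f: "smooth f" "g = (\<lambda>x. cnj (f x))" by auto
  show "g differentiable_on UNIV"
    unfolding f(2)
    using has_derivative_compose[OF smooth_has_derivative[OF f(1)]
        bounded_linear_imp_has_derivative[OF bounded_linear_cnj]]
    by (intro differentiable_at_imp_differentiable_on) (auto simp: differentiable_def)
qed (use assms in \<open>auto simp: partial_deriv_cnj intro: smooth_partial_deriv\<close>)

lemma partial_deriv_add: "smooth f \<Longrightarrow> smooth g \<Longrightarrow>
    partial_deriv i (\<lambda>x. f x + g x) = (\<lambda>x. partial_deriv i f x + partial_deriv i g x)"
  by (intro ext partial_deriv_add' smooth_differentiable)

lemma partial_deriv_mult: "smooth f \<Longrightarrow> smooth g \<Longrightarrow>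
    partial_deriv i (\<lambda>x. f x * g x) = (\<lambda>x. partial_deriv i f x * g x + f x * partial_deriv i g x)"
  by (intro ext partial_deriv_mult' smooth_differentiable)

lemma smooth_cmult: "smooth f \<Longrightarrow> smooth (\<lambda>x. c * f x)"
  by (intro smooth_mult smooth_const)

lemma partial_deriv_cmult: "smooth f \<Longrightarrow> partial_deriv i (\<lambda>x. c * f x) = (\<lambda>x. c * partial_deriv i f x)"
  by (simp add: partial_deriv_mult smooth_const)

lemma smooth_uminus: "smooth f \<Longrightarrow> smooth (\<lambda>x. - f x)"
  using smooth_cmult[of f "-1"] by simp

lemma smooth_diff: "smooth f \<Longrightarrow> smooth g \<Longrightarrow> smooth (\<lambda>x. f x - g x)"
  using smooth_add[OF _ smooth_uminus, of f g] by simp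

lemma partial_deriv_uminus: "smooth f \<Longrightarrow> partial_deriv i (\<lambda>x. - f x) = (\<lambda>x. - partial_deriv i f x)"
  using partial_deriv_cmult[of f i "-1"] by simp

lemma partial_deriv_diff: "smooth f \<Longrightarrow> smooth g \<Longrightarrow>
    partial_deriv i (\<lambda>x. f x - g x) = (\<lambda>x. partial_deriv i f x - partial_deriv i g x)"
  using partial_deriv_add[OF _ smooth_uminus, of f g] by (simp add: partial_deriv_uminus)

lemma smooth_sum: "(\<And>a. a \<in> A \<Longrightarrow> smooth (f a)) \<Longrightarrow> smooth (\<lambda>x. \<Sum>a\<in>A. f a x)"
  by (induction A rule: infinite_finite_induct) (auto intro: smooth_const smooth_add)

lemma smooth_prod: "(\<And>a. a \<in> A \<Longrightarrow> smooth (f a)) \<Longrightarrow> smooth (\<lambda>x. \<Prod>a\<in>A. f a x)"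
  by (induction A rule: infinite_finite_induct) (auto intro: smooth_const smooth_mult)

subsection \<open>Symmetry of mixed partial derivatives\<close>

lemma partial_deriv_line:
  assumes "smooth f"
  shows "((\<lambda>s. f (x + s *\<^sub>R axis i 1)) has_vector_derivative partial_deriv i f (x + s *\<^sub>R axis i 1)) (at s)"
proof -
  let ?D = "frechet_derivative f (at (x + s *\<^sub>R axis i 1))"
  have D: "(f has_derivative ?D) (at (x + s *\<^sub>R axis i 1))"
    by (rule smooth_has_derivative[OF assms])
  have "((\<lambda>s. x + s *\<^sub>R axis i 1) has_derivative (\<lambda>h. h *\<^sub>R axis i 1)) (at s)"
    by (auto intro!: derivative_eq_intros)
  from has_derivative_compose[OF this D]
  have "((\<lambda>s. f (x + s *\<^sub>R axis i 1)) has_derivative (\<lambda>h. ?D (h *\<^sub>R axis i 1))) (at s)" .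
  moreover have "?D (h *\<^sub>R axis i 1) = h *\<^sub>R ?D (axis i 1)" for h
    using D by (meson has_derivative_bounded_linear bounded_linear.linear linear_scale)
  ultimately show ?thesis
    unfolding has_vector_derivative_def partial_deriv_def by simp
qed

text \<open>The mean value theorem fails for complex values, hence the real functional
  \<open>\<rho>\<close>, later \<open>Re\<close> and \<open>Im\<close>. It is applied in direction
  \<open>i\<close> to the increment \<open>A\<close> over a step in direction \<open>j\<close>, and
  then in direction \<open>j\<close> to the partial derivative found there.\<close>

lemma second_difference_mvt:
  fixes f :: "real^'n::finite \<Rightarrow> complex" and \<rho> :: "complex \<Rightarrow> real"
  assumes f: "smooth f" and \<rho>: "bounded_linear \<rho>" and h: "h > 0"
  shows "\<exists>s\<in>{0..h}. \<exists>t\<in>{0..h}.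
     \<rho> (f (x + h *\<^sub>R axis i 1 + h *\<^sub>R axis j 1)) - \<rho> (f (x + h *\<^sub>R axis i 1)) - \<rho> (f (x + h *\<^sub>R axis j 1)) + \<rho> (f x)
     = h * h * \<rho> (partial_deriv j (partial_deriv i f) (x + s *\<^sub>R axis i 1 + t *\<^sub>R axis j 1))"
proof -
  define A where "A s = \<rho> (f ((x + h *\<^sub>R axis j 1) + s *\<^sub>R axis i 1)) - \<rho> (f (x + s *\<^sub>R axis i 1))" for s
  have dA: "(A has_real_derivative \<rho> (partial_deriv i f ((x + h *\<^sub>R axis j 1) + s *\<^sub>R axis i 1))
       - \<rho> (partial_deriv i f (x + s *\<^sub>R axis i 1))) (at s)" for s
    unfolding A_def has_real_derivative_iff_has_vector_derivative
    by (intro has_vector_derivative_diff bounded_linear.has_vector_derivative[OF \<rho>] partial_deriv_line f)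
  obtain s where s: "0 < s" "s < h" "A h - A 0 = h * (\<rho> (partial_deriv i f ((x + h *\<^sub>R axis j 1) + s *\<^sub>R axis i 1))
       - \<rho> (partial_deriv i f (x + s *\<^sub>R axis i 1)))"
    using MVT2[OF h, of A, OF dA] by auto
  define B where "B t = \<rho> (partial_deriv i f ((x + s *\<^sub>R axis i 1) + t *\<^sub>R axis j 1))" for t
  have dB: "(B has_real_derivative \<rho> (partial_deriv j (partial_deriv i f) ((x + s *\<^sub>R axis i 1) + t *\<^sub>R axis j 1))) (at t)" for t
    unfolding B_def has_real_derivative_iff_has_vector_derivative
    by (intro bounded_linear.has_vector_derivative[OF \<rho>] partial_deriv_line smooth_partial_deriv f)
  obtain t where t: "0 < t" "t < h" "B h - B 0 = h * \<rho> (partial_deriv j (partial_deriv i f) ((x + s *\<^sub>R axis i 1) + t *\<^sub>R axis j 1))"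
    using MVT2[OF h, of B, OF dB] by auto
  have "A h - A 0 = h * (B h - B 0)"
    unfolding s(3) B_def by (simp add: algebra_simps)
  then have "A h - A 0 = h * h * \<rho> (partial_deriv j (partial_deriv i f) ((x + s *\<^sub>R axis i 1) + t *\<^sub>R axis j 1))"
    using t by simp
  then show ?thesis using s t unfolding A_def
    by (intro bexI[of _ s] bexI[of _ t]) (auto simp: algebra_simps)
qed

text \<open>The second difference is symmetric in \<open>i\<close> and \<open>j\<close>. Evaluating
  it in both orders and letting \<open>h\<close> tend to 0 gives both mixed derivatives at
  \<open>x\<close>.\<close>

lemma partial_deriv_commute_part:
  fixes f :: "real^'n::finite \<Rightarrow> complex" and \<rho> :: "complex \<Rightarrow> real"
  assumes f: "smooth f" and \<rho>: "bounded_linear \<rho>"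
  shows "\<rho> (partial_deriv i (partial_deriv j f) x) = \<rho> (partial_deriv j (partial_deriv i f) x)"
proof -
  define h where "h n = inverse (real (Suc n))" for n
  have h0: "h n > 0" for n by (simp add: h_def)
  have hl: "h \<longlonglongrightarrow> 0" unfolding h_def using LIMSEQ_inverse_real_of_nat by simp
  have lim: "(\<lambda>n. \<rho> (g (x + s n *\<^sub>R axis i 1 + t n *\<^sub>R axis j 1))) \<longlonglongrightarrow> \<rho> (g x)"
    if "smooth g" "\<And>n. s n \<in> {0..h n}" "\<And>n. t n \<in> {0..h n}" for g s t and i j :: 'n
  proof -
    have "s \<longlonglongrightarrow> 0" by (rule tendsto_sandwich[OF _ _ tendsto_const hl]) (use that in auto)
    moreover have "t \<longlonglongrightarrow> 0" by (rule tendsto_sandwich[OF _ _ tendsto_const hl]) (use that in auto)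
    ultimately have "(\<lambda>n. x + s n *\<^sub>R axis i 1 + t n *\<^sub>R axis j 1) \<longlonglongrightarrow> x + 0 *\<^sub>R axis i 1 + 0 *\<^sub>R axis j 1"
      by (intro tendsto_intros)
    then have l: "(\<lambda>n. x + s n *\<^sub>R axis i 1 + t n *\<^sub>R axis j 1) \<longlonglongrightarrow> x" by simp
    have "isCont g x" by (rule differentiable_imp_continuous_within[OF smooth_differentiable[OF that(1)]])
    from bounded_linear.tendsto[OF \<rho> isCont_tendsto_compose[OF this l]] show ?thesis .
  qed
  obtain s t where st: "\<And>n. s n \<in> {0..h n}" "\<And>n. t n \<in> {0..h n}"
    "\<And>n. \<rho> (f (x + h n *\<^sub>R axis i 1 + h n *\<^sub>R axis j 1)) - \<rho> (f (x + h n *\<^sub>R axis i 1)) - \<rho> (f (x + h n *\<^sub>R axis j 1)) + \<rho> (f x)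
     = h n * h n * \<rho> (partial_deriv j (partial_deriv i f) (x + s n *\<^sub>R axis i 1 + t n *\<^sub>R axis j 1))"
    using second_difference_mvt[OF f \<rho> h0, where x=x and i=i and j=j] by metis
  obtain s' t' where st': "\<And>n. s' n \<in> {0..h n}" "\<And>n. t' n \<in> {0..h n}"
    "\<And>n. \<rho> (f (x + h n *\<^sub>R axis j 1 + h n *\<^sub>R axis i 1)) - \<rho> (f (x + h n *\<^sub>R axis j 1)) - \<rho> (f (x + h n *\<^sub>R axis i 1)) + \<rho> (f x)
     = h n * h n * \<rho> (partial_deriv i (partial_deriv j f) (x + s' n *\<^sub>R axis j 1 + t' n *\<^sub>R axis i 1))"
    using second_difference_mvt[OF f \<rho> h0, where x=x and i=j and j=i] by metis
  have eq: "\<rho> (partial_deriv j (partial_deriv i f) (x + s n *\<^sub>R axis i 1 + t n *\<^sub>R axis j 1))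
      = \<rho> (partial_deriv i (partial_deriv j f) (x + s' n *\<^sub>R axis j 1 + t' n *\<^sub>R axis i 1))" for n
  proof -
    have comm: "x + h n *\<^sub>R axis j 1 + h n *\<^sub>R axis i 1 = x + h n *\<^sub>R axis i 1 + h n *\<^sub>R axis j 1"
      by (simp add: algebra_simps)
    have "h n * h n * \<rho> (partial_deriv j (partial_deriv i f) (x + s n *\<^sub>R axis i 1 + t n *\<^sub>R axis j 1))
      = h n * h n * \<rho> (partial_deriv i (partial_deriv j f) (x + s' n *\<^sub>R axis j 1 + t' n *\<^sub>R axis i 1))"
      using st(3)[of n] st'(3)[of n] unfolding comm by linarith
    then show ?thesis using h0[of n] by simp
  qed
  have "(\<lambda>n. \<rho> (partial_deriv i (partial_deriv j f) (x + s' n *\<^sub>R axis j 1 + t' n *\<^sub>R axis i 1)))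
     \<longlonglongrightarrow> \<rho> (partial_deriv i (partial_deriv j f) x)"
    by (rule lim) (use st' f in \<open>auto intro: smooth_partial_deriv\<close>)
  moreover have "(\<lambda>n. \<rho> (partial_deriv j (partial_deriv i f) (x + s n *\<^sub>R axis i 1 + t n *\<^sub>R axis j 1)))
     \<longlonglongrightarrow> \<rho> (partial_deriv j (partial_deriv i f) x)"
    by (rule lim) (use st f in \<open>auto intro: smooth_partial_deriv\<close>)
  ultimately show ?thesis unfolding eq by (rule LIMSEQ_unique)
qed

lemma partial_deriv_commute:
  assumes "smooth f"
  shows "partial_deriv i (partial_deriv j f) = partial_deriv j (partial_deriv i f)"
  using partial_deriv_commute_part[OF assms bounded_linear_Re, of i j]
    partial_deriv_commute_part[OF assms bounded_linear_Im, of i j]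
  by (intro ext complex_eqI) auto

section \<open>Smooth functions of one variable and cutoffs\<close>

text \<open>Coinductive, so that a smooth function comes with a derivative that is smooth again,
  without any notation for iterated derivatives.\<close>

coinductive smooth1 :: "(real \<Rightarrow> real) \<Rightarrow> bool" where
  "(\<And>t. (G has_real_derivative G' t) (at t)) \<Longrightarrow> smooth1 G' \<Longrightarrow> smooth1 G"

text \<open>Affine substitutions are part of the generators: the chain rule then yields a constant
  times another generator, and reflected or rescaled bumps belong to the algebra.\<close>

inductive_set smooth1_alg :: "(real \<Rightarrow> real) set" where
  base: "smooth1 G \<Longrightarrow> (\<lambda>t. G (a * t + c)) \<in> smooth1_alg"
| const: "(\<lambda>t. c) \<in> smooth1_alg"
| add: "F \<in> smooth1_alg \<Longrightarrow> G \<in> smooth1_alg \<Longrightarrow> (\<lambda>t. F t + G t) \<in> smooth1_alg"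
| mult: "F \<in> smooth1_alg \<Longrightarrow> G \<in> smooth1_alg \<Longrightarrow> (\<lambda>t. F t * G t) \<in> smooth1_alg"

lemma smooth1_alg_deriv:
  "F \<in> smooth1_alg \<Longrightarrow> \<exists>F'\<in>smooth1_alg. \<forall>t. (F has_real_derivative F' t) (at t)"
proof (induction rule: smooth1_alg.induct)
  case (base G a c)
  then obtain G' where G': "\<And>t. (G has_real_derivative G' t) (at t)" "smooth1 G'"
    by (meson smooth1.cases)
  have "((\<lambda>t. G (a * t + c)) has_real_derivative a * G' (a * t + c)) (at t)" for t
    by (rule DERIV_cong[OF DERIV_chain2[OF G'(1)]]) (auto intro!: derivative_eq_intros)
  moreover have "(\<lambda>t. a * G' (a * t + c)) \<in> smooth1_alg"
    by (intro smooth1_alg.intros G')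
  ultimately show ?case by (intro bexI[of _ "\<lambda>t. a * G' (a * t + c)"]) auto
next
  case (const c)
  then show ?case by (intro bexI[of _ "\<lambda>t. 0"]) (auto intro: smooth1_alg.intros)
next
  case (add F G)
  then obtain F' G' where "F'\<in>smooth1_alg" "\<forall>t. (F has_real_derivative F' t) (at t)"
    "G'\<in>smooth1_alg" "\<forall>t. (G has_real_derivative G' t) (at t)" by blast
  then show ?case
    by (intro bexI[of _ "\<lambda>t. F' t + G' t"]) (auto intro: smooth1_alg.intros derivative_eq_intros)
next
  case (mult F G)
  then obtain F' G' where "F'\<in>smooth1_alg" "\<forall>t. (F has_real_derivative F' t) (at t)"
    "G'\<in>smooth1_alg" "\<forall>t. (G has_real_derivative G' t) (at t)" by blast
  with mult show ?case
    by (intro bexI[of _ "\<lambda>t. F' t * G t + F t * G' t"])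
      (auto intro!: smooth1_alg.intros derivative_eq_intros)
qed

lemma smooth1_alg_smooth1: "F \<in> smooth1_alg \<Longrightarrow> smooth1 F"
proof (coinduction arbitrary: F)
  case smooth1
  then show ?case using smooth1_alg_deriv[of F] by auto
qed

text \<open>\<open>flat 0\<close> is the classical function exp (-1/t) extended by 0. The powers of
  1/t make the family stable under differentiation up to linear combinations.\<close>

definition flat :: "nat \<Rightarrow> real \<Rightarrow> real" where
  "flat k t = (if t > 0 then inverse t ^ k * exp (- inverse t) else 0)"

lemma flat_tendsto: "((\<lambda>t. inverse t ^ k * exp (- inverse t)) \<longlongrightarrow> 0) (at_right (0::real))"
proof -
  have "((\<lambda>x::real. x ^ k / exp x) \<longlongrightarrow> 0) at_top" by (rule tendsto_power_div_exp_0)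
  from filterlim_compose[OF this filterlim_inverse_at_top_right]
  show ?thesis by (simp add: exp_minus field_simps)
qed

lemma flat_deriv:
  "(flat k has_real_derivative (flat (k + 2) t + - real k * flat (Suc k) t)) (at t)"
proof -
  consider "t < 0" | "t = 0" | "t > 0" by linarith
  then show ?thesis
  proof cases
    case 1
    have "((\<lambda>t. 0) has_real_derivative 0) (at t)" by simp
    then have "(flat k has_real_derivative 0) (at t)"
      by (rule has_field_derivative_transform_within_open[of _ _ _ "{..<0}"])
        (use 1 in \<open>auto simp: flat_def\<close>)
    then show ?thesis using 1 by (simp add: flat_def)
  next
    \<comment> \<open>At 0 the difference quotient from the right has the formula of
      \<open>flat (Suc k)\<close>, which tends to 0.\<close>
    case 2
    have "((\<lambda>h. flat k h / h) \<longlongrightarrow> 0) (at 0)"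
    proof (subst filterlim_at_split, intro conjI)
      show "((\<lambda>h. flat k h / h) \<longlongrightarrow> 0) (at_left 0)"
        by (rule tendsto_eventually) (auto simp: flat_def eventually_at_filter)
      show "((\<lambda>h. flat k h / h) \<longlongrightarrow> 0) (at_right 0)"
        by (rule Lim_transform_eventually[OF flat_tendsto[of "Suc k"]])
          (auto simp: flat_def eventually_at_filter field_simps)
    qed
    then show ?thesis using 2 unfolding has_field_derivative_iff by (simp add: flat_def)
  next
    case 3
    have "((\<lambda>t. inverse t ^ k) has_real_derivative (- real k * inverse t ^ Suc k)) (at t)"
    proof (rule DERIV_cong[OF DERIV_power[OF DERIV_inverse]])
      show "t \<noteq> 0" using 3 by simp
      show "of_nat k * (- (inverse t ^ Suc (Suc 0)) * inverse t ^ (k - Suc 0)) = - real k * inverse t ^ Suc k"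
        by (cases k) (auto simp: algebra_simps)
    qed
    moreover have "((\<lambda>t. exp (- inverse t)) has_real_derivative (exp (- inverse t) * inverse t ^ 2)) (at t)"
      using 3 by (auto intro!: derivative_eq_intros simp: power2_eq_square)
    ultimately have "((\<lambda>t. inverse t ^ k * exp (- inverse t)) has_real_derivative
        (flat (k + 2) t + - real k * flat (Suc k) t)) (at t)"
      by (rule DERIV_cong[OF DERIV_mult]) (use 3 in \<open>simp add: flat_def algebra_simps power_add power2_eq_square\<close>)
    then show ?thesis
      by (rule has_field_derivative_transform_within_open[of _ _ _ "{0<..}"])
        (use 3 in \<open>auto simp: flat_def\<close>)
  qed
qed

inductive_set flat_span :: "(real \<Rightarrow> real) set" where
  "flat k \<in> flat_span"
| "F \<in> flat_span \<Longrightarrow> G \<in> flat_span \<Longrightarrow> (\<lambda>t. F t + G t) \<in> flat_span"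
| "F \<in> flat_span \<Longrightarrow> (\<lambda>t. c * F t) \<in> flat_span"

lemma flat_span_deriv:
  "F \<in> flat_span \<Longrightarrow> \<exists>F'\<in>flat_span. \<forall>t. (F has_real_derivative F' t) (at t)"
proof (induction rule: flat_span.induct)
  case (1 k)
  have "(\<lambda>t. flat (k + 2) t + - real k * flat (Suc k) t) \<in> flat_span"
    by (intro flat_span.intros)
  then show ?case using flat_deriv
    by (intro bexI[of _ "\<lambda>t. flat (k + 2) t + - real k * flat (Suc k) t"]) blast+
next
  case (2 F G)
  then obtain F' G' where "F'\<in>flat_span" "\<forall>t. (F has_real_derivative F' t) (at t)"
    "G'\<in>flat_span" "\<forall>t. (G has_real_derivative G' t) (at t)" by blast
  then show ?case
    by (intro bexI[of _ "\<lambda>t. F' t + G' t"]) (auto intro: flat_span.intros derivative_eq_intros)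
next
  case (3 F c)
  then obtain F' where "F'\<in>flat_span" "\<forall>t. (F has_real_derivative F' t) (at t)" by blast
  then show ?case
    by (intro bexI[of _ "\<lambda>t. c * F' t"]) (auto intro: flat_span.intros intro!: derivative_eq_intros)
qed

lemma smooth1_flat: "smooth1 (flat k)"
proof -
  have "smooth1 F" if "F \<in> flat_span" for F
    using that
  proof (coinduction arbitrary: F)
    case smooth1
    then show ?case using flat_span_deriv[of F] by auto
  qed
  then show ?thesis by (auto intro: flat_span.intros)
qed

text \<open>\<open>R\<close> is the normalised antiderivative of a bump on the unit interval. Its
  derivative \<open>\<rho>\<close> is returned too, because \<open>sup_le_L1\<close> uses
  \<open>R\<close> as a smoothed Heaviside function and \<open>\<rho>\<close> as the matching
  approximate identity.\<close>

lemma smooth_step_exists: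
  "\<exists>R \<rho>. smooth1 R \<and> smooth1 \<rho> \<and> (\<forall>t. (R has_real_derivative \<rho> t) (at t)) \<and> (\<forall>t. \<rho> t \<ge> 0) \<and>
     (\<forall>t\<le>0. R t = 0) \<and> (\<forall>t\<ge>1. R t = 1) \<and> (\<forall>t. t \<le> 0 \<or> t \<ge> 1 \<longrightarrow> \<rho> t = 0) \<and> (\<forall>t. 0 \<le> R t \<and> R t \<le> 1)"
proof -
  \<comment> \<open>The arguments are written as \<open>a * t + c\<close> to fit the rule
    \<open>smooth1_alg.base\<close>.\<close>
  define \<beta> where "\<beta> t = flat 0 (1 * t + 0) * flat 0 (-1 * t + 1)" for t
  have \<beta>s: "\<beta> \<in> smooth1_alg"
    unfolding \<beta>_def by (intro smooth1_alg.intros smooth1_flat)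
  have \<beta>0: "\<beta> t \<ge> 0" for t by (auto simp: \<beta>_def flat_def)
  have \<beta>z: "\<beta> t = 0" if "t \<le> 0 \<or> t \<ge> 1" for t using that by (auto simp: \<beta>_def flat_def)
  have \<beta>p: "\<beta> t > 0" if "0 < t" "t < 1" for t using that by (auto simp: \<beta>_def flat_def)
  have "isCont \<beta> t" for t
    using smooth1_alg_deriv[OF \<beta>s] DERIV_isCont by blast
  then obtain F where F: "\<And>t. (F has_vector_derivative \<beta> t) (at t)"
    using einterval_antiderivative[of "-\<infinity>" \<infinity> \<beta>] by auto
  then have F': "\<And>t. (F has_real_derivative \<beta> t) (at t)"
    by (simp add: has_real_derivative_iff_has_vector_derivative)
  have Fl: "F t = F 0" if "t \<le> 0" for t
  proof (cases "t = 0")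
    case False
    then have "t < 0" using that by simp
    then obtain z where "z < 0" "F 0 - F t = (0 - t) * \<beta> z"
      using MVT2[of t 0 F \<beta>] F' by blast
    then show ?thesis using \<beta>z[of z] by simp
  qed simp
  have Fr: "F t = F 1" if "t \<ge> 1" for t
  proof (cases "t = 1")
    case False
    then have "1 < t" using that by simp
    then obtain z where "z > 1" "F t - F 1 = (t - 1) * \<beta> z"
      using MVT2[of 1 t F \<beta>] F' by blast
    then show ?thesis using \<beta>z[of z] by simp
  qed simp
  define c where "c = F 1 - F 0"
  have c: "c > 0"
  proof -
    obtain z where "0 < z" "z < 1" "F 1 - F 0 = (1 - 0) * \<beta> z"
      using MVT2[of 0 1 F \<beta>] F' by auto
    then show ?thesis using \<beta>p[of z] by (simp add: c_def)
  qed
  have mono: "F s \<le> F t" if "s \<le> t" for s t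
    by (rule DERIV_nonneg_imp_nondecreasing[OF that]) (use F' \<beta>0 in blast)
  define R where "R t = (1/c) * F t + - F 0 / c" for t
  define \<rho> where "\<rho> t = (1/c) * \<beta> t" for t
  have dR: "(R has_real_derivative \<rho> t) (at t)" for t
    unfolding R_def \<rho>_def by (rule DERIV_cong[OF DERIV_add[OF DERIV_cmult[OF F'] DERIV_const]]) simp
  have s\<rho>: "smooth1 \<rho>"
    unfolding \<rho>_def by (rule smooth1_alg_smooth1, rule smooth1_alg.mult[OF smooth1_alg.const \<beta>s])
  have "smooth1 R" using dR s\<rho> by (auto intro: smooth1.intros)
  moreover have R0: "R t = 0" if "t \<le> 0" for t using Fl[OF that] by (simp add: R_def)
  moreover have R1: "R t = 1" if "t \<ge> 1" for t proof -
    have "R t = c / c" unfolding R_def Fr[OF that] c_def by (simp flip: diff_divide_distrib)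
    then show ?thesis using c by simp
  qed
  moreover have "R s \<le> R t" if "s \<le> t" for s t
    using mono[OF that] c by (simp add: R_def divide_right_mono)
  then have "0 \<le> R t \<and> R t \<le> 1" for t
    using R0[of "min 0 t"] R1[of "max 1 t"] by (metis min.cobounded1 min.cobounded2 max.cobounded1 max.cobounded2)
  moreover have "\<rho> t \<ge> 0" for t using \<beta>0 c by (simp add: \<rho>_def)
  moreover have "\<rho> t = 0" if "t \<le> 0 \<or> t \<ge> 1" for t using \<beta>z[OF that] by (simp add: \<rho>_def)
  ultimately show ?thesis using dR s\<rho> by blast
qed

lemma smooth1_affine: "smooth1 G \<Longrightarrow> smooth1 (\<lambda>t. G (a * t + c))"
  by (rule smooth1_alg_smooth1) (rule smooth1_alg.base)

lemma bump1_exists: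
  "\<exists>g. smooth1 g \<and> (\<forall>t. 0 \<le> g t \<and> g t \<le> 1) \<and> (\<forall>t. \<bar>t\<bar> \<le> 1 \<longrightarrow> g t = 1) \<and> (\<forall>t. \<bar>t\<bar> \<ge> 2 \<longrightarrow> g t = 0)"
proof -
  obtain R where R: "smooth1 R" "\<forall>t\<le>0. R t = (0::real)" "\<forall>t\<ge>1. R t = 1" "\<forall>t. 0 \<le> R t \<and> R t \<le> 1"
    using smooth_step_exists by blast
  define g where "g t = R (-1 * t + 2) * R (1 * t + 2)" for t
  have "smooth1 g" unfolding g_def by (intro smooth1_alg_smooth1 smooth1_alg.intros R)
  moreover have "0 \<le> g t \<and> g t \<le> 1" for t unfolding g_def using R(4) by (simp add: mult_le_one)
  moreover have "g t = 1" if "\<bar>t\<bar> \<le> 1" for t using that R(3) by (simp add: g_def)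
  moreover have "g t = 0" if "\<bar>t\<bar> \<ge> 2" for t
  proof -
    from that have "-1 * t + 2 \<le> 0 \<or> 1 * t + 2 \<le> 0" by linarith
    then show ?thesis using R(2) by (auto simp: g_def)
  qed
  ultimately show ?thesis by blast
qed

lemma coord_fun_has_derivative:
  assumes "(G has_real_derivative G') (at (x $ j))"
  shows "((\<lambda>x. complex_of_real (G (x $ j))) has_derivative (\<lambda>h. complex_of_real (G' * h $ j))) (at x)"
proof -
  have "((\<lambda>x. x $ j) has_derivative (\<lambda>h. h $ j)) (at x)"
    by (intro bounded_linear_imp_has_derivative bounded_linear_vec_nth)
  from has_derivative_compose[OF this assms[unfolded has_field_derivative_def]]
  have "((\<lambda>x. G (x $ j)) has_derivative (\<lambda>h. G' * h $ j)) (at x)" .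
  from has_derivative_compose[OF this bounded_linear_imp_has_derivative[OF bounded_linear_of_real]]
  show ?thesis .
qed

lemma partial_deriv_coord_fun:
  assumes "\<And>t. (G has_real_derivative G' t) (at t)"
  shows "partial_deriv i (\<lambda>x. complex_of_real (G (x $ j))) = (\<lambda>x. if i = j then complex_of_real (G' (x $ j)) else 0)"
  by (rule ext, subst partial_deriv_eq[OF coord_fun_has_derivative[OF assms]]) (auto simp: axis_def)

lemma smooth_coord_fun:
  assumes "smooth1 G" shows "smooth (\<lambda>x::real^'n::finite. complex_of_real (G (x $ j)))"
proof (rule smooth_coinduct[of _ "insert (\<lambda>x. 0) {\<lambda>x. complex_of_real (G (x $ j)) |G. smooth1 G}"])
  fix g :: "real^'n \<Rightarrow> complex" and i
  assume g: "g \<in> insert (\<lambda>x. 0) {\<lambda>x. complex_of_real (G (x $ j)) |G. smooth1 G}"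
  show "g differentiable_on UNIV"
  proof (cases "g = (\<lambda>x. 0)")
    case False
    with g obtain G where G: "smooth1 G" "g = (\<lambda>x. complex_of_real (G (x $ j)))" by auto
    then obtain G' where "\<And>t. (G has_real_derivative G' t) (at t)" by (meson smooth1.cases)
    then show ?thesis unfolding G(2)
      by (intro differentiable_at_imp_differentiable_on)
        (auto simp: differentiable_def intro!: exI coord_fun_has_derivative)
  qed simp
  show "partial_deriv i g \<in> insert (\<lambda>x. 0) {\<lambda>x. complex_of_real (G (x $ j)) |G. smooth1 G}"
  proof (cases "g = (\<lambda>x. 0)")
    case False
    with g obtain G where G: "smooth1 G" "g = (\<lambda>x. complex_of_real (G (x $ j)))" by auto
    then obtain G' where G': "\<And>t. (G has_real_derivative G' t) (at t)" "smooth1 G'" by (meson smooth1.cases)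
    then show ?thesis unfolding G(2) partial_deriv_coord_fun[OF G'(1)] by (cases "i = j") auto
  qed simp
qed (use assms in auto)

text \<open>Cutoffs are taken from the algebra generated by functions of one coordinate. For a
  factor that depends on \<open>x $ j\<close> only, the Leibniz rule involves Hasse derivatives in
  direction \<open>j\<close> only, and \<open>tame_coord_alg\<close> can proceed by induction over
  this algebra.\<close>

inductive_set coord_alg :: "(real^'n::finite \<Rightarrow> complex) set" where
  const: "(\<lambda>x. c) \<in> coord_alg"
| coord_fun: "smooth1 G \<Longrightarrow> (\<lambda>x. complex_of_real (G (x $ j))) \<in> coord_alg"
| add: "f \<in> coord_alg \<Longrightarrow> g \<in> coord_alg \<Longrightarrow> (\<lambda>x. f x + g x) \<in> coord_alg"
| mult: "f \<in> coord_alg \<Longrightarrow> g \<in> coord_alg \<Longrightarrow> (\<lambda>x. f x * g x) \<in> coord_alg"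

lemma coord_alg_smooth: "f \<in> coord_alg \<Longrightarrow> smooth f"
  by (induction rule: coord_alg.induct) (auto intro: smooth_const smooth_coord_fun smooth_add smooth_mult)

lemma coord_alg_prod: "(\<And>a. a \<in> A \<Longrightarrow> f a \<in> coord_alg) \<Longrightarrow> (\<lambda>x. \<Prod>a\<in>A. f a x) \<in> coord_alg"
  by (induction A rule: infinite_finite_induct) (auto intro: coord_alg.intros)

text \<open>Finitely many cube bumps \<open>b a\<close> cover \<open>K\<close>. The function 1 -
  (product of all 1 - \<open>b a\<close>) stays inside \<open>coord_alg\<close> and equals 1 as soon
  as one bump does, so no partition of unity is needed.\<close>

lemma cutoff_exists:
  fixes K U :: "(real^'n::finite) set"
  assumes "compact K" "open U" "K \<subseteq> U"
  shows "\<exists>\<kappa>\<in>coord_alg. \<exists>L. compact L \<and> L \<subseteq> U \<and> (\<forall>x\<in>K. \<kappa> x = 1) \<and> (\<forall>x. x \<notin> L \<longrightarrow> \<kappa> x = 0) \<and>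
     (\<forall>x. \<exists>r\<in>{0..1}. \<kappa> x = complex_of_real r)"
proof -
  obtain g :: "real \<Rightarrow> real" where g: "smooth1 g" "\<And>t. 0 \<le> g t" "\<And>t. g t \<le> 1"
     "\<And>t. \<bar>t\<bar> \<le> 1 \<Longrightarrow> g t = 1" "\<And>t. \<bar>t\<bar> \<ge> 2 \<Longrightarrow> g t = 0"
    using bump1_exists by blast
  have "\<exists>d>0. \<forall>x. (\<forall>j. \<bar>x $ j - a $ j\<bar> \<le> 2 * d) \<longrightarrow> x \<in> U" if "a \<in> K" for a
  proof -
    have "a \<in> U" using that assms(3) by blast
    then obtain e where e: "e > 0" "ball a e \<subseteq> U" using openE[OF assms(2)] by metis
    \<comment> \<open>A cube with half side \<open>2 * d\<close> has l^1 radius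
      \<open>e / 2\<close>, hence lies in the ball of radius \<open>e\<close>.\<close>
    define d where "d = e / (4 * real CARD('n))"
    have d: "d > 0" using e by (simp add: d_def)
    have "x \<in> U" if x: "\<forall>j. \<bar>x $ j - a $ j\<bar> \<le> 2 * d" for x
    proof -
      have "norm (x - a) \<le> (\<Sum>j\<in>UNIV. \<bar>(x - a) $ j\<bar>)" by (rule norm_le_l1_cart)
      also have "\<dots> \<le> (\<Sum>j\<in>(UNIV::'n set). 2 * d)" using x by (intro sum_mono) auto
      also have "\<dots> < e" using e by (simp add: d_def)
      finally show ?thesis using e(2) by (auto simp: subset_iff dist_norm norm_minus_commute)
    qed
    with d show ?thesis by blast
  qed
  then obtain d where d: "\<And>a. a \<in> K \<Longrightarrow> d a > 0"
    "\<And>a x. a \<in> K \<Longrightarrow> (\<forall>j. \<bar>x $ j - a $ j\<bar> \<le> 2 * d a) \<Longrightarrow> x \<in> U" by metis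
  define N where "N a = {x. \<forall>j. \<bar>x $ j - a $ j\<bar> < d a}" for a :: "real^'n"
  have "open (N a)" for a
  proof -
    have "N a = (\<Inter>j\<in>UNIV. {x. \<bar>x $ j - a $ j\<bar> < d a})" by (auto simp: N_def)
    then show ?thesis by (simp only:) (intro open_INT ballI finite open_Collect_less continuous_intros)
  qed
  moreover have "K \<subseteq> \<Union> (N ` K)" using d(1) by (auto simp: N_def)
  ultimately obtain F where F: "F \<subseteq> K" "finite F" "K \<subseteq> \<Union> (N ` F)"
    using compactE_image[OF assms(1), of K N] by metis
  define b where "b a x = (\<Prod>j\<in>UNIV. g ((1 / d a) * x $ j + - a $ j / d a))" for a x :: "real^'n"
  have b01: "0 \<le> b a x" "b a x \<le> 1" for a x
    unfolding b_def by (auto intro!: prod_nonneg prod_le_1 g)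
  have b1: "b a x = 1" if "a \<in> F" "x \<in> N a" for a x
  proof -
    have "\<bar>(1 / d a) * x $ j + - a $ j / d a\<bar> \<le> 1" for j
    proof -
      have "(1 / d a) * x $ j + - a $ j / d a = (x $ j - a $ j) / d a" by (simp add: diff_divide_distrib)
      then show ?thesis using that(2) d(1)[of a] F(1) that(1) by (simp add: N_def less_imp_le subset_iff)
    qed
    then show ?thesis unfolding b_def using g(4) by simp
  qed
  define L where "L = (\<Union>a\<in>F. cbox (a - (\<chi> j. 2 * d a)) (a + (\<chi> j. 2 * d a)))"
  have b0: "b a x = 0" if "a \<in> F" "x \<notin> L" for a x
  proof -
    from that obtain j where j: "x $ j < a $ j - 2 * d a \<or> a $ j + 2 * d a < x $ j"
      by (auto simp: L_def mem_box_cart not_le)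
    have "(1 / d a) * x $ j + - a $ j / d a = (x $ j - a $ j) / d a" by (simp add: diff_divide_distrib)
    moreover have "\<bar>(x $ j - a $ j) / d a\<bar> \<ge> 2" using j d(1)[of a] F(1) that(1)
      by (auto simp: subset_iff le_divide_eq abs_divide)
    ultimately have "g ((1 / d a) * x $ j + - a $ j / d a) = 0" using g(5) by simp
    then show ?thesis unfolding b_def by (intro prod_zero) auto
  qed
  define \<kappa> where "\<kappa> x = 1 + (-1) * (\<Prod>a\<in>F. 1 + (-1) * (\<Prod>j\<in>UNIV. complex_of_real (g ((1 / d a) * x $ j + - a $ j / d a))))" for x :: "real^'n"
  have \<kappa>r: "\<kappa> x = complex_of_real (1 - (\<Prod>a\<in>F. 1 - b a x))" for x
    by (simp add: \<kappa>_def b_def)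
  have "\<kappa> \<in> coord_alg"
    unfolding \<kappa>_def
    by (intro coord_alg.add coord_alg.mult coord_alg.const coord_alg_prod
        coord_alg.coord_fun[of "\<lambda>t. g (_ * t + _)"] smooth1_affine g)
  moreover have "compact L" unfolding L_def using F by (intro compact_UN) auto
  moreover have "L \<subseteq> U"
  proof
    fix x assume "x \<in> L"
    then obtain a where "a \<in> F" "x \<in> cbox (a - (\<chi> j. 2 * d a)) (a + (\<chi> j. 2 * d a))" by (auto simp: L_def)
    then have "\<forall>j. \<bar>x $ j - a $ j\<bar> \<le> 2 * d a"
      by (simp add: mem_box_cart abs_le_iff) (metis add.commute diff_le_eq le_diff_eq)
    then show "x \<in> U" using d(2) F(1) \<open>a \<in> F\<close> by blast
  qed
  moreover have "\<kappa> x = 1" if "x \<in> K" for x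
  proof -
    from F(3) that obtain a where "a \<in> F" "x \<in> N a" by auto
    then have "(\<Prod>a\<in>F. 1 - b a x) = 0" using b1 F(2) by (intro prod_zero) auto
    then show ?thesis by (simp add: \<kappa>r)
  qed
  moreover have "\<kappa> x = 0" if "x \<notin> L" for x
    using b0[OF _ that] by (simp add: \<kappa>r)
  moreover have "\<exists>r\<in>{0..1}. \<kappa> x = complex_of_real r" for x
  proof (intro bexI[of _ "1 - (\<Prod>a\<in>F. 1 - b a x)"])
    have "0 \<le> (\<Prod>a\<in>F. 1 - b a x)" "(\<Prod>a\<in>F. 1 - b a x) \<le> 1" using b01 by (auto intro!: prod_nonneg prod_le_1)
    then show "1 - (\<Prod>a\<in>F. 1 - b a x) \<in> {0..1}" by auto
  qed (rule \<kappa>r)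
  ultimately show ?thesis by blast
qed

section \<open>Smooth functions with support in a compact set\<close>

text \<open>Constants in the estimates depend on a compact set that contains all supports. Fixing
  this set gives a vector space on which they are uniform; \<open>test_functions\<close> is the
  union over compact subsets (\<open>test_functions_iff\<close>).\<close>

definition smooth_in :: "(real^'n::finite) set \<Rightarrow> (real^'n \<Rightarrow> complex) set" where
  "smooth_in K = {f. smooth f \<and> (\<forall>x. x \<notin> K \<longrightarrow> f x = 0)}"

lemma smooth_inI: "smooth f \<Longrightarrow> (\<And>x. x \<notin> K \<Longrightarrow> f x = 0) \<Longrightarrow> f \<in> smooth_in K"
  by (simp add: smooth_in_def)

lemma smooth_inD: "f \<in> smooth_in K \<Longrightarrow> smooth f" "f \<in> smooth_in K \<Longrightarrow> x \<notin> K \<Longrightarrow> f x = 0"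
  by (simp_all add: smooth_in_def)

lemma smooth_in_mono: "f \<in> smooth_in K \<Longrightarrow> K \<subseteq> L \<Longrightarrow> f \<in> smooth_in L"
  by (auto simp: smooth_in_def)

lemma smooth_in_zero: "(\<lambda>x. 0) \<in> smooth_in K"
  by (simp add: smooth_in_def smooth_const)

lemma smooth_in_add: "f \<in> smooth_in K \<Longrightarrow> g \<in> smooth_in K \<Longrightarrow> (\<lambda>x. f x + g x) \<in> smooth_in K"
  and smooth_in_diff: "f \<in> smooth_in K \<Longrightarrow> g \<in> smooth_in K \<Longrightarrow> (\<lambda>x. f x - g x) \<in> smooth_in K"
  and smooth_in_cmult: "f \<in> smooth_in K \<Longrightarrow> (\<lambda>x. c * f x) \<in> smooth_in K"
  and smooth_in_mult: "smooth h \<Longrightarrow> f \<in> smooth_in K \<Longrightarrow> (\<lambda>x. h x * f x) \<in> smooth_in K"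
  and smooth_in_cnj: "f \<in> smooth_in K \<Longrightarrow> (\<lambda>x. cnj (f x)) \<in> smooth_in K"
  and smooth_in_uminus: "f \<in> smooth_in K \<Longrightarrow> (\<lambda>x. - f x) \<in> smooth_in K"
  by (auto simp: smooth_in_def smooth_add smooth_diff smooth_cmult smooth_mult smooth_cnj smooth_uminus)

lemma smooth_in_sum: "(\<And>a. a \<in> A \<Longrightarrow> f a \<in> smooth_in K) \<Longrightarrow> (\<lambda>x. \<Sum>a\<in>A. f a x) \<in> smooth_in K"
  by (induction A rule: infinite_finite_induct) (auto intro: smooth_in_zero smooth_in_add)

lemma partial_deriv_zero_off:
  assumes "closed K" "\<And>x. x \<notin> K \<Longrightarrow> f x = 0" "x \<notin> K"
  shows "partial_deriv i f x = 0"
proof -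
  have "((\<lambda>x. 0) has_derivative (\<lambda>h. 0)) (at x)" by simp
  then have "(f has_derivative (\<lambda>h. 0)) (at x)"
    by (rule has_derivative_transform_within_open[of _ _ _ _ "- K"]) (use assms in auto)
  then show ?thesis by (rule partial_deriv_eq)
qed

lemma smooth_in_partial_deriv: "closed K \<Longrightarrow> f \<in> smooth_in K \<Longrightarrow> partial_deriv i f \<in> smooth_in K"
  by (auto simp: smooth_in_def smooth_partial_deriv intro: partial_deriv_zero_off)

lemma smooth_in_fold: "closed K \<Longrightarrow> f \<in> smooth_in K \<Longrightarrow> fold partial_deriv w f \<in> smooth_in K"
  by (induction w arbitrary: f) (auto intro: smooth_in_partial_deriv)

lemma test_functions_iff:
  "f \<in> test_functions \<Omega> \<longleftrightarrow> (\<exists>K. compact K \<and> K \<subseteq> \<Omega> \<and> f \<in> smooth_in K)"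
proof
  assume "f \<in> test_functions \<Omega>"
  moreover have "f x = 0" if "x \<notin> closure {x. f x \<noteq> 0}" for x
    using that closure_subset[of "{x. f x \<noteq> 0}"] by auto
  ultimately show "\<exists>K. compact K \<and> K \<subseteq> \<Omega> \<and> f \<in> smooth_in K"
    unfolding test_functions_def smooth_in_def by blast
next
  assume "\<exists>K. compact K \<and> K \<subseteq> \<Omega> \<and> f \<in> smooth_in K"
  then obtain K where K: "compact K" "K \<subseteq> \<Omega>" "f \<in> smooth_in K" by blast
  have sub: "closure {x. f x \<noteq> 0} \<subseteq> K"
    using K by (intro closure_minimal) (auto simp: smooth_in_def compact_imp_closed)
  then have "compact (closure {x. f x \<noteq> 0})"
    using closed_Int_compact[OF closed_closure[of "{x. f x \<noteq> 0}"] K(1)] by (simp only: Int_absorb2)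
  then show "f \<in> test_functions \<Omega>"
    using K sub by (simp add: test_functions_def smooth_in_def)
qed

lemma smooth_in_supp: "closed K \<Longrightarrow> f \<in> smooth_in K \<Longrightarrow> closure {x. f x \<noteq> 0} \<subseteq> K"
  by (intro closure_minimal) (auto simp: smooth_in_def)

lemma test_functionsI: "compact K \<Longrightarrow> K \<subseteq> \<Omega> \<Longrightarrow> f \<in> smooth_in K \<Longrightarrow> f \<in> test_functions \<Omega>"
  by (auto simp: test_functions_iff)

lemma test_functions_smooth: "f \<in> test_functions \<Omega> \<Longrightarrow> smooth f"
  by (simp add: test_functions_def)

lemma test_functions_mono: "f \<in> test_functions A \<Longrightarrow> A \<subseteq> B \<Longrightarrow> f \<in> test_functions B"
  by (auto simp: test_functions_def)

lemma test_functions_smooth_in: "f \<in> test_functions A \<Longrightarrow> A \<subseteq> K \<Longrightarrow> f \<in> smooth_in K"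
  by (auto simp: test_functions_iff intro: smooth_in_mono)

lemma test_functions2:
  assumes "f \<in> test_functions \<Omega>" "g \<in> test_functions \<Omega>"
  obtains K where "compact K" "K \<subseteq> \<Omega>" "f \<in> smooth_in K" "g \<in> smooth_in K"
proof -
  from assms obtain K L where "compact K" "K \<subseteq> \<Omega>" "f \<in> smooth_in K" "compact L" "L \<subseteq> \<Omega>" "g \<in> smooth_in L"
    by (auto simp: test_functions_iff)
  then show ?thesis using that[of "K \<union> L"] smooth_in_mono by blast
qed

lemma test_functions_zero: "(\<lambda>x. 0) \<in> test_functions \<Omega>"
  using test_functionsI[of "{}", OF _ _ smooth_in_zero] by auto

lemma test_functions_add: "f \<in> test_functions \<Omega> \<Longrightarrow> g \<in> test_functions \<Omega> \<Longrightarrow> (\<lambda>x. f x + g x) \<in> test_functions \<Omega>"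
  by (rule test_functions2[of f \<Omega> g]) (auto intro: test_functionsI smooth_in_add)

lemma test_functions_diff: "f \<in> test_functions \<Omega> \<Longrightarrow> g \<in> test_functions \<Omega> \<Longrightarrow> (\<lambda>x. f x - g x) \<in> test_functions \<Omega>"
  by (rule test_functions2[of f \<Omega> g]) (auto intro: test_functionsI smooth_in_diff)

lemma test_functions_mult: "smooth h \<Longrightarrow> f \<in> test_functions \<Omega> \<Longrightarrow> (\<lambda>x. h x * f x) \<in> test_functions \<Omega>"
  by (auto simp: test_functions_iff intro: smooth_in_mult)

lemma test_functions_cmult: "f \<in> test_functions \<Omega> \<Longrightarrow> (\<lambda>x. c * f x) \<in> test_functions \<Omega>"
  by (intro test_functions_mult smooth_const)

lemma test_functions_partial_deriv: "f \<in> test_functions \<Omega> \<Longrightarrow> partial_deriv i f \<in> test_functions \<Omega>"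
  by (meson test_functions_iff smooth_in_partial_deriv compact_imp_closed)

lemma test_functions_fold: "f \<in> test_functions \<Omega> \<Longrightarrow> fold partial_deriv w f \<in> test_functions \<Omega>"
  by (induction w arbitrary: f) (auto intro: test_functions_partial_deriv)

lemma test_functions_sum: "(\<And>a. a \<in> A \<Longrightarrow> f a \<in> test_functions \<Omega>) \<Longrightarrow> (\<lambda>x. \<Sum>a\<in>A. f a x) \<in> test_functions \<Omega>"
  by (induction A rule: infinite_finite_induct) (auto intro: test_functions_zero test_functions_add)

section \<open>Integration by parts\<close>

lemma integrable_continuous_compact:
  fixes f :: "real^'n::finite \<Rightarrow> 'b::euclidean_space"
  assumes "compact K" "continuous_on UNIV f" "\<And>x. x \<notin> K \<Longrightarrow> f x = 0"
  shows "integrable lborel f"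
proof -
  have "integrable lborel (\<lambda>x. indicator K x *\<^sub>R f x)"
    using assms by (intro borel_integrable_compact) (auto intro: continuous_on_subset)
  also have "(\<lambda>x. indicator K x *\<^sub>R f x) = f" using assms(3) by (auto simp: indicator_def)
  finally show ?thesis .
qed

lemma bounded_continuous_compact:
  fixes f :: "real^'n::finite \<Rightarrow> 'b::real_normed_vector"
  assumes "compact K" "continuous_on UNIV f" "\<And>x. x \<notin> K \<Longrightarrow> f x = 0"
  obtains B where "B > 0" "\<And>x. norm (f x) \<le> B"
proof -
  have "bounded (f ` K)"
    using assms by (intro compact_imp_bounded compact_continuous_image) (auto intro: continuous_on_subset)
  then obtain B where "B > 0" "\<And>x. x \<in> K \<Longrightarrow> norm (f x) \<le> B"
    by (auto simp: bounded_pos)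
  then show ?thesis using assms(3) that[of B] by (metis less_imp_le norm_zero)
qed

lemma lborel_integral_shift:
  fixes f :: "real^'n::finite \<Rightarrow> complex"
  assumes "f \<in> borel_measurable borel"
  shows "(LINT x|lborel. f (c + x)) = (LINT x|lborel. f x)"
proof -
  have "(LINT x|lborel. f x) = (LINT x|distr lborel borel ((+) c). f x)"
    by (simp add: lborel_distr_plus)
  also have "\<dots> = (LINT x|lborel. f (c + x))"
    using assms by (subst integral_distr) auto
  finally show ?thesis by simp
qed

lemma integral_line_deriv_zero:
  fixes F G :: "real^'n::finite \<Rightarrow> complex"
  assumes K: "compact K" and F: "continuous_on UNIV F" "\<And>x. x \<notin> K \<Longrightarrow> F x = 0"
    and G: "continuous_on UNIV G" "\<And>x. x \<notin> K \<Longrightarrow> G x = 0"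
    and d: "\<And>x s. ((\<lambda>s. F (x + s *\<^sub>R e)) has_vector_derivative G (x + s *\<^sub>R e)) (at s)"
  shows "(LINT x|lborel. G x) = 0"
proof -
  obtain B where B: "B > 0" "\<And>x. norm (G x) \<le> B"
    using bounded_continuous_compact[OF K G] by blast
  define h where "h n = inverse (real (Suc n))" for n
  have h: "h n > 0" "h n \<le> 1" for n by (auto simp: h_def inverse_le_1_iff)
  have hl: "h \<longlonglongrightarrow> 0" unfolding h_def using LIMSEQ_inverse_real_of_nat by simp
  \<comment> \<open>All difference quotients with step at most 1 vanish off this set: it consists of
    \<open>K\<close> moved back along \<open>e\<close> by up to one unit.\<close>
  define L where "L = (\<lambda>(k, s). k - s *\<^sub>R e) ` (K \<times> {0..1::real})"
  have L: "compact L"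
    unfolding L_def by (intro compact_continuous_image compact_Times K)
      (auto simp: case_prod_unfold intro!: continuous_intros)
  define u where "u n x = (F (x + h n *\<^sub>R e) - F x) /\<^sub>R h n" for n x
  have u0: "u n x = 0" if "x \<notin> L" for n x
  proof -
    have "x \<notin> K"
    proof
      assume "x \<in> K" then have "x \<in> L" unfolding L_def by (intro image_eqI[of _ _ "(x, 0)"]) auto
      with that show False by simp
    qed
    moreover have "x + h n *\<^sub>R e \<notin> K"
    proof
      assume "x + h n *\<^sub>R e \<in> K" then have "x \<in> L" unfolding L_def using h[of n]
        by (intro image_eqI[of _ _ "(x + h n *\<^sub>R e, h n)"]) (auto intro: less_imp_le)
      with that show False by simp
    qed
    ultimately show ?thesis using F(2) by (simp add: u_def)
  qed
  have uB: "norm (u n x) \<le> B" for n x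
  proof -
    have "norm (F (x + h n *\<^sub>R e) - F (x + 0 *\<^sub>R e)) \<le> B * norm (h n - 0)"
    proof (rule differentiable_bound[of UNIV "\<lambda>s. F (x + s *\<^sub>R e)" "\<lambda>s t. t *\<^sub>R G (x + s *\<^sub>R e)"])
      fix s :: real
      show "((\<lambda>s. F (x + s *\<^sub>R e)) has_derivative (\<lambda>t. t *\<^sub>R G (x + s *\<^sub>R e))) (at s within UNIV)"
        using d[of x s] by (simp add: has_vector_derivative_def)
      show "onorm (\<lambda>t. t *\<^sub>R G (x + s *\<^sub>R e)) \<le> B"
        using B by (intro onorm_le) (auto simp: mult.commute[of B] intro: mult_left_mono)
    qed auto
    moreover have "norm (u n x) = norm (F (x + h n *\<^sub>R e) - F x) / h n"
      using h[of n] by (simp add: u_def divide_inverse mult.commute)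
    ultimately show ?thesis using h[of n] by (simp add: pos_divide_le_eq)
  qed
  have "(\<lambda>n. LINT x|lborel. u n x) \<longlonglongrightarrow> (LINT x|lborel. G x)"
  proof (rule integral_dominated_convergence[where w="\<lambda>x. indicator L x * B"])
    show "G \<in> borel_measurable lborel" using G(1) borel_measurable_continuous_onI by auto
    show "u n \<in> borel_measurable lborel" for n
    proof -
      have "continuous_on UNIV (u n)" unfolding u_def
        by (intro continuous_intros continuous_on_compose2[OF F(1)] F) auto
      then show ?thesis using borel_measurable_continuous_onI by auto
    qed
    show "integrable lborel (\<lambda>x. indicator L x * B)"
      using borel_integrable_compact[OF L, of "\<lambda>_. B"] by simp
    show "AE x in lborel. (\<lambda>n. u n x) \<longlonglongrightarrow> G x"
    proof (rule AE_I2)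
      fix x
      have "((\<lambda>t. (F (x + t *\<^sub>R e) - F x) /\<^sub>R t) \<longlongrightarrow> G x) (at 0)"
      proof (subst Lim_null, subst tendsto_norm_zero_iff[symmetric], rule Lim_transform_eventually)
        show "((\<lambda>t. norm (F (x + t *\<^sub>R e) - F (x + 0 *\<^sub>R e) - (t - 0) *\<^sub>R G (x + 0 *\<^sub>R e)) / norm (t - 0)) \<longlongrightarrow> 0) (at 0)"
          using d[of x 0] unfolding has_vector_derivative_def has_derivative_iff_norm by blast
        have "norm ((F (x + t *\<^sub>R e) - F x) - t *\<^sub>R G x) / norm t = norm ((F (x + t *\<^sub>R e) - F x) /\<^sub>R t - G x)"
          if "t \<noteq> 0" for t
        proof -
          have "(F (x + t *\<^sub>R e) - F x) /\<^sub>R t - G x = ((F (x + t *\<^sub>R e) - F x) - t *\<^sub>R G x) /\<^sub>R t"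
            using that by (simp add: scaleR_diff_right)
          then show ?thesis by (simp only: norm_scaleR) (simp add: divide_inverse mult.commute)
        qed
        then show "\<forall>\<^sub>F t in at 0. norm (F (x + t *\<^sub>R e) - F (x + 0 *\<^sub>R e) - (t - 0) *\<^sub>R G (x + 0 *\<^sub>R e)) / norm (t - 0)
            = norm ((F (x + t *\<^sub>R e) - F x) /\<^sub>R t - G x)"
          by (auto simp: eventually_at_filter)
      qed
      moreover have "filterlim h (at 0) sequentially"
        using hl h(1) by (auto simp: filterlim_at less_imp_neq[symmetric])
      ultimately show "(\<lambda>n. u n x) \<longlonglongrightarrow> G x"
        unfolding u_def by (rule filterlim_compose)
    qed
    show "AE x in lborel. norm (u n x) \<le> indicator L x * B" for n
      using uB u0 B by (intro AE_I2) (auto simp: indicator_def)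
  qed
  moreover have "(LINT x|lborel. u n x) = 0" for n
  proof -
    have Fm: "F \<in> borel_measurable borel" using F(1) borel_measurable_continuous_onI by auto
    have Fi: "integrable lborel F" by (rule integrable_continuous_compact[OF K F])
    have "integrable lborel (\<lambda>x. F (x + h n *\<^sub>R e))"
    proof (rule integrable_continuous_compact[of "(\<lambda>x. x - h n *\<^sub>R e) ` K"])
      show "compact ((\<lambda>x. x - h n *\<^sub>R e) ` K)"
        by (intro compact_continuous_image continuous_intros K)
      show "continuous_on UNIV (\<lambda>x. F (x + h n *\<^sub>R e))"
        by (intro continuous_on_compose2[OF F(1)] continuous_intros) auto
      fix x assume "x \<notin> (\<lambda>x. x - h n *\<^sub>R e) ` K"
      then have "x + h n *\<^sub>R e \<notin> K" by (metis add_diff_cancel image_eqI)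
      then show "F (x + h n *\<^sub>R e) = 0" by (rule F(2))
    qed
    moreover have "(LINT x|lborel. F (x + h n *\<^sub>R e)) = (LINT x|lborel. F x)"
      using lborel_integral_shift[OF Fm, of "h n *\<^sub>R e"] by (simp add: add.commute)
    ultimately show ?thesis unfolding u_def using Fi by simp
  qed
  ultimately show ?thesis by (simp add: LIMSEQ_const_iff)
qed

text \<open>By the convention \<open>0 powr a = 0\<close> the weight vanishes on the coordinate
  hyperplanes whatever the exponents are, see \<open>weight_eq_0\<close>.\<close>

definition weight :: "('n::finite \<Rightarrow> real) \<Rightarrow> real^'n \<Rightarrow> real" where
  "weight a x = (\<Prod>i\<in>UNIV. \<bar>x $ i\<bar> powr a i)"

lemma weight_nonneg: "weight a x \<ge> 0"
  by (auto simp: weight_def intro: prod_nonneg)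

lemma weight_measurable [measurable]: "weight a \<in> borel_measurable borel"
proof -
  have "(\<lambda>x::real^'n. x $ i) \<in> borel_measurable borel" for i
    by (intro borel_measurable_continuous_onI continuous_intros)
  then show ?thesis unfolding weight_def by measurable
qed

lemma continuous_on_weight:
  assumes "\<And>i. a i > 0" shows "continuous_on S (weight a)"
  unfolding weight_def
  by (intro continuous_on_prod continuous_on_powr' continuous_intros) (use assms in auto)

lemma weight_split: "weight a x = \<bar>x $ j\<bar> powr a j * (\<Prod>i\<in>UNIV - {j}. \<bar>x $ i\<bar> powr a i)"
  unfolding weight_def by (subst prod.remove[of _ j]) auto

text \<open>For small \<open>a\<close> the function \<open>|t| powr a\<close> has no derivative at
  0. The factor \<open>t\<close> repairs this, which is why Euler derivatives, unlike plain partial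
  derivatives, can be integrated by parts against the weight.\<close>

lemma DERIV_abs_powr:
  assumes "a > (0::real)"
  shows "((\<lambda>t. t * \<bar>t\<bar> powr a) has_real_derivative (1 + a) * \<bar>t\<bar> powr a) (at t)"
proof -
  consider "t < 0" | "t = 0" | "t > 0" by linarith
  then show ?thesis
  proof cases
    case 1
    have "((\<lambda>t. - ((- t) powr (1 + a))) has_real_derivative (1 + a) * (- t) powr a) (at t)"
      using 1 by (auto intro!: derivative_eq_intros)
    then have "((\<lambda>t. t * \<bar>t\<bar> powr a) has_real_derivative (1 + a) * (- t) powr a) (at t)"
      by (rule has_field_derivative_transform_within_open[of _ _ _ "{..<0}"])
        (use 1 in \<open>auto simp: powr_add\<close>)
    then show ?thesis using 1 by simp
  next
    case 2
    have "((\<lambda>h::real. \<bar>h\<bar> powr a) \<longlongrightarrow> \<bar>0\<bar> powr a) (at 0)"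
    proof -
      have "continuous_on UNIV (\<lambda>h::real. \<bar>h\<bar> powr a)"
        by (intro continuous_on_powr' continuous_intros) (use assms in auto)
      then have "isCont (\<lambda>h::real. \<bar>h\<bar> powr a) 0"
        by (simp add: continuous_on_eq_continuous_at)
      then show ?thesis by (simp only: isCont_def)
    qed
    then have "((\<lambda>h::real. h * \<bar>h\<bar> powr a / h) \<longlongrightarrow> 0) (at 0)"
      using assms by (rule_tac Lim_transform_eventually) (auto simp: eventually_at_filter)
    then show ?thesis using 2 assms by (simp add: has_field_derivative_iff)
  next
    case 3
    have "((\<lambda>t. t powr (1 + a)) has_real_derivative (1 + a) * t powr a) (at t)"
      using 3 by (auto intro!: derivative_eq_intros)
    then have "((\<lambda>t. t * \<bar>t\<bar> powr a) has_real_derivative (1 + a) * t powr a) (at t)"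
      by (rule has_field_derivative_transform_within_open[of _ _ _ "{0<..}"])
        (use 3 in \<open>auto simp: powr_add\<close>)
    then show ?thesis using 3 by simp
  qed
qed

section \<open>Integration by parts without and with weights\<close>

lemma smooth_in_integrable:
  "compact K \<Longrightarrow> f \<in> smooth_in K \<Longrightarrow> integrable lborel f"
  by (rule integrable_continuous_compact) (auto simp: smooth_in_def smooth_continuous_on)

lemma smooth_in_weight_integrable:
  assumes "compact K" "f \<in> smooth_in K" "\<And>i. a i > 0"
  shows "integrable lborel (\<lambda>x. complex_of_real (weight a x) * f x)"
  using assms
  by (intro integrable_continuous_compact[of K] continuous_intros continuous_on_weight)
     (auto simp: smooth_in_def smooth_continuous_on)

lemma integral_partial_deriv_zero:
  assumes K: "compact K" and f: "f \<in> smooth_in K"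
  shows "(LINT x|lborel. partial_deriv i f x) = 0"
  by (rule integral_line_deriv_zero[OF K, of f _ "axis i 1"])
    (use f smooth_in_partial_deriv[OF compact_imp_closed[OF K] f] in
      \<open>auto simp: smooth_in_def smooth_continuous_on partial_deriv_line\<close>)

lemma integral_by_parts:
  assumes K: "compact K" and f: "smooth f" and g: "g \<in> smooth_in K"
  shows "(LINT x|lborel. partial_deriv i f x * g x) = - (LINT x|lborel. f x * partial_deriv i g x)"
proof -
  have fg: "(\<lambda>x. f x * g x) \<in> smooth_in K" by (rule smooth_in_mult[OF f g])
  have i: "integrable lborel (\<lambda>x. partial_deriv i f x * g x)" "integrable lborel (\<lambda>x. f x * partial_deriv i g x)"
    by (intro smooth_in_integrable[OF K] smooth_in_mult smooth_partial_deriv smooth_in_partial_deriv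
        compact_imp_closed K f g)+
  have "0 = (LINT x|lborel. partial_deriv i f x * g x + f x * partial_deriv i g x)"
    using integral_partial_deriv_zero[OF K fg, of i] partial_deriv_mult[OF f smooth_inD(1)[OF g], of i] by simp
  then show ?thesis using i by (simp add: eq_neg_iff_add_eq_0)
qed

text \<open>The derivative of \<open>x $ j * weight a x * f x\<close> in direction \<open>j\<close>
  is the left integrand plus \<open>1 + a j\<close> times \<open>weight a x * f x\<close>, and its
  integral vanishes.\<close>

lemma weighted_integral_theta:
  fixes a :: "'n::finite \<Rightarrow> real" and f :: "real^'n \<Rightarrow> complex"
  assumes K: "compact K" and f: "f \<in> smooth_in K" and a: "\<And>i. a i > 0"
  shows "(LINT x|lborel. complex_of_real (weight a x) * (complex_of_real (x $ j) * partial_deriv j f x))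
     = - (1 + complex_of_real (a j)) * (LINT x|lborel. complex_of_real (weight a x) * f x)"
proof -
  define W where "W x = (\<Prod>i\<in>UNIV - {j}. \<bar>x $ i\<bar> powr a i)" for x :: "real^'n"
  have W: "W (x + s *\<^sub>R axis j 1) = W x" for x s
    unfolding W_def by (rule prod.cong) (auto simp: axis_def)
  define F where "F x = complex_of_real (x $ j * weight a x) * f x" for x
  define G where "G x = complex_of_real (weight a x) * (complex_of_real (x $ j) * partial_deriv j f x)
      + complex_of_real ((1 + a j) * weight a x) * f x" for x
  have pf: "partial_deriv j f \<in> smooth_in K" by (rule smooth_in_partial_deriv[OF compact_imp_closed[OF K] f])
  have xpf: "(\<lambda>x. complex_of_real (x $ j) * partial_deriv j f x) \<in> smooth_in K"
    by (rule smooth_in_mult[OF smooth_coord pf])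
  have "(LINT x|lborel. G x) = 0"
  proof (rule integral_line_deriv_zero[OF K, of F _ "axis j 1"])
    show "continuous_on UNIV F" unfolding F_def
      using f by (intro continuous_intros continuous_on_weight a) (auto simp: smooth_in_def smooth_continuous_on)
    show "continuous_on UNIV G" unfolding G_def
      using f pf by (intro continuous_intros continuous_on_weight a) (auto simp: smooth_in_def smooth_continuous_on)
    show "F x = 0" "G x = 0" if "x \<notin> K" for x
      using f pf that by (auto simp: F_def G_def smooth_in_def)
    fix x :: "real^'n" and s :: real
    have w: "weight a (x + s *\<^sub>R axis j 1) = \<bar>x $ j + s\<bar> powr a j * W x" for s
      unfolding weight_split[of a _ j] W_def[symmetric] W by simp
    have "((\<lambda>s. ((x $ j + s) * \<bar>x $ j + s\<bar> powr a j) * W x) has_real_derivative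
        ((1 + a j) * \<bar>x $ j + s\<bar> powr a j * 1) * W x) (at s)"
      by (rule DERIV_cmult_right, rule DERIV_chain2[OF DERIV_abs_powr[OF a]]) (auto intro!: derivative_eq_intros)
    then have 1: "((\<lambda>s. complex_of_real ((x $ j + s) * \<bar>x $ j + s\<bar> powr a j * W x)) has_vector_derivative
        complex_of_real ((1 + a j) * \<bar>x $ j + s\<bar> powr a j * W x)) (at s)"
      unfolding has_real_derivative_iff_has_vector_derivative
      using bounded_linear.has_vector_derivative[OF bounded_linear_of_real] by fastforce
    have 2: "((\<lambda>s. f (x + s *\<^sub>R axis j 1)) has_vector_derivative partial_deriv j f (x + s *\<^sub>R axis j 1)) (at s)"
      using f by (intro partial_deriv_line) (auto simp: smooth_in_def)
    from has_vector_derivative_mult[OF 1 2]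
    show "((\<lambda>s. F (x + s *\<^sub>R axis j 1)) has_vector_derivative G (x + s *\<^sub>R axis j 1)) (at s)"
      unfolding F_def G_def w by (simp add: algebra_simps)
  qed
  moreover have "integrable lborel (\<lambda>x. complex_of_real (weight a x) * (complex_of_real (x $ j) * partial_deriv j f x))"
    by (rule smooth_in_weight_integrable[OF K xpf a])
  moreover have "integrable lborel (\<lambda>x. complex_of_real ((1 + a j) * weight a x) * f x)"
    using integrable_mult_right[OF smooth_in_weight_integrable[OF K f a], of "complex_of_real (1 + a j)"]
    by (simp add: mult.assoc)
  ultimately have "(LINT x|lborel. complex_of_real (weight a x) * (complex_of_real (x $ j) * partial_deriv j f x))
      + (1 + complex_of_real (a j)) * (LINT x|lborel. complex_of_real (weight a x) * f x) = 0"
    unfolding G_def by (simp add: mult.assoc)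
  then show ?thesis by (simp only: add_eq_0_iff2 mult_minus_left)
qed

section \<open>Polynomials in the transposed Euler derivatives\<close>

lemma mdegree_zero [simp]: "mdegree 0 = 0"
  by (simp add: mdegree_def)

lemma mdegree_add: "mdegree (\<alpha> + \<beta>) = mdegree \<alpha> + mdegree \<beta>"
  by (simp add: mdegree_def lookup_add sum.distrib)

lemma mdegree_single [simp]: "mdegree (Poly_Mapping.single i k) = k"
  by (simp add: mdegree_def lookup_single when_def)

lemma multi_index_induct [case_names zero add]:
  fixes \<alpha> :: "'n::finite \<Rightarrow>\<^sub>0 nat"
  assumes "Q 0" and "\<And>\<alpha> i. Q \<alpha> \<Longrightarrow> Q (\<alpha> + Poly_Mapping.single i 1)"
  shows "Q \<alpha>"
proof (induction "mdegree \<alpha>" arbitrary: \<alpha>)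
  case 0
  then have "\<alpha> = 0"
    by (intro poly_mapping_eqI) (auto simp: mdegree_def)
  then show ?case using assms(1) by simp
next
  case (Suc k)
  then have "\<not> (\<forall>i. Poly_Mapping.lookup \<alpha> i = 0)"
    unfolding mdegree_def by (metis nat.distinct(1) sum.neutral)
  then obtain i where i: "Poly_Mapping.lookup \<alpha> i \<noteq> 0" by blast
  define \<beta> where "\<beta> = \<alpha> - Poly_Mapping.single i 1"
  have \<alpha>: "\<alpha> = \<beta> + Poly_Mapping.single i 1"
    by (rule poly_mapping_eqI) (use i in \<open>auto simp: \<beta>_def lookup_add lookup_minus lookup_single when_def\<close>)
  have "mdegree \<beta> = k" using Suc(2) unfolding \<alpha> by (simp add: mdegree_add)
  then show ?case using Suc(1)[of \<beta>] assms(2) unfolding \<alpha> by blast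
qed

lemma op_monom_zero [simp]: "op_monom A 0 f = f"
proof -
  have "fold (\<lambda>i. A i ^^ Poly_Mapping.lookup 0 i) xs f = f" for xs
    by (induction xs) auto
  then show ?thesis by (simp add: op_monom_def)
qed

text \<open>\<open>op_monom\<close> composes powers along an arbitrary enumeration of the variables.
  If the operators commute on an invariant set, one further power of any variable may be applied
  first or last, and this recursion is what the inductions over multi-indices use.\<close>

locale commuting =
  fixes S :: "'a set" and A :: "'n::finite \<Rightarrow> 'a \<Rightarrow> 'a"
  assumes closed: "f \<in> S \<Longrightarrow> A i f \<in> S"
    and comm: "f \<in> S \<Longrightarrow> A i (A j f) = A j (A i f)"
begin

lemma pow_closed: "f \<in> S \<Longrightarrow> (A i ^^ k) f \<in> S"
  by (induction k) (auto intro: closed)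

lemma pow_comm: "f \<in> S \<Longrightarrow> A j ((A i ^^ k) f) = (A i ^^ k) (A j f)"
  by (induction k) (auto simp: comm pow_closed)

lemma fold_closed: "f \<in> S \<Longrightarrow> fold (\<lambda>i. A i ^^ \<alpha> i) xs f \<in> S"
  by (induction xs arbitrary: f) (auto intro: pow_closed)

lemma fold_comm: "f \<in> S \<Longrightarrow> A j (fold (\<lambda>i. A i ^^ \<alpha> i) xs f) = fold (\<lambda>i. A i ^^ \<alpha> i) xs (A j f)"
  by (induction xs arbitrary: f) (auto simp: pow_closed pow_comm)

lemma fold_Suc:
  assumes "distinct xs" "j \<in> set xs" "f \<in> S"
  shows "fold (\<lambda>i. A i ^^ (\<alpha> i + (if i = j then 1 else 0))) xs f = fold (\<lambda>i. A i ^^ \<alpha> i) xs (A j f)"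
  using assms
proof (induction xs arbitrary: f)
  case (Cons i xs)
  show ?case
  proof (cases "i = j")
    case True
    with Cons.prems have "fold (\<lambda>i. A i ^^ (\<alpha> i + (if i = j then 1 else 0))) xs g = fold (\<lambda>i. A i ^^ \<alpha> i) xs g" for g
      by (intro fold_cong) auto
    then show ?thesis using True by (simp add: funpow_swap1)
  next
    case False
    with Cons show ?thesis by (simp add: pow_closed pow_comm)
  qed
qed simp

lemma op_monom_closed: "f \<in> S \<Longrightarrow> op_monom A \<alpha> f \<in> S"
  unfolding op_monom_def by (rule fold_closed)

lemma op_monom_comm: "f \<in> S \<Longrightarrow> A j (op_monom A \<alpha> f) = op_monom A \<alpha> (A j f)"
  unfolding op_monom_def by (rule fold_comm)

lemma op_monom_Suc': "f \<in> S \<Longrightarrow> op_monom A (\<alpha> + Poly_Mapping.single j 1) f = op_monom A \<alpha> (A j f)"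
  unfolding op_monom_def
  using fold_Suc[of "index_list :: 'n list" j f "Poly_Mapping.lookup \<alpha>"]
  by (simp add: index_list lookup_add lookup_single when_def eq_commute del: One_nat_def)

lemma op_monom_Suc: "f \<in> S \<Longrightarrow> op_monom A (\<alpha> + Poly_Mapping.single j 1) f = A j (op_monom A \<alpha> f)"
  by (simp only: op_monom_Suc' op_monom_comm)

end

interpretation partial: commuting "{f. smooth f}" partial_deriv
  by unfold_locales (auto intro: smooth_partial_deriv partial_deriv_commute)

text \<open>\<open>theta_shift u i\<close> is \<open>\<theta>\<^sub>i\<^sup>* - u\<^sub>i\<close>; the shifts \<open>u\<close> absorb derivatives, weights and adjoints.\<close>

definition theta_shift :: "('n::finite \<Rightarrow> complex) \<Rightarrow> 'n \<Rightarrow> (real^'n \<Rightarrow> complex) \<Rightarrow> real^'n \<Rightarrow> complex" where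
  "theta_shift u i f = (\<lambda>x. - (1 + u i) * f x - complex_of_real (x $ i) * partial_deriv i f x)"

lemma smooth_theta_shift: "smooth f \<Longrightarrow> smooth (theta_shift u i f)"
  unfolding theta_shift_def
  by (intro smooth_diff smooth_cmult smooth_mult smooth_coord smooth_partial_deriv)

lemma smooth_in_theta_shift: "closed K \<Longrightarrow> f \<in> smooth_in K \<Longrightarrow> theta_shift u i f \<in> smooth_in K"
  unfolding theta_shift_def
  by (intro smooth_in_diff smooth_in_cmult smooth_in_mult smooth_coord smooth_in_partial_deriv)

text \<open>The commutator relation: passing \<open>partial_deriv j\<close> through the transposed
  Euler derivative of the same variable subtracts 1 from it, that is, raises \<open>u j\<close> by
  1.\<close>

lemma partial_deriv_theta_shift:
  assumes f: "smooth f"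
  shows "partial_deriv j (theta_shift u i f) = theta_shift (u(j := u j + 1)) i (partial_deriv j f)"
proof -
  have "partial_deriv j (theta_shift u i f) = (\<lambda>x. - (1 + u i) * partial_deriv j f x -
      ((if j = i then 1 else 0) * partial_deriv i f x + complex_of_real (x $ i) * partial_deriv j (partial_deriv i f) x))"
    unfolding theta_shift_def
    by (simp only: partial_deriv_diff partial_deriv_cmult partial_deriv_mult smooth_diff smooth_cmult smooth_mult
         smooth_coord smooth_partial_deriv f partial_deriv_coord)
  also have "\<dots> = theta_shift (u(j := u j + 1)) i (partial_deriv j f)"
    using partial_deriv_commute[OF f, of i j] by (auto simp: theta_shift_def algebra_simps)
  finally show ?thesis .
qed

lemma theta_shift_commute:
  assumes f: "smooth f"
  shows "theta_shift u i (theta_shift v j f) = theta_shift v j (theta_shift u i f)"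
proof (cases "i = j")
  case True
  have "theta_shift u i g = (\<lambda>x. theta_shift v i g x + (v i - u i) * g x)" for g
    by (auto simp: theta_shift_def algebra_simps)
  note eq = this
  have lin: "theta_shift v i (\<lambda>x. g x + c * h x) = (\<lambda>x. theta_shift v i g x + c * theta_shift v i h x)"
    if "smooth g" "smooth h" for g h c
    by (auto simp: theta_shift_def partial_deriv_add partial_deriv_cmult smooth_cmult that algebra_simps)
  show ?thesis using True eq[of "theta_shift v i f"] eq[of f] lin[of "theta_shift v i f" f] f
    by (simp add: smooth_theta_shift)
next
  case False
  have p: "partial_deriv i (theta_shift v j f) = theta_shift v j (partial_deriv i f)"
    using partial_deriv_theta_shift[OF f, of i v j] False by (simp add: theta_shift_def)
  have q: "partial_deriv j (theta_shift u i f) = theta_shift u i (partial_deriv j f)"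
    using partial_deriv_theta_shift[OF f, of j u i] False by (simp add: theta_shift_def)
  show ?thesis
    unfolding theta_shift_def[of u i "theta_shift v j f"] theta_shift_def[of v j "theta_shift u i f"] p q
    using partial_deriv_commute[OF f, of i j] by (auto simp: theta_shift_def algebra_simps)
qed

interpretation theta: commuting "{f. smooth f}" "theta_shift u" for u
  by unfold_locales (auto intro: smooth_theta_shift theta_shift_commute)

lemma commuting_theta_in: "closed K \<Longrightarrow> commuting (smooth_in K) (theta_shift u)"
  by unfold_locales (auto intro: smooth_in_theta_shift theta_shift_commute smooth_inD)

lemma theta_shift_add: "smooth f \<Longrightarrow> smooth g \<Longrightarrow>
    theta_shift u i (\<lambda>x. f x + g x) = (\<lambda>x. theta_shift u i f x + theta_shift u i g x)"
  by (auto simp: theta_shift_def partial_deriv_add algebra_simps)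

lemma theta_shift_cmult: "smooth f \<Longrightarrow> theta_shift u i (\<lambda>x. c * f x) = (\<lambda>x. c * theta_shift u i f x)"
  by (auto simp: theta_shift_def partial_deriv_cmult algebra_simps)

abbreviation theta_monom :: "('n::finite \<Rightarrow> complex) \<Rightarrow> ('n \<Rightarrow>\<^sub>0 nat) \<Rightarrow> (real^'n \<Rightarrow> complex) \<Rightarrow> real^'n \<Rightarrow> complex" where
  "theta_monom u \<equiv> op_monom (theta_shift u)"

lemmas theta_monom_Suc = theta.op_monom_Suc[simplified]
text \<open>A variant with \<open>1\<close> not rewritten to \<open>Suc 0\<close>, for use outside
  the simplifier.\<close>

lemmas theta_monom_Suc1 = theta.op_monom_Suc[unfolded mem_Collect_eq]
lemmas theta_monom_comm = theta.op_monom_comm[simplified]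
lemmas smooth_theta_monom = theta.op_monom_closed[simplified]
lemmas smooth_in_theta_monom = commuting.op_monom_closed[OF commuting_theta_in]

lemma theta_monom_add: "smooth f \<Longrightarrow> smooth g \<Longrightarrow>
    theta_monom u \<alpha> (\<lambda>x. f x + g x) = (\<lambda>x. theta_monom u \<alpha> f x + theta_monom u \<alpha> g x)"
  by (induction \<alpha> rule: multi_index_induct)
    (simp_all add: theta_monom_Suc smooth_add theta_shift_add smooth_theta_monom)

lemma theta_monom_cmult: "smooth f \<Longrightarrow>
    theta_monom u \<alpha> (\<lambda>x. c * f x) = (\<lambda>x. c * theta_monom u \<alpha> f x)"
  by (induction \<alpha> rule: multi_index_induct)
    (simp_all add: theta_monom_Suc smooth_cmult theta_shift_cmult smooth_theta_monom)

text \<open>Polynomials are lists of pairs of a coefficient and an exponent; exponents may be repeated, so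
  that Hasse derivatives are computed entrywise.\<close>

type_synonym 'n lpoly = "(complex \<times> ('n \<Rightarrow>\<^sub>0 nat)) list"

definition theta_poly :: "('n::finite \<Rightarrow> complex) \<Rightarrow> 'n lpoly \<Rightarrow> (real^'n \<Rightarrow> complex) \<Rightarrow> real^'n \<Rightarrow> complex" where
  "theta_poly u P f = (\<lambda>x. \<Sum>(c, \<alpha>)\<leftarrow>P. c * theta_monom u \<alpha> f x)"

lemma theta_poly_Nil [simp]: "theta_poly u [] f = (\<lambda>x. 0)"
  and theta_poly_Cons: "theta_poly u ((c, \<alpha>) # P) f = (\<lambda>x. c * theta_monom u \<alpha> f x + theta_poly u P f x)"
  by (simp_all add: theta_poly_def)

lemma smooth_theta_poly: "smooth f \<Longrightarrow> smooth (theta_poly u P f)"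
  by (induction P) (auto simp: theta_poly_Cons intro!: smooth_const smooth_add smooth_cmult smooth_theta_monom)

lemma smooth_in_theta_poly: "closed K \<Longrightarrow> f \<in> smooth_in K \<Longrightarrow> theta_poly u P f \<in> smooth_in K"
  by (induction P) (auto simp: theta_poly_Cons intro!: smooth_in_zero smooth_in_add smooth_in_cmult smooth_in_theta_monom)

lemma theta_poly_add: "smooth f \<Longrightarrow> smooth g \<Longrightarrow>
    theta_poly u P (\<lambda>x. f x + g x) = (\<lambda>x. theta_poly u P f x + theta_poly u P g x)"
  by (induction P) (auto simp: theta_poly_Cons theta_monom_add algebra_simps)

lemma theta_poly_cmult: "smooth f \<Longrightarrow>
    theta_poly u P (\<lambda>x. c * f x) = (\<lambda>x. c * theta_poly u P f x)"
  by (induction P) (auto simp: theta_poly_Cons theta_monom_cmult algebra_simps)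

lemma theta_poly_diff: "smooth f \<Longrightarrow> smooth g \<Longrightarrow>
    theta_poly u P (\<lambda>x. f x - g x) = (\<lambda>x. theta_poly u P f x - theta_poly u P g x)"
  using theta_poly_add[of f "\<lambda>x. -1 * g x" u P] theta_poly_cmult[of g u P "-1"]
  by (simp add: smooth_uminus)

lemma test_functions_theta_poly: "f \<in> test_functions \<Omega> \<Longrightarrow> theta_poly u P f \<in> test_functions \<Omega>"
  by (meson test_functions_iff smooth_in_theta_poly compact_imp_closed)

text \<open>The divided derivative of order \<open>n\<close> in variable \<open>j\<close>, that is
  the \<open>n\<close>-th derivative over n!. Where the truncated subtraction of exponents is wrong,
  the binomial coefficient is 0.\<close>

definition hasse :: "'n::finite \<Rightarrow> nat \<Rightarrow> 'n lpoly \<Rightarrow> 'n lpoly" where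
  "hasse j n P = map (\<lambda>(c, \<alpha>). (of_nat (Poly_Mapping.lookup \<alpha> j choose n) * c, \<alpha> - Poly_Mapping.single j n)) P"

text \<open>The polynomial \<open>cnj (P (- cnj z))\<close>. The sign reflects that the adjoint of a
  shifted Euler derivative is minus a shifted Euler derivative.\<close>

definition sharp :: "'n::finite lpoly \<Rightarrow> 'n lpoly" where
  "sharp P = map (\<lambda>(c, \<alpha>). ((-1) ^ mdegree \<alpha> * cnj c, \<alpha>)) P"

lemma hasse_Nil [simp]: "hasse j n [] = []"
  and hasse_Cons: "hasse j n ((c, \<alpha>) # P) =
    (of_nat (Poly_Mapping.lookup \<alpha> j choose n) * c, \<alpha> - Poly_Mapping.single j n) # hasse j n P"
  by (simp_all add: hasse_def)

lemma sharp_Nil [simp]: "sharp [] = []"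
  and sharp_Cons: "sharp ((c, \<alpha>) # P) = ((-1) ^ mdegree \<alpha> * cnj c, \<alpha>) # sharp P"
  by (simp_all add: sharp_def)

text \<open>Stated for the operators and not for the lists, which spares scalar multiples of lists.
  Entrywise it is the identity (m choose k) ((m - k) choose l) = ((k + l) choose k) (m choose (k +
  l)).\<close>

lemma theta_poly_hasse_hasse:
  "theta_poly u (hasse j l (hasse j k P)) f = (\<lambda>x. of_nat ((k + l) choose k) * theta_poly u (hasse j (k + l) P) f x)"
proof (induction P)
  case (Cons p P)
  obtain c \<alpha> where p: "p = (c, \<alpha>)" by (cases p)
  let ?m = "Poly_Mapping.lookup \<alpha> j"
  have e: "\<alpha> - Poly_Mapping.single j k - Poly_Mapping.single j l = \<alpha> - Poly_Mapping.single j (k + l)"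
    by (rule poly_mapping_eqI) (auto simp: lookup_minus lookup_single when_def)
  have "(?m choose k) * ((?m - k) choose l) = ((k + l) choose k) * (?m choose (k + l))"
  proof (cases "k + l \<le> ?m")
    case True
    then show ?thesis using choose_mult[of k "k + l" ?m] by (simp add: mult.commute)
  next
    case False
    then show ?thesis by (cases "k \<le> ?m") (auto simp: binomial_eq_0)
  qed
  then have b: "(of_nat (?m choose k) * of_nat ((?m - k) choose l) :: complex)
      = of_nat ((k + l) choose k) * of_nat (?m choose (k + l))"
    by (metis of_nat_mult)
  have "of_nat ((?m - k) choose l) * (of_nat (?m choose k) * c)
      = of_nat ((k + l) choose k) * (of_nat (?m choose (k + l)) * c)"
    using b by (metis mult.assoc mult.commute)
  then have b': "of_nat ((?m - k) choose l) * (of_nat (?m choose k) * c) * z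
      = of_nat ((k + l) choose k) * (of_nat (?m choose (k + l)) * c * z)" for z
    by (metis mult.assoc)
  show ?case
    unfolding p hasse_Cons theta_poly_Cons Cons.IH e
    by (rule ext) (simp add: lookup_minus b' distrib_left)
qed simp

lemma sharp_hasse:
  "theta_poly u (hasse j n (sharp P)) f = (\<lambda>x. (-1) ^ n * theta_poly u (sharp (hasse j n P)) f x)"
proof (induction P)
  case (Cons p P)
  obtain c \<alpha> where p: "p = (c, \<alpha>)" by (cases p)
  let ?m = "Poly_Mapping.lookup \<alpha> j"
  have "of_nat (?m choose n) * (-1) ^ mdegree \<alpha> = ((-1) ^ n * (of_nat (?m choose n) * (-1) ^ mdegree (\<alpha> - Poly_Mapping.single j n)) :: complex)"
  proof (cases "n \<le> ?m")
    case True
    have "\<alpha> = \<alpha> - Poly_Mapping.single j n + Poly_Mapping.single j n"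
      by (rule poly_mapping_eqI) (use True in \<open>auto simp: lookup_add lookup_minus lookup_single when_def\<close>)
    then have "mdegree \<alpha> = mdegree (\<alpha> - Poly_Mapping.single j n) + n"
      by (metis mdegree_add mdegree_single)
    then show ?thesis by (simp add: power_add)
  qed (simp add: binomial_eq_0)
  then have e: "of_nat (?m choose n) * ((-1) ^ mdegree \<alpha> * cnj c) * z
     = (-1) ^ n * ((-1) ^ mdegree (\<alpha> - Poly_Mapping.single j n) * (of_nat (?m choose n) * cnj c) * z)" for z
    by (metis (no_types, lifting) mult.assoc mult.commute)
  show ?case
    unfolding p hasse_Cons sharp_Cons theta_poly_Cons Cons.IH
    by (rule ext) (simp add: e distrib_left)
qed simp

text \<open>Both the Taylor expansion in the shift and the Leibniz rule are instances.\<close>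

lemma theta_monom_leibniz_aux:
  assumes G: "\<And>n. smooth (G n)" and f: "smooth f"
    and X: "\<And>n i h. smooth h \<Longrightarrow> theta_shift v i (\<lambda>x. G n x * h x) =
        (\<lambda>x. G n x * theta_shift u i h x + (if i = j then G (Suc n) x * h x else 0))"
    and N: "Poly_Mapping.lookup \<alpha> j \<le> N"
  shows "theta_monom v \<alpha> (\<lambda>x. G 0 x * f x) =
     (\<lambda>x. \<Sum>n\<le>N. of_nat (Poly_Mapping.lookup \<alpha> j choose n) * G n x * theta_monom u (\<alpha> - Poly_Mapping.single j n) f x)"
  using N
proof (induction \<alpha> rule: multi_index_induct)
  case zero
  have "(\<Sum>n\<in>{..N} - {0}. of_nat (0 choose n) * G n x * theta_monom u (0 - Poly_Mapping.single j n) f x) = 0" for x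
    by (intro sum.neutral) (auto simp: binomial_eq_0)
  then show ?case by (simp add: sum.remove[of "{..N}" 0] fun_eq_iff)
next
  case (add \<alpha> i)
  let ?m = "Poly_Mapping.lookup \<alpha> j" and ?\<alpha> = "\<alpha> + Poly_Mapping.single i 1"
  define H where "H n = theta_monom u (\<alpha> - Poly_Mapping.single j n) f" for n
  have H: "smooth (H n)" for n unfolding H_def by (rule smooth_theta_monom[OF f])
  have sm: "smooth (\<lambda>x. c * (G n x * H n x))" for c n by (intro smooth_cmult smooth_mult G H)
  have sum_lin: "theta_shift v i (\<lambda>x. \<Sum>n\<in>A. c n * (G n x * H n x)) = (\<lambda>x. \<Sum>n\<in>A. c n * theta_shift v i (\<lambda>x. G n x * H n x) x)"
    if "finite A" for c and A :: "nat set"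
    using that
  proof (induction A)
    case empty
    then show ?case by (simp add: theta_shift_def)
  next
    case (insert a A)
    then show ?case
      by (simp add: theta_shift_add[OF sm smooth_sum[OF sm]] theta_shift_cmult[OF smooth_mult[OF G H]])
  qed
  have mN: "?m \<le> N" using add.prems by (simp add: lookup_add)
  have "theta_monom v ?\<alpha> (\<lambda>x. G 0 x * f x) = theta_shift v i (\<lambda>x. \<Sum>n\<le>N. of_nat (?m choose n) * (G n x * H n x))"
    using add.IH[OF mN] by (simp add: theta_monom_Suc smooth_mult G f H_def mult.assoc)
  also have "\<dots> = (\<lambda>x. \<Sum>n\<le>N. of_nat (?m choose n) * (G n x * theta_shift u i (H n) x + (if i = j then G (Suc n) x * H n x else 0)))"
    by (simp add: sum_lin X[OF H])
  also have "\<dots> = (\<lambda>x. \<Sum>n\<le>N. of_nat (Poly_Mapping.lookup ?\<alpha> j choose n) * G n x * theta_monom u (?\<alpha> - Poly_Mapping.single j n) f x)"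
  proof (cases "i = j")
    case False
    have "theta_monom u (?\<alpha> - Poly_Mapping.single j n) f = theta_shift u i (H n)" for n
    proof -
      have "?\<alpha> - Poly_Mapping.single j n = \<alpha> - Poly_Mapping.single j n + Poly_Mapping.single i 1"
        by (rule poly_mapping_eqI) (use False in \<open>auto simp: lookup_add lookup_minus lookup_single when_def\<close>)
      then show ?thesis unfolding H_def by (metis theta_monom_Suc1 f)
    qed
    then show ?thesis using False by (simp add: lookup_add lookup_single mult.assoc)
  next
    case True
    define E where "E n = theta_monom u (?\<alpha> - Poly_Mapping.single j n) f" for n
    \<comment> \<open>For \<open>n\<close> above \<open>?m\<close> truncated subtraction breaks the
      identity, but then the binomial coefficient in front vanishes.\<close>
    have E1: "theta_shift u i (H n) = E n" if "n \<le> ?m" for n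
    proof -
      have "?\<alpha> - Poly_Mapping.single j n = \<alpha> - Poly_Mapping.single j n + Poly_Mapping.single i 1"
        by (rule poly_mapping_eqI) (use True that in \<open>auto simp: lookup_add lookup_minus lookup_single when_def\<close>)
      then show ?thesis unfolding H_def E_def by (metis theta_monom_Suc1 f)
    qed
    have E2: "H n = E (Suc n)" for n
    proof -
      have "?\<alpha> - Poly_Mapping.single j (Suc n) = \<alpha> - Poly_Mapping.single j n"
        by (rule poly_mapping_eqI) (use True in \<open>auto simp: lookup_add lookup_minus lookup_single when_def\<close>)
      then show ?thesis unfolding H_def E_def by simp
    qed
    obtain M where M: "N = Suc M" using add.prems True by (cases N) (auto simp: lookup_add lookup_single)
    have mM: "?m \<le> M" using add.prems True M by (simp add: lookup_add lookup_single)
    have l: "Poly_Mapping.lookup ?\<alpha> j = Suc ?m" using True by (simp add: lookup_add lookup_single)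
    have "(\<Sum>n\<le>N. of_nat (?m choose n) * (G n x * theta_shift u i (H n) x + (if i = j then G (Suc n) x * H n x else 0)))
       = (\<Sum>n\<le>N. of_nat (Suc ?m choose n) * G n x * E n x)" for x
    proof -
      have "(\<Sum>n\<le>N. of_nat (?m choose n) * (G n x * theta_shift u i (H n) x + (if i = j then G (Suc n) x * H n x else 0)))
         = (\<Sum>n\<le>N. of_nat (?m choose n) * (G n x * E n x)) + (\<Sum>n\<le>N. of_nat (?m choose n) * (G (Suc n) x * E (Suc n) x))"
        unfolding sum.distrib[symmetric]
        by (rule sum.cong) (use True E1 E2 in \<open>auto simp: algebra_simps binomial_eq_0 not_le[symmetric], (metis E1 binomial_eq_0 not_le)?\<close>)
      also have "(\<Sum>n\<le>N. of_nat (?m choose n) * (G (Suc n) x * E (Suc n) x)) = (\<Sum>n\<le>M. of_nat (?m choose n) * (G (Suc n) x * E (Suc n) x))"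
        unfolding M using mM by (simp add: binomial_eq_0)
      also have "(\<Sum>n\<le>N. of_nat (?m choose n) * (G n x * E n x)) = G 0 x * E 0 x + (\<Sum>n\<le>M. of_nat (?m choose Suc n) * (G (Suc n) x * E (Suc n) x))"
        unfolding M by (subst sum.atMost_Suc_shift) simp
      \<comment> \<open>Pascal's rule, both sums being aligned at \<open>Suc n\<close>.\<close>
      also have "G 0 x * E 0 x + (\<Sum>n\<le>M. of_nat (?m choose Suc n) * (G (Suc n) x * E (Suc n) x)) + (\<Sum>n\<le>M. of_nat (?m choose n) * (G (Suc n) x * E (Suc n) x))
         = G 0 x * E 0 x + (\<Sum>n\<le>M. of_nat (Suc ?m choose Suc n) * (G (Suc n) x * E (Suc n) x))"
        by (simp add: sum.distrib[symmetric] algebra_simps)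
      also have "\<dots> = (\<Sum>n\<le>N. of_nat (Suc ?m choose n) * G n x * E n x)"
        unfolding M by (subst sum.atMost_Suc_shift) (simp add: mult.assoc)
      finally show ?thesis .
    qed
    then show ?thesis unfolding l E_def by simp
  qed
  finally show ?case .
qed

text \<open>A sum over the entries and not a maximum: it only bounds the degree in variable
  \<open>j\<close> from above, which suffices and is easy in inductions over the list.\<close>

definition lpoly_degree :: "'n::finite \<Rightarrow> 'n lpoly \<Rightarrow> nat" where
  "lpoly_degree j P = sum_list (map (\<lambda>(c, \<alpha>). Poly_Mapping.lookup \<alpha> j) P)"

lemma theta_poly_hasse_eq_0: "lpoly_degree j P < n \<Longrightarrow> theta_poly u (hasse j n P) f = (\<lambda>x. 0)"
  by (induction P) (auto simp: hasse_def theta_poly_Cons lpoly_degree_def binomial_eq_0)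

lemma theta_poly_leibniz_aux:
  assumes G: "\<And>n. smooth (G n)" and f: "smooth f"
    and X: "\<And>n i h. smooth h \<Longrightarrow> theta_shift v i (\<lambda>x. G n x * h x) =
        (\<lambda>x. G n x * theta_shift u i h x + (if i = j then G (Suc n) x * h x else 0))"
    and N: "lpoly_degree j P \<le> N"
  shows "theta_poly v P (\<lambda>x. G 0 x * f x) = (\<lambda>x. \<Sum>n\<le>N. G n x * theta_poly u (hasse j n P) f x)"
  using N
proof (induction P)
  case (Cons p P)
  obtain c \<alpha> where p: "p = (c, \<alpha>)" by (cases p)
  from Cons.prems have d: "Poly_Mapping.lookup \<alpha> j \<le> N" "lpoly_degree j P \<le> N"
    by (auto simp: lpoly_degree_def p)
  have m: "theta_monom v \<alpha> (\<lambda>x. G 0 x * f x) =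
     (\<lambda>x. \<Sum>n\<le>N. of_nat (Poly_Mapping.lookup \<alpha> j choose n) * G n x * theta_monom u (\<alpha> - Poly_Mapping.single j n) f x)"
    by (rule theta_monom_leibniz_aux[where G=G, OF G f X d(1)])
  show ?case
    unfolding p theta_poly_Cons hasse_Cons m Cons.IH[OF d(2)]
    by (rule ext) (simp add: sum_distrib_left sum.distrib[symmetric] distrib_left mult.assoc mult.left_commute)
qed simp

text \<open>P (z + s) expanded at z: lowering \<open>u j\<close> by \<open>s\<close> adds
  \<open>s\<close> to the \<open>j\<close>-th operator. The constant functions \<open>s ^ n\<close>
  play the role of \<open>G n\<close>.\<close>

lemma theta_poly_taylor:
  assumes f: "smooth f" and N: "lpoly_degree j P \<le> N"
  shows "theta_poly (u(j := u j - s)) P f = (\<lambda>x. \<Sum>n\<le>N. s ^ n * theta_poly u (hasse j n P) f x)"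
proof -
  have "theta_poly (u(j := u j - s)) P (\<lambda>x. s ^ 0 * f x) = (\<lambda>x. \<Sum>n\<le>N. s ^ n * theta_poly u (hasse j n P) f x)"
    by (rule theta_poly_leibniz_aux[where G="\<lambda>n x. s ^ n", OF smooth_const f _ N])
      (auto simp: theta_shift_cmult, auto simp: theta_shift_def algebra_simps)
  then show ?thesis by simp
qed

text \<open>\<open>G n\<close> is the \<open>n\<close>-th iterate of the derivation part of the
  transposed Euler derivative, \<open>- x $ j\<close> times \<open>partial_deriv j\<close>, on a
  function of \<open>x $ j\<close> alone; see \<open>leibniz_sequence\<close>.\<close>

lemma theta_poly_leibniz:
  assumes G: "\<And>n. smooth (G n)" and f: "smooth f"
    and Gi: "\<And>n i x. i \<noteq> j \<Longrightarrow> partial_deriv i (G n) x = 0"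
    and Gj: "\<And>n x. G (Suc n) x = - complex_of_real (x $ j) * partial_deriv j (G n) x"
    and N: "lpoly_degree j P \<le> N"
  shows "theta_poly u P (\<lambda>x. G 0 x * f x) = (\<lambda>x. \<Sum>n\<le>N. G n x * theta_poly u (hasse j n P) f x)"
  by (rule theta_poly_leibniz_aux[where G=G, OF G f _ N])
    (auto simp: theta_shift_def partial_deriv_mult G Gi Gj algebra_simps)

section \<open>Derivatives of the operators, and reduction to a constant\<close>

lemma partial_deriv_theta_monom:
  "smooth f \<Longrightarrow> partial_deriv j (theta_monom u \<alpha> f) = theta_monom (u(j := u j + 1)) \<alpha> (partial_deriv j f)"
  by (induction \<alpha> rule: multi_index_induct)
    (simp_all add: theta_monom_Suc smooth_theta_monom partial_deriv_theta_shift smooth_partial_deriv)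

lemma partial_deriv_theta_poly:
  "smooth f \<Longrightarrow> partial_deriv j (theta_poly u P f) = theta_poly (u(j := u j + 1)) P (partial_deriv j f)"
  by (induction P)
    (auto simp: theta_poly_Cons partial_deriv_add partial_deriv_cmult smooth_cmult smooth_theta_monom
      smooth_theta_poly partial_deriv_theta_monom)

text \<open>The quantifiers matter: the new shift depends on \<open>w\<close> and \<open>u\<close>
  but not on the polynomial, so an estimate of one polynomial by another survives
  differentiation.\<close>

lemma fold_partial_deriv_theta_poly:
  "\<exists>v. \<forall>P f. smooth f \<longrightarrow> fold partial_deriv w (theta_poly u P f) = theta_poly v P (fold partial_deriv w f)"
proof (induction w arbitrary: u)
  case (Cons j w)
  from Cons[of "u(j := u j + 1)"] obtain v where
    "\<forall>P f. smooth f \<longrightarrow> fold partial_deriv w (theta_poly (u(j := u j + 1)) P f) = theta_poly v P (fold partial_deriv w f)" ..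
  then show ?case
    by (intro exI[of _ v]) (simp add: partial_deriv_theta_poly smooth_partial_deriv)
qed auto

text \<open>The exact factor is claimed for distinct variables only: a repeated variable would meet
  an exponent that has already been lowered.\<close>

lemma hasse_fold:
  "\<exists>b. fold (\<lambda>j. hasse j (\<beta> j)) js P = map (\<lambda>(c, \<alpha>). (b \<alpha> * c, \<alpha> - (\<Sum>j\<leftarrow>js. Poly_Mapping.single j (\<beta> j)))) P \<and>
     (distinct js \<longrightarrow> (\<forall>\<alpha>. b \<alpha> = of_nat (\<Prod>j\<leftarrow>js. Poly_Mapping.lookup \<alpha> j choose \<beta> j)))"
proof (induction js arbitrary: P)
  case Nil
  then show ?case by (intro exI[of _ "\<lambda>_. 1"]) (auto intro!: map_idI[symmetric])
next
  case (Cons i js)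
  from Cons[of "hasse i (\<beta> i) P"] obtain b where
    b: "fold (\<lambda>j. hasse j (\<beta> j)) js (hasse i (\<beta> i) P) =
       map (\<lambda>(c, \<alpha>). (b \<alpha> * c, \<alpha> - (\<Sum>j\<leftarrow>js. Poly_Mapping.single j (\<beta> j)))) (hasse i (\<beta> i) P)"
    "distinct js \<Longrightarrow> b \<alpha> = of_nat (\<Prod>j\<leftarrow>js. Poly_Mapping.lookup \<alpha> j choose \<beta> j)" for \<alpha> by auto
  show ?case
  proof (intro exI[of _ "\<lambda>\<alpha>. b (\<alpha> - Poly_Mapping.single i (\<beta> i)) * of_nat (Poly_Mapping.lookup \<alpha> i choose \<beta> i)"] conjI impI allI)
    have "\<alpha> - Poly_Mapping.single i (\<beta> i) - (\<Sum>j\<leftarrow>js. Poly_Mapping.single j (\<beta> j))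
        = \<alpha> - (Poly_Mapping.single i (\<beta> i) + (\<Sum>j\<leftarrow>js. Poly_Mapping.single j (\<beta> j)))" for \<alpha>
      by (rule poly_mapping_eqI) (simp add: lookup_minus lookup_add)
    then show "fold (\<lambda>j. hasse j (\<beta> j)) (i # js) P = map (\<lambda>(c, \<alpha>). (b (\<alpha> - Poly_Mapping.single i (\<beta> i)) *
         of_nat (Poly_Mapping.lookup \<alpha> i choose \<beta> i) * c, \<alpha> - (\<Sum>j\<leftarrow>i # js. Poly_Mapping.single j (\<beta> j)))) P"
      using b(1) by (auto simp: hasse_def)
    fix \<alpha> assume d: "distinct (i # js)"
    have "(\<Prod>j\<leftarrow>js. Poly_Mapping.lookup (\<alpha> - Poly_Mapping.single i (\<beta> i)) j choose \<beta> j) = (\<Prod>j\<leftarrow>js. Poly_Mapping.lookup \<alpha> j choose \<beta> j)"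
      using d by (intro arg_cong[of _ _ prod_list] map_cong) (auto simp: lookup_minus lookup_single when_def)
    then show "b (\<alpha> - Poly_Mapping.single i (\<beta> i)) * of_nat (Poly_Mapping.lookup \<alpha> i choose \<beta> i)
       = of_nat (\<Prod>j\<leftarrow>i # js. Poly_Mapping.lookup \<alpha> j choose \<beta> j)"
      using b(2)[of "\<alpha> - Poly_Mapping.single i (\<beta> i)"] d by simp
  qed
qed

text \<open>Differentiating by an exponent of maximal degree isolates its coefficient.\<close>

lemma hasse_to_constant:
  fixes P :: "'n::finite lpoly"
  assumes "distinct (map snd P)" "(c0, \<alpha>0) \<in> set P" "\<And>c \<alpha>. (c, \<alpha>) \<in> set P \<Longrightarrow> mdegree \<alpha> \<le> mdegree \<alpha>0"
  shows "theta_poly u (fold (\<lambda>j. hasse j (Poly_Mapping.lookup \<alpha>0 j)) index_list P) f = (\<lambda>x. c0 * f x)"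
proof -
  define js where "js = (index_list :: 'n list)"
  have js: "distinct js" "set js = UNIV" by (auto simp: js_def index_list)
  obtain b where b: "fold (\<lambda>j. hasse j (Poly_Mapping.lookup \<alpha>0 j)) js P =
      map (\<lambda>(c, \<alpha>). (b \<alpha> * c, \<alpha> - (\<Sum>j\<leftarrow>js. Poly_Mapping.single j (Poly_Mapping.lookup \<alpha>0 j)))) P"
     "\<And>\<alpha>. b \<alpha> = of_nat (\<Prod>j\<leftarrow>js. Poly_Mapping.lookup \<alpha> j choose Poly_Mapping.lookup \<alpha>0 j)"
    using hasse_fold[of "Poly_Mapping.lookup \<alpha>0" js P] js by blast
  have s: "(\<Sum>j\<leftarrow>js. Poly_Mapping.single j (Poly_Mapping.lookup \<alpha>0 j)) = \<alpha>0"
  proof (rule poly_mapping_eqI)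
    fix i
    have "Poly_Mapping.lookup (\<Sum>j\<leftarrow>js. Poly_Mapping.single j (Poly_Mapping.lookup \<alpha>0 j)) i
      = (\<Sum>j\<leftarrow>js. Poly_Mapping.lookup (Poly_Mapping.single j (Poly_Mapping.lookup \<alpha>0 j)) i)"
      by (induction js) (auto simp: lookup_add)
    also have "\<dots> = (\<Sum>j\<in>UNIV. Poly_Mapping.lookup (Poly_Mapping.single j (Poly_Mapping.lookup \<alpha>0 j)) i)"
      using js by (simp add: sum_list_distinct_conv_sum_set)
    also have "\<dots> = Poly_Mapping.lookup \<alpha>0 i" by (simp add: lookup_single when_def)
    finally show "Poly_Mapping.lookup (\<Sum>j\<leftarrow>js. Poly_Mapping.single j (Poly_Mapping.lookup \<alpha>0 j)) i = Poly_Mapping.lookup \<alpha>0 i" .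
  qed
  \<comment> \<open>An exponent other than \<open>\<alpha>0\<close> of at most the same total degree
    is smaller than \<open>\<alpha>0\<close> in some variable, and there the binomial coefficient
    vanishes.\<close>
  have b0: "b \<alpha> = 0" if "\<alpha> \<noteq> \<alpha>0" "mdegree \<alpha> \<le> mdegree \<alpha>0" for \<alpha>
  proof -
    have "\<exists>i. Poly_Mapping.lookup \<alpha> i < Poly_Mapping.lookup \<alpha>0 i"
    proof (rule ccontr)
      assume "\<not> ?thesis"
      then have le: "Poly_Mapping.lookup \<alpha>0 i \<le> Poly_Mapping.lookup \<alpha> i" for i by (simp add: not_less)
      have "Poly_Mapping.lookup \<alpha>0 i = Poly_Mapping.lookup \<alpha> i" for i
      proof (rule ccontr)
        assume "Poly_Mapping.lookup \<alpha>0 i \<noteq> Poly_Mapping.lookup \<alpha> i"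
        then have "Poly_Mapping.lookup \<alpha>0 i < Poly_Mapping.lookup \<alpha> i" using le[of i] by simp
        then have "mdegree \<alpha>0 < mdegree \<alpha>" unfolding mdegree_def
          by (intro sum_strict_mono_ex1) (auto simp: le)
        with that show False by simp
      qed
      with that(1) show False by (metis poly_mapping_eqI)
    qed
    then obtain i where i: "Poly_Mapping.lookup \<alpha> i < Poly_Mapping.lookup \<alpha>0 i" ..
    have "(\<Prod>j\<leftarrow>js. Poly_Mapping.lookup \<alpha> j choose Poly_Mapping.lookup \<alpha>0 j) = 0"
      unfolding prod_list_zero_iff using i js(2) by (auto simp: image_iff intro!: bexI[of _ i] simp: binomial_eq_0)
    then show ?thesis by (simp only: b(2)) simp
  qed
  have b1: "b \<alpha>0 = 1" unfolding b(2) by (induction js) auto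
  have "theta_poly u (map (\<lambda>(c, \<alpha>). (b \<alpha> * c, \<alpha> - \<alpha>0)) Q) f x = (\<Sum>(c, \<alpha>)\<leftarrow>Q. if \<alpha> = \<alpha>0 then c * f x else 0)"
    if "set Q \<subseteq> set P" for Q x
    using that
  proof (induction Q)
    case (Cons p Q)
    obtain c \<alpha> where p: "p = (c, \<alpha>)" by (cases p)
    show ?case
    proof (cases "\<alpha> = \<alpha>0")
      case True
      then show ?thesis using Cons by (simp add: p theta_poly_Cons b1)
    next
      case False
      then have "b \<alpha> = 0" using Cons.prems assms(3) by (intro b0) (auto simp: p)
      then show ?thesis using Cons False by (simp add: p theta_poly_Cons)
    qed
  qed simp
  moreover have "(\<Sum>(c, \<alpha>)\<leftarrow>P. if \<alpha> = \<alpha>0 then c * f x else 0) = c0 * f x" for x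
    using assms(1,2)
  proof (induction P)
    case (Cons p P)
    have z: "(\<Sum>(c, \<alpha>)\<leftarrow>Q. if \<alpha> = \<alpha>0 then c * f x else 0) = 0" if "\<alpha>0 \<notin> snd ` set Q" for Q
      using that by (induction Q) (auto split: if_splits)
    show ?case
    proof (cases "p = (c0, \<alpha>0)")
      case True
      then show ?thesis using Cons.prems z[of P] by auto
    next
      case False
      with Cons.prems have m: "(c0, \<alpha>0) \<in> set P" by auto
      then have "snd p \<noteq> \<alpha>0" using Cons.prems by (auto simp: image_iff)
      then show ?thesis using Cons m by (auto simp: case_prod_unfold)
    qed
  qed simp
  ultimately show ?thesis unfolding js_def[symmetric] b(1) s by auto
qed

section \<open>Weighted norms\<close>

text \<open>The integral of the square of \<open>t * u - v\<close> is a nonnegative quadratic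
  polynomial in \<open>t\<close>; the case of a vanishing leading coefficient forces
  \<open>B = 0\<close>.\<close>

lemma integral_cauchy_schwarz:
  fixes u v :: "'a \<Rightarrow> real"
  assumes "integrable M (\<lambda>x. (u x)\<^sup>2)" "integrable M (\<lambda>x. (v x)\<^sup>2)" "integrable M (\<lambda>x. u x * v x)"
  shows "\<bar>LINT x|M. u x * v x\<bar> \<le> sqrt (LINT x|M. (u x)\<^sup>2) * sqrt (LINT x|M. (v x)\<^sup>2)"
proof -
  define A B C where "A = (LINT x|M. (u x)\<^sup>2)" "B = (LINT x|M. u x * v x)" "C = (LINT x|M. (v x)\<^sup>2)"
  note ABC = this
  have q: "0 \<le> t\<^sup>2 * A - 2 * t * B + C" for t
  proof -
    have "0 \<le> (LINT x|M. (t * u x - v x)\<^sup>2)" by simp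
    also have "(\<lambda>x. (t * u x - v x)\<^sup>2) = (\<lambda>x. t\<^sup>2 * (u x)\<^sup>2 - 2 * t * (u x * v x) + (v x)\<^sup>2)"
      by (auto simp: power2_eq_square algebra_simps)
    also have "(LINT x|M. t\<^sup>2 * (u x)\<^sup>2 - 2 * t * (u x * v x) + (v x)\<^sup>2) = t\<^sup>2 * A - 2 * t * B + C"
      using assms by (simp add: ABC)
    finally show ?thesis .
  qed
  have A: "A \<ge> 0" unfolding ABC by simp
  have "B\<^sup>2 \<le> A * C"
  proof (cases "A = 0")
    case True
    have "B = 0"
    proof (rule ccontr)
      assume "B \<noteq> 0"
      then show False using q[of "(C + 1) / (2 * B)"] True by simp
    qed
    then show ?thesis using True by simp
  next
    case False
    then have "A > 0" using A by simp
    then show ?thesis using q[of "B / A"] by (simp add: power2_eq_square field_simps)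
  qed
  then have "sqrt (B\<^sup>2) \<le> sqrt (A * C)" by (rule real_sqrt_le_mono)
  then show ?thesis by (simp add: ABC real_sqrt_mult)
qed

definition wnorm :: "('n::finite \<Rightarrow> real) \<Rightarrow> (real^'n \<Rightarrow> complex) \<Rightarrow> real" where
  "wnorm a f = sqrt (LINT x|lborel. weight a x * (norm (f x))\<^sup>2)"

lemma wnorm_nonneg: "wnorm a f \<ge> 0"
  by (simp add: wnorm_def weight_nonneg)

lemma wnorm_sq: "(wnorm a f)\<^sup>2 = (LINT x|lborel. weight a x * (norm (f x))\<^sup>2)"
  by (simp add: wnorm_def weight_nonneg)

lemma smooth_in_continuous: "f \<in> smooth_in K \<Longrightarrow> continuous_on S f"
  by (simp add: smooth_in_def smooth_continuous_on)

lemma smooth_in_measurable: "f \<in> smooth_in K \<Longrightarrow> f \<in> borel_measurable borel"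
  by (intro borel_measurable_continuous_onI smooth_in_continuous)

lemma wnorm_integrable2:
  assumes "compact K" "f \<in> smooth_in K" "g \<in> smooth_in K" "\<And>i. a i > 0"
  shows "integrable lborel (\<lambda>x. weight a x * (norm (f x) * norm (g x)))"
  using assms
  by (intro integrable_continuous_compact[of K] continuous_intros continuous_on_weight smooth_in_continuous)
     (auto simp: smooth_in_def)

lemma wnorm_integrable:
  assumes "compact K" "f \<in> smooth_in K" "\<And>i. a i > 0"
  shows "integrable lborel (\<lambda>x. weight a x * (norm (f x))\<^sup>2)"
  using wnorm_integrable2[OF assms(1,2,2,3)] by (simp add: power2_eq_square)

lemma wnorm_cauchy_schwarz:
  assumes "compact K" "f \<in> smooth_in K" "g \<in> smooth_in K" "\<And>i. a i > 0"
  shows "(LINT x|lborel. weight a x * (norm (f x) * norm (g x))) \<le> wnorm a f * wnorm a g"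
proof -
  let ?u = "\<lambda>x. sqrt (weight a x) * norm (f x)" and ?v = "\<lambda>x. sqrt (weight a x) * norm (g x)"
  have e: "?u x * ?v x = weight a x * (norm (f x) * norm (g x))"
    "(?u x)\<^sup>2 = weight a x * (norm (f x))\<^sup>2" "(?v x)\<^sup>2 = weight a x * (norm (g x))\<^sup>2" for x
    using weight_nonneg[of a x] by (auto simp: power_mult_distrib)
  show ?thesis
    using integral_cauchy_schwarz[of lborel ?u ?v] unfolding e wnorm_def
    using wnorm_integrable[OF assms(1,2,4)] wnorm_integrable[OF assms(1,3,4)] wnorm_integrable2[OF assms] by auto
qed

lemma wnorm_add:
  assumes "compact K" "f \<in> smooth_in K" "g \<in> smooth_in K" "\<And>i. a i > 0"
  shows "wnorm a (\<lambda>x. f x + g x) \<le> wnorm a f + wnorm a g"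
proof (rule power2_le_imp_le)
  have "(wnorm a (\<lambda>x. f x + g x))\<^sup>2 = (LINT x|lborel. weight a x * (norm (f x + g x))\<^sup>2)" by (rule wnorm_sq)
  also have "\<dots> \<le> (LINT x|lborel. weight a x * (norm (f x))\<^sup>2 + 2 * (weight a x * (norm (f x) * norm (g x))) + weight a x * (norm (g x))\<^sup>2)"
  proof (rule integral_mono)
    fix x
    have "(norm (f x + g x))\<^sup>2 \<le> (norm (f x) + norm (g x))\<^sup>2" by (simp add: norm_triangle_ineq power_mono)
    from mult_left_mono[OF this weight_nonneg[of a x]]
    show "weight a x * (norm (f x + g x))\<^sup>2 \<le> weight a x * (norm (f x))\<^sup>2 + 2 * (weight a x * (norm (f x) * norm (g x))) + weight a x * (norm (g x))\<^sup>2"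
      by (simp add: power2_eq_square algebra_simps)
  qed (use assms in \<open>auto intro!: wnorm_integrable wnorm_integrable2 smooth_in_add Bochner_Integration.integrable_add integrable_mult_right\<close>)
  also have "\<dots> = (wnorm a f)\<^sup>2 + 2 * (LINT x|lborel. weight a x * (norm (f x) * norm (g x))) + (wnorm a g)\<^sup>2"
    using wnorm_integrable[OF assms(1,2,4)] wnorm_integrable[OF assms(1,3,4)] wnorm_integrable2[OF assms]
    by (simp add: wnorm_sq)
  also have "\<dots> \<le> (wnorm a f + wnorm a g)\<^sup>2"
    using wnorm_cauchy_schwarz[OF assms] by (simp add: power2_sum)
  finally show "(wnorm a (\<lambda>x. f x + g x))\<^sup>2 \<le> (wnorm a f + wnorm a g)\<^sup>2" .
qed (simp add: wnorm_nonneg)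

lemma wnorm_zero [simp]: "wnorm a (\<lambda>x. 0) = 0"
  by (simp add: wnorm_def)

lemma wnorm_cmult: "wnorm a (\<lambda>x. c * f x) = norm c * wnorm a f"
proof -
  have "(LINT x|lborel. weight a x * (norm (c * f x))\<^sup>2) = (LINT x|lborel. (norm c)\<^sup>2 * (weight a x * (norm (f x))\<^sup>2))"
    by (rule Bochner_Integration.integral_cong) (auto simp: norm_mult power_mult_distrib)
  then show ?thesis by (simp add: wnorm_def real_sqrt_mult)
qed

lemma wnorm_sum:
  assumes "compact K" "\<And>k. k \<in> A \<Longrightarrow> f k \<in> smooth_in K" "\<And>i. a i > 0"
  shows "wnorm a (\<lambda>x. \<Sum>k\<in>A. f k x) \<le> (\<Sum>k\<in>A. wnorm a (f k))"
  using assms(2)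
proof (induction A rule: infinite_finite_induct)
  case (insert k A)
  have "wnorm a (\<lambda>x. f k x + (\<Sum>k\<in>A. f k x)) \<le> wnorm a (f k) + wnorm a (\<lambda>x. \<Sum>k\<in>A. f k x)"
    using insert by (intro wnorm_add[OF assms(1) _ _ assms(3)] smooth_in_sum) auto
  with insert show ?case by simp
qed auto

lemma wnorm_uminus: "wnorm a (\<lambda>x. - f x) = wnorm a f"
  by (simp add: wnorm_def)

lemma wnorm_diff:
  assumes "compact K" "f \<in> smooth_in K" "g \<in> smooth_in K" "\<And>i. a i > 0"
  shows "wnorm a (\<lambda>x. f x - g x) \<le> wnorm a f + wnorm a g"
  using wnorm_add[OF assms(1,2) smooth_in_uminus[OF assms(3)] assms(4)] by (simp add: wnorm_uminus)

lemma compact_coord_bound: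
  fixes K :: "(real^'n::finite) set"
  assumes "compact K"
  obtains R where "R \<ge> 1" "\<And>x i. x \<in> K \<Longrightarrow> \<bar>x $ i\<bar> \<le> R"
proof -
  obtain B where "\<And>x. x \<in> K \<Longrightarrow> norm x \<le> B"
    using compact_imp_bounded[OF assms] by (auto simp: bounded_iff)
  then have "\<bar>x $ i\<bar> \<le> max 1 B" if "x \<in> K" for x i
    using that component_le_norm_cart[of x i] by fastforce
  then show ?thesis using that[of "max 1 B"] by simp
qed

lemma abs_powr_mono_bound:
  fixes t R :: real
  assumes "\<bar>t\<bar> \<le> R" "R \<ge> 1" "0 < c" "c \<le> d" "d \<le> c + e"
  shows "\<bar>t\<bar> powr d \<le> R powr e * \<bar>t\<bar> powr c"
proof (cases "t = 0")
  case False
  have "\<bar>t\<bar> powr d = \<bar>t\<bar> powr (d - c) * \<bar>t\<bar> powr c" using False by (simp add: powr_add[symmetric])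
  also have "\<bar>t\<bar> powr (d - c) \<le> R powr (d - c)" using assms by (intro powr_mono2) auto
  also have "\<dots> \<le> R powr e" using assms by (intro powr_mono) auto
  finally show ?thesis by (simp add: mult_right_mono)
qed simp

text \<open>On a bounded set a larger exponent gives a smaller weight up to a constant. The constant
  is uniform in \<open>c\<close> and \<open>d\<close>, since in \<open>hasse_estimate\<close> the
  exponents vary along a circle.\<close>

lemma wnorm_mono:
  fixes K :: "(real^'n::finite) set"
  assumes K: "compact K"
  shows "\<exists>C\<ge>0. \<forall>c d f. f \<in> smooth_in K \<longrightarrow> (\<forall>i. 0 < c i \<and> c i \<le> d i \<and> d i \<le> c i + 1) \<longrightarrow> wnorm d f \<le> C * wnorm c f"
proof -
  obtain R where R: "R \<ge> 1" "\<And>x i. x \<in> K \<Longrightarrow> \<bar>x $ i\<bar> \<le> R" using compact_coord_bound[OF K] by blast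
  define C where "C = sqrt (R ^ CARD('n))"
  have "wnorm d f \<le> C * wnorm c f"
    if f: "f \<in> smooth_in K" and cd: "\<forall>i. 0 < c i \<and> c i \<le> d i \<and> d i \<le> c i + 1" for c d f
  proof -
    have w: "weight d x \<le> R ^ CARD('n) * weight c x" if "x \<in> K" for x
    proof -
      have "weight d x \<le> (\<Prod>i\<in>(UNIV::'n set). R powr 1 * \<bar>x $ i\<bar> powr c i)"
        unfolding weight_def by (intro prod_mono conjI abs_powr_mono_bound) (use R that cd in auto)
      also have "\<dots> = R ^ CARD('n) * weight c x" using R by (simp add: weight_def prod.distrib)
      finally show ?thesis .
    qed
    have p: "0 < c i" "0 < d i" for i using cd by (auto intro: less_le_trans)
    have "(LINT x|lborel. weight d x * (norm (f x))\<^sup>2) \<le> (LINT x|lborel. R ^ CARD('n) * (weight c x * (norm (f x))\<^sup>2))"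
    proof (rule integral_mono)
      show "weight d x * (norm (f x))\<^sup>2 \<le> R ^ CARD('n) * (weight c x * (norm (f x))\<^sup>2)" for x
        using w[of x] f by (cases "x \<in> K") (auto simp: smooth_in_def mult.assoc[symmetric] intro: mult_right_mono)
    qed (use wnorm_integrable[OF K f] p in auto)
    then have "sqrt (LINT x|lborel. weight d x * (norm (f x))\<^sup>2) \<le> sqrt (R ^ CARD('n) * (LINT x|lborel. weight c x * (norm (f x))\<^sup>2))"
      by (intro real_sqrt_le_mono) simp
    then show ?thesis by (simp add: wnorm_def C_def real_sqrt_mult)
  qed
  moreover have "C \<ge> 0" using R by (simp add: C_def)
  ultimately show ?thesis by blast
qed

section \<open>Adjoints and normality\<close>

definition ip :: "('n::finite \<Rightarrow> real) \<Rightarrow> (real^'n \<Rightarrow> complex) \<Rightarrow> (real^'n \<Rightarrow> complex) \<Rightarrow> complex" where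
  "ip a f g = (LINT x|lborel. complex_of_real (weight a x) * (f x * cnj (g x)))"

lemma ip_integrable:
  assumes "compact K" "f \<in> smooth_in K" "smooth g" "\<And>i. a i > 0"
  shows "integrable lborel (\<lambda>x. complex_of_real (weight a x) * (f x * cnj (g x)))"
  using smooth_in_weight_integrable[where a=a, OF assms(1) smooth_in_mult[OF smooth_cnj[OF assms(3)] assms(2)] assms(4)]
  by (simp add: mult.commute mult.left_commute)

lemma ip_self: "ip a f f = complex_of_real ((wnorm a f)\<^sup>2)"
proof -
  have "ip a f f = (LINT x|lborel. complex_of_real (weight a x * (norm (f x))\<^sup>2))"
    unfolding ip_def by (rule Bochner_Integration.integral_cong) (simp_all only: of_real_mult complex_norm_square)
  then show ?thesis by (simp add: wnorm_sq del: of_real_mult)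
qed

text \<open>In the weight \<open>a\<close>, the adjoint of \<open>P(\<theta>\<^sup>* - u)\<close> is \<open>(sharp P)(\<theta>\<^sup>* - adjoint_shift a u)\<close>.\<close>

definition adjoint_shift :: "('n \<Rightarrow> real) \<Rightarrow> ('n \<Rightarrow> complex) \<Rightarrow> 'n \<Rightarrow> complex" where
  "adjoint_shift a u = (\<lambda>i. complex_of_real (a i) - 1 - cnj (u i))"

lemma adjoint_shift_twice [simp]: "adjoint_shift a (adjoint_shift a u) = u"
  by (auto simp: adjoint_shift_def)

lemma ip_add_right:
  assumes "compact K" "f \<in> smooth_in K" "smooth g" "smooth h" "\<And>i. a i > 0"
  shows "ip a f (\<lambda>x. g x + h x) = ip a f g + ip a f h"
  unfolding ip_def using ip_integrable[OF assms(1,2) assms(3) assms(5)] ip_integrable[OF assms(1,2) assms(4) assms(5)]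
  by (simp add: algebra_simps)

lemma ip_add_left:
  assumes "compact K" "f \<in> smooth_in K" "g \<in> smooth_in K" "smooth h" "\<And>i. a i > 0"
  shows "ip a (\<lambda>x. f x + g x) h = ip a f h + ip a g h"
  unfolding ip_def using ip_integrable[OF assms(1,2) assms(4) assms(5)] ip_integrable[OF assms(1,3) assms(4) assms(5)]
  by (simp add: algebra_simps)

lemma ip_cmult_left: "ip a (\<lambda>x. c * f x) g = c * ip a f g"
  by (simp add: ip_def mult.assoc mult.left_commute[of _ c])

lemma ip_cmult_right: "ip a f (\<lambda>x. c * g x) = cnj c * ip a f g"
  by (simp add: ip_def mult.assoc mult.left_commute[of _ "cnj c"])

text \<open>The adjoint shift is chosen such that the terms of order 0 of both sides add up to
  \<open>- (1 + a j)\<close> times the product of \<open>f\<close> and \<open>cnj g\<close>, exactly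
  what \<open>weighted_integral_theta\<close> cancels against the derivative of that
  product.\<close>

lemma ip_theta_shift:
  fixes a :: "'n::finite \<Rightarrow> real"
  assumes K: "compact K" and f: "f \<in> smooth_in K" and g: "smooth g" and a: "\<And>i. a i > 0"
  shows "ip a (theta_shift u j f) g = - ip a f (theta_shift (adjoint_shift a u) j g)"
proof -
  have fg: "(\<lambda>x. f x * cnj (g x)) \<in> smooth_in K"
    using smooth_in_mult[OF smooth_cnj[OF g] f] by (simp add: mult.commute)
  have tf: "theta_shift u j f \<in> smooth_in K" by (intro smooth_in_theta_shift f compact_imp_closed K)
  have tg: "smooth (theta_shift (adjoint_shift a u) j g)" by (intro smooth_theta_shift g)
  have pm: "partial_deriv j (\<lambda>x. f x * cnj (g x)) x = partial_deriv j f x * cnj (g x) + f x * cnj (partial_deriv j g x)" for x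
    using partial_deriv_mult[OF smooth_inD(1)[OF f] smooth_cnj[OF g], of j] by (simp add: partial_deriv_cnj g)
  have "ip a (theta_shift u j f) g + ip a f (theta_shift (adjoint_shift a u) j g)
     = (LINT x|lborel. complex_of_real (weight a x) * (theta_shift u j f x * cnj (g x)) +
          complex_of_real (weight a x) * (f x * cnj (theta_shift (adjoint_shift a u) j g x)))"
    unfolding ip_def by (rule Bochner_Integration.integral_add[symmetric]) (intro ip_integrable[OF K] f g tf tg a)+
  also have "\<dots> = (LINT x|lborel. - (complex_of_real (weight a x) * (complex_of_real (x $ j) * partial_deriv j (\<lambda>x. f x * cnj (g x)) x))
        + (- (1 + complex_of_real (a j))) * (complex_of_real (weight a x) * (f x * cnj (g x))))"
    by (rule Bochner_Integration.integral_cong)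
      (auto simp: pm theta_shift_def adjoint_shift_def algebra_simps)
  also have "\<dots> = - (LINT x|lborel. complex_of_real (weight a x) * (complex_of_real (x $ j) * partial_deriv j (\<lambda>x. f x * cnj (g x)) x))
        + (- (1 + complex_of_real (a j))) * (LINT x|lborel. complex_of_real (weight a x) * (f x * cnj (g x)))"
  proof -
    have 1: "integrable lborel (\<lambda>x. complex_of_real (weight a x) * (complex_of_real (x $ j) * partial_deriv j (\<lambda>x. f x * cnj (g x)) x))"
      by (intro smooth_in_weight_integrable[OF K] a smooth_in_mult smooth_coord smooth_in_partial_deriv compact_imp_closed[OF K] fg)
    have 2: "integrable lborel (\<lambda>x. complex_of_real (weight a x) * (f x * cnj (g x)))"
      by (intro smooth_in_weight_integrable[OF K] a fg)
    show ?thesis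
      by (subst Bochner_Integration.integral_add[OF integrable_minus[OF 1] integrable_mult_right[OF 2]]) simp
  qed
  also have "\<dots> = 0" unfolding weighted_integral_theta[OF K fg a] by simp
  finally show ?thesis by (simp add: eq_neg_iff_add_eq_0)
qed

lemma ip_theta_monom:
  assumes K: "compact K" and a: "\<And>i. a i > 0" and f: "f \<in> smooth_in K" and g: "smooth g"
  shows "ip a (theta_monom u \<alpha> f) g = (-1) ^ mdegree \<alpha> * ip a f (theta_monom (adjoint_shift a u) \<alpha> g)"
  using g
proof (induction \<alpha> arbitrary: g rule: multi_index_induct)
  case (add \<alpha> i)
  have "ip a (theta_monom u (\<alpha> + Poly_Mapping.single i 1) f) g = ip a (theta_shift u i (theta_monom u \<alpha> f)) g"
    using f by (simp add: theta_monom_Suc smooth_inD)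
  also have "\<dots> = - ip a (theta_monom u \<alpha> f) (theta_shift (adjoint_shift a u) i g)"
    by (intro ip_theta_shift[OF K] smooth_in_theta_monom compact_imp_closed K f add.prems a)
  also have "\<dots> = - ((-1) ^ mdegree \<alpha> * ip a f (theta_monom (adjoint_shift a u) \<alpha> (theta_shift (adjoint_shift a u) i g)))"
    by (subst add.IH) (auto intro: smooth_theta_shift add.prems)
  finally show ?case
    using add.prems by (simp add: theta_monom_Suc theta_monom_comm mdegree_add)
qed simp

lemma ip_theta_poly:
  assumes K: "compact K" and a: "\<And>i. a i > 0" and f: "f \<in> smooth_in K" and g: "smooth g"
  shows "ip a (theta_poly u P f) g = ip a f (theta_poly (adjoint_shift a u) (sharp P) g)"
proof (induction P)
  case Nil
  then show ?case by (simp add: ip_def)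
next
  case (Cons p P)
  obtain c \<alpha> where p: "p = (c, \<alpha>)" by (cases p)
  have cl: "closed K" using K by (rule compact_imp_closed)
  show ?case
    unfolding p sharp_Cons theta_poly_Cons
    using Cons.IH
    by (simp add: ip_add_left[OF K] ip_add_right[OF K] smooth_in_cmult smooth_in_theta_monom smooth_in_theta_poly cl f g a
        smooth_cmult smooth_theta_monom smooth_theta_poly ip_cmult_left ip_cmult_right ip_theta_monom[OF K a])
qed

lemma theta_monom_shift_commute:
  "smooth f \<Longrightarrow> theta_monom u \<alpha> (theta_shift v j f) = theta_shift v j (theta_monom u \<alpha> f)"
  by (induction \<alpha> rule: multi_index_induct)
    (simp_all add: theta_monom_Suc smooth_theta_shift theta_shift_commute[OF smooth_theta_monom])

lemma theta_monom_commute: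
  "smooth f \<Longrightarrow> theta_monom u \<alpha> (theta_monom v \<beta> f) = theta_monom v \<beta> (theta_monom u \<alpha> f)"
  by (induction \<beta> rule: multi_index_induct)
    (simp_all add: theta_monom_Suc smooth_theta_monom theta_monom_shift_commute)

lemma theta_poly_monom_commute:
  "smooth f \<Longrightarrow> theta_poly u P (theta_monom v \<beta> f) = theta_monom v \<beta> (theta_poly u P f)"
proof (induction P)
  case Nil
  then show ?case using theta_monom_cmult[of "\<lambda>x. 0" v \<beta> 0] by (simp add: smooth_const)
next
  case (Cons p P)
  then show ?case
    by (cases p) (simp add: theta_poly_Cons theta_monom_add theta_monom_cmult smooth_cmult smooth_theta_monom
        smooth_theta_poly theta_monom_commute)
qed

lemma theta_poly_commute:
  "smooth f \<Longrightarrow> theta_poly u P (theta_poly v Q f) = theta_poly v Q (theta_poly u P f)"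
proof (induction P)
  case Nil
  then show ?case using theta_poly_cmult[of "\<lambda>x. 0" v Q 0] by (simp add: smooth_const)
next
  case (Cons p P)
  then show ?case
    by (cases p) (simp add: theta_poly_Cons theta_poly_add theta_poly_cmult smooth_cmult smooth_theta_monom
        smooth_theta_poly theta_poly_monom_commute)
qed

lemma theta_poly_sharp_sharp: "theta_poly u (sharp (sharp P)) f = theta_poly u P f"
proof (induction P)
  case (Cons p P)
  obtain c \<alpha> where p: "p = (c, \<alpha>)" by (cases p)
  have "(-1) ^ mdegree \<alpha> * ((-1) ^ mdegree \<alpha> * c) = (c::complex)"
    by (simp add: mult.assoc[symmetric] power_mult_distrib[symmetric])
  with Cons show ?case by (simp add: p sharp_Cons theta_poly_Cons)
qed simp

text \<open>An operator and its adjoint are polynomials in commuting operators, so with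
  \<open>?Q\<close> adjoint to \<open>?P\<close> the squared norms of \<open>?Q f\<close> and
  \<open>?P f\<close> both equal the inner product of \<open>f\<close> with
  \<open>?P (?Q f)\<close>.\<close>

lemma theta_poly_normal:
  assumes K: "compact K" and a: "\<And>i. a i > 0" and f: "f \<in> smooth_in K"
  shows "wnorm a (theta_poly (adjoint_shift a u) (sharp P) f) = wnorm a (theta_poly u P f)"
proof -
  let ?P = "theta_poly u P" and ?Q = "theta_poly (adjoint_shift a u) (sharp P)"
  have s: "smooth f" using f by (rule smooth_inD)
  have "ip a (?Q f) (?Q f) = ip a f (?P (?Q f))"
    using ip_theta_poly[OF K a f smooth_theta_poly[OF s], where u="adjoint_shift a u" and P="sharp P"]
    by (simp add: theta_poly_sharp_sharp)
  also have "\<dots> = ip a f (?Q (?P f))" by (simp add: theta_poly_commute s)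
  also have "\<dots> = ip a (?P f) (?P f)"
    by (rule ip_theta_poly[OF K a f smooth_theta_poly[OF s], symmetric])
  finally have "(wnorm a (?Q f))\<^sup>2 = (wnorm a (?P f))\<^sup>2" by (simp only: ip_self of_real_eq_iff)
  then show ?thesis by (rule power2_eq_imp_eq[OF _ wnorm_nonneg wnorm_nonneg])
qed

section \<open>The a priori estimate\<close>

lemma circle_mean_value:
  assumes f: "f holomorphic_on UNIV" and r: "r > 0"
  shows "(LINT t|lborel. indicator {0..1} t *\<^sub>R f (complex_of_real r * exp (2 * of_real pi * \<i> * of_real t))) = f 0"
proof -
  let ?c = "\<lambda>t. complex_of_real r * exp (2 * of_real pi * \<i> * of_real t)"
  have "((\<lambda>u. f u / (u - 0)) has_contour_integral (2 * of_real pi * \<i> * f 0)) (circlepath 0 r)"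
    using f r by (intro Cauchy_integral_circlepath_simple) (auto intro: holomorphic_on_subset)
  then have "((\<lambda>t. f (circlepath 0 r t) / circlepath 0 r t * vector_derivative (circlepath 0 r) (at t within {0..1}))
      has_integral (2 * of_real pi * \<i> * f 0)) {0..1}"
    by (simp add: has_contour_integral_def)
  then have "((\<lambda>t. (2 * of_real pi * \<i>) * f (?c t)) has_integral (2 * of_real pi * \<i> * f 0)) {0..1}"
  proof (rule has_integral_eq[rotated])
    fix t :: real assume "t \<in> {0..1}"
    then have v: "vector_derivative (circlepath 0 r) (at t within {0..1}) = 2 * pi * \<i> * r * exp (2 * of_real pi * \<i> * t)"
      by (intro vector_derivative_circlepath01) auto
    show "f (circlepath 0 r t) / circlepath 0 r t * vector_derivative (circlepath 0 r) (at t within {0..1}) = 2 * of_real pi * \<i> * f (?c t)"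
      unfolding v using r by (simp add: circlepath)
  qed
  from has_integral_mult_right[OF this, of "1 / (2 * of_real pi * \<i>)"]
  have hi: "((\<lambda>t. f (?c t)) has_integral f 0) {0..1}"
    by simp
  have "continuous_on UNIV f" using f by (rule holomorphic_on_imp_continuous_on)
  then have c: "continuous_on {0..1} (\<lambda>t. f (?c t))"
    by (rule continuous_on_compose2) (auto intro!: continuous_intros)
  have "set_integrable lborel {0..1} (\<lambda>t. f (?c t))"
    unfolding set_integrable_def by (rule borel_integrable_compact[OF compact_Icc c])
  then have "(LINT t:{0..1}|lborel. f (?c t)) = integral {0..1} (\<lambda>t. f (?c t))"
    by (rule set_borel_integral_eq_integral)
  also have "\<dots> = f 0" using hi by (rule integral_unique)
  finally show ?thesis by (simp add: set_lebesgue_integral_def)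
qed

lemma weight_update:
  assumes "x $ j \<noteq> 0"
  shows "weight a x * \<bar>x $ j\<bar> powr s = weight (a(j := a j + s)) x"
proof -
  have "(\<Prod>i\<in>UNIV - {j}. \<bar>x $ i\<bar> powr (a(j := a j + s)) i) = (\<Prod>i\<in>UNIV - {j}. \<bar>x $ i\<bar> powr a i)"
    by (rule prod.cong) auto
  then show ?thesis using assms by (simp add: weight_split[of _ _ j] powr_add)
qed

lemma weight_eq_0: "x $ j = 0 \<Longrightarrow> weight a x = 0"
  by (simp add: weight_split[of _ _ j])

text \<open>This is the reflection trick behind Malgrange's lemma: on the circle \<open>|w| = r\<close> one has
  \<open>2 Re w = w + r\<^sup>2 / w\<close>, so \<open>w\<^sup>n \<Sum>\<^sub>k (- 2 Re w)\<^sup>k |x\<^sub>j|\<^sup>- \<^sup>w h\<^sub>k\<close> is the restriction of an entire function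
  whose value at \<open>0\<close> is \<open>(- r\<^sup>2)\<^sup>n h\<^sub>n\<close>.\<close>

lemma circle_estimate:
  fixes a :: "'n::finite \<Rightarrow> real"
  assumes K: "compact K" and h: "\<And>k. h k \<in> smooth_in K" and a: "\<And>i. a i > 0"
    and r: "r > 0" "2 * r < a j"
    and M: "\<And>w. norm w = r \<Longrightarrow> wnorm (a(j := a j - 2 * Re w)) (\<lambda>x. \<Sum>k\<le>n. complex_of_real (- 2 * Re w) ^ k * h k x) \<le> M"
  shows "r ^ n * wnorm a (h n) \<le> M"
proof -
  define circ where "circ t = complex_of_real r * exp (2 * of_real pi * \<i> * of_real t)" for t :: real
  have circ: "norm (circ t) = r" for t using r by (simp add: circ_def norm_mult)
  \<comment> \<open>The exponential is \<open>|x $ j|\<close> to the power \<open>- w\<close>. Its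
    value on \<open>x $ j = 0\<close> does not matter, since the weight vanishes there. The
    remaining factors are polynomial in \<open>w\<close>, and at \<open>w = 0\<close> only the
    summand \<open>k = n\<close> survives.\<close>
  define F where "F x w = (\<Sum>k\<le>n. (-1) ^ k * w ^ (n - k) * (w\<^sup>2 + of_real (r\<^sup>2)) ^ k * exp (- w * of_real (ln \<bar>x $ j\<bar>)) * h k x)"
    for x :: "real^'n" and w :: complex
  define X where "X w x = (\<Sum>k\<le>n. complex_of_real (- 2 * Re w) ^ k * h k x)" for w x
  have X: "X w \<in> smooth_in K" for w unfolding X_def by (intro smooth_in_sum smooth_in_cmult h)
  have F0: "F x 0 = (-1) ^ n * of_real (r ^ (2 * n)) * h n x" for x
  proof -
    have "F x 0 = (\<Sum>k\<le>n. if k = n then (-1) ^ n * of_real (r ^ (2 * n)) * h n x else 0)"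
      unfolding F_def by (rule sum.cong) (auto simp: power_0_left power_mult)
    then show ?thesis by simp
  qed
  have FX: "F x w = w ^ n * exp (- w * of_real (ln \<bar>x $ j\<bar>)) * X w x" if "norm w = r" for x w
  proof -
    have rw: "of_real (r\<^sup>2) = w * cnj w" using that by (metis complex_norm_square of_real_power)
    have wr: "w\<^sup>2 + of_real (r\<^sup>2) = w * of_real (2 * Re w)"
      unfolding rw by (simp only: power2_eq_square distrib_left[symmetric] complex_add_cnj)
    have e: "(-1) ^ k * w ^ (n - k) * (w\<^sup>2 + of_real (r\<^sup>2)) ^ k = w ^ n * complex_of_real (- 2 * Re w) ^ k" if "k \<le> n" for k
    proof -
      have "w ^ n = w ^ (n - k) * w ^ k" using that by (simp add: power_add[symmetric])
      moreover have "complex_of_real (- 2 * Re w) ^ k = (-1) ^ k * of_real (2 * Re w) ^ k"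
        unfolding power_mult_distrib[symmetric] by simp
      moreover have "(w\<^sup>2 + of_real (r\<^sup>2)) ^ k = w ^ k * of_real (2 * Re w) ^ k"
        unfolding wr by (rule power_mult_distrib)
      ultimately show ?thesis by (simp only:) (simp only: mult_ac)
    qed
    show ?thesis unfolding F_def X_def sum_distrib_left
      by (rule sum.cong) (use e in \<open>auto simp: mult_ac\<close>)
  qed
  \<comment> \<open>The mean over the circle is paired with \<open>h n\<close> in the weight
    \<open>a\<close>. Integrating in \<open>t\<close> first produces the squared norm of
    \<open>h n\<close>; integrating in \<open>x\<close> first allows the hypothesis on each point of
    the circle to be used.\<close>
  define \<Phi> where "\<Phi> t x = indicator {0..1} t *\<^sub>R (complex_of_real (weight a x) * F x (circ t) * cnj (h n x))" for t :: real and x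
  obtain R where R: "R \<ge> 1" "\<And>x i. x \<in> K \<Longrightarrow> \<bar>x $ i\<bar> \<le> R" using compact_coord_bound[OF K] by blast
  define W where "W = (\<Prod>i\<in>(UNIV::'n set). R powr (a i + r))"
  have wexp: "weight a x * norm (exp (- w * complex_of_real (ln \<bar>x $ j\<bar>))) = weight (a(j := a j - Re w)) x"
    if "x $ j \<noteq> 0" for x w
  proof -
    have "norm (exp (- w * complex_of_real (ln \<bar>x $ j\<bar>))) = \<bar>x $ j\<bar> powr (- Re w)"
      using that by (simp add: powr_def norm_exp_eq_Re)
    then show ?thesis using weight_update[OF that, of a "- Re w"] by simp
  qed
  have Re: "\<bar>Re w\<bar> \<le> r" if "norm w = r" for w using that abs_Re_le_cmod[of w] by simp
  have W: "weight a x * norm (exp (- w * complex_of_real (ln \<bar>x $ j\<bar>))) \<le> W" if "norm w = r" "x \<in> K" for x w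
  proof (cases "x $ j = 0")
    case True
    have "W \<ge> 0" unfolding W_def by (intro prod_nonneg) auto
    then show ?thesis using weight_eq_0[OF True] by simp
  next
    case False
    have "weight (a(j := a j - Re w)) x \<le> W"
      unfolding weight_def W_def
    proof (intro prod_mono conjI)
      fix i
      let ?e = "(a(j := a j - Re w)) i"
      have e: "0 \<le> ?e" "?e \<le> a i + r" using Re[OF that(1)] a[of i] r by (auto simp: abs_le_iff)
      have "\<bar>x $ i\<bar> powr ?e \<le> R powr ?e" using e R that by (intro powr_mono2) auto
      also have "\<dots> \<le> R powr (a i + r)" using e R by (intro powr_mono) auto
      finally show "\<bar>x $ i\<bar> powr ?e \<le> R powr (a i + r)" .
    qed auto
    then show ?thesis using wexp[OF False] by simp
  qed
  have "\<exists>B. \<forall>x. norm (h k x) \<le> B" for k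
    using bounded_continuous_compact[OF K smooth_in_continuous[OF h[of k]] smooth_inD(2)[OF h[of k]]] by metis
  then obtain B where B: "\<And>k x. norm (h k x) \<le> B k" by metis
  have hm [measurable]: "h k \<in> borel_measurable borel" for k using smooth_in_measurable[OF h] .
  have jm [measurable]: "(\<lambda>x::real^'n. x $ j) \<in> borel_measurable borel"
    by (intro borel_measurable_continuous_onI continuous_intros)
  have cm [measurable]: "circ \<in> borel_measurable borel"
    unfolding circ_def by (intro borel_measurable_continuous_onI continuous_intros)
  have cnjm [measurable]: "cnj \<in> borel_measurable borel"
    by (intro borel_measurable_continuous_onI continuous_intros)
  have expm [measurable]: "(exp :: complex \<Rightarrow> complex) \<in> borel_measurable borel"
    by (intro borel_measurable_continuous_onI continuous_intros)
  have "integrable (lborel \<Otimes>\<^sub>M lborel) (case_prod \<Phi>)"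
  proof (rule integrableI_bounded_set[where A="{0..1::real} \<times> K" and B="W * (\<Sum>k\<le>n. r ^ (n - k) * (2 * r\<^sup>2) ^ k * B k) * B n"])
    show "{0..1::real} \<times> K \<in> sets (lborel \<Otimes>\<^sub>M lborel)"
      using borel_closed[OF compact_imp_closed[OF K]] borel_closed[OF closed_atLeastAtMost[of "0::real" 1]]
      by (intro pair_measureI) simp_all
    show "case_prod \<Phi> \<in> borel_measurable (lborel \<Otimes>\<^sub>M lborel)"
      unfolding \<Phi>_def F_def case_prod_beta by measurable
    have "emeasure lborel K < \<infinity>" using emeasure_bounded_finite[OF compact_imp_bounded[OF K]] by simp
    then show "emeasure (lborel \<Otimes>\<^sub>M lborel) ({0..1::real} \<times> K) < \<infinity>"
      using compact_imp_closed[OF K] by (simp add: lborel.emeasure_pair_measure_Times ennreal_mult_less_top)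
    have "norm (\<Phi> t x) \<le> W * (\<Sum>k\<le>n. r ^ (n - k) * (2 * r\<^sup>2) ^ k * B k) * B n" if "t \<in> {0..1}" "x \<in> K" for t x
    proof -
      let ?w = "circ t" and ?E = "exp (- circ t * of_real (ln \<bar>x $ j\<bar>))"
      define S where "S = (\<Sum>k\<le>n. (-1) ^ k * ?w ^ (n - k) * (?w\<^sup>2 + of_real (r\<^sup>2)) ^ k * h k x)"
      have FS: "F x ?w = ?E * S" unfolding F_def S_def sum_distrib_left by (rule sum.cong) (auto simp: mult_ac)
      have S: "norm S \<le> (\<Sum>k\<le>n. r ^ (n - k) * (2 * r\<^sup>2) ^ k * B k)"
        unfolding S_def
      proof (rule sum_norm_le)
        fix k assume "k \<in> {..n}"
        have "norm (?w\<^sup>2 + of_real (r\<^sup>2)) \<le> norm (?w\<^sup>2) + norm (complex_of_real (r\<^sup>2))" by (rule norm_triangle_ineq)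
        also have "\<dots> = 2 * r\<^sup>2" using r by (simp only: norm_power circ norm_of_real) (simp add: norm_power)
        finally have "norm (?w\<^sup>2 + of_real (r\<^sup>2)) ^ k \<le> (2 * r\<^sup>2) ^ k" by (intro power_mono) auto
        then show "norm ((-1) ^ k * ?w ^ (n - k) * (?w\<^sup>2 + of_real (r\<^sup>2)) ^ k * h k x) \<le> r ^ (n - k) * (2 * r\<^sup>2) ^ k * B k"
          unfolding norm_mult norm_power using B[of k x] r by (simp add: circ mult_mono)
      qed
      have "norm (\<Phi> t x) = (weight a x * norm ?E) * norm S * norm (h n x)"
        using that weight_nonneg[of a x] by (simp add: \<Phi>_def FS norm_mult mult_ac)
      also have "\<dots> \<le> W * (\<Sum>k\<le>n. r ^ (n - k) * (2 * r\<^sup>2) ^ k * B k) * B n"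
        using W[OF circ that(2), of t] S B[of n x] weight_nonneg[of a x]
        by (intro mult_mono mult_nonneg_nonneg order_trans[OF norm_ge_zero S]) (auto intro: order_trans[rotated])
      finally show ?thesis .
    qed
    then show "AE p in lborel \<Otimes>\<^sub>M lborel. p \<in> {0..1::real} \<times> K \<longrightarrow> norm (case_prod \<Phi> p) \<le> W * (\<Sum>k\<le>n. r ^ (n - k) * (2 * r\<^sup>2) ^ k * B k) * B n"
      by (intro AE_I2) auto
    show "AE p in lborel \<Otimes>\<^sub>M lborel. p \<notin> {0..1::real} \<times> K \<longrightarrow> case_prod \<Phi> p = 0"
    proof -
      have "b \<in> K" if "h n b \<noteq> 0" for b using smooth_inD(2)[OF h[of n]] that by blast
      then show ?thesis by (intro AE_I2) (auto simp: \<Phi>_def indicator_def split: if_splits)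
    qed
  qed
  note int\<Phi> = this
  note fub = lborel_pair.Fubini_integral[OF int\<Phi>]
  have inner: "(LINT t|lborel. \<Phi> t x) = complex_of_real (weight a x) * F x 0 * cnj (h n x)" for x
  proof -
    have "F x holomorphic_on UNIV" unfolding F_def by (intro holomorphic_intros)
    from circle_mean_value[OF this r(1)]
    have "(LINT t|lborel. indicator {0..1} t *\<^sub>R F x (circ t)) = F x 0" by (simp add: circ_def)
    moreover have "(\<lambda>t. \<Phi> t x) = (\<lambda>t. (complex_of_real (weight a x) * cnj (h n x)) * (indicator {0..1} t *\<^sub>R F x (circ t)))"
      by (simp add: \<Phi>_def mult_ac)
    ultimately show ?thesis by (simp only: integral_mult_right_zero) (simp add: mult_ac)
  qed
  have "(LINT x|lborel. (LINT t|lborel. \<Phi> t x)) = (-1) ^ n * of_real (r ^ (2 * n)) * ip a (h n) (h n)"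
    unfolding inner F0 ip_def integral_mult_right_zero[symmetric]
    by (rule Bochner_Integration.integral_cong) (auto simp: mult_ac)
  then have lhs: "norm (LINT x|lborel. (LINT t|lborel. \<Phi> t x)) = r ^ (2 * n) * (wnorm a (h n))\<^sup>2"
    using r by (simp add: ip_self norm_mult norm_power)
  have out: "norm (LINT x|lborel. \<Phi> t x) \<le> indicator {0..1} t * (r ^ n * M * wnorm a (h n))" for t
  proof (cases "t \<in> {0..1::real}")
    case False
    then show ?thesis by (simp add: \<Phi>_def)
  next
    case True
    define w where "w = circ t"
    have w: "norm w = r" by (simp add: w_def circ)
    \<comment> \<open>The factor \<open>|x $ j| powr (- Re w)\<close> is distributed by
      Cauchy-Schwarz: the weight with exponent \<open>a j - Re w\<close> is the geometric mean of
      the weights for \<open>a\<close> and \<open>a'\<close>. Positivity of \<open>a' j\<close> is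
      the reason for \<open>2 * r < a j\<close>.\<close>
    define a' where "a' = a(j := a j - 2 * Re w)"
    have a': "a' i > 0" for i using Re[OF w] a[of i] r by (auto simp: a'_def abs_le_iff)
    define u v where "u x = sqrt (weight a' x) * norm (X w x)" "v x = sqrt (weight a x) * norm (h n x)" for x
    note uv = this
    have u2: "(u x)\<^sup>2 = weight a' x * (norm (X w x))\<^sup>2" "(v x)\<^sup>2 = weight a x * (norm (h n x))\<^sup>2" for x
      by (auto simp: uv power_mult_distrib weight_nonneg)
    have um [measurable]: "u \<in> borel_measurable borel" "v \<in> borel_measurable borel"
      using smooth_in_measurable[OF X[of w]] unfolding uv by measurable
    have i: "integrable lborel (\<lambda>x. (u x)\<^sup>2)" "integrable lborel (\<lambda>x. (v x)\<^sup>2)"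
      unfolding u2 by (intro wnorm_integrable[OF K] X h a a')+
    have iuv: "integrable lborel (\<lambda>x. u x * v x)"
    proof (rule Bochner_Integration.integrable_bound[OF Bochner_Integration.integrable_add[OF i]])
      show "AE x in lborel. norm (u x * v x) \<le> norm ((u x)\<^sup>2 + (v x)\<^sup>2)"
      proof (rule AE_I2)
        fix x
        have "2 * (u x * v x) \<le> (u x)\<^sup>2 + (v x)\<^sup>2" using sum_squares_bound[of "u x" "v x"] by (simp add: mult.assoc)
        moreover have "u x * v x \<ge> 0" by (simp add: uv weight_nonneg)
        ultimately show "norm (u x * v x) \<le> norm ((u x)\<^sup>2 + (v x)\<^sup>2)" by simp
      qed
    qed simp
    have pt: "norm (\<Phi> t x) = r ^ n * (u x * v x)" for x
    proof (cases "x $ j = 0")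
      case True
      have "weight a x = 0" "weight a' x = 0" using weight_eq_0[OF True] by auto
      then show ?thesis by (simp add: \<Phi>_def uv)
    next
      case False
      have "weight a x * weight a' x = (weight (a(j := a j - Re w)) x)\<^sup>2"
      proof -
        define p where "p = \<bar>x $ j\<bar> powr (- Re w)"
        have "\<bar>x $ j\<bar> powr (- 2 * Re w) = p * p" unfolding p_def powr_add[symmetric] by simp
        then have "weight a' x = weight a x * (p * p)"
          using weight_update[OF False, of a "- 2 * Re w"] by (simp add: a'_def)
        moreover have "weight (a(j := a j - Re w)) x = weight a x * p"
          using weight_update[OF False, of a "- Re w"] by (simp add: p_def)
        ultimately show ?thesis by (simp add: power2_eq_square)
      qed
      then have "sqrt (weight a x) * sqrt (weight a' x) = weight (a(j := a j - Re w)) x"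
        by (simp add: real_sqrt_mult[symmetric] weight_nonneg)
      moreover have "norm (\<Phi> t x) = (weight a x * norm (exp (- w * complex_of_real (ln \<bar>x $ j\<bar>)))) * r ^ n * norm (X w x) * norm (h n x)"
        using \<open>t \<in> {0..1}\<close> weight_nonneg[of a x]
        by (simp add: \<Phi>_def w_def[symmetric] FX[OF w] norm_mult norm_power w mult_ac)
      ultimately show ?thesis unfolding wexp[OF False] by (simp add: uv mult_ac)
    qed
    have "norm (LINT x|lborel. \<Phi> t x) \<le> (LINT x|lborel. norm (\<Phi> t x))" by (rule integral_norm_bound)
    also have "\<dots> = r ^ n * (LINT x|lborel. u x * v x)" unfolding pt by simp
    also have "\<dots> \<le> r ^ n * (wnorm a' (X w) * wnorm a (h n))"
      using integral_cauchy_schwarz[OF i iuv] r unfolding u2 wnorm_def by (intro mult_left_mono) auto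
    also have "\<dots> \<le> r ^ n * (M * wnorm a (h n))"
      using M[OF w] r unfolding a'_def X_def by (intro mult_left_mono mult_right_mono) (auto simp: wnorm_nonneg)
    finally show ?thesis using True by simp
  qed
  have "r ^ (2 * n) * (wnorm a (h n))\<^sup>2 \<le> r ^ n * M * wnorm a (h n)"
  proof -
    have "norm (LINT t|lborel. (LINT x|lborel. \<Phi> t x)) \<le> (LINT t|lborel. norm (LINT x|lborel. \<Phi> t x))"
      by (rule integral_norm_bound)
    also have "\<dots> \<le> (LINT t|lborel. indicator {0..1::real} t * (r ^ n * M * wnorm a (h n)))"
    proof (rule integral_mono)
      show "integrable lborel (\<lambda>t. norm (LINT x|lborel. \<Phi> t x))"
        using lborel_pair.integrable_fst[OF int\<Phi>] by (rule integrable_norm)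
      show "integrable lborel (\<lambda>t. indicator {0..1::real} t * (r ^ n * M * wnorm a (h n)))"
        using borel_integrable_compact[of "{0..1::real}" "\<lambda>_. r ^ n * M * wnorm a (h n)"] by simp
    qed (rule out)
    also have "\<dots> = r ^ n * M * wnorm a (h n)" by simp
    finally show ?thesis using lhs fub by simp
  qed
  show ?thesis
  proof (cases "wnorm a (h n) = 0")
    case True
    \<comment> \<open>The point \<open>w = r\<close> of the circle shows that \<open>M\<close> is
      nonnegative.\<close>
    have "0 \<le> wnorm (a(j := a j - 2 * Re (of_real r))) (\<lambda>x. \<Sum>k\<le>n. complex_of_real (- 2 * Re (of_real r)) ^ k * h k x)"
      by (rule wnorm_nonneg)
    also have "\<dots> \<le> M" using r by (intro M) simp
    finally show ?thesis using True by simp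
  next
    case False
    then have p: "wnorm a (h n) > 0" using wnorm_nonneg[of a "h n"] by simp
    have "(r ^ n * wnorm a (h n)) * (r ^ n * wnorm a (h n)) \<le> M * (r ^ n * wnorm a (h n))"
      using \<open>r ^ (2 * n) * (wnorm a (h n))\<^sup>2 \<le> r ^ n * M * wnorm a (h n)\<close>
      by (simp add: power_mult power2_eq_square power_mult_distrib mult_ac)
    then show ?thesis using p r by (simp add: mult_le_cancel_right)
  qed
qed


text \<open>Descending induction on \<open>n\<close>. On the circle, the adjoint operator for the
  moved weight is a Taylor sum of the \<open>h k\<close> with powers of \<open>- 2 * Re w\<close>,
  and by normality its norm is that of \<open>theta_poly u P f\<close>. The terms with
  \<open>k > n\<close> are known by induction; what remains is the sum to which
  \<open>circle_estimate\<close> applies, and it isolates \<open>h n\<close>.\<close>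

lemma hasse_estimate:
  fixes P :: "'n::finite lpoly" and K :: "(real^'n) set"
  assumes K: "compact K"
  shows "(\<forall>i. a i > 0) \<Longrightarrow> 0 < \<delta> \<Longrightarrow> \<delta> \<le> 1 / 2 \<Longrightarrow> \<delta> < a j \<Longrightarrow>
    \<exists>C\<ge>0. \<forall>f\<in>smooth_in K. wnorm a (theta_poly u (hasse j n P) f) \<le> C * wnorm (a(j := a j - \<delta>)) (theta_poly u P f)"
proof (induction "Suc (lpoly_degree j P) - n" arbitrary: n a \<delta> rule: less_induct)
  case less
  note a = less.prems(1)[rule_format] and \<delta> = less.prems(2-4)
  show ?case
  proof (cases "lpoly_degree j P < n")
    case True
    then show ?thesis by (auto simp: theta_poly_hasse_eq_0)
  next
    case False
    define N where "N = lpoly_degree j P"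
    have nN: "n \<le> N" using False by (simp add: N_def)
    \<comment> \<open>Exponents on the circle deviate from \<open>a j\<close> by at most
      \<open>2 * r\<close>, half of the allowed loss. The other half is left to the induction
      hypothesis, which leads from \<open>a1\<close> to \<open>a2\<close>.\<close>
    define r where "r = \<delta> / 4"
    have r: "r > 0" "2 * r < a j" "2 * r \<le> 1/2" using \<delta> by (auto simp: r_def)
    define a1 where "a1 = a(j := a j - \<delta> / 2)"
    define a2 where "a2 = a(j := a j - \<delta>)"
    have a1: "a1 i > 0" and a2: "a2 i > 0" for i using a[of i] \<delta> by (auto simp: a1_def a2_def)
    have cl: "closed K" using K by (rule compact_imp_closed)
    obtain C0 where C0: "C0 \<ge> 0" "\<And>c d f. f \<in> smooth_in K \<Longrightarrow> (\<And>i. 0 < c i \<and> c i \<le> d i \<and> d i \<le> c i + 1) \<Longrightarrow> wnorm d f \<le> C0 * wnorm c f"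
      using wnorm_mono[OF K] by blast
    have "\<exists>C\<ge>0. \<forall>f\<in>smooth_in K. wnorm a1 (theta_poly u (hasse j m P) f) \<le> C * wnorm a2 (theta_poly u P f)" if "m > n" for m
    proof -
      have "Suc (lpoly_degree j P) - m < Suc (lpoly_degree j P) - n" using that nN by (auto simp: N_def)
      from less.hyps[OF this, of a1 "\<delta> / 2"]
      have "\<exists>C\<ge>0. \<forall>f\<in>smooth_in K. wnorm a1 (theta_poly u (hasse j m P) f) \<le> C * wnorm (a1(j := a1 j - \<delta> / 2)) (theta_poly u P f)"
        using a1 \<delta> by (auto simp: a1_def)
      moreover have "a1(j := a1 j - \<delta> / 2) = a2" by (auto simp: a1_def a2_def)
      ultimately show ?thesis by simp
    qed
    then obtain D where D: "\<And>m. m > n \<Longrightarrow> D m \<ge> 0"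
      "\<And>m f. m > n \<Longrightarrow> f \<in> smooth_in K \<Longrightarrow> wnorm a1 (theta_poly u (hasse j m P) f) \<le> D m * wnorm a2 (theta_poly u P f)"
      by metis
    \<comment> \<open>\<open>C0\<close> pays for moving the weight. The double sum bounds the terms
      \<open>k > n\<close> of the Taylor sum, each of which is itself expanded around the moved
      weight.\<close>
    define E where "E = C0 + (\<Sum>k\<in>{n<..N}. \<Sum>l\<le>N. C0 * (real ((k + l) choose k) * D (k + l)))"
    have E0: "E \<ge> 0" unfolding E_def using C0(1) D(1) by (auto intro!: add_nonneg_nonneg sum_nonneg mult_nonneg_nonneg)
    have "r ^ n * wnorm a (theta_poly u (hasse j n P) f) \<le> E * wnorm a2 (theta_poly u P f)" if f: "f \<in> smooth_in K" for f
    proof -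
      have s: "smooth f" using f by (rule smooth_inD)
      \<comment> \<open>The adjoints of the Hasse derivatives, formed in the fixed weight
        \<open>a\<close>. In this weight they have the same norms as the Hasse derivatives.\<close>
      define h where "h k = theta_poly (adjoint_shift a u) (sharp (hasse j k P)) f" for k
      have h: "h k \<in> smooth_in K" for k unfolding h_def by (intro smooth_in_theta_poly cl f)
      have "r ^ n * wnorm a (h n) \<le> E * wnorm a2 (theta_poly u P f)"
      proof (rule circle_estimate[where h=h and a=a, OF K h a r(1,2)])
        fix w :: complex assume w: "norm w = r"
        define \<sigma> where "\<sigma> = - 2 * Re w"
        define a' where "a' = a(j := a j - 2 * Re w)"
        have \<sigma>: "\<bar>\<sigma>\<bar> \<le> 2 * r" using abs_Re_le_cmod[of w] w by (simp add: \<sigma>_def abs_mult)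
        have \<sigma>1: "\<bar>\<sigma>\<bar> ^ k \<le> 1" for k using \<sigma> r(3) by (intro power_le_one) auto
        have a'\<sigma>: "a' = a(j := a j + \<sigma>)" by (simp add: a'_def \<sigma>_def)
        have a1': "0 < a1 i \<and> a1 i \<le> a' i \<and> a' i \<le> a1 i + 1" for i
          using a1[of i] \<sigma> \<delta> by (auto simp: a1_def a'\<sigma> r_def abs_le_iff)
        have a2': "0 < a2 i \<and> a2 i \<le> a' i \<and> a' i \<le> a2 i + 1" for i
          using a2[of i] \<sigma> \<delta> by (auto simp: a2_def a'\<sigma> r_def abs_le_iff)
        have a'p: "a' i > 0" for i using a1'[of i] by linarith
        have h1: "wnorm a' (h k) \<le> (\<Sum>l\<le>N. C0 * (real ((k + l) choose k) * D (k + l))) * wnorm a2 (theta_poly u P f)" if k: "k > n" for k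
        proof -
          \<comment> \<open>An adjoint formed in the weight \<open>a\<close> is, in the weight
            \<open>a'\<close>, the adjoint of an operator whose shift is larger by
            \<open>\<sigma>\<close>. Normality in \<open>a'\<close> thus leads to Hasse derivatives
            at \<open>u'\<close>, and Taylor expansion back to \<open>u\<close>.\<close>
          define u' where "u' = u(j := u j - (- complex_of_real \<sigma>))"
          have "adjoint_shift a u = adjoint_shift a' u'"
            by (auto simp: adjoint_shift_def a'\<sigma> u'_def)
          then have "wnorm a' (h k) = wnorm a' (theta_poly u' (hasse j k P) f)"
            unfolding h_def using theta_poly_normal[OF K a'p f] by simp
          also have "theta_poly u' (hasse j k P) f = (\<lambda>x. \<Sum>l\<le>max N (lpoly_degree j (hasse j k P)). (- complex_of_real \<sigma>) ^ l * theta_poly u (hasse j l (hasse j k P)) f x)"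
            unfolding u'_def by (rule theta_poly_taylor[OF s]) simp
          also have "\<dots> = (\<lambda>x. \<Sum>l\<le>N. ((- complex_of_real \<sigma>) ^ l * of_nat ((k + l) choose k)) * theta_poly u (hasse j (k + l) P) f x)"
          proof
            fix x
            have "(- complex_of_real \<sigma>) ^ l * theta_poly u (hasse j l (hasse j k P)) f x = 0"
              if "l \<in> {..max N (lpoly_degree j (hasse j k P))} - {..N}" for l
              using that by (simp add: theta_poly_hasse_hasse theta_poly_hasse_eq_0 N_def)
            then have "(\<Sum>l\<le>max N (lpoly_degree j (hasse j k P)). (- complex_of_real \<sigma>) ^ l * theta_poly u (hasse j l (hasse j k P)) f x)
               = (\<Sum>l\<le>N. (- complex_of_real \<sigma>) ^ l * theta_poly u (hasse j l (hasse j k P)) f x)"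
              by (intro sum.mono_neutral_right) auto
            then show "(\<Sum>l\<le>max N (lpoly_degree j (hasse j k P)). (- complex_of_real \<sigma>) ^ l * theta_poly u (hasse j l (hasse j k P)) f x)
               = (\<Sum>l\<le>N. ((- complex_of_real \<sigma>) ^ l * of_nat ((k + l) choose k)) * theta_poly u (hasse j (k + l) P) f x)"
              by (simp add: theta_poly_hasse_hasse mult.assoc)
          qed
          finally have "wnorm a' (h k) \<le> (\<Sum>l\<le>N. wnorm a' (\<lambda>x. ((- complex_of_real \<sigma>) ^ l * of_nat ((k + l) choose k)) * theta_poly u (hasse j (k + l) P) f x))"
            by (simp only:) (intro wnorm_sum[OF K] smooth_in_cmult smooth_in_theta_poly cl f a'p)
          also have "\<dots> \<le> (\<Sum>l\<le>N. (C0 * (real ((k + l) choose k) * D (k + l))) * wnorm a2 (theta_poly u P f))"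
          proof (rule sum_mono)
            fix l
            let ?g = "theta_poly u (hasse j (k + l) P) f"
            have "wnorm a' ?g \<le> C0 * wnorm a1 ?g"
              by (intro C0(2) smooth_in_theta_poly cl f a1')
            also have "\<dots> \<le> C0 * (D (k + l) * wnorm a2 (theta_poly u P f))"
              using k by (intro mult_left_mono D(2) f C0(1)) auto
            finally have g: "wnorm a' ?g \<le> C0 * (D (k + l) * wnorm a2 (theta_poly u P f))" .
            have "wnorm a' (\<lambda>x. ((- complex_of_real \<sigma>) ^ l * of_nat ((k + l) choose k)) * ?g x) = \<bar>\<sigma>\<bar> ^ l * (real ((k + l) choose k) * wnorm a' ?g)"
              unfolding wnorm_cmult by (simp add: norm_mult norm_power)
            also have "\<dots> \<le> 1 * (real ((k + l) choose k) * wnorm a' ?g)"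
              using \<sigma>1 by (intro mult_right_mono) (auto simp: wnorm_nonneg)
            also have "\<dots> \<le> 1 * (real ((k + l) choose k) * (C0 * (D (k + l) * wnorm a2 (theta_poly u P f))))"
              using g by (intro mult_left_mono) auto
            finally show "wnorm a' (\<lambda>x. ((- complex_of_real \<sigma>) ^ l * of_nat ((k + l) choose k)) * ?g x)
               \<le> (C0 * (real ((k + l) choose k) * D (k + l))) * wnorm a2 (theta_poly u P f)"
              by (simp add: mult_ac)
          qed
          also have "\<dots> = (\<Sum>l\<le>N. C0 * (real ((k + l) choose k) * D (k + l))) * wnorm a2 (theta_poly u P f)"
            by (simp add: sum_distrib_right)
          finally show ?thesis .
        qed
        \<comment> \<open>Conversely the adjoint of P in the weight \<open>a'\<close> differs from
          that in \<open>a\<close> by the shift \<open>\<sigma>\<close>. The signs of the Taylor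
          powers cancel against those from \<open>sharp_hasse\<close>.\<close>
        define M' where "M' = max N (lpoly_degree j (sharp P))"
        have "adjoint_shift a' u = (adjoint_shift a u)(j := adjoint_shift a u j - (- complex_of_real \<sigma>))"
          by (auto simp: adjoint_shift_def a'\<sigma>)
        then have "theta_poly (adjoint_shift a' u) (sharp P) f = (\<lambda>x. \<Sum>k\<le>M'. (- complex_of_real \<sigma>) ^ k * theta_poly (adjoint_shift a u) (hasse j k (sharp P)) f x)"
          by (simp only:) (rule theta_poly_taylor[OF s], simp add: M'_def)
        also have "\<dots> = (\<lambda>x. \<Sum>k\<le>M'. complex_of_real \<sigma> ^ k * h k x)"
        proof (intro ext sum.cong refl)
          fix x k
          have "(- complex_of_real \<sigma>) ^ k * ((-1) ^ k * z) = complex_of_real \<sigma> ^ k * z" for z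
            by (simp add: mult.assoc[symmetric] power_mult_distrib[symmetric])
          then show "(- complex_of_real \<sigma>) ^ k * theta_poly (adjoint_shift a u) (hasse j k (sharp P)) f x = complex_of_real \<sigma> ^ k * h k x"
            by (simp add: sharp_hasse h_def)
        qed
        also have "\<dots> = (\<lambda>x. \<Sum>k\<le>N. complex_of_real \<sigma> ^ k * h k x)"
        proof
          fix x
          have "h k x = 0" if "k > N" for k
          proof -
            have "lpoly_degree j (sharp P) = lpoly_degree j P"
              by (induction P) (auto simp: lpoly_degree_def sharp_Cons)
            then have "theta_poly (adjoint_shift a u) (hasse j k (sharp P)) f x = 0"
              using that by (simp add: theta_poly_hasse_eq_0 N_def)
            then show ?thesis by (simp add: sharp_hasse h_def)
          qed
          then show "(\<Sum>k\<le>M'. complex_of_real \<sigma> ^ k * h k x) = (\<Sum>k\<le>N. complex_of_real \<sigma> ^ k * h k x)"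
            by (intro sum.mono_neutral_right) (auto simp: M'_def)
        qed
        finally have T: "theta_poly (adjoint_shift a' u) (sharp P) f = (\<lambda>x. \<Sum>k\<le>N. complex_of_real \<sigma> ^ k * h k x)" .
        define Y where "Y = theta_poly (adjoint_shift a' u) (sharp P) f"
        have Y: "Y \<in> smooth_in K" unfolding Y_def by (intro smooth_in_theta_poly cl f)
        have split: "(\<lambda>x. \<Sum>k\<le>n. complex_of_real \<sigma> ^ k * h k x) = (\<lambda>x. Y x - (\<Sum>k\<in>{n<..N}. complex_of_real \<sigma> ^ k * h k x))"
        proof
          fix x
          have "{..N} = {..n} \<union> {n<..N}" using nN by auto
          then have "(\<Sum>k\<le>N. complex_of_real \<sigma> ^ k * h k x) = (\<Sum>k\<le>n. complex_of_real \<sigma> ^ k * h k x) + (\<Sum>k\<in>{n<..N}. complex_of_real \<sigma> ^ k * h k x)"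
            by (simp add: sum.union_disjoint ivl_disj_int_one)
          then show "(\<Sum>k\<le>n. complex_of_real \<sigma> ^ k * h k x) = Y x - (\<Sum>k\<in>{n<..N}. complex_of_real \<sigma> ^ k * h k x)"
            by (simp add: Y_def T)
        qed
        have "wnorm a' (\<lambda>x. \<Sum>k\<le>n. complex_of_real \<sigma> ^ k * h k x) \<le> wnorm a' Y + wnorm a' (\<lambda>x. \<Sum>k\<in>{n<..N}. complex_of_real \<sigma> ^ k * h k x)"
          unfolding split by (intro wnorm_diff[OF K] Y smooth_in_sum smooth_in_cmult h a'p)
        also have "\<dots> \<le> wnorm a' Y + (\<Sum>k\<in>{n<..N}. wnorm a' (\<lambda>x. complex_of_real \<sigma> ^ k * h k x))"
          by (intro add_left_mono wnorm_sum[OF K] smooth_in_cmult h a'p)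
        also have "wnorm a' Y = wnorm a' (theta_poly u P f)" unfolding Y_def by (rule theta_poly_normal[OF K a'p f])
        also have "\<dots> \<le> C0 * wnorm a2 (theta_poly u P f)" by (intro C0(2) smooth_in_theta_poly cl f a2')
        also have "(\<Sum>k\<in>{n<..N}. wnorm a' (\<lambda>x. complex_of_real \<sigma> ^ k * h k x)) \<le> (\<Sum>k\<in>{n<..N}. (\<Sum>l\<le>N. C0 * (real ((k + l) choose k) * D (k + l))) * wnorm a2 (theta_poly u P f))"
        proof (rule sum_mono)
          fix k assume "k \<in> {n<..N}"
          have "wnorm a' (\<lambda>x. complex_of_real \<sigma> ^ k * h k x) = \<bar>\<sigma>\<bar> ^ k * wnorm a' (h k)"
            unfolding wnorm_cmult by (simp add: norm_power)
          also have "\<dots> \<le> 1 * wnorm a' (h k)" by (intro mult_right_mono \<sigma>1 wnorm_nonneg)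
          finally show "wnorm a' (\<lambda>x. complex_of_real \<sigma> ^ k * h k x) \<le> (\<Sum>l\<le>N. C0 * (real ((k + l) choose k) * D (k + l))) * wnorm a2 (theta_poly u P f)"
            using h1[of k] \<open>k \<in> {n<..N}\<close> by simp
        qed
        finally have "wnorm a' (\<lambda>x. \<Sum>k\<le>n. complex_of_real \<sigma> ^ k * h k x) \<le> E * wnorm a2 (theta_poly u P f)"
          by (simp add: E_def distrib_right sum_distrib_right)
        then show "wnorm (a(j := a j - 2 * Re w)) (\<lambda>x. \<Sum>k\<le>n. complex_of_real (- 2 * Re w) ^ k * h k x) \<le> E * wnorm a2 (theta_poly u P f)"
          by (simp only: a'_def \<sigma>_def)
      qed
      moreover have "wnorm a (h n) = wnorm a (theta_poly u (hasse j n P) f)"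
        unfolding h_def by (rule theta_poly_normal[OF K a f])
      ultimately show ?thesis by simp
    qed
    then have "wnorm a (theta_poly u (hasse j n P) f) \<le> (E / r ^ n) * wnorm a2 (theta_poly u P f)" if "f \<in> smooth_in K" for f
      using that r(1) by (simp add: field_simps)
    then show ?thesis using E0 r(1) unfolding a2_def by (intro exI[of _ "E / r ^ n"]) auto
  qed
qed

text \<open>Everything that iterated use of \<open>hasse_estimate\<close> bounds by P. It serves two
  ends: it contains a nonzero constant, by which the function itself is controlled, and it is stable
  under the Leibniz rule, by which cutoffs are.\<close>

inductive_set hasse_closure :: "'n::finite lpoly \<Rightarrow> 'n lpoly set" for P where
  self: "P \<in> hasse_closure P"
| step: "Q \<in> hasse_closure P \<Longrightarrow> hasse j n Q \<in> hasse_closure P"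

lemma hasse_closure_estimate:
  fixes P :: "'n::finite lpoly" and K :: "(real^'n) set"
  assumes K: "compact K"
  shows "Q \<in> hasse_closure P \<Longrightarrow> 0 < c \<Longrightarrow> c < b \<Longrightarrow> b \<le> 1 \<Longrightarrow>
    \<exists>C\<ge>0. \<forall>f\<in>smooth_in K. wnorm (\<lambda>_. b) (theta_poly u Q f) \<le> C * wnorm (\<lambda>_. c) (theta_poly u P f)"
proof (induction arbitrary: b rule: hasse_closure.induct)
  case self
  obtain C where C: "C \<ge> 0" "\<And>a a' f. f \<in> smooth_in K \<Longrightarrow> (\<forall>i. 0 < a i \<and> a i \<le> a' i \<and> a' i \<le> a i + 1) \<Longrightarrow> wnorm a' f \<le> C * wnorm a f"
    using wnorm_mono[OF K] by blast
  have "wnorm (\<lambda>_. b) (theta_poly u P f) \<le> C * wnorm (\<lambda>_. c) (theta_poly u P f)" if "f \<in> smooth_in K" for f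
    using self by (intro C(2) smooth_in_theta_poly compact_imp_closed K that) auto
  then show ?case using C(1) by blast
next
  case (step Q j n)
  \<comment> \<open>Half of the remaining gap between \<open>c\<close> and \<open>b\<close> is spent
    on the outermost derivative, the rest is passed on. So any number of derivatives fits into an
    arbitrarily small loss.\<close>
  define d where "d = (b + c) / 2"
  define \<delta> where "\<delta> = b - d"
  have d: "c < d" "d < b" "0 < \<delta>" "\<delta> \<le> 1 / 2" "\<delta> < b" "0 < d" using step.prems by (auto simp: d_def \<delta>_def field_simps)
  obtain C1 where C1: "C1 \<ge> 0" "\<And>f. f \<in> smooth_in K \<Longrightarrow> wnorm (\<lambda>_. b) (theta_poly u (hasse j n Q) f) \<le> C1 * wnorm ((\<lambda>_. b)(j := b - \<delta>)) (theta_poly u Q f)"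
    using hasse_estimate[OF K, of "\<lambda>_. b" \<delta> j u n Q] d step.prems by auto
  obtain C2 where C2: "C2 \<ge> 0" "\<And>a a' f. f \<in> smooth_in K \<Longrightarrow> (\<And>i. 0 < a i \<and> a i \<le> a' i \<and> a' i \<le> a i + 1) \<Longrightarrow> wnorm a' f \<le> C2 * wnorm a f"
    using wnorm_mono[OF K] by blast
  obtain C3 where C3: "C3 \<ge> 0" "\<And>f. f \<in> smooth_in K \<Longrightarrow> wnorm (\<lambda>_. d) (theta_poly u Q f) \<le> C3 * wnorm (\<lambda>_. c) (theta_poly u P f)"
    using step.IH[of d] step.prems d by auto
  have "wnorm (\<lambda>_. b) (theta_poly u (hasse j n Q) f) \<le> (C1 * C2 * C3) * wnorm (\<lambda>_. c) (theta_poly u P f)" if f: "f \<in> smooth_in K" for f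
  proof -
    have "wnorm (\<lambda>_. b) (theta_poly u (hasse j n Q) f) \<le> C1 * wnorm ((\<lambda>_. b)(j := b - \<delta>)) (theta_poly u Q f)" by (rule C1(2)[OF f])
    \<comment> \<open>\<open>hasse_estimate\<close> lowered the exponent of variable
      \<open>j\<close> only; the others are lowered to \<open>d\<close> as well, so that the weight
      is again the same in all variables.\<close>
    also have "\<dots> \<le> C1 * (C2 * wnorm (\<lambda>_. d) (theta_poly u Q f))"
      using d step.prems by (intro mult_left_mono C1(1) C2(2) smooth_in_theta_poly compact_imp_closed K f) (auto simp: \<delta>_def)
    also have "\<dots> \<le> C1 * (C2 * (C3 * wnorm (\<lambda>_. c) (theta_poly u P f)))"
      by (intro mult_left_mono C1(1) C2(1) C3(2) f)
    finally show ?thesis by (simp add: mult_ac)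
  qed
  then show ?case using C1(1) C2(1) C3(1) by (intro exI[of _ "C1 * C2 * C3"]) auto
qed

lemma hasse_closure_fold: "Q \<in> hasse_closure P \<Longrightarrow> fold (\<lambda>j. hasse j (\<beta> j)) js Q \<in> hasse_closure P"
  by (induction js arbitrary: Q) (auto intro: hasse_closure.step)

lemma hasse_closure_constant:
  fixes P :: "'n::finite lpoly"
  assumes "distinct (map snd P)" "P \<noteq> []" "\<And>c \<alpha>. (c, \<alpha>) \<in> set P \<Longrightarrow> c \<noteq> 0"
  obtains Q c where "Q \<in> hasse_closure P" "c \<noteq> 0" "\<And>u f. theta_poly u Q f = (\<lambda>x. c * f x)"
proof -
  have "finite ((mdegree \<circ> snd) ` set P)" "(mdegree \<circ> snd) ` set P \<noteq> {}" using assms(2) by auto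
  from Max_in[OF this] obtain p where p: "p \<in> set P" "mdegree (snd p) = Max ((mdegree \<circ> snd) ` set P)" by auto
  obtain c0 \<alpha>0 where c0: "p = (c0, \<alpha>0)" by (cases p)
  have "mdegree \<alpha> \<le> mdegree \<alpha>0" if "(c, \<alpha>) \<in> set P" for c \<alpha>
  proof -
    have "mdegree \<alpha> \<in> (mdegree \<circ> snd) ` set P" using that by force
    then show ?thesis using p(2) c0 by (simp add: Max_ge)
  qed
  then have "theta_poly u (fold (\<lambda>j. hasse j (Poly_Mapping.lookup \<alpha>0 j)) index_list P) f = (\<lambda>x. c0 * f x)" for u f
    using hasse_to_constant[OF assms(1), of c0 \<alpha>0] p(1) c0 by blast
  then show ?thesis using that[OF hasse_closure_fold[OF hasse_closure.self]] assms(3) p(1) c0 by blast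
qed

section \<open>A Sobolev inequality with weights\<close>

lemma nn_integral_prod_coords:
  fixes f :: "'n::finite \<Rightarrow> real \<Rightarrow> ennreal"
  assumes [measurable]: "\<And>i. f i \<in> borel_measurable borel"
  shows "(\<integral>\<^sup>+(x::real^'n). (\<Prod>i\<in>UNIV. f i (x $ i)) \<partial>lborel) = (\<Prod>i\<in>UNIV. (\<integral>\<^sup>+t. f i t \<partial>lborel))"
proof -
  have B: "(Basis :: (real^'n) set) = range (\<lambda>i. axis i 1)" by (auto simp: Basis_vec_def)
  have inj: "inj (\<lambda>i::'n. axis i (1::real))" by (auto simp: inj_on_def axis_eq_axis)
  \<comment> \<open>Relabels the factors by basis vectors, the index set of the product formula for
    \<open>lborel\<close>.\<close>
  define g where "g b = f (THE i. b = axis i 1)" for b :: "real^'n"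
  have g: "g (axis i 1) = f i" for i
    unfolding g_def by (rule arg_cong[of _ _ f]) (auto simp: axis_eq_axis)
  have gm: "g b \<in> borel_measurable borel" for b by (simp add: g_def)
  have "(\<integral>\<^sup>+(x::real^'n). (\<Prod>b\<in>Basis. g b (x \<bullet> b)) \<partial>lborel) = (\<Prod>b\<in>(Basis :: (real^'n) set). (\<integral>\<^sup>+t. g b t \<partial>lborel))"
    by (rule nn_integral_lborel_prod) (use gm in auto)
  then show ?thesis unfolding B by (simp add: prod.reindex[OF inj] g inner_axis)
qed

lemma nn_integral_neg_power_finite:
  assumes "b < (1::real)" "R \<ge> 0"
  shows "(\<integral>\<^sup>+t. ennreal (indicator {-R..R} t * \<bar>t\<bar> powr (- b)) \<partial>lborel) < \<infinity>"
proof -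
  define f where "f t = indicator {0..R} t * t powr (- b)" for t :: real
  have "(\<lambda>x. x powr (- b)) integrable_on {0..R}"
    using assms by (intro integrable_on_powr_from_0) auto
  then have "(\<lambda>x. if x \<in> {0..R} then x powr (- b) else 0) integrable_on UNIV"
    by (simp only: integrable_restrict_UNIV)
  then obtain I where "((\<lambda>x. if x \<in> {0..R} then x powr (- b) else 0) has_integral I) UNIV" by blast
  moreover have "(\<lambda>x. if x \<in> {0..R} then x powr (- b) else 0) = f" by (auto simp: f_def)
  ultimately have I: "(f has_integral I) UNIV" by simp
  have fm [measurable]: "f \<in> borel_measurable borel" unfolding f_def by measurable
  have f0: "f t \<ge> 0" for t by (simp add: f_def)
  have 1: "(\<integral>\<^sup>+t. ennreal (f t) \<partial>lborel) = ennreal I"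
    by (rule nn_integral_has_integral_lborel[OF fm f0 I])
  have 2: "(\<integral>\<^sup>+t. ennreal (f (- t)) \<partial>lborel) = ennreal I"
    using nn_integral_real_affine[of "\<lambda>t. ennreal (f t)" "-1" 0] 1 by simp
  have "(\<integral>\<^sup>+t. ennreal (indicator {-R..R} t * \<bar>t\<bar> powr (- b)) \<partial>lborel) \<le> (\<integral>\<^sup>+t. ennreal (f t) + ennreal (f (- t)) \<partial>lborel)"
  proof (rule nn_integral_mono)
    fix t :: real
    show "ennreal (indicator {-R..R} t * \<bar>t\<bar> powr (- b)) \<le> ennreal (f t) + ennreal (f (- t))"
      unfolding ennreal_plus[OF f0 f0, symmetric]
      by (rule ennreal_leI) (auto simp: f_def indicator_def abs_if)
  qed
  also have "\<dots> = ennreal I + ennreal I" by (subst nn_integral_add) (use 1 2 in auto)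
  also have "\<dots> < \<infinity>" by simp
  finally show ?thesis .
qed

lemma AE_coords_nonzero: "AE x::real^'n::finite in lborel. \<forall>i. x $ i \<noteq> 0"
proof -
  have "AE x::real^'n in lborel. x $ i \<noteq> 0" for i
  proof (rule AE_I[of _ _ "{x. x $ i = 0}"])
    have m: "{x::real^'n. x $ i = 0} \<in> sets borel"
      by (intro borel_closed closed_Collect_eq continuous_intros)
    have "{x::real^'n. x $ i = 0} = {x. axis i 1 \<bullet> x = 0}"
      by (auto simp: inner_axis' )
    then have "negligible {x::real^'n. x $ i = 0}"
      using negligible_hyperplane[of "axis i (1::real)" 0] by (simp add: axis_eq_0_iff)
    then have "{x::real^'n. x $ i = 0} \<in> null_sets lborel"
      using m by (simp add: negligible_iff_null_sets null_sets_completion_iff)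
    then show "emeasure lborel {x::real^'n. x $ i = 0} = 0" by auto
    show "{x::real^'n. x $ i = 0} \<in> sets lborel" using m by simp
  qed auto
  then show ?thesis by (simp add: AE_finite_all[of UNIV, simplified])
qed

text \<open>The place where exponents below 1 are essential: on a cube the integral is a product of
  integrals of \<open>|t| powr (- b i)\<close>, each finite at 0.\<close>

lemma integrable_inverse_weight:
  fixes K :: "(real^'n::finite) set"
  assumes K: "compact K" and b: "\<And>i. b i < 1"
  shows "integrable lborel (\<lambda>x. indicator K x * weight (\<lambda>i. - b i) x)"
proof (rule integrableI_nonneg)
  have [measurable]: "K \<in> sets borel" using compact_imp_closed[OF K] by (rule borel_closed)
  show "(\<lambda>x. indicator K x * weight (\<lambda>i. - b i) x) \<in> borel_measurable lborel" by measurable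
  obtain R where R: "R \<ge> 1" "\<And>x i. x \<in> K \<Longrightarrow> \<bar>x $ i\<bar> \<le> R" using compact_coord_bound[OF K] by blast
  have "(\<integral>\<^sup>+x. ennreal (indicator K x * weight (\<lambda>i. - b i) x) \<partial>lborel)
     \<le> (\<integral>\<^sup>+x. (\<Prod>i\<in>UNIV. ennreal (indicator {-R..R} (x $ i) * \<bar>x $ i\<bar> powr (- b i))) \<partial>lborel)"
  proof (rule nn_integral_mono)
    fix x :: "real^'n"
    have "indicator K x * weight (\<lambda>i. - b i) x \<le> (\<Prod>i\<in>UNIV. indicator {-R..R} (x $ i) * \<bar>x $ i\<bar> powr (- b i))"
    proof (cases "x \<in> K")
      case True
      have "-R \<le> x $ i \<and> x $ i \<le> R" for i using R(2)[OF True, of i] by (simp add: abs_le_iff)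
      then show ?thesis using True by (simp add: weight_def)
    next
      case False
      have "0 \<le> (\<Prod>i\<in>UNIV. indicator {-R..R} (x $ i) * \<bar>x $ i\<bar> powr (- b i))" by (intro prod_nonneg) auto
      then show ?thesis using False by simp
    qed
    then show "ennreal (indicator K x * weight (\<lambda>i. - b i) x) \<le> (\<Prod>i\<in>UNIV. ennreal (indicator {-R..R} (x $ i) * \<bar>x $ i\<bar> powr (- b i)))"
      by (subst prod_ennreal) (auto intro: ennreal_leI)
  qed
  also have "\<dots> = (\<Prod>i\<in>UNIV. (\<integral>\<^sup>+t. ennreal (indicator {-R..R} t * \<bar>t\<bar> powr (- b i)) \<partial>lborel))"
    by (rule nn_integral_prod_coords) measurable
  also have "\<dots> < \<infinity>"
    using nn_integral_neg_power_finite[OF b] R(1)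
    by (auto simp: less_top[symmetric] ennreal_prod_eq_top)
  finally show "(\<integral>\<^sup>+x. ennreal (indicator K x * weight (\<lambda>i. - b i) x) \<partial>lborel) < \<infinity>" .
qed (auto simp: weight_nonneg)

text \<open>Cauchy-Schwarz for the square root of the weight times \<open>f\<close> against the
  square root of the inverse weight; their product is \<open>norm (f x)\<close> off the coordinate
  hyperplanes.\<close>

lemma L1_bound:
  fixes K :: "(real^'n::finite) set"
  assumes K: "compact K" and b: "\<And>i. 0 < b i" "\<And>i. b i < 1"
  shows "\<exists>C\<ge>0. \<forall>f\<in>smooth_in K. (LINT x|lborel. norm (f x)) \<le> C * wnorm b f"
proof -
  let ?v2 = "\<lambda>x. indicator K x * weight (\<lambda>i. - b i) x"
  define C where "C = sqrt (LINT x|lborel. ?v2 x)"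
  have iv: "integrable lborel ?v2" by (rule integrable_inverse_weight[OF K b(2)])
  have [measurable]: "K \<in> sets borel" using compact_imp_closed[OF K] by (rule borel_closed)
  have "(LINT x|lborel. norm (f x)) \<le> C * wnorm b f" if f: "f \<in> smooth_in K" for f
  proof -
    define u v where "u x = sqrt (weight b x) * norm (f x)" "v x = indicator K x * sqrt (weight (\<lambda>i. - b i) x)" for x
    note uv = this
    have u2: "(u x)\<^sup>2 = weight b x * (norm (f x))\<^sup>2" and v2: "(v x)\<^sup>2 = ?v2 x" for x
      by (auto simp: uv power_mult_distrib weight_nonneg indicator_def)
    have w1: "weight b x * weight (\<lambda>i. - b i) x = 1" if "\<forall>i. x $ i \<noteq> 0" for x
      unfolding weight_def prod.distrib[symmetric] using that by (simp add: powr_add[symmetric])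
    have e: "AE x in lborel. u x * v x = norm (f x)"
      using AE_coords_nonzero
    proof eventually_elim
      case (elim x)
      have "sqrt (weight b x) * sqrt (weight (\<lambda>i. - b i) x) = 1"
        using w1[OF elim] by (simp add: real_sqrt_mult[symmetric])
      then have "(sqrt (weight b x) * sqrt (weight (\<lambda>i. - b i) x)) * norm (f x) = norm (f x)" by simp
      then show ?case using smooth_inD(2)[OF f, of x] by (cases "x \<in> K") (auto simp: uv mult_ac)
    qed
    have [measurable]: "f \<in> borel_measurable borel" by (rule smooth_in_measurable[OF f])
    have [measurable]: "u \<in> borel_measurable borel" "v \<in> borel_measurable borel" unfolding uv by measurable
    have fi: "integrable lborel (\<lambda>x. norm (f x))"
      using smooth_in_integrable[OF K f] by (rule integrable_norm)
    have iuv: "integrable lborel (\<lambda>x. u x * v x)"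
      by (rule integrable_cong_AE_imp[OF fi]) (use e in \<open>auto elim: AE_mp\<close>)
    have "(LINT x|lborel. norm (f x)) = (LINT x|lborel. u x * v x)"
      by (rule integral_cong_AE) (use e in \<open>auto elim: AE_mp\<close>)
    also have "\<dots> \<le> sqrt (LINT x|lborel. (u x)\<^sup>2) * sqrt (LINT x|lborel. (v x)\<^sup>2)"
      using integral_cauchy_schwarz[of lborel u v] iuv wnorm_integrable[OF K f b(1)] iv unfolding u2 v2 by auto
    finally show ?thesis unfolding u2 v2 by (simp add: wnorm_def C_def mult.commute)
  qed
  moreover have "C \<ge> 0" by (simp add: C_def weight_nonneg)
  ultimately show ?thesis by blast
qed

text \<open>\<open>H\<close> carries the factors \<open>A j\<close> of those variables whose
  derivative is moved later; being independent of the variables in \<open>js\<close>, it passes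
  through the induction as a constant.\<close>

lemma iterated_by_parts:
  fixes A B :: "'n::finite \<Rightarrow> real^'n \<Rightarrow> complex"
  assumes K: "compact K"
    and A: "\<And>i. smooth (A i)" and B: "\<And>i. smooth (B i)"
    and AB: "\<And>i j x. partial_deriv j (A i) x = (if i = j then B i x else 0)"
    and Bj: "\<And>i j x. i \<noteq> j \<Longrightarrow> partial_deriv j (B i) x = 0"
  shows "distinct js \<Longrightarrow> smooth H \<Longrightarrow> (\<And>j x. j \<in> set js \<Longrightarrow> partial_deriv j H x = 0) \<Longrightarrow> f \<in> smooth_in K \<Longrightarrow>
    (LINT x|lborel. H x * (\<Prod>j\<in>set js. A j x) * fold partial_deriv js f x)
     = (-1) ^ length js * (LINT x|lborel. H x * (\<Prod>j\<in>set js. B j x) * f x)"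
proof (induction js arbitrary: H f)
  case (Cons j js)
  define H' where "H' = (\<lambda>x. H x * A j x)"
  have H': "smooth H'" unfolding H'_def by (intro smooth_mult Cons.prems A)
  have "partial_deriv i H' x = 0" if "i \<in> set js" for i x
    using that Cons.prems by (auto simp: H'_def partial_deriv_mult A AB)
  from Cons.IH[OF _ H' this, of "partial_deriv j f"]
  have 1: "(LINT x|lborel. H' x * (\<Prod>j\<in>set js. A j x) * fold partial_deriv js (partial_deriv j f) x)
     = (-1) ^ length js * (LINT x|lborel. (H' x * (\<Prod>j\<in>set js. B j x)) * partial_deriv j f x)"
    using Cons.prems compact_imp_closed[OF K] by (auto intro: smooth_in_partial_deriv)
  define G where "G = (\<lambda>x. H' x * (\<Prod>j\<in>set js. B j x))"
  have sB: "smooth (\<lambda>x. \<Prod>j\<in>J. B j x)" for J by (intro smooth_prod B)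
  have dB: "partial_deriv j (\<lambda>x. \<Prod>j\<in>J. B j x) x = 0" if "finite J" "j \<notin> J" for J x
    using that
  proof (induction J arbitrary: x)
    case (insert i J)
    then show ?case using partial_deriv_mult[OF B[of i] sB[of J], of j] Bj[of i j x] by auto
  qed simp
  have G: "smooth G" unfolding G_def by (intro smooth_mult H' sB)
  have dG: "partial_deriv j G x = H x * B j x * (\<Prod>j\<in>set js. B j x)" for x
    using Cons.prems dB[of "set js" x] unfolding G_def H'_def
    by (simp add: partial_deriv_mult smooth_mult A sB AB)
  have "(LINT x|lborel. G x * partial_deriv j f x) = - (LINT x|lborel. partial_deriv j G x * f x)"
    using integral_by_parts[OF K G Cons.prems(4), of j] by simp
  also have "(LINT x|lborel. partial_deriv j G x * f x) = (LINT x|lborel. H x * (\<Prod>i\<in>set (j # js). B i x) * f x)"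
    using Cons.prems(1) by (intro Bochner_Integration.integral_cong) (auto simp: dG mult_ac)
  finally have 2: "(LINT x|lborel. G x * partial_deriv j f x) = - (LINT x|lborel. H x * (\<Prod>i\<in>set (j # js). B i x) * f x)" .
  have "(LINT x|lborel. H x * (\<Prod>i\<in>set (j # js). A i x) * fold partial_deriv (j # js) f x)
      = (LINT x|lborel. H' x * (\<Prod>j\<in>set js. A j x) * fold partial_deriv js (partial_deriv j f) x)"
    using Cons.prems(1) by (intro Bochner_Integration.integral_cong) (auto simp: H'_def mult_ac)
  then show ?case using 1 2 by (simp add: G_def)
qed simp

text \<open>A smoothed form of the representation of \<open>f x\<close> by the integral of the full
  mixed derivative over an orthant. The Heaviside functions are replaced by \<open>R1 i\<close> with
  values between 0 and 1, and their derivatives \<open>\<rho>1 i\<close> multiply to an approximate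
  identity near \<open>x\<close>.\<close>

lemma sup_le_L1:
  fixes K :: "(real^'n::finite) set"
  assumes K: "compact K" and f: "f \<in> smooth_in K"
  shows "norm (f x) \<le> (LINT y|lborel. norm (fold partial_deriv (index_list :: 'n list) f y))"
    (is "_ \<le> ?I")
proof (rule field_le_epsilon)
  fix e :: real assume e: "e > 0"
  have "isCont f x" using smooth_in_continuous[OF f, of UNIV] by (simp add: continuous_on_eq_continuous_at)
  then obtain d where d: "d > 0" "\<And>y. dist y x < d \<Longrightarrow> dist (f y) (f x) < e"
    using e unfolding continuous_at_eps_delta by blast
  \<comment> \<open>The cube with corner \<open>x\<close> and side \<open>h\<close> has l^1 diameter
    \<open>d / 2\<close>, so \<open>f\<close> varies by less than \<open>e\<close> on it.\<close>
  define h where "h = d / (2 * real CARD('n))"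
  have h: "h > 0" using d by (simp add: h_def)
  obtain R \<rho> where R: "smooth1 R" "smooth1 \<rho>" "\<And>t. (R has_real_derivative \<rho> t) (at t)" "\<And>t. \<rho> t \<ge> 0"
     "\<And>t. t \<le> 0 \<Longrightarrow> R t = 0" "\<And>t. t \<ge> 1 \<Longrightarrow> R t = 1" "\<And>t. t \<le> 0 \<or> t \<ge> 1 \<Longrightarrow> \<rho> t = 0" "\<And>t. 0 \<le> R t \<and> R t \<le> 1"
    using smooth_step_exists by blast
  define R1 where "R1 i t = R ((1/h) * t + - x $ i / h)" for i t
  define \<rho>1 where "\<rho>1 i t = (1/h) * \<rho> ((1/h) * t + - x $ i / h)" for i t
  have sR1: "smooth1 (R1 i)" for i unfolding R1_def by (rule smooth1_affine[OF R(1)])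
  have s\<rho>1: "smooth1 (\<rho>1 i)" for i
    unfolding \<rho>1_def by (rule smooth1_alg_smooth1, rule smooth1_alg.mult[OF smooth1_alg.const smooth1_alg.base[OF R(2)]])
  have dR1: "(R1 i has_real_derivative \<rho>1 i t) (at t)" for i t
    unfolding R1_def \<rho>1_def
    by (rule DERIV_cong[OF DERIV_chain2[OF R(3) DERIV_add[OF DERIV_cmult_Id DERIV_const]]]) simp
  have \<rho>10: "\<rho>1 i t \<ge> 0" for i t using R(4) h by (simp add: \<rho>1_def)
  have arg: "(1/h) * t + - x $ i / h = (t - x $ i) / h" for t i by (simp add: diff_divide_distrib)
  have \<rho>1z: "\<rho>1 i t = 0" if "t \<notin> {x $ i..x $ i + h}" for i t
  proof -
    have "(t - x $ i) / h \<le> 0 \<or> (t - x $ i) / h \<ge> 1" using that h by (auto simp: field_simps)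
    then show ?thesis using R(7) unfolding \<rho>1_def arg by simp
  qed
  define A where "A i y = complex_of_real (R1 i (y $ i))" for i and y :: "real^'n"
  define B where "B i y = complex_of_real (\<rho>1 i (y $ i))" for i and y :: "real^'n"
  have sA: "smooth (A i)" and sB: "smooth (B i)" for i
    unfolding A_def B_def by (intro smooth_coord_fun sR1 s\<rho>1)+
  have AB: "partial_deriv j (A i) y = (if i = j then B i y else 0)" for i j y
    unfolding A_def partial_deriv_coord_fun[where i=j and j=i, OF dR1[of i]] by (simp add: B_def)
  have Bj: "partial_deriv j (B i) y = 0" if "i \<noteq> j" for i j y
  proof -
    from s\<rho>1[of i] obtain G' where "\<And>t. (\<rho>1 i has_real_derivative G' t) (at t)" by (meson smooth1.cases)
    from partial_deriv_coord_fun[where i=j and j=i, OF this] show ?thesis using that unfolding B_def by simp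
  qed
  define J where "J = (index_list :: 'n list)"
  have J: "distinct J" "set J = UNIV" by (simp_all add: J_def index_list)
  have eq: "(LINT y|lborel. (\<Prod>j\<in>UNIV. A j y) * fold partial_deriv J f y) = (-1) ^ length J * (LINT y|lborel. (\<Prod>j\<in>UNIV. B j y) * f y)"
    using iterated_by_parts[where A=A and B=B and H="\<lambda>_. 1" and js=J, OF K sA sB AB Bj J(1) smooth_const _ f] J(2) by simp
  have Ff: "fold partial_deriv J f \<in> smooth_in K" by (intro smooth_in_fold compact_imp_closed K f)
  have "norm (LINT y|lborel. (\<Prod>j\<in>UNIV. A j y) * fold partial_deriv J f y) \<le> (LINT y|lborel. norm ((\<Prod>j\<in>UNIV. A j y) * fold partial_deriv J f y))"
    by (rule integral_norm_bound)
  also have "\<dots> \<le> ?I"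
  proof (rule integral_mono)
    show "integrable lborel (\<lambda>y. norm ((\<Prod>j\<in>UNIV. A j y) * fold partial_deriv J f y))"
      by (intro integrable_norm smooth_in_integrable[OF K] smooth_in_mult smooth_prod sA Ff)
    show "integrable lborel (\<lambda>y. norm (fold partial_deriv index_list f y))"
      using Ff by (intro integrable_norm smooth_in_integrable[OF K]) (simp add: J_def)
    fix y
    have "norm (\<Prod>j\<in>UNIV. A j y) = (\<Prod>j\<in>UNIV. norm (A j y))" by (rule prod_norm[symmetric])
    also have "\<dots> \<le> 1" using R(8) by (intro prod_le_1) (auto simp: A_def R1_def)
    finally show "norm ((\<Prod>j\<in>UNIV. A j y) * fold partial_deriv J f y) \<le> norm (fold partial_deriv index_list f y)"
      unfolding norm_mult J_def by (intro mult_left_le_one_le) auto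
  qed
  finally have I: "norm (LINT y|lborel. (\<Prod>j\<in>UNIV. B j y) * f y) \<le> ?I"
    unfolding eq by (simp add: norm_mult norm_power)
  define \<beta> where "\<beta> y = (\<Prod>j\<in>UNIV. \<rho>1 j (y $ j))" for y :: "real^'n"
  have \<beta>B: "(\<Prod>j\<in>UNIV. B j y) = complex_of_real (\<beta> y)" for y by (simp add: B_def \<beta>_def)
  have \<beta>0: "\<beta> y \<ge> 0" for y unfolding \<beta>_def by (intro prod_nonneg) (simp add: \<rho>10)
  have cont1: "continuous_on UNIV (\<rho>1 i)" for i
  proof -
    from s\<rho>1[of i] obtain G' where "\<And>t. (\<rho>1 i has_real_derivative G' t) (at t)" by (meson smooth1.cases)
    then show ?thesis by (meson DERIV_isCont continuous_at_imp_continuous_on)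
  qed
  have \<beta>c: "continuous_on UNIV \<beta>"
    unfolding \<beta>_def by (intro continuous_on_prod continuous_on_compose2[OF cont1] continuous_intros) auto
  define Q where "Q = cbox x (\<chi> i. x $ i + h)"
  have \<beta>z: "\<beta> y = 0" if "y \<notin> Q" for y
  proof -
    from that obtain i where "y $ i \<notin> {x $ i..x $ i + h}" by (auto simp: Q_def mem_box_cart)
    then have "\<rho>1 i (y $ i) = 0" by (rule \<rho>1z)
    then show ?thesis unfolding \<beta>_def by (intro prod_zero) auto
  qed
  have \<beta>i: "integrable lborel \<beta>"
    by (rule integrable_continuous_compact[of Q, OF _ \<beta>c \<beta>z]) (auto simp: Q_def)
  have \<beta>1: "(LINT y|lborel. \<beta> y) = 1"
  proof -
    have m: "(\<integral>\<^sup>+t. ennreal (\<rho>1 i t) \<partial>lborel) = 1" for i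
    proof -
      have "(\<integral>\<^sup>+t. ennreal (\<rho>1 i t) \<partial>lborel) = (\<integral>\<^sup>+t. ennreal (\<rho>1 i t) * indicator {x $ i..x $ i + h} t \<partial>lborel)"
        using \<rho>1z by (intro nn_integral_cong) (auto simp: indicator_def)
      also have "\<dots> = ennreal (R1 i (x $ i + h) - R1 i (x $ i))"
      proof (rule nn_integral_FTC_Icc)
        show "\<rho>1 i \<in> borel_measurable borel" using cont1 by (rule borel_measurable_continuous_onI)
        show "DERIV (R1 i) t :> \<rho>1 i t" for t by (rule dR1)
      qed (use h \<rho>10 in auto)
      also have "\<dots> = 1" using h R(5)[of 0] R(6)[of 1] unfolding R1_def arg by simp
      finally show ?thesis .
    qed
    have "(\<integral>\<^sup>+y. ennreal (\<beta> y) \<partial>lborel) = (\<integral>\<^sup>+(y::real^'n). (\<Prod>i\<in>UNIV. ennreal (\<rho>1 i (y $ i))) \<partial>lborel)"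
      unfolding \<beta>_def by (intro nn_integral_cong) (simp add: prod_ennreal \<rho>10)
    also have "\<dots> = (\<Prod>i\<in>UNIV. (\<integral>\<^sup>+t. ennreal (\<rho>1 i t) \<partial>lborel))"
      by (intro nn_integral_prod_coords measurable_compose[OF borel_measurable_continuous_onI[OF cont1] measurable_ennreal])
    also have "\<dots> = 1" by (simp add: m)
    finally have "ennreal (LINT y|lborel. \<beta> y) = ennreal 1"
      using nn_integral_eq_integral[OF \<beta>i] \<beta>0 by simp
    then show ?thesis using \<beta>0 by (subst (asm) ennreal_inj) auto
  qed
  have fy: "norm (complex_of_real (\<beta> y) * (f x - f y)) \<le> \<beta> y * e" for y
  proof (cases "y \<in> Q")
    case False
    then show ?thesis using \<beta>z by simp
  next
    case True
    have "norm (y - x) \<le> (\<Sum>j\<in>UNIV. \<bar>(y - x) $ j\<bar>)" by (rule norm_le_l1_cart)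
    also have "\<dots> \<le> (\<Sum>j\<in>(UNIV::'n set). h)"
    proof (rule sum_mono)
      fix j
      have "x $ j \<le> y $ j" "y $ j \<le> x $ j + h" using True by (auto simp: Q_def mem_box_cart)
      then show "\<bar>(y - x) $ j\<bar> \<le> h" by simp
    qed
    also have "\<dots> < d" using d by (simp add: h_def)
    finally have "norm (f x - f y) < e" using d(2)[of y] by (simp add: dist_norm norm_minus_commute)
    then show ?thesis using \<beta>0[of y] by (simp add: norm_mult mult_left_mono)
  qed
  have i1: "integrable lborel (\<lambda>y. complex_of_real (\<beta> y) * f y)"
    unfolding \<beta>B[symmetric] by (intro smooth_in_integrable[OF K] smooth_in_mult smooth_prod sB f)
  have i2: "integrable lborel (\<lambda>y. complex_of_real (\<beta> y) * f x)"
    using \<beta>i by (intro integrable_mult_left integrable_of_real)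
  have "f x = (LINT y|lborel. complex_of_real (\<beta> y) * f x)"
    using \<beta>1 \<beta>i by (simp add: integral_complex_of_real)
  also have "\<dots> = (LINT y|lborel. complex_of_real (\<beta> y) * f y) + (LINT y|lborel. complex_of_real (\<beta> y) * (f x - f y))"
    using i1 i2 by (simp add: right_diff_distrib)
  finally have "norm (f x) \<le> norm (LINT y|lborel. complex_of_real (\<beta> y) * f y) + norm (LINT y|lborel. complex_of_real (\<beta> y) * (f x - f y))"
    by (metis norm_triangle_ineq)
  also have "norm (LINT y|lborel. complex_of_real (\<beta> y) * f y) \<le> ?I" using I by (simp add: \<beta>B)
  also have "norm (LINT y|lborel. complex_of_real (\<beta> y) * (f x - f y)) \<le> (LINT y|lborel. \<beta> y * e)"
  proof (rule order_trans[OF integral_norm_bound], rule integral_mono)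
    show "integrable lborel (\<lambda>y. norm (complex_of_real (\<beta> y) * (f x - f y)))"
      using Bochner_Integration.integrable_diff[OF i2 i1] by (intro integrable_norm) (simp add: right_diff_distrib)
  qed (use \<beta>i fy in auto)
  also have "\<dots> = e" using \<beta>1 by simp
  finally show "norm (f x) \<le> ?I + e" by simp
qed

section \<open>The norms\<close>

text \<open>Derivatives are indexed by words and not by multi-indices. Equal derivatives are then
  counted several times, which gives an equivalent norm and fits inductions over
  \<open>fold\<close>.\<close>

definition words :: "nat \<Rightarrow> 'n::finite list set" where
  "words L = {w. length w \<le> L}"

lemma finite_words [simp]: "finite (words L :: 'n::finite list set)"
  using finite_lists_length_le[of "UNIV :: 'n set" L] by (simp add: words_def)

text \<open>The l^2 combination keeps the parallelogram law (\<open>qnorm_parallelogram\<close>), on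
  which the use of \<open>minimizing_sequence\<close> depends.\<close>

definition qnorm :: "nat \<Rightarrow> real \<Rightarrow> (real^'n::finite \<Rightarrow> complex) \<Rightarrow> real" where
  "qnorm L b f = L2_set (\<lambda>w. wnorm (\<lambda>_. b) (fold partial_deriv w f)) (words L)"

lemma fold_partial_deriv_add: "smooth f \<Longrightarrow> smooth g \<Longrightarrow>
    fold partial_deriv w (\<lambda>x. f x + g x) = (\<lambda>x. fold partial_deriv w f x + fold partial_deriv w g x)"
  by (induction w arbitrary: f g) (simp_all add: partial_deriv_add smooth_partial_deriv)

lemma fold_partial_deriv_cmult: "smooth f \<Longrightarrow>
    fold partial_deriv w (\<lambda>x. c * f x) = (\<lambda>x. c * fold partial_deriv w f x)"
  by (induction w arbitrary: f) (simp_all add: partial_deriv_cmult smooth_partial_deriv)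

lemma fold_partial_deriv_diff: "smooth f \<Longrightarrow> smooth g \<Longrightarrow>
    fold partial_deriv w (\<lambda>x. f x - g x) = (\<lambda>x. fold partial_deriv w f x - fold partial_deriv w g x)"
  by (induction w arbitrary: f g) (simp_all add: partial_deriv_diff smooth_partial_deriv)

lemma qnorm_nonneg: "qnorm L b f \<ge> 0"
  by (simp add: qnorm_def)

lemma qnorm_cmult: "smooth f \<Longrightarrow> qnorm L b (\<lambda>x. c * f x) = norm c * qnorm L b f"
  by (simp add: qnorm_def fold_partial_deriv_cmult wnorm_cmult L2_set_right_distrib)

lemma qnorm_zero [simp]: "qnorm L b (\<lambda>x. 0) = 0"
  using qnorm_cmult[of "\<lambda>x. 0" L b 0] by (simp add: smooth_const)

lemma qnorm_add:
  assumes "compact K" "f \<in> smooth_in K" "g \<in> smooth_in K" "b > 0"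
  shows "qnorm L b (\<lambda>x. f x + g x) \<le> qnorm L b f + qnorm L b g"
proof -
  have "qnorm L b (\<lambda>x. f x + g x) \<le> L2_set (\<lambda>w. wnorm (\<lambda>_. b) (fold partial_deriv w f) + wnorm (\<lambda>_. b) (fold partial_deriv w g)) (words L)"
    unfolding qnorm_def fold_partial_deriv_add[OF smooth_inD(1)[OF assms(2)] smooth_inD(1)[OF assms(3)]]
    by (intro L2_set_mono wnorm_add[OF assms(1)] smooth_in_fold compact_imp_closed assms wnorm_nonneg)
  also have "\<dots> \<le> qnorm L b f + qnorm L b g"
    unfolding qnorm_def by (rule L2_set_triangle_ineq)
  finally show ?thesis .
qed

lemma qnorm_diff:
  assumes "compact K" "f \<in> smooth_in K" "g \<in> smooth_in K" "b > 0"
  shows "qnorm L b (\<lambda>x. f x - g x) \<le> qnorm L b f + qnorm L b g"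
  using qnorm_add[OF assms(1,2) smooth_in_cmult[OF assms(3), of "-1"] assms(4), of L]
    qnorm_cmult[OF smooth_inD(1)[OF assms(3)], of L b "-1"] by simp

lemma wnorm_le_qnorm: "length w \<le> L \<Longrightarrow> wnorm (\<lambda>_. b) (fold partial_deriv w f) \<le> qnorm L b f"
  unfolding qnorm_def by (rule member_le_L2_set[OF finite_words]) (simp add: words_def)

lemma qnorm_le_sum: "qnorm L b f \<le> (\<Sum>w\<in>words L. wnorm (\<lambda>_. b) (fold partial_deriv w f))"
  unfolding qnorm_def by (rule L2_set_le_sum) (simp add: wnorm_nonneg)

lemma wnorm_parallelogram:
  assumes "compact K" "f \<in> smooth_in K" "g \<in> smooth_in K" "\<And>i. a i > 0"
  shows "(wnorm a (\<lambda>x. f x + g x))\<^sup>2 + (wnorm a (\<lambda>x. f x - g x))\<^sup>2 = 2 * (wnorm a f)\<^sup>2 + 2 * (wnorm a g)\<^sup>2"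
proof -
  have p: "(norm (f x + g x))\<^sup>2 + (norm (f x - g x))\<^sup>2 = 2 * (norm (f x))\<^sup>2 + 2 * (norm (g x))\<^sup>2" for x
    unfolding cmod_power2 by (simp add: power2_eq_square algebra_simps)
  have "(wnorm a (\<lambda>x. f x + g x))\<^sup>2 + (wnorm a (\<lambda>x. f x - g x))\<^sup>2
     = (LINT x|lborel. weight a x * (norm (f x + g x))\<^sup>2 + weight a x * (norm (f x - g x))\<^sup>2)"
    unfolding wnorm_sq
    by (intro Bochner_Integration.integral_add[symmetric] wnorm_integrable[OF assms(1)] smooth_in_add smooth_in_diff assms)
  also have "\<dots> = (LINT x|lborel. 2 * (weight a x * (norm (f x))\<^sup>2) + 2 * (weight a x * (norm (g x))\<^sup>2))"
    by (intro Bochner_Integration.integral_cong refl) (metis (no_types, lifting) p distrib_left mult.left_commute)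
  also have "\<dots> = 2 * (wnorm a f)\<^sup>2 + 2 * (wnorm a g)\<^sup>2"
    unfolding wnorm_sq using wnorm_integrable[OF assms(1,2,4)] wnorm_integrable[OF assms(1,3,4)] by simp
  finally show ?thesis .
qed

lemma qnorm_sq: "(qnorm L b f)\<^sup>2 = (\<Sum>w\<in>words L. (wnorm (\<lambda>_. b) (fold partial_deriv w f))\<^sup>2)"
  by (simp add: qnorm_def L2_set_def sum_nonneg)

lemma qnorm_parallelogram:
  assumes "compact K" "f \<in> smooth_in K" "g \<in> smooth_in K" "b > 0"
  shows "(qnorm L b (\<lambda>x. f x + g x))\<^sup>2 + (qnorm L b (\<lambda>x. f x - g x))\<^sup>2 = 2 * (qnorm L b f)\<^sup>2 + 2 * (qnorm L b g)\<^sup>2"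
  unfolding qnorm_sq sum.distrib[symmetric] sum_distrib_left
    fold_partial_deriv_add[OF smooth_inD(1)[OF assms(2)] smooth_inD(1)[OF assms(3)]]
    fold_partial_deriv_diff[OF smooth_inD(1)[OF assms(2)] smooth_inD(1)[OF assms(3)]]
  by (intro sum.cong refl wnorm_parallelogram[OF assms(1)] smooth_in_fold compact_imp_closed assms)

text \<open>Differentiating by a word \<open>w\<close> turns both operators into operators with one
  common new shift, so the L^2 estimate is applied to each derivative of \<open>f\<close>
  separately.\<close>

lemma qnorm_hasse_estimate:
  fixes P :: "'n::finite lpoly" and K :: "(real^'n) set"
  assumes K: "compact K" and Q: "Q \<in> hasse_closure P" and bc: "0 < c" "c < b" "b \<le> 1"
  shows "\<exists>C\<ge>0. \<forall>f\<in>smooth_in K. qnorm L b (theta_poly u Q f) \<le> C * qnorm L c (theta_poly u P f)"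
proof -
  have "\<exists>C\<ge>0. \<forall>f\<in>smooth_in K. wnorm (\<lambda>_. b) (fold partial_deriv w (theta_poly u Q f)) \<le> C * wnorm (\<lambda>_. c) (fold partial_deriv w (theta_poly u P f))" for w
  proof -
    obtain v where v: "\<And>P f. smooth f \<Longrightarrow> fold partial_deriv w (theta_poly u P f) = theta_poly v P (fold partial_deriv w f)"
      using fold_partial_deriv_theta_poly[of w u] by blast
    obtain C where "C \<ge> 0" "\<And>f. f \<in> smooth_in K \<Longrightarrow> wnorm (\<lambda>_. b) (theta_poly v Q f) \<le> C * wnorm (\<lambda>_. c) (theta_poly v P f)"
      using hasse_closure_estimate[OF K Q bc] by blast
    moreover have "fold partial_deriv w f \<in> smooth_in K" if "f \<in> smooth_in K" for f
      by (intro smooth_in_fold compact_imp_closed K that)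
    ultimately show ?thesis by (intro exI[of _ C]) (simp add: v smooth_inD(1))
  qed
  then obtain C where C: "\<And>w. C w \<ge> 0" "\<And>w f. f \<in> smooth_in K \<Longrightarrow>
     wnorm (\<lambda>_. b) (fold partial_deriv w (theta_poly u Q f)) \<le> C w * wnorm (\<lambda>_. c) (fold partial_deriv w (theta_poly u P f))"
    by metis
  have "qnorm L b (theta_poly u Q f) \<le> (\<Sum>w\<in>words L. C w) * qnorm L c (theta_poly u P f)" if f: "f \<in> smooth_in K" for f
  proof -
    have "qnorm L b (theta_poly u Q f) \<le> (\<Sum>w\<in>words L. wnorm (\<lambda>_. b) (fold partial_deriv w (theta_poly u Q f)))"
      by (rule qnorm_le_sum)
    also have "\<dots> \<le> (\<Sum>w\<in>words L. C w * qnorm L c (theta_poly u P f))"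
      by (intro sum_mono order_trans[OF C(2)[OF f]] mult_left_mono wnorm_le_qnorm C(1)) (simp add: words_def)
    finally show ?thesis by (simp add: sum_distrib_right)
  qed
  moreover have "0 \<le> (\<Sum>w\<in>words L. C w)" by (intro sum_nonneg C(1))
  ultimately show ?thesis by blast
qed

lemma qnorm_mono_weight:
  assumes K: "compact K"
  shows "\<exists>C\<ge>0. \<forall>f\<in>smooth_in K. \<forall>b c. 0 < c \<longrightarrow> c \<le> b \<longrightarrow> b \<le> 1 \<longrightarrow> qnorm L b f \<le> C * qnorm L c f"
proof -
  obtain C where C: "C \<ge> 0" "\<And>d c f. f \<in> smooth_in K \<Longrightarrow> (\<forall>i. 0 < c i \<and> c i \<le> d i \<and> d i \<le> c i + 1) \<Longrightarrow> wnorm d f \<le> C * wnorm c f"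
    using wnorm_mono[OF K] by blast
  have "qnorm L b f \<le> C * qnorm L c f" if f: "f \<in> smooth_in K" and "0 < c" "c \<le> b" "b \<le> 1" for f b c
    unfolding qnorm_def L2_set_right_distrib[OF C(1)]
    using that(2-4) by (intro L2_set_mono wnorm_nonneg C(2) smooth_in_fold compact_imp_closed K f) auto
  then show ?thesis using C(1) by blast
qed

lemma sup_le_qnorm:
  fixes K :: "(real^'n::finite) set"
  assumes K: "compact K" and b: "0 < b" "b < 1"
  shows "\<exists>C\<ge>0. \<forall>f\<in>smooth_in K. \<forall>w x. length w + CARD('n) \<le> L \<longrightarrow> norm (fold partial_deriv w f x) \<le> C * qnorm L b f"
proof -
  obtain C where C: "C \<ge> 0" "\<And>f. f \<in> smooth_in K \<Longrightarrow> (LINT x|lborel. norm (f x)) \<le> C * wnorm (\<lambda>_. b) f"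
    using L1_bound[OF K, of "\<lambda>_. b"] b by blast
  have J: "length (index_list :: 'n list) = CARD('n)" using index_list by (metis distinct_card)
  have "norm (fold partial_deriv w f x) \<le> C * qnorm L b f"
    if f: "f \<in> smooth_in K" and w: "length w + CARD('n) \<le> L" for f w x
  proof -
    have wf: "fold partial_deriv v f \<in> smooth_in K" for v by (intro smooth_in_fold compact_imp_closed K f)
    have "norm (fold partial_deriv w f x) \<le> (LINT y|lborel. norm (fold partial_deriv (w @ index_list) f y))"
      using sup_le_L1[OF K wf[of w]] by simp
    also have "\<dots> \<le> C * wnorm (\<lambda>_. b) (fold partial_deriv (w @ index_list) f)" by (rule C(2)[OF wf])
    also have "\<dots> \<le> C * qnorm L b f" using w by (intro mult_left_mono wnorm_le_qnorm C(1)) (simp add: J)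
    finally show ?thesis .
  qed
  then show ?thesis using C(1) by blast
qed

lemma qnorm_partial_deriv: "qnorm L b (partial_deriv i f) \<le> qnorm (Suc L) b f"
proof (rule power2_le_imp_le)
  have "(qnorm L b (partial_deriv i f))\<^sup>2 = (\<Sum>v\<in>(\<lambda>w. i # w) ` words L. (wnorm (\<lambda>_. b) (fold partial_deriv v f))\<^sup>2)"
    unfolding qnorm_sq by (subst sum.reindex) (auto simp: inj_on_def)
  also have "\<dots> \<le> (\<Sum>v\<in>words (Suc L). (wnorm (\<lambda>_. b) (fold partial_deriv v f))\<^sup>2)"
    by (intro sum_mono2 finite_words) (auto simp: words_def)
  finally show "(qnorm L b (partial_deriv i f))\<^sup>2 \<le> (qnorm (Suc L) b f)\<^sup>2" by (simp add: qnorm_sq)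
qed (rule qnorm_nonneg)

lemma qnorm_mult:
  assumes K: "compact K" and g: "smooth g" and b: "0 < b"
  shows "\<exists>C\<ge>0. \<forall>f\<in>smooth_in K. qnorm L b (\<lambda>x. g x * f x) \<le> C * qnorm L b f"
proof -
  have cl: "closed K" using K by (rule compact_imp_closed)
  \<comment> \<open>The constant has to serve all orders \<open>L\<close> at once: when the Leibniz
    rule puts a derivative on \<open>f\<close>, the induction hypothesis is used at the order one
    less.\<close>
  have "\<exists>C\<ge>0. \<forall>f\<in>smooth_in K. \<forall>L\<ge>length w. wnorm (\<lambda>_. b) (fold partial_deriv w (\<lambda>x. g x * f x)) \<le> C * qnorm L b f"
    if "smooth g" for w g
    using that
  proof (induction w arbitrary: g)
    case Nil
    have "compact (g ` K)" by (intro compact_continuous_image smooth_continuous_on Nil K)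
    then obtain B where B: "B > 0" "\<And>x. x \<in> K \<Longrightarrow> norm (g x) \<le> B"
      using compact_imp_bounded by (force simp: bounded_pos)
    have "wnorm (\<lambda>_. b) (\<lambda>x. g x * f x) \<le> B * wnorm (\<lambda>_. b) f" if f: "f \<in> smooth_in K" for f
    proof -
      have "(LINT x|lborel. weight (\<lambda>_. b) x * (norm (g x * f x))\<^sup>2) \<le> (LINT x|lborel. B\<^sup>2 * (weight (\<lambda>_. b) x * (norm (f x))\<^sup>2))"
      proof (rule integral_mono)
        fix x
        have "(norm (g x * f x))\<^sup>2 \<le> B\<^sup>2 * (norm (f x))\<^sup>2"
          using B smooth_inD(2)[OF f, of x] by (cases "x \<in> K") (auto simp: norm_mult power_mult_distrib intro!: mult_right_mono power_mono)
        from mult_left_mono[OF this weight_nonneg]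
        show "weight (\<lambda>_. b) x * (norm (g x * f x))\<^sup>2 \<le> B\<^sup>2 * (weight (\<lambda>_. b) x * (norm (f x))\<^sup>2)" by (simp add: mult_ac)
      qed (use b in \<open>intro wnorm_integrable[OF K] smooth_in_mult Nil f integrable_mult_right; simp\<close>)+
      then have "sqrt (LINT x|lborel. weight (\<lambda>_. b) x * (norm (g x * f x))\<^sup>2) \<le> sqrt (B\<^sup>2 * (LINT x|lborel. weight (\<lambda>_. b) x * (norm (f x))\<^sup>2))"
        by (intro real_sqrt_le_mono) simp
      then show ?thesis using B(1) by (simp add: wnorm_def real_sqrt_mult)
    qed
    moreover have "wnorm (\<lambda>_. b) f \<le> qnorm L b f" for L f using wnorm_le_qnorm[of "[]" L b f] by simp
    ultimately have "wnorm (\<lambda>_. b) (\<lambda>x. g x * f x) \<le> B * qnorm L b f" if "f \<in> smooth_in K" for f L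
      by (rule order_trans[OF _ mult_left_mono]) (use B(1) that in auto)
    then show ?case using B(1) by (intro exI[of _ B]) auto
  next
    case (Cons i w)
    obtain C1 where C1: "C1 \<ge> 0" "\<And>f L. f \<in> smooth_in K \<Longrightarrow> length w \<le> L \<Longrightarrow> wnorm (\<lambda>_. b) (fold partial_deriv w (\<lambda>x. partial_deriv i g x * f x)) \<le> C1 * qnorm L b f"
      using Cons.IH[OF smooth_partial_deriv[OF Cons.prems]] by blast
    obtain C2 where C2: "C2 \<ge> 0" "\<And>f L. f \<in> smooth_in K \<Longrightarrow> length w \<le> L \<Longrightarrow> wnorm (\<lambda>_. b) (fold partial_deriv w (\<lambda>x. g x * f x)) \<le> C2 * qnorm L b f"
      using Cons.IH[OF Cons.prems] by blast
    have "wnorm (\<lambda>_. b) (fold partial_deriv (i # w) (\<lambda>x. g x * f x)) \<le> (C1 + C2) * qnorm L b f"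
      if f: "f \<in> smooth_in K" and L: "length (i # w) \<le> L" for f L
    proof -
      obtain M where M: "L = Suc M" "length w \<le> M" using L by (cases L) auto
      have pf: "partial_deriv i f \<in> smooth_in K" by (rule smooth_in_partial_deriv[OF cl f])
      have in1: "(\<lambda>x. partial_deriv i g x * f x) \<in> smooth_in K" by (intro smooth_in_mult smooth_partial_deriv Cons.prems f)
      have in2: "(\<lambda>x. g x * partial_deriv i f x) \<in> smooth_in K" by (intro smooth_in_mult Cons.prems pf)
      have "fold partial_deriv (i # w) (\<lambda>x. g x * f x)
         = (\<lambda>x. fold partial_deriv w (\<lambda>x. partial_deriv i g x * f x) x + fold partial_deriv w (\<lambda>x. g x * partial_deriv i f x) x)"
        using fold_partial_deriv_add[OF smooth_inD(1)[OF in1] smooth_inD(1)[OF in2], of w]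
        by (simp add: partial_deriv_mult Cons.prems smooth_inD(1)[OF f])
      then have "wnorm (\<lambda>_. b) (fold partial_deriv (i # w) (\<lambda>x. g x * f x))
         \<le> wnorm (\<lambda>_. b) (fold partial_deriv w (\<lambda>x. partial_deriv i g x * f x)) + wnorm (\<lambda>_. b) (fold partial_deriv w (\<lambda>x. g x * partial_deriv i f x))"
        using wnorm_add[OF K smooth_in_fold[OF cl in1] smooth_in_fold[OF cl in2], of "\<lambda>_. b"] b by simp
      also have "\<dots> \<le> C1 * qnorm L b f + C2 * qnorm M b (partial_deriv i f)"
        using L by (intro add_mono C1(2) C2(2) f pf M(2)) simp
      also have "\<dots> \<le> C1 * qnorm L b f + C2 * qnorm L b f"
        unfolding M(1) by (intro add_left_mono mult_left_mono qnorm_partial_deriv C2(1))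
      finally show ?thesis by (simp add: distrib_right)
    qed
    then show ?case using C1(1) C2(1) by (intro exI[of _ "C1 + C2"]) auto
  qed
  from this[OF g] obtain C where C: "\<And>w. C w \<ge> 0"
    "\<And>w f L. f \<in> smooth_in K \<Longrightarrow> length w \<le> L \<Longrightarrow> wnorm (\<lambda>_. b) (fold partial_deriv w (\<lambda>x. g x * f x)) \<le> C w * qnorm L b f"
    by metis
  have "qnorm L b (\<lambda>x. g x * f x) \<le> (\<Sum>w\<in>words L. C w) * qnorm L b f" if f: "f \<in> smooth_in K" for f
    unfolding sum_distrib_right
    by (intro order_trans[OF qnorm_le_sum] sum_mono C(2) f) (simp add: words_def)
  moreover have "0 \<le> (\<Sum>w\<in>words L. C w)" by (intro sum_nonneg C(1))
  ultimately show ?thesis by blast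
qed

section \<open>Closability of the norms\<close>

lemma smooth_real_polynomial:
  fixes p :: "real^'n::finite \<Rightarrow> real"
  assumes "real_polynomial_function p"
  shows "smooth (\<lambda>x. complex_of_real (p x))"
  using assms
proof (induction p rule: real_polynomial_function.induct)
  case (linear f)
  have e: "f x = (\<Sum>i\<in>UNIV. x $ i * f (axis i 1))" for x
  proof -
    have "f x = f (\<Sum>i\<in>UNIV. x $ i *\<^sub>R axis i 1)" using basis_expansion[of x] by (simp add: scalar_mult_eq_scaleR)
    also have "\<dots> = (\<Sum>i\<in>UNIV. x $ i * f (axis i 1))"
      using linear by (simp add: linear_sum bounded_linear.linear linear_scale)
    finally show ?thesis .
  qed
  have "(\<lambda>x. complex_of_real (f x)) = (\<lambda>x. \<Sum>i\<in>UNIV. complex_of_real (f (axis i 1)) * complex_of_real (x $ i))"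
  proof
    fix x
    show "complex_of_real (f x) = (\<Sum>i\<in>UNIV. complex_of_real (f (axis i 1)) * complex_of_real (x $ i))"
      unfolding e[of x] by (simp add: mult.commute)
  qed
  then show ?case by (simp add: smooth_sum smooth_cmult smooth_coord)
qed (auto intro: smooth_const smooth_add smooth_mult)

text \<open>Stone-Weierstrass for real and imaginary part, followed by a cutoff equal to 1 on
  \<open>K\<close>; this takes the place of mollification.\<close>

lemma smooth_approx:
  fixes h :: "real^'n::finite \<Rightarrow> complex"
  assumes K: "compact K" and h: "continuous_on K h" and e: "e > 0"
  obtains h' where "h' \<in> test_functions UNIV" "\<And>x. x \<in> K \<Longrightarrow> norm (h x - h' x) < e"
proof -
  obtain p where p: "real_polynomial_function p" "\<And>x. x \<in> K \<Longrightarrow> \<bar>Re (h x) - p x\<bar> < e / 2"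
    using Stone_Weierstrass_real_polynomial_function[OF K, of "\<lambda>x. Re (h x)" "e / 2"] h e
    by (auto intro: continuous_intros)
  obtain q where q: "real_polynomial_function q" "\<And>x. x \<in> K \<Longrightarrow> \<bar>Im (h x) - q x\<bar> < e / 2"
    using Stone_Weierstrass_real_polynomial_function[OF K, of "\<lambda>x. Im (h x)" "e / 2"] h e
    by (auto intro: continuous_intros)
  obtain \<kappa> L where \<kappa>: "\<kappa> \<in> coord_alg" "compact L" "\<And>x. x \<in> K \<Longrightarrow> \<kappa> x = 1" "\<And>x. x \<notin> L \<Longrightarrow> \<kappa> x = 0"
    using cutoff_exists[OF K open_UNIV] by blast
  define h' where "h' x = (complex_of_real (p x) + \<i> * complex_of_real (q x)) * \<kappa> x" for x
  have "h' \<in> smooth_in L"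
    unfolding h'_def
    by (intro smooth_in_mult smooth_add smooth_cmult smooth_real_polynomial p q smooth_inI coord_alg_smooth \<kappa>)
  then have "h' \<in> test_functions UNIV" using \<kappa>(2) by (intro test_functionsI[of L]) auto
  moreover have "norm (h x - h' x) < e" if "x \<in> K" for x
  proof -
    have "norm (h x - h' x) \<le> \<bar>Re (h x - h' x)\<bar> + \<bar>Im (h x - h' x)\<bar>" by (rule cmod_le)
    also have "\<dots> < e" using p(2)[OF that] q(2)[OF that] \<kappa>(3)[OF that] by (simp add: h'_def)
    finally show ?thesis .
  qed
  ultimately show ?thesis by (rule that)
qed

definition weakly_null :: "(nat \<Rightarrow> real^'n::finite \<Rightarrow> complex) \<Rightarrow> bool" where
  "weakly_null f \<longleftrightarrow> (\<forall>h\<in>test_functions UNIV. (\<lambda>j. LINT x|lborel. f j x * h x) \<longlonglongrightarrow> 0)"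

text \<open>The squared norm of \<open>g j\<close> is the inner product of \<open>g j\<close> with
  \<open>g j - g l\<close> plus that with \<open>g l\<close>. The first is small because the
  sequence is Cauchy, the second tends to 0 for fixed \<open>l\<close> by weak convergence.\<close>

lemma wnorm_closable:
  fixes K :: "(real^'n::finite) set"
  assumes K: "compact K" and b: "0 < b" "b < 1" and g: "\<And>j. g j \<in> smooth_in K"
    and cau: "\<And>e. e > 0 \<Longrightarrow> \<exists>N. \<forall>m\<ge>N. \<forall>l\<ge>N. wnorm (\<lambda>_. b) (\<lambda>x. g m x - g l x) < e"
    and weak: "weakly_null g"
  shows "(\<lambda>j. wnorm (\<lambda>_. b) (g j)) \<longlonglongrightarrow> 0"
proof (rule LIMSEQ_I)
  fix e :: real assume e: "e > 0"
  let ?a = "\<lambda>_::'n. b"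
  have a: "?a i > 0" for i using b by simp
  obtain C where C: "C \<ge> 0" "\<And>f. f \<in> smooth_in K \<Longrightarrow> (LINT x|lborel. norm (f x)) \<le> C * wnorm ?a f"
    using L1_bound[OF K, of ?a] b by blast
  obtain N0 where N0: "\<And>m l. m \<ge> N0 \<Longrightarrow> l \<ge> N0 \<Longrightarrow> wnorm ?a (\<lambda>x. g m x - g l x) < 1" using cau[of 1] by auto
  define M where "M = wnorm ?a (g N0) + 1"
  have M: "M > 0" using wnorm_nonneg[of ?a "g N0"] by (simp add: M_def)
  have bd: "wnorm ?a (g m) \<le> M" if "m \<ge> N0" for m
  proof -
    have "wnorm ?a (\<lambda>x. (g m x - g N0 x) + g N0 x) \<le> wnorm ?a (\<lambda>x. g m x - g N0 x) + wnorm ?a (g N0)"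
      by (intro wnorm_add[OF K] smooth_in_diff g a)
    then show ?thesis using N0[OF that order_refl] by (simp add: M_def)
  qed
  \<comment> \<open>Makes the two errors \<open>M * \<eta>\<close> and
    \<open>\<eta> * (C * M)\<close> add up to a quarter of the square of \<open>e\<close>.\<close>
  define \<eta> where "\<eta> = e\<^sup>2 / (4 * (M + C * M))"
  have MC: "M + C * M > 0" using M C(1) by (simp add: add_pos_nonneg)
  have \<eta>: "\<eta> > 0" using e MC by (simp add: \<eta>_def)
  obtain N1 where N1: "\<And>m l. m \<ge> N1 \<Longrightarrow> l \<ge> N1 \<Longrightarrow> wnorm ?a (\<lambda>x. g m x - g l x) < \<eta>" using cau[OF \<eta>] by auto
  define l where "l = max N0 N1"
  \<comment> \<open>The function against which weak convergence should be tested is only continuous,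
    owing to the weight. It is replaced on \<open>K\<close> by a test function \<open>h'\<close>,
    with an error controlled by the L^1 bound.\<close>
  define h where "h x = complex_of_real (weight ?a x) * cnj (g l x)" for x
  have "continuous_on K h" unfolding h_def
    by (intro continuous_intros continuous_on_weight a smooth_in_continuous[OF g])
  then obtain h' where h': "h' \<in> test_functions UNIV" "\<And>x. x \<in> K \<Longrightarrow> norm (h x - h' x) < \<eta>"
    using smooth_approx[OF K _ \<eta>] by blast
  have e4: "e\<^sup>2 / 4 > 0" using e by simp
  have "(\<lambda>j. LINT x|lborel. g j x * h' x) \<longlonglongrightarrow> 0" using weak h'(1) unfolding weakly_null_def by (rule bspec)
  from LIMSEQ_D[OF this e4] obtain N2 where "\<forall>j\<ge>N2. norm ((LINT x|lborel. g j x * h' x) - 0) < e\<^sup>2 / 4" ..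
  then have N2: "norm (LINT x|lborel. g j x * h' x) < e\<^sup>2 / 4" if "j \<ge> N2" for j using that by simp
  have "wnorm ?a (g j) < e" if j: "j \<ge> max l N2" for j
  proof -
    have jl: "j \<ge> N0" "j \<ge> N1" "l \<ge> N1" "j \<ge> N2" using j by (auto simp: l_def)
    have dl: "(\<lambda>x. g j x - g l x) \<in> smooth_in K" by (intro smooth_in_diff g)
    have "complex_of_real ((wnorm ?a (g j))\<^sup>2) = ip ?a (g j) (\<lambda>x. (g j x - g l x) + g l x)" by (simp add: ip_self)
    also have "\<dots> = ip ?a (g j) (\<lambda>x. g j x - g l x) + ip ?a (g j) (g l)"
      by (intro ip_add_right[OF K] g a smooth_inD(1)[OF dl] smooth_inD(1)[OF g])
    finally have "(wnorm ?a (g j))\<^sup>2 = norm (ip ?a (g j) (\<lambda>x. g j x - g l x) + ip ?a (g j) (g l))"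
      by (metis abs_of_nonneg norm_of_real zero_le_power2)
    also have "\<dots> \<le> norm (ip ?a (g j) (\<lambda>x. g j x - g l x)) + norm (ip ?a (g j) (g l))" by (rule norm_triangle_ineq)
    also have "norm (ip ?a (g j) (\<lambda>x. g j x - g l x)) \<le> M * \<eta>"
    proof -
      have "norm (ip ?a (g j) (\<lambda>x. g j x - g l x)) \<le> (LINT x|lborel. norm (complex_of_real (weight ?a x) * (g j x * cnj (g j x - g l x))))"
        unfolding ip_def by (rule integral_norm_bound)
      also have "\<dots> = (LINT x|lborel. weight ?a x * (norm (g j x) * norm (g j x - g l x)))"
        unfolding norm_mult complex_mod_cnj norm_of_real abs_of_nonneg[OF weight_nonneg] ..
      also have "\<dots> \<le> wnorm ?a (g j) * wnorm ?a (\<lambda>x. g j x - g l x)"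
        by (rule wnorm_cauchy_schwarz[OF K g dl a])
      also have "\<dots> \<le> M * \<eta>" using bd[OF jl(1)] N1[OF jl(2,3)] M
        by (intro mult_mono) (auto simp: wnorm_nonneg)
      finally show ?thesis .
    qed
    also have "norm (ip ?a (g j) (g l)) \<le> e\<^sup>2 / 4 + \<eta> * (C * M)"
    proof -
      have i1: "integrable lborel (\<lambda>x. g j x * h' x)"
        using smooth_in_integrable[OF K smooth_in_mult[OF test_functions_smooth[OF h'(1)] g[of j]]] by (simp add: mult.commute)
      have i2: "integrable lborel (\<lambda>x. g j x * h x)"
        using ip_integrable[OF K g[of j] smooth_inD(1)[OF g[of l]] a] by (simp add: h_def mult_ac)
      have i3: "integrable lborel (\<lambda>x. g j x * (h x - h' x))"
        using Bochner_Integration.integrable_diff[OF i2 i1] by (simp add: right_diff_distrib)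
      have "ip ?a (g j) (g l) = (LINT x|lborel. g j x * h x)"
        unfolding ip_def h_def by (intro Bochner_Integration.integral_cong) (auto simp: mult_ac)
      also have "\<dots> = (LINT x|lborel. g j x * h' x) + (LINT x|lborel. g j x * (h x - h' x))"
        using i1 i2 by (simp add: right_diff_distrib)
      finally have "norm (ip ?a (g j) (g l)) \<le> norm (LINT x|lborel. g j x * h' x) + norm (LINT x|lborel. g j x * (h x - h' x))"
        by (metis norm_triangle_ineq)
      also have "norm (LINT x|lborel. g j x * (h x - h' x)) \<le> (LINT x|lborel. \<eta> * norm (g j x))"
      proof (rule order_trans[OF integral_norm_bound], rule integral_mono)
        show "norm (g j x * (h x - h' x)) \<le> \<eta> * norm (g j x)" for x
          using h'(2)[of x] smooth_inD(2)[OF g[of j], of x]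
          by (cases "x \<in> K") (auto simp: norm_mult mult.commute[of \<eta>] intro!: mult_left_mono[OF less_imp_le])
      qed (use i3 smooth_in_integrable[OF K g] in \<open>auto intro!: integrable_norm integrable_mult_right\<close>)
      also have "\<dots> = \<eta> * (LINT x|lborel. norm (g j x))" by simp
      also have "\<dots> \<le> \<eta> * (C * M)"
        by (intro mult_left_mono order_trans[OF C(2)[OF g[of j]]] bd[OF jl(1)] C(1) less_imp_le[OF \<eta>])
      finally show ?thesis using N2[OF jl(4)] by simp
    qed
    finally have "(wnorm ?a (g j))\<^sup>2 \<le> \<eta> * (M + C * M) + e\<^sup>2 / 4" by (simp add: algebra_simps)
    also have "\<eta> * (M + C * M) = e\<^sup>2 / 4"
      using nonzero_mult_divide_mult_cancel_right[of "M + C * M" "e\<^sup>2" 4] MC by (simp only: \<eta>_def) simp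
    also have "e\<^sup>2 / 4 + e\<^sup>2 / 4 = e\<^sup>2 / 2" by simp
    also have "\<dots> < e\<^sup>2" using e by simp
    finally show ?thesis using e by (simp add: power2_less_imp_less)
  qed
  then show "\<exists>no. \<forall>n\<ge>no. norm (wnorm ?a (g n) - 0) < e"
    by (intro exI[of _ "max l N2"]) (auto simp: wnorm_nonneg)
qed

lemma integral_fold_by_parts:
  assumes K: "compact K" and h: "smooth h"
  shows "f \<in> smooth_in K \<Longrightarrow>
    (LINT x|lborel. fold partial_deriv w f x * h x) = (-1) ^ length w * (LINT x|lborel. f x * fold partial_deriv (rev w) h x)"
proof (induction w arbitrary: f)
  case (Cons i w)
  let ?h = "fold partial_deriv (rev w) h"
  have "(LINT x|lborel. fold partial_deriv (i # w) f x * h x) = (-1) ^ length w * (LINT x|lborel. partial_deriv i f x * ?h x)"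
    using Cons.IH[OF smooth_in_partial_deriv[OF compact_imp_closed[OF K] Cons.prems]] by simp
  also have "(LINT x|lborel. partial_deriv i f x * ?h x) = - (LINT x|lborel. f x * partial_deriv i ?h x)"
    using integral_by_parts[OF K smooth_fold[OF h] Cons.prems, of i "rev w"] by (simp add: mult.commute)
  finally show ?case by simp
qed simp

definition qcauchy :: "nat \<Rightarrow> real \<Rightarrow> (nat \<Rightarrow> real^'n::finite \<Rightarrow> complex) \<Rightarrow> bool" where
  "qcauchy L b f \<longleftrightarrow> (\<forall>e>0. \<exists>N. \<forall>m\<ge>N. \<forall>l\<ge>N. qnorm L b (\<lambda>x. f m x - f l x) < e)"

text \<open>Derivatives of a weakly null sequence are weakly null, as they can be moved to the test
  function; so each summand of the norm falls under \<open>wnorm_closable\<close>.\<close>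

lemma qnorm_closable:
  fixes K :: "(real^'n::finite) set"
  assumes K: "compact K" and b: "0 < b" "b < 1" and f: "\<And>j. f j \<in> smooth_in K"
    and cau: "qcauchy L b f" and weak: "weakly_null f"
  shows "(\<lambda>j. qnorm L b (f j)) \<longlonglongrightarrow> 0"
proof -
  have "(\<lambda>j. wnorm (\<lambda>_. b) (fold partial_deriv w (f j))) \<longlonglongrightarrow> 0" if w: "w \<in> words L" for w
  proof (rule wnorm_closable[OF K b])
    show "fold partial_deriv w (f j) \<in> smooth_in K" for j by (intro smooth_in_fold compact_imp_closed K f)
    fix e :: real assume "e > 0"
    then obtain N where N: "\<And>m l. m \<ge> N \<Longrightarrow> l \<ge> N \<Longrightarrow> qnorm L b (\<lambda>x. f m x - f l x) < e"
      using cau unfolding qcauchy_def by blast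
    have "wnorm (\<lambda>_. b) (\<lambda>x. fold partial_deriv w (f m) x - fold partial_deriv w (f l) x) < e" if "m \<ge> N" "l \<ge> N" for m l
      using N[OF that] wnorm_le_qnorm[of w L b "\<lambda>x. f m x - f l x"] w
        fold_partial_deriv_diff[OF smooth_inD(1)[OF f[of m]] smooth_inD(1)[OF f[of l]], of w]
      by (simp add: words_def)
    then show "\<exists>N. \<forall>m\<ge>N. \<forall>l\<ge>N. wnorm (\<lambda>_. b) (\<lambda>x. fold partial_deriv w (f m) x - fold partial_deriv w (f l) x) < e" by blast
  next
    show "weakly_null (\<lambda>j. fold partial_deriv w (f j))"
      unfolding weakly_null_def
    proof
      fix h :: "real^'n \<Rightarrow> complex" assume h: "h \<in> test_functions UNIV"
      have "(\<lambda>j. (-1) ^ length w * (LINT x|lborel. f j x * fold partial_deriv (rev w) h x)) \<longlonglongrightarrow> (-1) ^ length w * 0"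
        using weak test_functions_fold[OF h] unfolding weakly_null_def by (intro tendsto_mult_left) blast
      then show "(\<lambda>j. LINT x|lborel. fold partial_deriv w (f j) x * h x) \<longlonglongrightarrow> 0"
        by (simp add: integral_fold_by_parts[OF K test_functions_smooth[OF h] f])
    qed
  qed
  then have "(\<lambda>j. \<Sum>w\<in>words L. wnorm (\<lambda>_. b) (fold partial_deriv w (f j))) \<longlonglongrightarrow> 0"
    by (rule tendsto_null_sum)
  then show ?thesis
    by (rule Lim_null_comparison[rotated]) (auto intro!: always_eventually qnorm_le_sum simp: qnorm_nonneg)
qed

section \<open>Weak derivatives\<close>

text \<open>Cutoffs shrinking to a compact set show that the integral of \<open>g\<close> over it
  vanishes. Compact sets then determine all Borel sets.\<close>

lemma integral_test_zero_AE:
  fixes g :: "real^'n::finite \<Rightarrow> complex"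
  assumes gm [measurable]: "g \<in> borel_measurable borel"
    and gi: "\<And>K. compact K \<Longrightarrow> integrable lborel (\<lambda>x. indicator K x *\<^sub>R g x)"
    and z: "\<And>h. h \<in> test_functions UNIV \<Longrightarrow> (LINT x|lborel. g x * h x) = 0"
  shows "AE x in lborel. g x = 0"
proof -
  have cz: "(LINT x|lborel. indicator C x *\<^sub>R g x) = 0" if C: "compact C" for C
  proof (cases "C = {}")
    case False
    define U where "U j = {x. infdist x C < inverse (real (Suc j))}" for j
    have oU: "open (U j)" for j unfolding U_def by (intro open_Collect_less continuous_intros)
    have CU: "C \<subseteq> U j" for j by (auto simp: U_def)
    have "\<exists>\<kappa>\<in>coord_alg. \<exists>L. compact L \<and> L \<subseteq> U j \<and> (\<forall>x\<in>C. \<kappa> x = 1) \<and> (\<forall>x. x \<notin> L \<longrightarrow> \<kappa> x = 0) \<and>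
       (\<forall>x. \<exists>r\<in>{0..1}. \<kappa> x = complex_of_real r)" for j by (rule cutoff_exists[OF C oU CU])
    then obtain \<kappa> L where \<kappa>: "\<And>j. \<kappa> j \<in> coord_alg" "\<And>j. compact (L j)" "\<And>j. L j \<subseteq> U j"
      "\<And>j x. x \<in> C \<Longrightarrow> \<kappa> j x = 1" "\<And>j x. x \<notin> L j \<Longrightarrow> \<kappa> j x = 0" "\<And>j x. \<exists>r\<in>{0..1}. \<kappa> j x = complex_of_real r"
      by metis
    have n\<kappa>: "norm (\<kappa> j x) \<le> 1" for j x using \<kappa>(6)[of j x] by auto
    define K where "K = {x. infdist x C \<le> 1}"
    have K: "compact K" unfolding K_def by (rule compact_infdist_le[OF False C]) simp
    have UK: "U j \<subseteq> K" for j
    proof -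
      have "inverse (real (Suc j)) \<le> 1" by (simp add: inverse_le_1_iff)
      then show ?thesis by (auto simp: U_def K_def)
    qed
    have [measurable]: "\<kappa> j \<in> borel_measurable borel" for j
      by (intro borel_measurable_continuous_onI smooth_continuous_on coord_alg_smooth \<kappa>)
    have [measurable]: "C \<in> sets borel" using compact_imp_closed[OF C] by (rule borel_closed)
    have "(\<lambda>j. LINT x|lborel. g x * \<kappa> j x) \<longlonglongrightarrow> (LINT x|lborel. indicator C x *\<^sub>R g x)"
    proof (rule integral_dominated_convergence[where w="\<lambda>x. norm (indicator K x *\<^sub>R g x)"])
      show "integrable lborel (\<lambda>x. norm (indicator K x *\<^sub>R g x))" by (rule integrable_norm[OF gi[OF K]])
      show "AE x in lborel. norm (g x * \<kappa> j x) \<le> norm (indicator K x *\<^sub>R g x)" for j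
      proof (rule AE_I2)
        fix x
        show "norm (g x * \<kappa> j x) \<le> norm (indicator K x *\<^sub>R g x)"
        proof (cases "x \<in> K")
          case True
          then show ?thesis using n\<kappa>[of j x] by (simp add: norm_mult mult_left_le)
        next
          case False
          then have "x \<notin> L j" using \<kappa>(3)[of j] UK[of j] by auto
          then show ?thesis using \<kappa>(5) by simp
        qed
      qed
      show "AE x in lborel. (\<lambda>j. g x * \<kappa> j x) \<longlonglongrightarrow> indicator C x *\<^sub>R g x"
      proof (rule AE_I2)
        fix x
        show "(\<lambda>j. g x * \<kappa> j x) \<longlonglongrightarrow> indicator C x *\<^sub>R g x"
        proof (cases "x \<in> C")
          case True
          then show ?thesis using \<kappa>(4) by simp
        next
          case x: False
          have "infdist x C \<noteq> 0" using in_closed_iff_infdist_zero[OF compact_imp_closed[OF C] False] x by simp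
          then have "infdist x C > 0" using infdist_nonneg[of x C] by simp
          then have "\<forall>\<^sub>F j in sequentially. inverse (real (Suc j)) < infdist x C"
            by (rule order_tendstoD(2)[OF LIMSEQ_inverse_real_of_nat])
          then have "\<forall>\<^sub>F j in sequentially. g x * \<kappa> j x = indicator C x *\<^sub>R g x"
          proof eventually_elim
            case (elim j)
            then have "x \<notin> L j" using \<kappa>(3)[of j] by (auto simp: U_def)
            then show ?case using \<kappa>(5) x by simp
          qed
          then show ?thesis by (rule tendsto_eventually)
        qed
      qed
    qed measurable
    moreover have "(LINT x|lborel. g x * \<kappa> j x) = 0" for j
      by (intro z test_functionsI[OF \<kappa>(2) subset_UNIV] smooth_inI coord_alg_smooth \<kappa>)
    ultimately show ?thesis by (simp add: LIMSEQ_const_iff)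
  qed simp
  \<comment> \<open>Restricted to a ball \<open>g\<close> is integrable. The sets over which its
    integral vanishes contain the closed ones, an intersection-stable generator, and form a Dynkin
    system.\<close>
  have "AE x in lborel. indicator (cball 0 (real n)) x *\<^sub>R g x = 0" for n
  proof (rule sigma_finite_measure.density_zero[OF sigma_finite_lborel])
    let ?G = "\<lambda>x. indicator (cball 0 (real n)) x *\<^sub>R g x"
    show i: "integrable lborel ?G" by (rule gi) simp
    fix A :: "(real^'n) set" assume "A \<in> sets lborel"
    then have A: "A \<in> sigma_sets UNIV (Collect closed)" by (simp add: borel_eq_closed sets_measure_of)
    have s: "set_integrable lborel A ?G" if "A \<in> sets borel" for A
      unfolding set_integrable_def by (rule integrable_mult_indicator[OF _ i]) (use that in simp)
    have sm: "A \<in> sets borel" if "A \<in> sigma_sets UNIV (Collect closed)" for A :: "(real^'n) set"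
      using that by (simp add: borel_eq_closed sets_measure_of)
    have cl0: "set_lebesgue_integral lborel A ?G = 0" if "closed A" for A
    proof -
      have "set_lebesgue_integral lborel A ?G = (LINT x|lborel. indicator (A \<inter> cball 0 (real n)) x *\<^sub>R g x)"
        unfolding set_lebesgue_integral_def by (intro Bochner_Integration.integral_cong) (auto simp: indicator_def)
      also have "\<dots> = 0" by (intro cz closed_Int_compact that) simp
      finally show ?thesis .
    qed
    have "Int_stable (Collect closed :: (real^'n) set set)" "Collect closed \<subseteq> Pow (UNIV :: (real^'n) set)"
      by (auto simp: Int_stable_def)
    from this A show "set_lebesgue_integral lborel A ?G = 0"
    proof (induction rule: sigma_sets_induct_disjoint)
      case (basic A)
      then show ?case using cl0 by simp
    next
      case empty
      show ?case by (simp add: set_lebesgue_integral_def)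
    next
      case (compl A)
      have "set_lebesgue_integral lborel (A \<union> (UNIV - A)) ?G = set_lebesgue_integral lborel A ?G + set_lebesgue_integral lborel (UNIV - A) ?G"
        using sm[OF compl(1)] by (intro set_integral_Un s) auto
      then show ?case using compl cl0[of UNIV] by simp
    next
      case (union A)
      have Am: "A i \<in> sets borel" for i using union(2) by (intro sm) auto
      have "set_lebesgue_integral lborel (\<Union>i. A i) ?G = suminf (\<lambda>i. set_lebesgue_integral lborel (A i) ?G)"
        using union(1) Am by (intro lebesgue_integral_countable_add s) (auto simp: disjoint_family_on_def)
      then show ?case using union(3) by simp
    qed
  qed
  then have "AE x in lborel. \<forall>n. indicator (cball 0 (real n)) x *\<^sub>R g x = 0" by (intro AE_all_countable[THEN iffD2] allI)
  then show ?thesis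
  proof eventually_elim
    case (elim x)
    obtain n where "norm x \<le> real n" using real_arch_simple by blast
    then show ?case using elim[rule_format, of n] by simp
  qed
qed

section \<open>Sobolev spaces\<close>

lemma L2_continuous:
  fixes f :: "real^'n::finite \<Rightarrow> complex"
  assumes "compact K" "continuous_on UNIV f" "\<And>x. x \<notin> K \<Longrightarrow> f x = 0"
  shows "f \<in> L2"
proof -
  have "integrable lborel (\<lambda>x. (norm (f x))\<^sup>2)"
    using assms by (intro integrable_continuous_compact[of K] continuous_intros) auto
  then show ?thesis using assms(2) by (simp add: L2_def borel_measurable_continuous_onI)
qed

lemma L2_diff:
  fixes f g :: "real^'n::finite \<Rightarrow> complex"
  assumes "f \<in> L2" "g \<in> L2"
  shows "(\<lambda>x. f x - g x) \<in> L2"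
proof -
  have [measurable]: "f \<in> borel_measurable lborel" "g \<in> borel_measurable lborel" using assms by (auto simp: L2_def)
  have "integrable lborel (\<lambda>x. (norm (f x - g x))\<^sup>2)"
  proof (rule Bochner_Integration.integrable_bound)
    show "integrable lborel (\<lambda>x. 2 * (norm (f x))\<^sup>2 + 2 * (norm (g x))\<^sup>2)"
      using assms by (simp add: L2_def)
    show "AE x in lborel. norm ((norm (f x - g x))\<^sup>2) \<le> norm (2 * (norm (f x))\<^sup>2 + 2 * (norm (g x))\<^sup>2)"
    proof (rule AE_I2)
      fix x
      have "(norm (f x - g x))\<^sup>2 \<le> (norm (f x) + norm (g x))\<^sup>2" by (intro power_mono norm_triangle_ineq4) simp
      also have "\<dots> \<le> 2 * (norm (f x))\<^sup>2 + 2 * (norm (g x))\<^sup>2"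
        using sum_squares_bound[of "norm (f x)" "norm (g x)"] by (simp add: power2_sum)
      finally show "norm ((norm (f x - g x))\<^sup>2) \<le> norm (2 * (norm (f x))\<^sup>2 + 2 * (norm (g x))\<^sup>2)" by simp
    qed
  qed measurable
  then show ?thesis by (simp add: L2_def)
qed

lemma L2_locally_integrable:
  fixes f :: "real^'n::finite \<Rightarrow> complex"
  assumes "f \<in> L2" "compact K"
  shows "integrable lborel (\<lambda>x. indicator K x *\<^sub>R f x)"
proof (rule Bochner_Integration.integrable_bound)
  have [measurable]: "f \<in> borel_measurable lborel" using assms by (auto simp: L2_def)
  have [measurable]: "K \<in> sets borel" using compact_imp_closed[OF assms(2)] by (rule borel_closed)
  have "integrable lborel (\<lambda>x. indicator K x *\<^sub>R (1::real))"
    by (rule borel_integrable_compact[OF assms(2)]) simp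
  then show "integrable lborel (\<lambda>x. indicator K x + (norm (f x))\<^sup>2)"
    using assms by (simp add: L2_def)
  show "AE x in lborel. norm (indicator K x *\<^sub>R f x) \<le> norm (indicator K x + (norm (f x))\<^sup>2)"
  proof (rule AE_I2)
    fix x
    have "2 * norm (f x) \<le> 1 + (norm (f x))\<^sup>2" using sum_squares_bound[of 1 "norm (f x)"] by simp
    then have "norm (f x) \<le> 1 + (norm (f x))\<^sup>2" using norm_ge_zero[of "f x"] by linarith
    then show "norm (indicator K x *\<^sub>R f x) \<le> norm (indicator K x + (norm (f x))\<^sup>2)"
      by (auto simp: indicator_def)
  qed
  show "(\<lambda>x. indicator K x *\<^sub>R f x) \<in> borel_measurable lborel" by measurable
qed

lemma L2_test_integrable:
  fixes f :: "real^'n::finite \<Rightarrow> complex"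
  assumes f: "f \<in> L2" and h: "h \<in> test_functions UNIV"
  shows "integrable lborel (\<lambda>x. f x * h x)"
proof -
  obtain K where K: "compact K" "h \<in> smooth_in K" using h by (auto simp: test_functions_iff)
  have [measurable]: "h \<in> borel_measurable borel" by (rule smooth_in_measurable[OF K(2)])
  obtain B where B: "\<And>x. norm (h x) \<le> B"
    using bounded_continuous_compact[OF K(1) smooth_in_continuous[OF K(2)] smooth_inD(2)[OF K(2)]] by metis
  have i: "integrable lborel (\<lambda>x. indicator K x *\<^sub>R f x)" by (rule L2_locally_integrable[OF f K(1)])
  have "integrable lborel (\<lambda>x. h x * (indicator K x *\<^sub>R f x))"
  proof (rule Bochner_Integration.integrable_bound[OF integrable_mult_right[OF integrable_norm[OF i], of B]])
    show "(\<lambda>x. h x * (indicator K x *\<^sub>R f x)) \<in> borel_measurable lborel"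
      using borel_measurable_integrable[OF i] by measurable
    show "AE x in lborel. norm (h x * (indicator K x *\<^sub>R f x)) \<le> norm (B * norm (indicator K x *\<^sub>R f x))"
    proof (rule AE_I2)
      fix x
      have "norm (h x) * norm (indicator K x *\<^sub>R f x) \<le> B * norm (indicator K x *\<^sub>R f x)"
        by (intro mult_right_mono B norm_ge_zero)
      then show "norm (h x * (indicator K x *\<^sub>R f x)) \<le> norm (B * norm (indicator K x *\<^sub>R f x))"
        using order_trans[OF norm_ge_zero B] by (simp only: norm_mult real_norm_def abs_mult abs_of_nonneg abs_norm_cancel)
    qed
  qed
  also have "(\<lambda>x. h x * (indicator K x *\<^sub>R f x)) = (\<lambda>x. f x * h x)"
    using smooth_inD(2)[OF K(2)] by (auto simp: indicator_def)
  finally show ?thesis .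
qed

lemma dist_of_eq_AE:
  fixes f g :: "real^'n::finite \<Rightarrow> complex"
  assumes f: "f \<in> L2" and g: "g \<in> L2" and eq: "dist_eq_on UNIV (dist_of f) (dist_of g)"
  shows "AE x in lborel. f x = g x"
proof -
  have d: "(\<lambda>x. f x - g x) \<in> L2" by (rule L2_diff[OF f g])
  have "AE x in lborel. f x - g x = 0"
  proof (rule integral_test_zero_AE)
    show "(\<lambda>x. f x - g x) \<in> borel_measurable borel" using d by (simp add: L2_def)
    show "integrable lborel (\<lambda>x. indicator K x *\<^sub>R (f x - g x))" if "compact K" for K
      by (rule L2_locally_integrable[OF d that])
    fix h :: "real^'n \<Rightarrow> complex" assume h: "h \<in> test_functions UNIV"
    have "(LINT x|lborel. f x * h x) = (LINT x|lborel. g x * h x)"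
      using eq h by (simp add: dist_eq_on_def dist_of_def)
    then show "(LINT x|lborel. (f x - g x) * h x) = 0"
      using L2_test_integrable[OF f h] L2_test_integrable[OF g h] by (simp add: left_diff_distrib)
  qed
  then show ?thesis by simp
qed

text \<open>\<open>weak_deriv\<close> is a choice among functions that agree almost everywhere; this
  lets any concrete weak derivative stand for it in norms.\<close>

lemma weak_deriv_AE:
  assumes "g \<in> L2" "is_weak_deriv \<alpha> f g"
  shows "weak_deriv \<alpha> f \<in> L2" "AE x in lborel. weak_deriv \<alpha> f x = g x"
proof -
  have *: "weak_deriv \<alpha> f \<in> L2 \<and> is_weak_deriv \<alpha> f (weak_deriv \<alpha> f)"
    unfolding weak_deriv_def using assms by (intro someI_ex[of "\<lambda>g. g \<in> L2 \<and> is_weak_deriv \<alpha> f g"]) blast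
  then show "weak_deriv \<alpha> f \<in> L2" ..
  show "AE x in lborel. weak_deriv \<alpha> f x = g x"
    using * assms by (intro dist_of_eq_AE) (auto simp: is_weak_deriv_def dist_eq_on_def)
qed

lemma weak_deriv_norm:
  assumes "g \<in> L2" "is_weak_deriv \<alpha> f g"
  shows "(LINT x|lborel. (norm (weak_deriv \<alpha> f x))\<^sup>2) = (LINT x|lborel. (norm (g x))\<^sup>2)"
proof (rule integral_cong_AE)
  have [measurable]: "weak_deriv \<alpha> f \<in> borel_measurable lborel" "g \<in> borel_measurable lborel"
    using weak_deriv_AE(1)[OF assms] assms(1) by (auto simp: L2_def)
  show "(\<lambda>x. (norm (weak_deriv \<alpha> f x))\<^sup>2) \<in> borel_measurable lborel" "(\<lambda>x. (norm (g x))\<^sup>2) \<in> borel_measurable lborel"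
    by measurable
  show "AE x in lborel. (norm (weak_deriv \<alpha> f x))\<^sup>2 = (norm (g x))\<^sup>2"
    using weak_deriv_AE(2)[OF assms] by eventually_elim simp
qed

lemma is_weak_deriv_0: "is_weak_deriv 0 f f"
  by (simp add: is_weak_deriv_def dist_eq_on_def)

lemma op_monom_single: "op_monom A (Poly_Mapping.single i 1) f = A i f"
proof -
  have 0: "fold (\<lambda>k. A k ^^ Poly_Mapping.lookup (Poly_Mapping.single i 1) k) xs f = f" if "i \<notin> set xs" for xs f
    using that by (induction xs arbitrary: f) (auto simp: lookup_single when_def)
  have "fold (\<lambda>k. A k ^^ Poly_Mapping.lookup (Poly_Mapping.single i 1) k) xs f = A i f" if "distinct xs" "i \<in> set xs" for xs f
    using that
  proof (induction xs arbitrary: f)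
    case (Cons k xs)
    then show ?case using 0[of xs] by (cases "i = k") (auto simp: lookup_single when_def)
  qed simp
  then show ?thesis by (simp add: op_monom_def index_list)
qed

lemma is_weak_deriv_single:
  "is_weak_deriv (Poly_Mapping.single i 1) f g \<longleftrightarrow>
    (\<forall>h\<in>test_functions UNIV. - (LINT x|lborel. f x * partial_deriv i h x) = (LINT x|lborel. g x * h x))"
  unfolding is_weak_deriv_def op_monom_single by (simp add: dist_eq_on_def dist_deriv_def dist_of_def)

lemma mdegree_le_1:
  fixes \<alpha> :: "'n::finite \<Rightarrow>\<^sub>0 nat"
  assumes "mdegree \<alpha> \<le> 1" "\<alpha> \<noteq> 0"
  obtains i where "\<alpha> = Poly_Mapping.single i 1"
proof -
  obtain i where i: "Poly_Mapping.lookup \<alpha> i \<noteq> 0" using assms(2) by (metis poly_mapping_eqI lookup_zero)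
  have "mdegree \<alpha> = Poly_Mapping.lookup \<alpha> i + (\<Sum>j\<in>UNIV - {i}. Poly_Mapping.lookup \<alpha> j)"
    unfolding mdegree_def by (rule sum.remove) auto
  then have "Poly_Mapping.lookup \<alpha> i = 1" "(\<Sum>j\<in>UNIV - {i}. Poly_Mapping.lookup \<alpha> j) = 0"
    using assms(1) i by linarith+
  then have "\<alpha> = Poly_Mapping.single i 1"
    by (intro poly_mapping_eqI) (auto simp: lookup_single when_def)
  then show ?thesis by (rule that)
qed

lemma half_cancel: "J \<noteq> 0 \<Longrightarrow> e / (2 * J) * J = e / (2::real)"
  by simp

lemma uniform_limit_integral:
  fixes F :: "nat \<Rightarrow> real^'n::finite \<Rightarrow> complex"
  assumes u: "uniform_limit UNIV F f sequentially" and F: "\<And>m. continuous_on UNIV (F m)"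
    and h: "h \<in> test_functions UNIV"
  shows "(\<lambda>m. LINT x|lborel. F m x * h x) \<longlonglongrightarrow> (LINT x|lborel. f x * h x)"
proof (rule LIMSEQ_I)
  fix e :: real assume e: "e > 0"
  obtain K where K: "compact K" "h \<in> smooth_in K" using h by (auto simp: test_functions_iff)
  have f: "continuous_on UNIV f" by (rule uniform_limit_theorem[OF _ u]) (use F in auto)
  define I where "I = (LINT x|lborel. norm (h x))"
  have I: "I \<ge> 0" by (simp add: I_def)
  define d where "d = e / (2 * (I + 1))"
  have d: "d > 0" using e I by (simp add: d_def)
  have ih: "integrable lborel (\<lambda>x. norm (h x))" by (rule integrable_norm[OF smooth_in_integrable[OF K]])
  have ii: "integrable lborel (\<lambda>x. g x * h x)" if "continuous_on UNIV g" for g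
    using smooth_in_continuous[OF K(2), of UNIV] smooth_inD(2)[OF K(2)] that
    by (intro integrable_continuous_compact[OF K(1)] continuous_intros) auto
  obtain N where N: "\<And>m x. m \<ge> N \<Longrightarrow> dist (F m x) (f x) < d"
    using u d unfolding uniform_limit_iff eventually_sequentially by blast
  have "norm ((LINT x|lborel. F m x * h x) - (LINT x|lborel. f x * h x)) < e" if m: "m \<ge> N" for m
  proof -
    have i: "integrable lborel (\<lambda>x. (F m x - f x) * h x)"
      by (rule ii) (intro continuous_intros F f)
    have "(LINT x|lborel. F m x * h x) - (LINT x|lborel. f x * h x) = (LINT x|lborel. (F m x - f x) * h x)"
      using ii[OF F] ii[OF f] by (simp add: left_diff_distrib)
    also have "norm \<dots> \<le> (LINT x|lborel. norm ((F m x - f x) * h x))" by (rule integral_norm_bound)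
    also have "\<dots> \<le> (LINT x|lborel. d * norm (h x))"
    proof (rule integral_mono)
      show "integrable lborel (\<lambda>x. norm ((F m x - f x) * h x))" using i by (rule integrable_norm)
      show "integrable lborel (\<lambda>x. d * norm (h x))" using ih by simp
      show "norm ((F m x - f x) * h x) \<le> d * norm (h x)" for x
        unfolding norm_mult using N[OF m, of x] by (intro mult_right_mono) (auto simp: dist_norm)
    qed
    also have "\<dots> = d * I" by (simp add: I_def)
    also have "\<dots> \<le> d * (I + 1)" using d by simp
    also have "\<dots> = e / 2" unfolding d_def using I by (intro half_cancel) simp
    also have "\<dots> < e" using e by simp
    finally show ?thesis .
  qed
  then show "\<exists>no. \<forall>n\<ge>no. norm ((LINT x|lborel. F n x * h x) - (LINT x|lborel. f x * h x)) < e" by blast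
qed

lemma uniform_limit_square_integral:
  fixes D :: "nat \<Rightarrow> real^'n::finite \<Rightarrow> complex"
  assumes K: "compact K" and D: "\<And>m. continuous_on UNIV (D m)" "\<And>m x. x \<notin> K \<Longrightarrow> D m x = 0"
    and u: "uniform_limit UNIV D (\<lambda>x. 0) sequentially"
  shows "(\<lambda>m. LINT x|lborel. (norm (D m x))\<^sup>2) \<longlonglongrightarrow> 0"
proof (rule LIMSEQ_I)
  fix e :: real assume e: "e > 0"
  have iK: "integrable lborel (\<lambda>x. indicator K x :: real)"
    using borel_integrable_compact[OF K, of "\<lambda>_. 1::real"] by simp
  define I where "I = (LINT x|lborel. (indicator K x :: real))"
  have I: "I \<ge> 0" by (simp add: I_def)
  define d where "d = sqrt (e / (2 * (I + 1)))"
  have d: "d > 0" using e I by (simp add: d_def)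
  obtain N where N: "\<And>m x. m \<ge> N \<Longrightarrow> dist (D m x) 0 < d"
    using u d unfolding uniform_limit_iff eventually_sequentially by blast
  have "norm ((LINT x|lborel. (norm (D m x))\<^sup>2) - 0) < e" if m: "m \<ge> N" for m
  proof -
    have "(LINT x|lborel. (norm (D m x))\<^sup>2) \<le> (LINT x|lborel. d\<^sup>2 * indicator K x)"
    proof (rule integral_mono)
      show "integrable lborel (\<lambda>x. (norm (D m x))\<^sup>2)"
        by (rule integrable_continuous_compact[OF K]) (auto intro!: continuous_intros D simp: D(2))
      show "integrable lborel (\<lambda>x. d\<^sup>2 * indicator K x :: real)" using iK by simp
      show "(norm (D m x))\<^sup>2 \<le> d\<^sup>2 * indicator K x" for x
        using N[OF m, of x] D(2)[of x m] by (cases "x \<in> K") (auto intro: power_mono)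
    qed
    also have "\<dots> = d\<^sup>2 * I" by (simp add: I_def)
    also have "\<dots> \<le> d\<^sup>2 * (I + 1)" by (intro mult_left_mono) auto
    also have "\<dots> = e / 2"
    proof -
      have d2: "d\<^sup>2 = e / (2 * (I + 1))" using e I by (simp add: d_def)
      show ?thesis unfolding d2 using I by (intro half_cancel) simp
    qed
    also have "\<dots> < e" using e by simp
    finally show ?thesis by simp
  qed
  then show "\<exists>no. \<forall>n\<ge>no. norm ((LINT x|lborel. (norm (D n x))\<^sup>2) - 0) < e" by blast
qed

text \<open>All functions vanish off the compact closure of \<open>\<omega>\<close>, where uniform
  convergence of functions and first derivatives implies L^2 convergence. The uniform limits of the
  derivatives are weak derivatives of \<open>f\<close>, by passing to the limit in integration by
  parts.\<close>

lemma sobolev0_limit: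
  fixes F :: "nat \<Rightarrow> real^'n::finite \<Rightarrow> complex"
  assumes \<omega>: "compact (closure \<omega>)" and F: "\<And>m. F m \<in> test_functions \<omega>"
    and u0: "uniform_limit UNIV F f sequentially"
    and u1: "\<And>i. uniform_limit UNIV (\<lambda>m. partial_deriv i (F m)) (g i) sequentially"
  shows "f \<in> sobolev0 1 \<omega>"
proof -
  define K where "K = closure \<omega>"
  have K: "compact K" using \<omega> by (simp add: K_def)
  have FK: "F m \<in> smooth_in K" for m
    using F closure_subset by (auto simp: K_def intro: test_functions_smooth_in)
  have pFK: "partial_deriv i (F m) \<in> smooth_in K" for i m by (intro smooth_in_partial_deriv compact_imp_closed K FK)
  have z: "h x = 0" if "uniform_limit UNIV H h sequentially" "\<And>m. H m \<in> smooth_in K" "x \<notin> K" for H h x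
  proof -
    have "(\<lambda>m. H m x) \<longlonglongrightarrow> h x" by (rule tendsto_uniform_limitI[OF that(1)]) simp
    then show ?thesis using smooth_inD(2)[OF that(2,3)] by (simp add: LIMSEQ_const_iff)
  qed
  have c: "continuous_on UNIV h" if "uniform_limit UNIV H h sequentially" "\<And>m. H m \<in> smooth_in K" for H h
    by (rule uniform_limit_theorem[OF _ that(1)]) (use that(2) in \<open>auto intro!: always_eventually smooth_in_continuous\<close>)
  have fc: "continuous_on UNIV f" and gc: "continuous_on UNIV (g i)" for i
    using c[OF u0 FK] c[OF u1 pFK] by auto
  have fz: "f x = 0" and gz: "g i x = 0" if "x \<notin> K" for x i
    using z[OF u0 FK that] z[OF u1 pFK that] by auto
  have fL: "f \<in> L2" and gL: "g i \<in> L2" for i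
    using L2_continuous[OF K fc fz] L2_continuous[OF K gc gz] by auto
  have wF: "- (LINT x|lborel. F m x * partial_deriv i h x) = (LINT x|lborel. partial_deriv i (F m) x * h x)"
    if h: "h \<in> test_functions UNIV" for m i h
  proof -
    obtain L where "compact L" "h \<in> smooth_in L" using h by (auto simp: test_functions_iff)
    then show ?thesis using integral_by_parts[of L "F m" h i] smooth_inD(1)[OF FK] by simp
  qed
  have wf: "- (LINT x|lborel. f x * partial_deriv i h x) = (LINT x|lborel. g i x * h x)"
    if h: "h \<in> test_functions UNIV" for i h
  proof -
    have "(\<lambda>m. - (LINT x|lborel. F m x * partial_deriv i h x)) \<longlonglongrightarrow> - (LINT x|lborel. f x * partial_deriv i h x)"
      by (intro tendsto_minus uniform_limit_integral[OF u0] smooth_in_continuous[OF FK] test_functions_partial_deriv h)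
    moreover have "(\<lambda>m. - (LINT x|lborel. F m x * partial_deriv i h x)) \<longlonglongrightarrow> (LINT x|lborel. g i x * h x)"
      unfolding wF[OF h] by (intro uniform_limit_integral[OF u1] smooth_in_continuous[OF pFK] h)
    ultimately show ?thesis by (rule LIMSEQ_unique)
  qed
  have "\<exists>g\<in>L2. is_weak_deriv \<alpha> f g" if m1: "mdegree \<alpha> \<le> 1" for \<alpha>
  proof (cases "\<alpha> = 0")
    case True
    then show ?thesis using fL is_weak_deriv_0 by blast
  next
    case False
    then obtain i where "\<alpha> = Poly_Mapping.single i 1" using mdegree_le_1[OF m1] by blast
    moreover have "is_weak_deriv (Poly_Mapping.single i 1) f (g i)"
      unfolding is_weak_deriv_single using wf by blast
    ultimately show ?thesis using gL[of i] by blast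
  qed
  then have fS: "f \<in> sobolev 1" using fL by (simp add: sobolev_def)
  have lim: "(\<lambda>m. LINT x|lborel. (norm (weak_deriv \<alpha> (\<lambda>x. f x - F m x) x))\<^sup>2) \<longlonglongrightarrow> 0" if "mdegree \<alpha> \<le> 1" for \<alpha>
  proof -
    have sq: "(\<lambda>m. LINT x|lborel. (norm (h x - H m x))\<^sup>2) \<longlonglongrightarrow> 0" and L: "(\<lambda>x. h x - H m x) \<in> L2"
      if H: "uniform_limit UNIV H h sequentially" "\<And>m. H m \<in> smooth_in K" for H h m
    proof -
      have cc: "continuous_on UNIV (\<lambda>x. h x - H m x)" for m
        by (intro continuous_intros c[OF H] smooth_in_continuous[OF H(2)])
      have zz: "h x - H m x = 0" if "x \<notin> K" for m x using z[OF H that] smooth_inD(2)[OF H(2) that] by simp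
      have "uniform_limit UNIV (\<lambda>m x. h x - H m x) (\<lambda>x. h x - h x) sequentially"
        by (intro uniform_limit_intros H(1))
      then have "uniform_limit UNIV (\<lambda>m x. h x - H m x) (\<lambda>x. 0) sequentially" by simp
      from uniform_limit_square_integral[OF K cc zz this]
      show "(\<lambda>m. LINT x|lborel. (norm (h x - H m x))\<^sup>2) \<longlonglongrightarrow> 0" .
      show "(\<lambda>x. h x - H m x) \<in> L2" by (rule L2_continuous[OF K cc zz])
    qed
    show ?thesis
    proof (cases "\<alpha> = 0")
      case True
      have "(LINT x|lborel. (norm (weak_deriv \<alpha> (\<lambda>x. f x - F m x) x))\<^sup>2) = (LINT x|lborel. (norm (f x - F m x))\<^sup>2)" for m
        unfolding True by (rule weak_deriv_norm[OF L[OF u0 FK] is_weak_deriv_0])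
      then show ?thesis using sq[OF u0 FK] by simp
    next
      case False
      then obtain i where i: "\<alpha> = Poly_Mapping.single i 1" using mdegree_le_1[OF \<open>mdegree \<alpha> \<le> 1\<close>] by blast
      have w: "is_weak_deriv \<alpha> (\<lambda>x. f x - F m x) (\<lambda>x. g i x - partial_deriv i (F m) x)" for m
        unfolding i is_weak_deriv_single
      proof
        fix h :: "real^'n \<Rightarrow> complex" assume h: "h \<in> test_functions UNIV"
        have FL: "F m \<in> L2" "partial_deriv i (F m) \<in> L2"
          using L2_continuous[OF K smooth_in_continuous[OF FK] smooth_inD(2)[OF FK]]
            L2_continuous[OF K smooth_in_continuous[OF pFK] smooth_inD(2)[OF pFK]] by auto
        note ints = L2_test_integrable[OF fL test_functions_partial_deriv[OF h, of i]] L2_test_integrable[OF FL(1) test_functions_partial_deriv[OF h, of i]]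
          L2_test_integrable[OF gL[of i] h] L2_test_integrable[OF FL(2) h]
        show "- (LINT x|lborel. (f x - F m x) * partial_deriv i h x) = (LINT x|lborel. (g i x - partial_deriv i (F m) x) * h x)"
          using wf[OF h, of i] wF[OF h, of m i] ints by (simp add: left_diff_distrib flip: wf[OF h, of i] wF[OF h, of m i])
      qed
      have "(LINT x|lborel. (norm (weak_deriv \<alpha> (\<lambda>x. f x - F m x) x))\<^sup>2) = (LINT x|lborel. (norm (g i x - partial_deriv i (F m) x))\<^sup>2)" for m
        by (rule weak_deriv_norm[OF L[OF u1 pFK] w])
      then show ?thesis using sq[OF u1 pFK] by simp
    qed
  qed
  have "(\<lambda>m. sobolev_norm 1 (\<lambda>x. f x - F m x)) \<longlonglongrightarrow> sqrt 0"
    unfolding sobolev_norm_def by (intro tendsto_real_sqrt tendsto_null_sum lim) auto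
  then show ?thesis using fS F unfolding sobolev0_def by auto
qed

text \<open>Elements of \<open>sobolev0\<close> are functions and are determined only up to null
  sets, so L^2 approximation shows vanishing almost everywhere off the closure; continuity makes it
  pointwise.\<close>

lemma sobolev0_vanish:
  fixes f :: "real^'n::finite \<Rightarrow> complex"
  assumes f: "f \<in> sobolev0 1 \<omega>" and c: "continuous_on UNIV f" and x: "x \<notin> closure \<omega>"
  shows "f x = 0"
proof (rule ccontr)
  assume nz: "f x \<noteq> 0"
  obtain \<Phi> where \<Phi>: "\<And>n. \<Phi> n \<in> test_functions \<omega>" "(\<lambda>n. sobolev_norm 1 (\<lambda>x. f x - \<Phi> n x)) \<longlonglongrightarrow> 0"
    using f by (auto simp: sobolev0_def)
  have fL: "f \<in> L2" using f by (auto simp: sobolev0_def sobolev_def)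
  define U where "U = - closure \<omega>"
  have U: "open U" "x \<in> U" using x by (auto simp: U_def)
  have [measurable]: "U \<in> sets borel" using U(1) by (rule borel_open)
  have fm [measurable]: "f \<in> borel_measurable borel" using fL by (simp add: L2_def)
  have i: "integrable lborel (\<lambda>x. indicator U x * (norm (f x))\<^sup>2)"
    using integrable_mult_indicator[of U lborel "\<lambda>x. (norm (f x))\<^sup>2"] fL by (simp add: L2_def)
  have b: "(LINT x|lborel. indicator U x * (norm (f x))\<^sup>2) \<le> (sobolev_norm 1 (\<lambda>x. f x - \<Phi> n x))\<^sup>2" for n
  proof -
    obtain K where K: "compact K" "K \<subseteq> \<omega>" "\<Phi> n \<in> smooth_in K" using \<Phi>(1)[of n] by (auto simp: test_functions_iff)
    have "\<Phi> n \<in> L2" by (rule L2_continuous[OF K(1) smooth_in_continuous[OF K(3)] smooth_inD(2)[OF K(3)]])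
    then have dL: "(\<lambda>x. f x - \<Phi> n x) \<in> L2" by (rule L2_diff[OF fL])
    have "(LINT x|lborel. indicator U x * (norm (f x))\<^sup>2) \<le> (LINT x|lborel. (norm (f x - \<Phi> n x))\<^sup>2)"
    proof (rule integral_mono[OF i])
      show "integrable lborel (\<lambda>x. (norm (f x - \<Phi> n x))\<^sup>2)" using dL by (simp add: L2_def)
      show "indicator U x * (norm (f x))\<^sup>2 \<le> (norm (f x - \<Phi> n x))\<^sup>2" for x
      proof (cases "x \<in> U")
        case True
        then have "x \<notin> K" using K(2) closure_subset[of \<omega>] by (auto simp: U_def)
        then show ?thesis using smooth_inD(2)[OF K(3)] True by simp
      qed simp
    qed
    also have "\<dots> = (LINT x|lborel. (norm (weak_deriv 0 (\<lambda>x. f x - \<Phi> n x) x))\<^sup>2)"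
      by (rule weak_deriv_norm[OF dL is_weak_deriv_0, symmetric])
    also have "\<dots> \<le> (\<Sum>\<alpha> | mdegree \<alpha> \<le> 1. LINT x|lborel. (norm (weak_deriv \<alpha> (\<lambda>x. f x - \<Phi> n x) x))\<^sup>2)"
      by (rule member_le_sum) (auto simp: finite_mdegree_le)
    also have "\<dots> = (sobolev_norm 1 (\<lambda>x. f x - \<Phi> n x))\<^sup>2"
      unfolding sobolev_norm_def by (subst real_sqrt_pow2) (auto intro: sum_nonneg)
    finally show ?thesis .
  qed
  have "(\<lambda>n. (sobolev_norm 1 (\<lambda>x. f x - \<Phi> n x))\<^sup>2) \<longlonglongrightarrow> 0\<^sup>2" by (intro tendsto_power \<Phi>(2))
  then have "(LINT x|lborel. indicator U x * (norm (f x))\<^sup>2) \<le> 0\<^sup>2"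
    by (rule LIMSEQ_le_const) (use b in auto)
  then have "(LINT x|lborel. indicator U x * (norm (f x))\<^sup>2) = 0"
    by (intro antisym) auto
  then have ae: "AE x in lborel. indicator U x * (norm (f x))\<^sup>2 = 0"
    using integral_nonneg_eq_0_iff_AE[OF i] by auto
  \<comment> \<open>A nonempty open set which would have measure 0.\<close>
  define V where "V = U \<inter> {y. f y \<noteq> 0}"
  have oV: "open V" unfolding V_def by (intro open_Int U open_Collect_neq c continuous_on_const)
  have "V \<noteq> {}" using U nz by (auto simp: V_def)
  have "AE y in lborel. y \<notin> V" using ae by eventually_elim (auto simp: V_def)
  then have "V \<in> null_sets lborel" using oV by (subst AE_iff_null_sets) auto
  then have "negligible V" using oV by (simp add: negligible_iff_null_sets null_sets_completion_iff)
  then show False using open_not_negligible[OF oV \<open>V \<noteq> {}\<close>] by simp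
qed

section \<open>The transposed operators\<close>

text \<open>Transposition reverses the order of composition, hence \<open>foldr\<close> on the side
  of the test functions.\<close>

lemma op_monom_functional:
  assumes "\<And>i T. A i T = (\<lambda>\<phi>. T (B i \<phi>))"
  shows "op_monom A \<alpha> T \<phi> = T (foldr (\<lambda>i. B i ^^ Poly_Mapping.lookup \<alpha> i) index_list \<phi>)"
proof -
  have p: "(A i ^^ k) T = (\<lambda>\<phi>. T ((B i ^^ k) \<phi>))" for i k T
    by (induction k arbitrary: T) (auto simp: assms funpow_swap1)
  have "fold (\<lambda>i. A i ^^ Poly_Mapping.lookup \<alpha> i) xs T \<phi> = T (foldr (\<lambda>i. B i ^^ Poly_Mapping.lookup \<alpha> i) xs \<phi>)" for xs T
    by (induction xs arbitrary: T) (auto simp: p)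
  then show ?thesis by (simp add: op_monom_def)
qed

text \<open>The Euler derivative itself, on functions: \<open>dist_theta_star i\<close> tests
  against it, with two signs cancelling.\<close>

definition euler_theta :: "'n::finite \<Rightarrow> (real^'n \<Rightarrow> complex) \<Rightarrow> real^'n \<Rightarrow> complex" where
  "euler_theta i h = (\<lambda>x. complex_of_real (x $ i) * partial_deriv i h x)"

lemma test_functions_euler_theta_foldr:
  "h \<in> test_functions \<Omega> \<Longrightarrow> foldr (\<lambda>i. euler_theta i ^^ k i) xs h \<in> test_functions \<Omega>"
proof -
  have 1: "euler_theta i h \<in> test_functions \<Omega>" if "h \<in> test_functions \<Omega>" for i h
    unfolding euler_theta_def by (intro test_functions_mult smooth_coord test_functions_partial_deriv that)
  have 2: "(euler_theta i ^^ m) h \<in> test_functions \<Omega>" if "h \<in> test_functions \<Omega>" for i h m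
    using that by (induction m) (auto intro: 1)
  show "h \<in> test_functions \<Omega> \<Longrightarrow> foldr (\<lambda>i. euler_theta i ^^ k i) xs h \<in> test_functions \<Omega>"
    by (induction xs) (auto intro: 2)
qed

lemma integral_euler_theta:
  assumes K: "compact K" and f: "f \<in> smooth_in K" and h: "smooth h"
  shows "(LINT x|lborel. f x * euler_theta i h x) = (LINT x|lborel. theta_shift (\<lambda>_. 0) i f x * h x)"
proof -
  have xf: "(\<lambda>x. complex_of_real (x $ i) * f x) \<in> smooth_in K" by (rule smooth_in_mult[OF smooth_coord f])
  have "(LINT x|lborel. f x * euler_theta i h x) = (LINT x|lborel. partial_deriv i h x * (complex_of_real (x $ i) * f x))"
    by (intro Bochner_Integration.integral_cong) (auto simp: euler_theta_def mult_ac)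
  also have "\<dots> = - (LINT x|lborel. h x * partial_deriv i (\<lambda>x. complex_of_real (x $ i) * f x) x)"
    by (rule integral_by_parts[OF K h xf])
  also have "\<dots> = (LINT x|lborel. - (h x * partial_deriv i (\<lambda>x. complex_of_real (x $ i) * f x) x))" by simp
  also have "\<dots> = (LINT x|lborel. theta_shift (\<lambda>_. 0) i f x * h x)"
    by (intro Bochner_Integration.integral_cong)
      (auto simp: partial_deriv_mult smooth_coord smooth_inD(1)[OF f] partial_deriv_coord theta_shift_def algebra_simps)
  finally show ?thesis .
qed

lemma integral_theta_monom:
  assumes K: "compact K" and f: "f \<in> smooth_in K" and h: "h \<in> test_functions UNIV"
  shows "(LINT x|lborel. f x * foldr (\<lambda>i. euler_theta i ^^ Poly_Mapping.lookup \<alpha> i) index_list h x)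
     = (LINT x|lborel. theta_monom (\<lambda>_. 0) \<alpha> f x * h x)"
proof -
  have cl: "closed K" by (rule compact_imp_closed[OF K])
  have th: "smooth (euler_theta i h)" if "smooth h" for i and h :: "real^'a \<Rightarrow> complex"
    unfolding euler_theta_def by (intro smooth_mult smooth_coord smooth_partial_deriv that)
  have th': "smooth ((euler_theta i ^^ m) h)" if "smooth h" for i m and h :: "real^'a \<Rightarrow> complex"
    using that by (induction m) (auto intro: th)
  have p: "(LINT x|lborel. f x * (euler_theta i ^^ m) h x) = (LINT x|lborel. (theta_shift (\<lambda>_. 0) i ^^ m) f x * h x)"
    if "f \<in> smooth_in K" "smooth h" for f h i m
    using that
  proof (induction m arbitrary: f)
    case (Suc m)
    have "(LINT x|lborel. f x * (euler_theta i ^^ Suc m) h x) = (LINT x|lborel. theta_shift (\<lambda>_. 0) i f x * (euler_theta i ^^ m) h x)"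
      using integral_euler_theta[OF K Suc.prems(1) th'[OF Suc.prems(2), where i=i and m=m], of i] by simp
    also have "\<dots> = (LINT x|lborel. (theta_shift (\<lambda>_. 0) i ^^ m) (theta_shift (\<lambda>_. 0) i f) x * h x)"
      by (intro Suc.IH smooth_in_theta_shift cl Suc.prems)
    finally show ?case by (simp add: funpow_swap1)
  qed simp
  have "(LINT x|lborel. f x * foldr (\<lambda>i. euler_theta i ^^ Poly_Mapping.lookup \<alpha> i) xs h x)
     = (LINT x|lborel. fold (\<lambda>i. theta_shift (\<lambda>_. 0) i ^^ Poly_Mapping.lookup \<alpha> i) xs f x * h x)" if "f \<in> smooth_in K" for xs f
    using that
  proof (induction xs arbitrary: f)
    case (Cons i xs)
    have "smooth (foldr (\<lambda>i. euler_theta i ^^ Poly_Mapping.lookup \<alpha> i) xs h)"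
      by (rule test_functions_smooth[OF test_functions_euler_theta_foldr[OF h]])
    from p[OF Cons.prems this]
    have "(LINT x|lborel. f x * foldr (\<lambda>i. euler_theta i ^^ Poly_Mapping.lookup \<alpha> i) (i # xs) h x)
       = (LINT x|lborel. (theta_shift (\<lambda>_. 0) i ^^ Poly_Mapping.lookup \<alpha> i) f x * foldr (\<lambda>i. euler_theta i ^^ Poly_Mapping.lookup \<alpha> i) xs h x)" by simp
    also have "\<dots> = (LINT x|lborel. fold (\<lambda>i. theta_shift (\<lambda>_. 0) i ^^ Poly_Mapping.lookup \<alpha> i) xs ((theta_shift (\<lambda>_. 0) i ^^ Poly_Mapping.lookup \<alpha> i) f) x * h x)"
      by (intro Cons.IH commuting.pow_closed[OF commuting_theta_in[OF cl]] Cons.prems)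
    finally show ?case by simp
  qed simp
  from this[OF f] show ?thesis by (simp add: op_monom_def)
qed

definition lpoly_of :: "(('n \<Rightarrow>\<^sub>0 nat) \<Rightarrow>\<^sub>0 complex) \<Rightarrow> 'n lpoly" where
  "lpoly_of P = map (\<lambda>\<alpha>. (Poly_Mapping.lookup P \<alpha>, \<alpha>)) (SOME xs. distinct xs \<and> set xs = Poly_Mapping.keys P)"

lemma lpoly_of_list:
  obtains xs where "distinct xs" "set xs = Poly_Mapping.keys P" "lpoly_of P = map (\<lambda>\<alpha>. (Poly_Mapping.lookup P \<alpha>, \<alpha>)) xs"
proof -
  have "\<exists>xs. distinct xs \<and> set xs = Poly_Mapping.keys P"
    using finite_distinct_list[OF finite_keys[of P]] by blast
  from someI_ex[OF this] show ?thesis using that by (auto simp: lpoly_of_def)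
qed

lemma hasse_closure_constant_lpoly_of:
  assumes P: "P \<noteq> 0"
  obtains Q c where "Q \<in> hasse_closure (lpoly_of P)" "c \<noteq> 0" "\<And>u f. theta_poly u Q f = (\<lambda>x. c * f x)"
proof -
  obtain xs where xs: "distinct xs" "set xs = Poly_Mapping.keys P" "lpoly_of P = map (\<lambda>\<alpha>. (Poly_Mapping.lookup P \<alpha>, \<alpha>)) xs"
    by (rule lpoly_of_list)
  have "distinct (map snd (lpoly_of P))" using xs by (simp add: o_def)
  moreover have "lpoly_of P \<noteq> []" using xs P keys_eq_empty[of P] by fastforce
  moreover have "c \<noteq> 0" if "(c, \<alpha>) \<in> set (lpoly_of P)" for c \<alpha> using xs that by (auto simp: in_keys_iff)
  ultimately show ?thesis using that by (rule hasse_closure_constant)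
qed

lemma theta_poly_lpoly_of:
  "theta_poly u (lpoly_of P) f x = (\<Sum>\<alpha>\<in>Poly_Mapping.keys P. Poly_Mapping.lookup P \<alpha> * theta_monom u \<alpha> f x)"
proof -
  obtain xs where xs: "distinct xs" "set xs = Poly_Mapping.keys P" "lpoly_of P = map (\<lambda>\<alpha>. (Poly_Mapping.lookup P \<alpha>, \<alpha>)) xs"
    by (rule lpoly_of_list)
  show ?thesis unfolding theta_poly_def xs(3) by (simp add: o_def sum_list_distinct_conv_sum_set xs)
qed

lemma transpose_test:
  assumes K: "compact K" and f: "f \<in> smooth_in K" and h: "h \<in> test_functions UNIV"
  shows "euler_op_transpose P (dist_of f) h = (LINT x|lborel. theta_poly (\<lambda>_. 0) (lpoly_of P) f x * h x)"
proof -
  have A: "dist_theta_star i T = (\<lambda>\<phi>. T (euler_theta i \<phi>))" for i and T :: "'a functional"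
    by (simp add: dist_theta_star_def dist_deriv_def dist_coord_def euler_theta_def)
  have M: "op_monom dist_theta_star \<alpha> T \<phi> = T (foldr (\<lambda>i. euler_theta i ^^ Poly_Mapping.lookup \<alpha> i) index_list \<phi>)"
    for \<alpha> \<phi> and T :: "'a functional"
    by (rule op_monom_functional[OF A])
  have "euler_op_transpose P (dist_of f) h = (\<Sum>\<alpha>\<in>Poly_Mapping.keys P. Poly_Mapping.lookup P \<alpha> * (LINT x|lborel. theta_monom (\<lambda>_. 0) \<alpha> f x * h x))"
    unfolding euler_op_transpose_def op_poly_def M
    by (simp add: dist_of_def integral_theta_monom[OF K f h])
  also have "\<dots> = (LINT x|lborel. (\<Sum>\<alpha>\<in>Poly_Mapping.keys P. Poly_Mapping.lookup P \<alpha> * (theta_monom (\<lambda>_. 0) \<alpha> f x * h x)))"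
  proof -
    have "integrable lborel (\<lambda>x. theta_monom (\<lambda>_. 0) \<alpha> f x * h x)" for \<alpha>
      using smooth_in_integrable[OF K smooth_in_mult[OF test_functions_smooth[OF h] smooth_in_theta_monom[OF compact_imp_closed[OF K] f]]]
      by (simp add: mult.commute)
    then show ?thesis by (subst Bochner_Integration.integral_sum) auto
  qed
  also have "\<dots> = (LINT x|lborel. theta_poly (\<lambda>_. 0) (lpoly_of P) f x * h x)"
    by (intro Bochner_Integration.integral_cong) (auto simp: theta_poly_lpoly_of sum_distrib_right mult.assoc)
  finally show ?thesis .
qed

text \<open>All derivatives rest on the test function \<open>h\<close>, so uniform convergence
  without derivatives is enough.\<close>

lemma transpose_limit:
  assumes u: "uniform_limit UNIV F f sequentially" and F: "\<And>m. continuous_on UNIV (F m)"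
    and h: "h \<in> test_functions UNIV"
  shows "(\<lambda>m. euler_op_transpose P (dist_of (F m)) h) \<longlonglongrightarrow> euler_op_transpose P (dist_of f) h"
proof -
  have A: "dist_theta_star i T = (\<lambda>\<phi>. T (euler_theta i \<phi>))" for i and T :: "'a functional"
    by (simp add: dist_theta_star_def dist_deriv_def dist_coord_def euler_theta_def)
  have M: "op_monom dist_theta_star \<alpha> T \<phi> = T (foldr (\<lambda>i. euler_theta i ^^ Poly_Mapping.lookup \<alpha> i) index_list \<phi>)"
    for \<alpha> \<phi> and T :: "'a functional"
    by (rule op_monom_functional[OF A])
  show ?thesis
    unfolding euler_op_transpose_def op_poly_def M dist_of_def
    by (intro tendsto_sum tendsto_mult_left uniform_limit_integral[OF u F] test_functions_euler_theta_foldr h)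
qed

lemma linear_on_test_add: "linear_on_test_functions \<Omega> T \<Longrightarrow> f \<in> test_functions \<Omega> \<Longrightarrow> g \<in> test_functions \<Omega> \<Longrightarrow>
    T (\<lambda>x. f x + g x) = T f + T g"
  and linear_on_test_cmult: "linear_on_test_functions \<Omega> T \<Longrightarrow> f \<in> test_functions \<Omega> \<Longrightarrow> T (\<lambda>x. c * f x) = c * T f"
  by (simp_all add: linear_on_test_functions_def)

lemma linear_on_test_sum:
  assumes T: "linear_on_test_functions \<Omega> T" and f: "\<And>a. a \<in> A \<Longrightarrow> f a \<in> test_functions \<Omega>"
  shows "T (\<lambda>x. \<Sum>a\<in>A. f a x) = (\<Sum>a\<in>A. T (f a))"
proof -
  from linear_on_test_cmult[OF T test_functions_zero, of 0] have z: "T (\<lambda>x. 0) = 0" by simp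
  show ?thesis
    using f
  proof (induction A rule: infinite_finite_induct)
  case (insert a A)
  then have "T (\<lambda>x. f a x + (\<Sum>a\<in>A. f a x)) = T (f a) + T (\<lambda>x. \<Sum>a\<in>A. f a x)"
    by (intro linear_on_test_add[OF T] test_functions_sum) auto
  with insert show ?case by simp
qed (use z in simp_all)
qed

lemma test_functions_theta_monom:
  assumes "f \<in> test_functions \<Omega>" shows "theta_monom u \<alpha> f \<in> test_functions \<Omega>"
proof -
  obtain K where "compact K" "K \<subseteq> \<Omega>" "f \<in> smooth_in K" using assms by (auto simp: test_functions_iff)
  then show ?thesis by (intro test_functionsI[of K] smooth_in_theta_monom compact_imp_closed)
qed

text \<open>A functional is only meaningful, and only linear, on test functions, so signs and sums
  may be pulled out just there. Linearity and the test function property are therefore carried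
  through all iterates.\<close>

lemma euler_op_test:
  assumes S: "linear_on_test_functions \<Omega> S" and h: "h \<in> test_functions \<Omega>"
  shows "euler_op P S h = S (theta_poly (\<lambda>_. 0) (lpoly_of P) h)"
proof -
  let ?t = "theta_shift (\<lambda>_. 0)"
  have tt: "?t i h \<in> test_functions \<Omega>" if "h \<in> test_functions \<Omega>" for i h
    using that unfolding theta_shift_def
    by (intro test_functions_diff test_functions_cmult test_functions_mult smooth_coord test_functions_partial_deriv)
  have tp: "(?t i ^^ k) h \<in> test_functions \<Omega>" if "h \<in> test_functions \<Omega>" for i h k
    using that by (induction k) (auto intro: tt)
  have 1: "dist_theta i S h = S (?t i h)" if "linear_on_test_functions \<Omega> S" "h \<in> test_functions \<Omega>" for i S h
  proof -
    have "S (\<lambda>x. -1 * ?t i h x) = -1 * S (?t i h)"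
      by (rule linear_on_test_cmult[OF that(1) tt[OF that(2)]])
    moreover have "partial_deriv i (\<lambda>x. complex_of_real (x $ i) * h x) = (\<lambda>x. -1 * ?t i h x)"
      using test_functions_smooth[OF that(2)] by (auto simp: partial_deriv_mult smooth_coord partial_deriv_coord theta_shift_def)
    ultimately show ?thesis by (simp add: dist_theta_def dist_coord_def dist_deriv_def)
  qed
  have 2: "linear_on_test_functions \<Omega> (dist_theta i S)" if "linear_on_test_functions \<Omega> S" for i S
    using that 1[OF that] unfolding linear_on_test_functions_def
    by (simp add: test_functions_add test_functions_cmult theta_shift_add theta_shift_cmult test_functions_smooth tt)
  have 3: "(dist_theta i ^^ k) S h = S ((?t i ^^ k) h)" "linear_on_test_functions \<Omega> ((dist_theta i ^^ k) S)"
    if "linear_on_test_functions \<Omega> S" "h \<in> test_functions \<Omega>" for i k S h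
  proof -
    show L: "linear_on_test_functions \<Omega> ((dist_theta i ^^ k) S)" for k
      using that(1) by (induction k) (auto intro: 2)
    show "(dist_theta i ^^ k) S h = S ((?t i ^^ k) h)"
      using that(2)
    proof (induction k arbitrary: h)
      case (Suc k)
      have "(dist_theta i ^^ Suc k) S h = (dist_theta i ^^ k) S (?t i h)"
        using 1[OF L Suc.prems] by simp
      also have "\<dots> = S ((?t i ^^ k) (?t i h))" by (rule Suc.IH[OF tt[OF Suc.prems]])
      finally show ?case by (simp add: funpow_swap1)
    qed simp
  qed
  have 4: "fold (\<lambda>i. dist_theta i ^^ k i) xs S h = S (foldr (\<lambda>i. ?t i ^^ k i) xs h)"
    if "linear_on_test_functions \<Omega> S" "h \<in> test_functions \<Omega>" for k xs S h
    using that
  proof (induction xs arbitrary: S)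
    case (Cons i xs)
    have "foldr (\<lambda>i. ?t i ^^ k i) xs h \<in> test_functions \<Omega>" using Cons.prems(2) by (induction xs) (auto intro: tp)
    then show ?case using Cons.IH[OF 3(2)[OF Cons.prems] Cons.prems(2)] 3(1)[OF Cons.prems(1)] by simp
  qed simp
  \<comment> \<open>The order reversed by transposition is restored, the operators being commuting
    on smooth functions.\<close>
  have 5: "foldr (\<lambda>i. ?t i ^^ k i) xs h = fold (\<lambda>i. ?t i ^^ k i) xs h" if "smooth h" for k xs h
    using that
  proof (induction xs arbitrary: h)
    case (Cons i xs)
    have pc: "(?t i ^^ m) (fold (\<lambda>i. ?t i ^^ k i) xs h) = fold (\<lambda>i. ?t i ^^ k i) xs ((?t i ^^ m) h)" for m
      using Cons.prems by (induction m) (auto simp: theta.fold_comm theta.pow_closed[simplified])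
    show ?case using Cons by (simp add: pc)
  qed simp
  have "euler_op P S h = (\<Sum>\<alpha>\<in>Poly_Mapping.keys P. Poly_Mapping.lookup P \<alpha> * S (theta_monom (\<lambda>_. 0) \<alpha> h))"
    unfolding euler_op_def op_poly_def op_monom_def[of dist_theta] op_monom_def[of ?t]
    using 4[OF S h] 5[OF test_functions_smooth[OF h]] by simp
  also have "\<dots> = (\<Sum>\<alpha>\<in>Poly_Mapping.keys P. S (\<lambda>x. Poly_Mapping.lookup P \<alpha> * theta_monom (\<lambda>_. 0) \<alpha> h x))"
  proof -
    have "theta_monom (\<lambda>_. 0) \<alpha> h \<in> test_functions \<Omega>" for \<alpha>
      by (rule test_functions_theta_monom[OF h])
    then show ?thesis using S unfolding linear_on_test_functions_def by simp
  qed
  also have "\<dots> = S (\<lambda>x. \<Sum>\<alpha>\<in>Poly_Mapping.keys P. Poly_Mapping.lookup P \<alpha> * theta_monom (\<lambda>_. 0) \<alpha> h x)"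
  proof (rule linear_on_test_sum[OF S, symmetric])
    show "(\<lambda>x. Poly_Mapping.lookup P \<alpha> * theta_monom (\<lambda>_. 0) \<alpha> h x) \<in> test_functions \<Omega>" for \<alpha>
      by (intro test_functions_cmult test_functions_theta_monom[OF h])
  qed
  also have "(\<lambda>x. \<Sum>\<alpha>\<in>Poly_Mapping.keys P. Poly_Mapping.lookup P \<alpha> * theta_monom (\<lambda>_. 0) \<alpha> h x) = theta_poly (\<lambda>_. 0) (lpoly_of P) h"
    by (simp add: theta_poly_lpoly_of fun_eq_iff)
  finally show ?thesis .
qed

section \<open>Hahn-Banach for spaces of functions\<close>

definition fun_subspace :: "('a \<Rightarrow> complex) set \<Rightarrow> bool" where
  "fun_subspace W \<longleftrightarrow> (\<lambda>x. 0) \<in> W \<and> (\<forall>f\<in>W. \<forall>g\<in>W. (\<lambda>x. f x + g x) \<in> W) \<and> (\<forall>c. \<forall>f\<in>W. (\<lambda>x. c * f x) \<in> W)"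

definition sublinear_on :: "('a \<Rightarrow> complex) set \<Rightarrow> (('a \<Rightarrow> complex) \<Rightarrow> real) \<Rightarrow> bool" where
  "sublinear_on W p \<longleftrightarrow> (\<forall>f\<in>W. \<forall>g\<in>W. p (\<lambda>x. f x + g x) \<le> p f + p g) \<and>
     (\<forall>c>0. \<forall>f\<in>W. p (\<lambda>x. complex_of_real c * f x) \<le> c * p f)"

lemma fun_subspaceD:
  assumes "fun_subspace W"
  shows "(\<lambda>x. 0) \<in> W" "f \<in> W \<Longrightarrow> g \<in> W \<Longrightarrow> (\<lambda>x. f x + g x) \<in> W" "f \<in> W \<Longrightarrow> (\<lambda>x. c * f x) \<in> W"
    "f \<in> W \<Longrightarrow> (\<lambda>x. - f x) \<in> W" "f \<in> W \<Longrightarrow> g \<in> W \<Longrightarrow> (\<lambda>x. f x - g x) \<in> W"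
proof -
  show 1: "(\<lambda>x. 0) \<in> W" "f \<in> W \<Longrightarrow> g \<in> W \<Longrightarrow> (\<lambda>x. f x + g x) \<in> W" "f \<in> W \<Longrightarrow> (\<lambda>x. c * f x) \<in> W" for f g c
    using assms by (auto simp: fun_subspace_def)
  show 2: "f \<in> W \<Longrightarrow> (\<lambda>x. - f x) \<in> W" for f using 1(3)[of f "-1"] by simp
  show "f \<in> W \<Longrightarrow> g \<in> W \<Longrightarrow> (\<lambda>x. f x - g x) \<in> W" using 1(2)[OF _ 2, of f g] by simp
qed

lemma sublinear_add: "sublinear_on W p \<Longrightarrow> f \<in> W \<Longrightarrow> g \<in> W \<Longrightarrow> p (\<lambda>x. f x + g x) \<le> p f + p g"
  and sublinear_scale: "sublinear_on W p \<Longrightarrow> f \<in> W \<Longrightarrow> c > 0 \<Longrightarrow> p (\<lambda>x. complex_of_real c * f x) \<le> c * p f"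
  by (auto simp: sublinear_on_def)

lemma sublinear_zero:
  assumes W: "fun_subspace W" and p: "sublinear_on W p"
  shows "p (\<lambda>x. 0) = 0"
proof -
  have "p (\<lambda>x. 0) \<le> p (\<lambda>x. 0) + p (\<lambda>x. 0)"
    using sublinear_add[OF p fun_subspaceD(1)[OF W] fun_subspaceD(1)[OF W]] by simp
  moreover have "p (\<lambda>x. 0) \<le> (1/2) * p (\<lambda>x. 0)"
    using sublinear_scale[OF p fun_subspaceD(1)[OF W], of "1/2"] by simp
  ultimately show ?thesis by simp
qed

lemma sublinear_lower:
  assumes W: "fun_subspace W" and p: "sublinear_on W p" and f: "f \<in> W"
  shows "- p (\<lambda>x. - f x) \<le> p f"
  using sublinear_add[OF p f fun_subspaceD(4)[OF W f]] sublinear_zero[OF W p] by simp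

lemma sublinear_scale_eq:
  assumes W: "fun_subspace W" and p: "sublinear_on W p" and f: "f \<in> W" and c: "c > 0"
  shows "p (\<lambda>x. complex_of_real c * f x) = c * p f"
proof (rule antisym)
  show "p (\<lambda>x. complex_of_real c * f x) \<le> c * p f" by (rule sublinear_scale[OF p f c])
  have "p (\<lambda>x. complex_of_real (inverse c) * (complex_of_real c * f x)) \<le> inverse c * p (\<lambda>x. complex_of_real c * f x)"
    using c by (intro sublinear_scale[OF p] fun_subspaceD(3)[OF W f]) simp
  moreover have "(\<lambda>x. complex_of_real (inverse c) * (complex_of_real c * f x)) = f"
    using c by (auto simp: mult.assoc[symmetric] simp flip: of_real_mult)
  ultimately show "c * p f \<le> p (\<lambda>x. complex_of_real c * f x)" using c by (simp add: field_simps)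
qed

text \<open>A minimal sublinear functional below \<open>p\<close> is linear; Zorn's lemma supplies
  one. This version needs no domain extension and yields a real linear functional on all of
  \<open>W\<close>.\<close>

lemma hahn_banach_sublinear:
  fixes W :: "('a \<Rightarrow> complex) set"
  assumes W: "fun_subspace W" and p: "sublinear_on W p"
  obtains F where "\<And>f g. f \<in> W \<Longrightarrow> g \<in> W \<Longrightarrow> F (\<lambda>x. f x + g x) = F f + F g"
    "\<And>f c. f \<in> W \<Longrightarrow> F (\<lambda>x. complex_of_real c * f x) = c * F f" "\<And>f. f \<in> W \<Longrightarrow> F f \<le> p f"
proof -
  note Wd = fun_subspaceD[OF W]
  \<comment> \<open>Values off \<open>W\<close> are fixed as 0, so that two members that agree on
    \<open>W\<close> are equal and the order is antisymmetric.\<close>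
  define A where "A = {q. sublinear_on W q \<and> (\<forall>f\<in>W. q f \<le> p f) \<and> (\<forall>f. f \<notin> W \<longrightarrow> q f = (0::real))}"
  \<comment> \<open>The order is reversed: maximal elements for \<open>R\<close> are minimal
    functionals.\<close>
  define R where "R q r \<longleftrightarrow> (\<forall>f. r f \<le> q f)" for q r :: "('a \<Rightarrow> complex) \<Rightarrow> real"
  have lowA: "- p (\<lambda>x. - f x) \<le> q f" if "q \<in> A" "f \<in> W" for q f
    using sublinear_lower[OF W, of q f] that Wd(4)[OF that(2)] unfolding A_def by fastforce
  have po: "partial_order_on A (relation_of R A)"
    by (rule partial_order_on_relation_ofI) (auto simp: R_def intro: order_trans intro!: ext antisym)
  have "\<exists>m\<in>A. \<forall>a\<in>A. R m a \<longrightarrow> a = m"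
  proof (rule predicate_Zorn[OF po])
    fix C assume C: "C \<in> Chains (relation_of R A)"
    then have CA: "C \<subseteq> A" and tot: "\<And>q r. q \<in> C \<Longrightarrow> r \<in> C \<Longrightarrow> R q r \<or> R r q"
      by (auto simp: Chains_def relation_of_def)
    show "\<exists>u\<in>A. \<forall>a\<in>C. R a u"
    proof (cases "C = {}")
      case True
      have "(\<lambda>f. if f \<in> W then p f else 0) \<in> A"
        using p Wd by (auto simp: A_def sublinear_on_def)
      then show ?thesis using True by blast
    next
      case False
      define u where "u f = (if f \<in> W then INF q\<in>C. q f else 0)" for f
      have bd: "bdd_below ((\<lambda>q. q f) ` C)" if "f \<in> W" for f
        using lowA[OF _ that] CA by (intro bdd_belowI2[of _ "- p (\<lambda>x. - f x)"]) auto
      have ul: "u f \<le> q f" if "f \<in> W" "q \<in> C" for f q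
        unfolding u_def using that by (simp add: cINF_lower[OF bd])
      have ug: "z \<le> u f" if "f \<in> W" "\<And>q. q \<in> C \<Longrightarrow> z \<le> q f" for f z
        unfolding u_def using that False by (auto intro: cINF_greatest)
      have sl: "sublinear_on W q" if "q \<in> C" for q using CA that by (auto simp: A_def)
      have "sublinear_on W u"
        unfolding sublinear_on_def
      proof (intro conjI ballI allI impI)
        fix f g assume f: "f \<in> W" and g: "g \<in> W"
        have *: "u (\<lambda>x. f x + g x) \<le> q f + r g" if qr: "q \<in> C" "r \<in> C" for q r
        proof -
          obtain s where s: "s \<in> C" "s f \<le> q f" "s g \<le> r g"
            using tot[OF qr] qr unfolding R_def by (meson order_refl)
          have "u (\<lambda>x. f x + g x) \<le> s (\<lambda>x. f x + g x)" by (rule ul[OF Wd(2)[OF f g] s(1)])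
          also have "\<dots> \<le> s f + s g" by (rule sublinear_add[OF sl[OF s(1)] f g])
          finally show ?thesis using s by linarith
        qed
        have "u (\<lambda>x. f x + g x) - r g \<le> u f" if "r \<in> C" for r
          by (rule ug[OF f]) (use *[OF _ that] in \<open>simp add: diff_le_eq\<close>)
        then have "u (\<lambda>x. f x + g x) - u f \<le> u g" by (intro ug[OF g]) (simp add: diff_le_eq add.commute)
        then show "u (\<lambda>x. f x + g x) \<le> u f + u g" by simp
      next
        fix c :: real and f assume c: "c > 0" and f: "f \<in> W"
        have "u (\<lambda>x. complex_of_real c * f x) / c \<le> u f"
        proof (rule ug[OF f])
          fix q assume q: "q \<in> C"
          have "u (\<lambda>x. complex_of_real c * f x) \<le> q (\<lambda>x. complex_of_real c * f x)" by (rule ul[OF Wd(3)[OF f] q])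
          also have "\<dots> \<le> c * q f" by (rule sublinear_scale[OF sl[OF q] f c])
          finally show "u (\<lambda>x. complex_of_real c * f x) / c \<le> q f" using c by (simp add: field_simps)
        qed
        then show "u (\<lambda>x. complex_of_real c * f x) \<le> c * u f" using c by (simp add: field_simps)
      qed
      moreover have "u f \<le> p f" if "f \<in> W" for f
      proof -
        obtain q where "q \<in> C" using False by blast
        then show ?thesis using ul[OF that] CA that by (fastforce simp: A_def)
      qed
      ultimately have "u \<in> A" by (auto simp: A_def u_def)
      moreover have "R q u" if "q \<in> C" for q
        unfolding R_def
      proof
        fix f show "u f \<le> q f"
          using ul[OF _ that, of f] CA that by (cases "f \<in> W") (auto simp: u_def A_def)
      qed
      ultimately show ?thesis by blast
    qed
  qed
  then obtain m where m: "m \<in> A" "\<And>a. a \<in> A \<Longrightarrow> R m a \<Longrightarrow> a = m" by blast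
  have ms: "sublinear_on W m" and mp: "\<And>f. f \<in> W \<Longrightarrow> m f \<le> p f" and m0: "\<And>f. f \<notin> W \<Longrightarrow> m f = 0" using m(1) by (auto simp: A_def)
  have sup: "m x + m y \<le> m (\<lambda>t. x t + y t)" if x: "x \<in> W" and y: "y \<in> W" for x y
  proof -
    define v where "v z s t = z t + complex_of_real s * y t" for z s t
    have vW: "v z s \<in> W" if "z \<in> W" for z s unfolding v_def using that by (intro Wd y)
    \<comment> \<open>This functional is sublinear and below \<open>m\<close>, hence equal to
      \<open>m\<close> by minimality; comparing with \<open>s = 1\<close> gives
      superadditivity.\<close>
    define my where "my z = (if z \<in> W then INF s\<in>{0..}. m (v z s) - s * m y else 0)" for z
    have lb: "- m (\<lambda>t. - z t) \<le> m (v z s) - s * m y" if z: "z \<in> W" and s: "s \<ge> 0" for z s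
    proof -
      have "m (\<lambda>t. complex_of_real s * y t) = s * m y"
        using s sublinear_scale_eq[OF W ms y, of s] sublinear_zero[OF W ms] by (cases "s = 0") auto
      moreover have "m (\<lambda>t. v z s t + - z t) \<le> m (v z s) + m (\<lambda>t. - z t)" by (rule sublinear_add[OF ms vW[OF z] Wd(4)[OF z]])
      ultimately show ?thesis by (simp add: v_def)
    qed
    have bd: "bdd_below ((\<lambda>s. m (v z s) - s * m y) ` {0..})" if "z \<in> W" for z
      using lb[OF that] by (intro bdd_belowI2[of _ "- m (\<lambda>t. - z t)"]) auto
    have ul: "my z \<le> m (v z s) - s * m y" if "z \<in> W" "s \<ge> 0" for z s
      unfolding my_def using that cINF_lower[OF bd[OF that(1)], of s] by simp
    have ug: "c \<le> my z" if "z \<in> W" "\<And>s. s \<ge> 0 \<Longrightarrow> c \<le> m (v z s) - s * m y" for c z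
      unfolding my_def using that by (auto intro: cINF_greatest)
    have "v z 0 = z" for z by (rule ext) (simp add: v_def)
    then have my_m: "my z \<le> m z" if "z \<in> W" for z using ul[OF that, of 0] by simp
    have "sublinear_on W my"
      unfolding sublinear_on_def
    proof (intro conjI ballI allI impI)
      fix f g assume f: "f \<in> W" and g: "g \<in> W"
      have *: "my (\<lambda>t. f t + g t) \<le> (m (v f s) - s * m y) + (m (v g r) - r * m y)" if "s \<ge> 0" "r \<ge> 0" for s r
      proof -
        have "my (\<lambda>t. f t + g t) \<le> m (v (\<lambda>t. f t + g t) (s + r)) - (s + r) * m y" by (intro ul Wd f g) (use that in simp)
        also have "v (\<lambda>t. f t + g t) (s + r) = (\<lambda>t. v f s t + v g r t)" by (auto simp: v_def algebra_simps)
        also have "m (\<lambda>t. v f s t + v g r t) \<le> m (v f s) + m (v g r)" by (rule sublinear_add[OF ms vW[OF f] vW[OF g]])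
        finally show ?thesis by (simp add: algebra_simps)
      qed
      have "my (\<lambda>t. f t + g t) - (m (v g r) - r * m y) \<le> my f" if "r \<ge> 0" for r
        by (rule ug[OF f]) (use *[OF _ that] in \<open>simp add: diff_le_eq\<close>)
      then have "my (\<lambda>t. f t + g t) - my f \<le> my g" by (intro ug[OF g]) (simp add: diff_le_eq add.commute)
      then show "my (\<lambda>t. f t + g t) \<le> my f + my g" by simp
    next
      fix c :: real and f assume c: "c > 0" and f: "f \<in> W"
      have "my (\<lambda>t. complex_of_real c * f t) / c \<le> my f"
      proof (rule ug[OF f])
        fix s :: real assume s: "s \<ge> 0"
        have "my (\<lambda>t. complex_of_real c * f t) \<le> m (v (\<lambda>t. complex_of_real c * f t) (c * s)) - (c * s) * m y"
          by (intro ul Wd f) (use c s in simp)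
        also have "v (\<lambda>t. complex_of_real c * f t) (c * s) = (\<lambda>t. complex_of_real c * v f s t)"
          by (auto simp: v_def algebra_simps)
        also have "m (\<lambda>t. complex_of_real c * v f s t) \<le> c * m (v f s)" by (rule sublinear_scale[OF ms vW[OF f] c])
        finally show "my (\<lambda>t. complex_of_real c * f t) / c \<le> m (v f s) - s * m y"
          using c by (simp add: field_simps)
      qed
      then show "my (\<lambda>t. complex_of_real c * f t) \<le> c * my f" using c by (simp add: field_simps)
    qed
    then have "my \<in> A" using my_m mp by (auto simp: A_def my_def intro: order_trans)
    moreover have "R m my" using my_m m0 by (auto simp: R_def my_def)
    ultimately have "my = m" by (rule m(2))
    then have "m x \<le> m (v x 1) - 1 * m y" using ul[OF x, of 1] by simp
    moreover have "v x 1 = (\<lambda>t. x t + y t)" by (auto simp: v_def)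
    ultimately show ?thesis by simp
  qed
  have add: "m (\<lambda>t. f t + g t) = m f + m g" if "f \<in> W" "g \<in> W" for f g
    using sup[OF that] sublinear_add[OF ms that] by simp
  have neg: "m (\<lambda>t. - f t) = - m f" if f: "f \<in> W" for f
    using add[OF f Wd(4)[OF f]] sublinear_zero[OF W ms] by simp
  have "m (\<lambda>t. complex_of_real c * f t) = c * m f" if f: "f \<in> W" for f c
  proof -
    consider "c = 0" | "c > 0" | "c < 0" by linarith
    then show ?thesis
    proof cases
      case 1 then show ?thesis using sublinear_zero[OF W ms] by simp
    next
      case 2 then show ?thesis by (rule sublinear_scale_eq[OF W ms f])
    next
      case 3
      then have "m (\<lambda>t. complex_of_real (- c) * f t) = - c * m f" by (intro sublinear_scale_eq[OF W ms f]) simp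
      moreover have "m (\<lambda>t. - (complex_of_real c * f t)) = - m (\<lambda>t. complex_of_real c * f t)" by (intro neg Wd f)
      ultimately show ?thesis by simp
    qed
  qed
  with add mp show ?thesis by (intro that[of m]) auto
qed

definition clinear_on :: "('a \<Rightarrow> complex) set \<Rightarrow> (('a \<Rightarrow> complex) \<Rightarrow> complex) \<Rightarrow> bool" where
  "clinear_on W T \<longleftrightarrow> (\<forall>f\<in>W. \<forall>g\<in>W. T (\<lambda>x. f x + g x) = T f + T g) \<and> (\<forall>c. \<forall>f\<in>W. T (\<lambda>x. c * f x) = c * T f)"

lemma clinear_onD:
  "clinear_on W T \<Longrightarrow> f \<in> W \<Longrightarrow> g \<in> W \<Longrightarrow> T (\<lambda>x. f x + g x) = T f + T g"
  "clinear_on W T \<Longrightarrow> f \<in> W \<Longrightarrow> T (\<lambda>x. c * f x) = c * T f"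
  by (auto simp: clinear_on_def)

lemma clinear_zero: "clinear_on W T \<Longrightarrow> fun_subspace W \<Longrightarrow> T (\<lambda>x. 0) = 0"
  using clinear_onD(2)[of W T "\<lambda>x. 0" 0] fun_subspaceD(1)[of W] by simp

definition seminorm_on :: "('a \<Rightarrow> complex) set \<Rightarrow> (('a \<Rightarrow> complex) \<Rightarrow> real) \<Rightarrow> bool" where
  "seminorm_on W q \<longleftrightarrow> (\<forall>f\<in>W. q f \<ge> 0) \<and> (\<forall>f\<in>W. \<forall>g\<in>W. q (\<lambda>x. f x + g x) \<le> q f + q g) \<and>
     (\<forall>c. \<forall>f\<in>W. q (\<lambda>x. c * f x) = norm c * q f)"

lemma seminorm_onD:
  "seminorm_on W q \<Longrightarrow> f \<in> W \<Longrightarrow> q f \<ge> 0"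
  "seminorm_on W q \<Longrightarrow> f \<in> W \<Longrightarrow> g \<in> W \<Longrightarrow> q (\<lambda>x. f x + g x) \<le> q f + q g"
  "seminorm_on W q \<Longrightarrow> f \<in> W \<Longrightarrow> q (\<lambda>x. c * f x) = norm c * q f"
  by (auto simp: seminorm_on_def)

text \<open>A unimodular factor rotates \<open>H f\<close> onto the positive real axis without
  changing the seminorm.\<close>

lemma norm_le_if_Re_le:
  assumes W: "fun_subspace W" and q: "seminorm_on W q" and H: "clinear_on W H"
    and le: "\<And>f. f \<in> W \<Longrightarrow> Re (H f) \<le> C * q f" and f: "f \<in> W"
  shows "norm (H f) \<le> C * q f"
proof (cases "H f = 0")
  case True
  have "0 \<le> C * q f" using le[OF f] True by simp
  then show ?thesis using True by simp
next
  case False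
  define c where "c = cnj (H f) / of_real (norm (H f))"
  have nc: "norm c = 1" using False by (simp add: c_def norm_divide)
  have "H (\<lambda>x. c * f x) = c * H f" by (rule clinear_onD(2)[OF H f])
  also have "\<dots> = of_real (norm (H f))"
    using False by (simp add: c_def complex_norm_square[symmetric] power2_eq_square mult.commute[of "cnj _"])
  finally have "norm (H f) = Re (H (\<lambda>x. c * f x))" by simp
  also have "\<dots> \<le> C * q (\<lambda>x. c * f x)" by (intro le fun_subspaceD(3)[OF W f])
  also have "\<dots> = C * q f" by (simp add: seminorm_onD(3)[OF q f] nc)
  finally show ?thesis .
qed

text \<open>Solving \<open>G (A f) = T f\<close>, the bound by \<open>C * q\<close> and closeness to
  \<open>S\<close> on \<open>D1\<close> are obtained from one sublinear functional \<open>Q\<close>,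
  the infimum of \<open>B\<close>. The hypothesis \<open>le\<close> is what bounds \<open>B\<close>
  from below. Special choices of \<open>f\<close> and \<open>g\<close> in \<open>B\<close> give the
  three conclusions: both zero, \<open>h = A f\<close> with \<open>g\<close> zero, and
  \<open>h = g\<close> with \<open>f\<close> zero.\<close>

lemma sandwich_extension:
  assumes W: "fun_subspace W" and q: "seminorm_on W q"
    and D1: "fun_subspace D1" "D1 \<subseteq> W" and S: "clinear_on D1 S"
    and D2: "fun_subspace D2" and T: "clinear_on D2 T"
    and A: "\<And>f. f \<in> D2 \<Longrightarrow> A f \<in> W" "\<And>f g. f \<in> D2 \<Longrightarrow> g \<in> D2 \<Longrightarrow> A (\<lambda>x. f x + g x) = (\<lambda>x. A f x + A g x)"
      "\<And>f c. f \<in> D2 \<Longrightarrow> A (\<lambda>x. c * f x) = (\<lambda>x. c * A f x)"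
    and C: "C \<ge> 0" "e \<ge> 0"
    and le: "\<And>f g. f \<in> D2 \<Longrightarrow> g \<in> D1 \<Longrightarrow> Re (T f) - Re (S g) \<le> e * q g + C * q (\<lambda>x. A f x - g x)"
  obtains G where "clinear_on W G" "\<And>f. f \<in> W \<Longrightarrow> norm (G f) \<le> C * q f" "\<And>f. f \<in> D2 \<Longrightarrow> G (A f) = T f"
    "\<And>g. g \<in> D1 \<Longrightarrow> norm (G g - S g) \<le> e * q g"
proof -
  note Wd = fun_subspaceD[OF W] and D1d = fun_subspaceD[OF D1(1)] and D2d = fun_subspaceD[OF D2]
  have D1W: "g \<in> W" if "g \<in> D1" for g using D1(2) that by blast
  define B where "B h g f = Re (S g) + e * q g + C * q (\<lambda>x. h x - g x - A f x) + Re (T f)" for h g f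
  define Q where "Q h = (INF (g, f)\<in>D1 \<times> D2. B h g f)" for h
  have hgf: "(\<lambda>x. h x - g x - A f x) \<in> W" if "h \<in> W" "g \<in> D1" "f \<in> D2" for h g f
    using Wd(5)[OF Wd(5)[OF that(1) D1W[OF that(2)]] A(1)[OF that(3)]] by simp
  \<comment> \<open>\<open>le\<close> is used for \<open>- f\<close>; the triangle inequality then
    exchanges \<open>- A f - g\<close> for \<open>h - g - A f\<close> at the cost of
    \<open>q h\<close>.\<close>
  have lb: "- (C * q h) \<le> B h g f" if h: "h \<in> W" and g: "g \<in> D1" and f: "f \<in> D2" for h g f
  proof -
    have mf: "(\<lambda>x. -1 * f x) \<in> D2" by (intro D2d f)
    have Am: "A (\<lambda>x. -1 * f x) = (\<lambda>x. -1 * A f x)" by (rule A(3)[OF f])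
    have Tm: "T (\<lambda>x. -1 * f x) = -1 * T f" by (rule clinear_onD(2)[OF T f])
    have 1: "- Re (T f) - Re (S g) \<le> e * q g + C * q (\<lambda>x. -1 * A f x - g x)"
      using le[OF mf g] unfolding Am Tm by simp
    have "(\<lambda>x. -1 * A f x - g x) = (\<lambda>x. (h x - g x - A f x) + (-1) * h x)" by auto
    then have "q (\<lambda>x. -1 * A f x - g x) \<le> q (\<lambda>x. h x - g x - A f x) + q (\<lambda>x. (-1) * h x)"
      using seminorm_onD(2)[OF q hgf[OF h g f] Wd(3)[OF h, of "-1"]] by simp
    also have "q (\<lambda>x. (-1) * h x) = q h" using seminorm_onD(3)[OF q h, of "-1"] by simp
    finally have "C * q (\<lambda>x. -1 * A f x - g x) \<le> C * q (\<lambda>x. h x - g x - A f x) + C * q h"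
      using mult_left_mono[OF _ C(1)] by (simp add: distrib_left[symmetric])
    with 1 show ?thesis by (simp add: B_def)
  qed
  have bd: "bdd_below ((\<lambda>(g, f). B h g f) ` (D1 \<times> D2))" if "h \<in> W" for h
    using lb[OF that] by (intro bdd_belowI2[of _ "- (C * q h)"]) auto
  have Ql: "Q h \<le> B h g f" if "h \<in> W" "g \<in> D1" "f \<in> D2" for h g f
    unfolding Q_def using cINF_lower[OF bd[OF that(1)], of "(g, f)"] that by simp
  have ne: "D1 \<times> D2 \<noteq> {}" using D1d(1) D2d(1) by blast
  have Qg: "z \<le> Q h" if "\<And>g f. g \<in> D1 \<Longrightarrow> f \<in> D2 \<Longrightarrow> z \<le> B h g f" for z h
    unfolding Q_def by (rule cINF_greatest[OF ne]) (use that in auto)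
  have "sublinear_on W Q"
    unfolding sublinear_on_def
  proof (intro conjI ballI allI impI)
    fix h k assume h: "h \<in> W" and k: "k \<in> W"
    have *: "Q (\<lambda>x. h x + k x) \<le> B h g f + B k g' f'" if g: "g \<in> D1" "g' \<in> D1" and f: "f \<in> D2" "f' \<in> D2" for g g' f f'
    proof -
      have "Q (\<lambda>x. h x + k x) \<le> B (\<lambda>x. h x + k x) (\<lambda>x. g x + g' x) (\<lambda>x. f x + f' x)"
        by (intro Ql Wd h k D1d D2d g f)
      also have "\<dots> \<le> B h g f + B k g' f'"
      proof -
        have 1: "S (\<lambda>x. g x + g' x) = S g + S g'" by (rule clinear_onD(1)[OF S g])
        have 2: "T (\<lambda>x. f x + f' x) = T f + T f'" by (rule clinear_onD(1)[OF T f])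
        have 3: "e * q (\<lambda>x. g x + g' x) \<le> e * q g + e * q g'"
          using mult_left_mono[OF seminorm_onD(2)[OF q D1W[OF g(1)] D1W[OF g(2)]] C(2)] by (simp add: distrib_left)
        have "(\<lambda>x. h x + k x - (g x + g' x) - A (\<lambda>x. f x + f' x) x) = (\<lambda>x. (h x - g x - A f x) + (k x - g' x - A f' x))"
          by (auto simp: A(2)[OF f])
        then have "C * q (\<lambda>x. h x + k x - (g x + g' x) - A (\<lambda>x. f x + f' x) x) \<le> C * q (\<lambda>x. h x - g x - A f x) + C * q (\<lambda>x. k x - g' x - A f' x)"
          using mult_left_mono[OF seminorm_onD(2)[OF q hgf[OF h g(1) f(1)] hgf[OF k g(2) f(2)]] C(1)] by (simp add: distrib_left)
        then show ?thesis using 1 2 3 by (simp add: B_def)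
      qed
      finally show ?thesis .
    qed
    have "Q (\<lambda>x. h x + k x) - B k g' f' \<le> Q h" if "g' \<in> D1" "f' \<in> D2" for g' f'
      by (rule Qg) (use * that in \<open>simp add: diff_le_eq\<close>)
    then have "Q (\<lambda>x. h x + k x) - Q h \<le> Q k" by (intro Qg) (simp add: diff_le_eq add.commute)
    then show "Q (\<lambda>x. h x + k x) \<le> Q h + Q k" by simp
  next
    fix c :: real and h assume c: "c > 0" and h: "h \<in> W"
    have "Q (\<lambda>x. complex_of_real c * h x) / c \<le> Q h"
    proof (rule Qg)
      fix g f assume g: "g \<in> D1" and f: "f \<in> D2"
      have "Q (\<lambda>x. complex_of_real c * h x) \<le> B (\<lambda>x. complex_of_real c * h x) (\<lambda>x. complex_of_real c * g x) (\<lambda>x. complex_of_real c * f x)"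
        by (intro Ql Wd h D1d D2d g f)
      also have "\<dots> = c * B h g f"
      proof -
        have "(\<lambda>x. complex_of_real c * h x - complex_of_real c * g x - A (\<lambda>x. complex_of_real c * f x) x) = (\<lambda>x. complex_of_real c * (h x - g x - A f x))"
          by (simp only: A(3)[OF f]) (simp add: algebra_simps)
        then have 1: "q (\<lambda>x. complex_of_real c * h x - complex_of_real c * g x - A (\<lambda>x. complex_of_real c * f x) x) = c * q (\<lambda>x. h x - g x - A f x)"
          using seminorm_onD(3)[OF q hgf[OF h g f], of "complex_of_real c"] c by (simp only: norm_of_real abs_of_pos)
        have 2: "q (\<lambda>x. complex_of_real c * g x) = c * q g"
          using seminorm_onD(3)[OF q D1W[OF g], of "complex_of_real c"] c by (simp only: norm_of_real abs_of_pos)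
        show ?thesis
          unfolding B_def 1 2 clinear_onD(2)[OF S g] clinear_onD(2)[OF T f] by (simp add: algebra_simps)
      qed
      finally show "Q (\<lambda>x. complex_of_real c * h x) / c \<le> B h g f" using c by (simp add: field_simps)
    qed
    then show "Q (\<lambda>x. complex_of_real c * h x) \<le> c * Q h" using c by (simp add: field_simps)
  qed
  then obtain F where F: "\<And>f g. f \<in> W \<Longrightarrow> g \<in> W \<Longrightarrow> F (\<lambda>x. f x + g x) = F f + F g"
    "\<And>f c. f \<in> W \<Longrightarrow> F (\<lambda>x. complex_of_real c * f x) = c * F f" "\<And>f. f \<in> W \<Longrightarrow> F f \<le> Q f"
    using hahn_banach_sublinear[OF W] by blast
  \<comment> \<open>The complex linear functional with real part \<open>F\<close>.\<close>
  define G where "G f = complex_of_real (F f) - \<i> * complex_of_real (F (\<lambda>x. \<i> * f x))" for f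
  have ReG: "Re (G f) = F f" for f by (simp add: G_def)
  have Gadd: "G (\<lambda>x. f x + g x) = G f + G g" if f: "f \<in> W" and g: "g \<in> W" for f g
    using F(1)[OF f g] F(1)[OF Wd(3)[OF f, of \<i>] Wd(3)[OF g, of \<i>]] by (simp add: G_def algebra_simps)
  have Gr: "G (\<lambda>x. complex_of_real c * f x) = complex_of_real c * G f" if f: "f \<in> W" for f c
  proof -
    have "(\<lambda>x. \<i> * (complex_of_real c * f x)) = (\<lambda>x. complex_of_real c * (\<i> * f x))" by (rule ext) (rule mult.left_commute)
    then have 1: "F (\<lambda>x. \<i> * (complex_of_real c * f x)) = c * F (\<lambda>x. \<i> * f x)" using F(2)[OF Wd(3)[OF f, of \<i>], of c] by simp
    show ?thesis unfolding G_def 1 F(2)[OF f] by (simp add: right_diff_distrib)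
  qed
  have Gi: "G (\<lambda>x. \<i> * f x) = \<i> * G f" if f: "f \<in> W" for f
  proof -
    have "F (\<lambda>x. \<i> * (\<i> * f x)) = - F f" using F(2)[OF f, of "-1"] by (simp add: mult.assoc[symmetric])
    then show ?thesis by (simp add: G_def right_diff_distrib mult.assoc[symmetric])
  qed
  have Gc: "G (\<lambda>x. c * f x) = c * G f" if f: "f \<in> W" for f c
  proof -
    have "(\<lambda>x. c * f x) = (\<lambda>x. complex_of_real (Re c) * f x + \<i> * (complex_of_real (Im c) * f x))"
      by (rule ext, subst complex_eq[of c]) (simp add: distrib_right mult.assoc)
    then have "G (\<lambda>x. c * f x) = G (\<lambda>x. complex_of_real (Re c) * f x) + G (\<lambda>x. \<i> * (complex_of_real (Im c) * f x))"
      using Gadd[OF Wd(3)[OF f, of "complex_of_real (Re c)"] Wd(3)[OF Wd(3)[OF f, of "complex_of_real (Im c)"], of \<i>]] by simp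
    also have "\<dots> = complex_of_real (Re c) * G f + \<i> * (complex_of_real (Im c) * G f)"
      by (simp only: Gr[OF f] Gi[OF Wd(3)[OF f]])
    also have "\<dots> = (complex_of_real (Re c) + \<i> * complex_of_real (Im c)) * G f" by (simp add: distrib_right mult.assoc)
    also have "\<dots> = c * G f" by (simp only: complex_eq[symmetric])
    finally show ?thesis .
  qed
  have GL: "clinear_on W G" using Gadd Gc by (auto simp: clinear_on_def)
  have q0: "q (\<lambda>x. 0) = 0" using seminorm_onD(3)[OF q Wd(1), of 0] by simp
  have S0: "S (\<lambda>x. 0) = 0" and T0: "T (\<lambda>x. 0) = 0" using clinear_zero[OF S D1(1)] clinear_zero[OF T D2] by auto
  have A0: "A (\<lambda>x. 0) = (\<lambda>x. 0)" using A(3)[OF D2d(1), of 0] by simp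
  have "Re (G f) \<le> C * q f" if f: "f \<in> W" for f
    using F(3)[OF f] Ql[OF f D1d(1) D2d(1)] by (simp add: B_def q0 S0 T0 A0 ReG)
  then have Gb: "norm (G f) \<le> C * q f" if "f \<in> W" for f using norm_le_if_Re_le[OF W q GL] that by blast
  have FA: "F (A f) = Re (T f)" if f: "f \<in> D2" for f
  proof -
    have 1: "F (A f) \<le> Re (T f)" if f: "f \<in> D2" for f
      using F(3)[OF A(1)[OF f]] Ql[OF A(1)[OF f] D1d(1) f] by (simp add: B_def q0 S0)
    have 2: "F (A (\<lambda>x. -1 * f x)) \<le> Re (T (\<lambda>x. -1 * f x))" by (intro 1 D2d f)
    have 3: "F (\<lambda>x. -1 * A f x) = - F (A f)" using F(2)[OF A(1)[OF f], of "-1"] by simp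
    have "- F (A f) \<le> - Re (T f)"
      using 2 unfolding A(3)[OF f, of "-1"] clinear_onD(2)[OF T f, of "-1"] 3 by simp
    then show ?thesis using 1[OF f] by simp
  qed
  have GA: "G (A f) = T f" if f: "f \<in> D2" for f
  proof -
    have "F (\<lambda>x. \<i> * A f x) = Re (\<i> * T f)"
      using FA[OF D2d(3)[OF f, of \<i>]] by (simp only: A(3)[OF f] clinear_onD(2)[OF T f])
    then show ?thesis unfolding G_def FA[OF f] by (simp add: complex_eq_iff)
  qed
  have GS: "norm (G g - S g) \<le> e * q g" if g: "g \<in> D1" for g
  proof (rule norm_le_if_Re_le[where H="\<lambda>g. G g - S g", OF D1(1) _ _ _ g])
    show "seminorm_on D1 q" using q D1W by (auto simp: seminorm_on_def)
    show "clinear_on D1 (\<lambda>g. G g - S g)"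
      using clinear_onD[OF GL D1W] clinear_onD[OF S] D1W by (auto simp: clinear_on_def algebra_simps)
    fix h assume h: "h \<in> D1"
    have "F h \<le> B h h (\<lambda>x. 0)" using F(3)[OF D1W[OF h]] Ql[OF D1W[OF h] h D2d(1)] by simp
    then show "Re (G h - S h) \<le> e * q h" by (simp add: B_def A0 q0 T0 ReG)
  qed
  show ?thesis using that[OF GL Gb GA GS] .
qed

text \<open>Used with \<open>Q\<close> the square of a Hilbert seminorm: by the parallelogram law the conclusion then
  says that the sequence is Cauchy, which replaces weak compactness arguments.\<close>

lemma minimizing_sequence:
  fixes E :: "nat \<Rightarrow> 'a set" and Q :: "'a \<Rightarrow> real"
  assumes ne: "\<And>j. E j \<noteq> {}" and dec: "\<And>j k. j \<le> k \<Longrightarrow> E k \<subseteq> E j"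
    and mid: "\<And>j x y. x \<in> E j \<Longrightarrow> y \<in> E j \<Longrightarrow> mid x y \<in> E j"
    and Q: "\<And>x. 0 \<le> Q x" "\<And>x. x \<in> E 0 \<Longrightarrow> Q x \<le> B"
  obtains s where "\<And>j. s j \<in> E j"
    "\<And>e. e > 0 \<Longrightarrow> \<exists>N. \<forall>m\<ge>N. \<forall>l\<ge>N. 2 * Q (s m) + 2 * Q (s l) - 4 * Q (mid (s m) (s l)) < e"
proof -
  define d where "d j = Inf (Q ` E j)" for j
  have bd: "bdd_below (Q ` E j)" for j using Q(1) by (intro bdd_belowI2[of _ 0]) auto
  have dl: "d j \<le> Q x" if "x \<in> E j" for j x unfolding d_def using that by (intro cInf_lower bd) auto
  have "\<exists>x\<in>E j. Q x < d j + inverse (real (Suc j))" for j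
  proof -
    have "Inf (Q ` E j) < d j + inverse (real (Suc j))" by (simp add: d_def)
    then show ?thesis using cInf_less_iff[of "Q ` E j"] bd ne[of j] by auto
  qed
  then obtain s where s: "\<And>j. s j \<in> E j" "\<And>j. Q (s j) < d j + inverse (real (Suc j))" by metis
  have inc: "incseq d"
    unfolding d_def by (intro incseq_SucI cInf_superset_mono bd image_mono dec) (use ne in auto)
  have dB: "d j \<le> B" for j
  proof -
    have "s j \<in> E 0" using s(1) dec[of 0 j] by blast
    then show ?thesis using dl[OF s(1)] Q(2) order_trans by blast
  qed
  obtain D where D: "d \<longlonglongrightarrow> D" "\<And>j. d j \<le> D"
    using incseq_convergent[OF inc, of B] dB by blast
  have "\<exists>N. \<forall>m\<ge>N. \<forall>l\<ge>N. 2 * Q (s m) + 2 * Q (s l) - 4 * Q (mid (s m) (s l)) < e" if e: "e > 0" for e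
  proof -
    have ev1: "\<forall>\<^sub>F N in sequentially. D - e / 8 < d N" by (rule order_tendstoD(1)[OF D(1)]) (use e in simp)
    have ev2: "\<forall>\<^sub>F N in sequentially. inverse (real (Suc N)) < e / 8"
      by (rule order_tendstoD(2)[OF LIMSEQ_inverse_real_of_nat]) (use e in simp)
    obtain N where N: "D - e / 8 < d N" "inverse (real (Suc N)) < e / 8"
      using eventually_happens'[OF sequentially_bot eventually_conj[OF ev1 ev2]] by blast
    have "2 * Q (s m) + 2 * Q (s l) - 4 * Q (mid (s m) (s l)) < e" if "m \<ge> N" "l \<ge> N" for m l
    proof -
      have "mid (s m) (s l) \<in> E N" using s(1) dec[OF that(1)] dec[OF that(2)] by (intro mid) auto
      then have "d N \<le> Q (mid (s m) (s l))" by (rule dl)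
      moreover have "inverse (real (Suc m)) \<le> inverse (real (Suc N))" "inverse (real (Suc l)) \<le> inverse (real (Suc N))"
        using that by (auto intro!: le_imp_inverse_le)
      ultimately show ?thesis using s(2)[of m] s(2)[of l] D(2)[of m] D(2)[of l] N by linarith
    qed
    then show ?thesis by blast
  qed
  with s(1) show ?thesis by (rule that)
qed

section \<open>Cauchy sequences of test functions\<close>

lemma qcauchy_image:
  assumes "qcauchy L c F" and C: "C \<ge> 0"
    and le: "\<And>m l. qnorm L b (\<lambda>x. G m x - G l x) \<le> C * qnorm L c (\<lambda>x. F m x - F l x)"
  shows "qcauchy L b G"
  unfolding qcauchy_def
proof (intro allI impI)
  fix e :: real assume e: "e > 0"
  have "e / (C + 1) > 0" using e C by simp
  then obtain N where N: "\<And>m l. m \<ge> N \<Longrightarrow> l \<ge> N \<Longrightarrow> qnorm L c (\<lambda>x. F m x - F l x) < e / (C + 1)"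
    using assms(1) unfolding qcauchy_def by blast
  have "qnorm L b (\<lambda>x. G m x - G l x) < e" if "m \<ge> N" "l \<ge> N" for m l
  proof -
    have "qnorm L b (\<lambda>x. G m x - G l x) \<le> (C + 1) * qnorm L c (\<lambda>x. F m x - F l x)"
      by (rule order_trans[OF le]) (simp add: mult_right_mono qnorm_nonneg)
    also have "\<dots> < e" using N[OF that] C by (simp add: pos_less_divide_eq mult.commute)
    finally show ?thesis .
  qed
  then show "\<exists>N. \<forall>m\<ge>N. \<forall>l\<ge>N. qnorm L b (\<lambda>x. G m x - G l x) < e" by blast
qed

lemma qcauchy_add:
  assumes K: "compact K" and b: "b > 0" and F: "\<And>m. F m \<in> smooth_in K" "qcauchy L b F"
    and G: "\<And>m. G m \<in> smooth_in K" "qcauchy L b G"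
  shows "qcauchy L b (\<lambda>m x. F m x + G m x)"
  unfolding qcauchy_def
proof (intro allI impI)
  fix e :: real assume "e > 0"
  then have e2: "e / 2 > 0" by simp
  obtain N where N: "\<And>m l. m \<ge> N \<Longrightarrow> l \<ge> N \<Longrightarrow> qnorm L b (\<lambda>x. F m x - F l x) < e / 2"
    using F(2) e2 unfolding qcauchy_def by blast
  obtain M where M: "\<And>m l. m \<ge> M \<Longrightarrow> l \<ge> M \<Longrightarrow> qnorm L b (\<lambda>x. G m x - G l x) < e / 2"
    using G(2) e2 unfolding qcauchy_def by blast
  have "qnorm L b (\<lambda>x. F m x + G m x - (F l x + G l x)) < e" if "m \<ge> max N M" "l \<ge> max N M" for m l
  proof -
    have "(\<lambda>x. F m x + G m x - (F l x + G l x)) = (\<lambda>x. (F m x - F l x) + (G m x - G l x))" by auto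
    then have "qnorm L b (\<lambda>x. F m x + G m x - (F l x + G l x)) \<le> qnorm L b (\<lambda>x. F m x - F l x) + qnorm L b (\<lambda>x. G m x - G l x)"
      using qnorm_add[OF K smooth_in_diff[OF F(1) F(1)] smooth_in_diff[OF G(1) G(1)] b, of L m l m l] by simp
    also have "\<dots> < e" using N[of m l] M[of m l] that by simp
    finally show ?thesis .
  qed
  then show "\<exists>N. \<forall>m\<ge>N. \<forall>l\<ge>N. qnorm L b (\<lambda>x. F m x + G m x - (F l x + G l x)) < e" by blast
qed

lemma qcauchy_mult:
  assumes K: "compact K" and b: "b > 0" and F: "\<And>m. F m \<in> smooth_in K" "qcauchy L b F" and g: "smooth g"
  shows "qcauchy L b (\<lambda>m x. g x * F m x)"
proof -
  obtain C where C: "C \<ge> 0" "\<And>f. f \<in> smooth_in K \<Longrightarrow> qnorm L b (\<lambda>x. g x * f x) \<le> C * qnorm L b f"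
    using qnorm_mult[OF K g b] by blast
  show ?thesis
  proof (rule qcauchy_image[OF F(2) C(1)])
    show "qnorm L b (\<lambda>x. g x * F m x - g x * F l x) \<le> C * qnorm L b (\<lambda>x. F m x - F l x)" for m l
      using C(2)[OF smooth_in_diff[OF F(1) F(1)], of m l] by (simp add: right_diff_distrib)
  qed
qed

lemma qcauchy_zero: "qcauchy L b (\<lambda>m x. 0)"
  by (simp add: qcauchy_def)

lemma qcauchy_sum:
  assumes K: "compact K" and b: "b > 0"
    and F: "\<And>a m. a \<in> A \<Longrightarrow> F a m \<in> smooth_in K" "\<And>a. a \<in> A \<Longrightarrow> qcauchy L b (F a)"
  shows "qcauchy L b (\<lambda>m x. \<Sum>a\<in>A. F a m x)"
  using F
proof (induction A rule: infinite_finite_induct)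
  case (insert a A)
  have "qcauchy L b (\<lambda>m x. F a m x + (\<Sum>a\<in>A. F a m x))"
    by (rule qcauchy_add[OF K b]) (use insert in \<open>auto intro: smooth_in_sum\<close>)
  with insert show ?case by simp
qed (auto simp: qcauchy_zero)

lemma qcauchy_uniform:
  fixes K :: "(real^'n::finite) set"
  assumes K: "compact K" and b: "0 < b" "b < 1" and F: "\<And>m. F m \<in> smooth_in K" "qcauchy L b F"
    and w: "length w + CARD('n) \<le> L"
  shows "\<exists>f. uniform_limit UNIV (\<lambda>m. fold partial_deriv w (F m)) f sequentially"
proof -
  obtain C where C: "C \<ge> 0" "\<And>f x. f \<in> smooth_in K \<Longrightarrow> norm (fold partial_deriv w f x) \<le> C * qnorm L b f"
    using sup_le_qnorm[OF K b, of L] w by blast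
  have "uniformly_Cauchy_on UNIV (\<lambda>m. fold partial_deriv w (F m))"
    unfolding uniformly_Cauchy_on_def
  proof (intro allI impI)
    fix e :: real assume e: "e > 0"
    have "e / (C + 1) > 0" using e C(1) by simp
    then obtain N where N: "\<And>m l. m \<ge> N \<Longrightarrow> l \<ge> N \<Longrightarrow> qnorm L b (\<lambda>x. F m x - F l x) < e / (C + 1)"
      using F(2) unfolding qcauchy_def by blast
    have "dist (fold partial_deriv w (F m) x) (fold partial_deriv w (F l) x) < e" if "m \<ge> N" "l \<ge> N" for m l x
    proof -
      have "dist (fold partial_deriv w (F m) x) (fold partial_deriv w (F l) x) = norm (fold partial_deriv w (\<lambda>x. F m x - F l x) x)"
        using fold_partial_deriv_diff[OF smooth_inD(1)[OF F(1)] smooth_inD(1)[OF F(1)], of w m l] by (simp add: dist_norm)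
      also have "\<dots> \<le> C * qnorm L b (\<lambda>x. F m x - F l x)" by (intro C(2) smooth_in_diff F)
      also have "\<dots> \<le> (C + 1) * qnorm L b (\<lambda>x. F m x - F l x)" by (simp add: mult_right_mono qnorm_nonneg)
      also have "\<dots> < e" using N[OF that] C(1) by (simp add: pos_less_divide_eq mult.commute)
      finally show ?thesis .
    qed
    then show "\<exists>M. \<forall>x\<in>UNIV. \<forall>m\<ge>M. \<forall>n\<ge>M. dist (fold partial_deriv w (F m) x) (fold partial_deriv w (F n) x) < e" by blast
  qed
  then show ?thesis
    using Cauchy_uniformly_convergent unfolding uniformly_convergent_on_def by blast
qed

text \<open>The Cauchy property for P alone would not survive a cutoff, since the Leibniz rule
  produces Hasse derivatives. Demanded for the whole \<open>hasse_closure\<close>, it does.\<close>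

definition tame :: "(real^'n::finite) set \<Rightarrow> nat \<Rightarrow> real \<Rightarrow> 'n lpoly \<Rightarrow> (nat \<Rightarrow> real^'n \<Rightarrow> complex) \<Rightarrow> bool" where
  "tame K L b P F \<longleftrightarrow> (\<forall>m. F m \<in> smooth_in K) \<and>
     (\<forall>Q\<in>hasse_closure P. qcauchy L b (\<lambda>m. theta_poly (\<lambda>_. 0) Q (F m)))"

text \<open>Supplies the iterates that \<open>theta_poly_leibniz\<close> asks for. They remain
  independent of the other coordinates because mixed partial derivatives commute.\<close>

lemma leibniz_sequence:
  assumes G: "smooth1 G"
  obtains D :: "nat \<Rightarrow> real^'n::finite \<Rightarrow> complex" where "D 0 = (\<lambda>x. complex_of_real (G (x $ j)))" "\<And>n. smooth (D n)"
    "\<And>n i x. i \<noteq> j \<Longrightarrow> partial_deriv i (D n) x = 0"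
    "\<And>n x. D (Suc n) x = - complex_of_real (x $ j) * partial_deriv j (D n) x"
proof -
  define D where "D n = ((\<lambda>(h :: real^'n \<Rightarrow> complex) x. - complex_of_real (x $ j) * partial_deriv j h x) ^^ n) (\<lambda>x. complex_of_real (G (x $ j)))" for n
  have DS: "D (Suc n) = (\<lambda>x. - (complex_of_real (x $ j) * partial_deriv j (D n) x))" for n
    by (simp add: D_def)
  have sD: "smooth (D n)" for n
  proof (induction n)
    case 0
    show ?case using smooth_coord_fun[OF G, of j] by (simp add: D_def)
  next
    case (Suc n)
    then show ?case unfolding DS by (intro smooth_uminus smooth_mult smooth_coord smooth_partial_deriv)
  qed
  have zD: "partial_deriv i (D n) = (\<lambda>x. 0)" if "i \<noteq> j" for i n
  proof (induction n)
    case 0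
    from G obtain G' where "\<And>t. (G has_real_derivative G' t) (at t)" by (meson smooth1.cases)
    from partial_deriv_coord_fun[OF this, of i j] show ?case using that by (simp add: D_def)
  next
    case (Suc n)
    have "partial_deriv i (partial_deriv j (D n)) = (\<lambda>x. 0)"
      using partial_deriv_commute[OF sD[of n], of i j] Suc by simp
    then show ?case unfolding DS using that
      by (simp add: partial_deriv_uminus partial_deriv_mult smooth_mult smooth_coord smooth_partial_deriv sD partial_deriv_coord)
  qed
  show ?thesis by (rule that[of D]) (use sD zD DS in \<open>auto simp: D_def\<close>)
qed

lemma tame_coord_alg:
  fixes K :: "(real^'n::finite) set"
  assumes K: "compact K" and b: "b > 0"
  shows "\<kappa> \<in> coord_alg \<Longrightarrow> tame K L b P F \<Longrightarrow> tame K L b P (\<lambda>m x. \<kappa> x * F m x)"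
proof (induction arbitrary: F rule: coord_alg.induct)
  case (const c)
  then show ?case unfolding tame_def
    by (auto intro!: smooth_in_cmult smooth_in_theta_poly compact_imp_closed[OF K] qcauchy_mult[OF K b _ _ smooth_const]
        simp: theta_poly_cmult[OF smooth_inD(1)[of _ K]])
next
  case (coord_fun G j)
  obtain D :: "nat \<Rightarrow> real^'n \<Rightarrow> complex" where D: "D 0 = (\<lambda>x. complex_of_real (G (x $ j)))" "\<And>n. smooth (D n)"
    "\<And>n i x. i \<noteq> j \<Longrightarrow> partial_deriv i (D n) x = 0"
    "\<And>n x. D (Suc n) x = - complex_of_real (x $ j) * partial_deriv j (D n) x"
    using leibniz_sequence[OF coord_fun(1)] by metis
  have FK: "F m \<in> smooth_in K" for m using coord_fun(2) by (simp add: tame_def)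
  have Fq: "qcauchy L b (\<lambda>m. theta_poly (\<lambda>_. 0) Q (F m))" if "Q \<in> hasse_closure P" for Q
    using coord_fun(2) that by (simp add: tame_def)
  have TK: "theta_poly (\<lambda>_. 0) Q (F m) \<in> smooth_in K" for Q m
    by (intro smooth_in_theta_poly compact_imp_closed K FK)
  have "qcauchy L b (\<lambda>m. theta_poly (\<lambda>_. 0) Q (\<lambda>x. D 0 x * F m x))" if Q: "Q \<in> hasse_closure P" for Q
  proof -
    have e: "theta_poly (\<lambda>_. 0) Q (\<lambda>x. D 0 x * F m x) = (\<lambda>x. \<Sum>n\<le>lpoly_degree j Q. D n x * theta_poly (\<lambda>_. 0) (hasse j n Q) (F m) x)" for m
      by (rule theta_poly_leibniz[where G=D, OF D(2) smooth_inD(1)[OF FK] D(3) D(4) order_refl])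
    show ?thesis unfolding e
      by (intro qcauchy_sum[OF K b] smooth_in_mult D(2) TK qcauchy_mult[OF K b] Fq hasse_closure.step Q)
  qed
  moreover have "(\<lambda>x. D 0 x * F m x) \<in> smooth_in K" for m by (rule smooth_in_mult[OF D(2) FK])
  ultimately show ?case unfolding tame_def D(1) by blast
next
  case (add f g)
  have "tame K L b P (\<lambda>m x. f x * F m x)" "tame K L b P (\<lambda>m x. g x * F m x)" using add by auto
  then have 1: "\<And>m. (\<lambda>x. f x * F m x) \<in> smooth_in K" "\<And>m. (\<lambda>x. g x * F m x) \<in> smooth_in K"
    "\<And>Q. Q \<in> hasse_closure P \<Longrightarrow> qcauchy L b (\<lambda>m. theta_poly (\<lambda>_. 0) Q (\<lambda>x. f x * F m x))"
    "\<And>Q. Q \<in> hasse_closure P \<Longrightarrow> qcauchy L b (\<lambda>m. theta_poly (\<lambda>_. 0) Q (\<lambda>x. g x * F m x))"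
    by (auto simp: tame_def)
  have "qcauchy L b (\<lambda>m x. theta_poly (\<lambda>_. 0) Q (\<lambda>x. f x * F m x) x + theta_poly (\<lambda>_. 0) Q (\<lambda>x. g x * F m x) x)"
    if "Q \<in> hasse_closure P" for Q
    by (intro qcauchy_add[OF K b] smooth_in_theta_poly compact_imp_closed K 1 that)
  then have "qcauchy L b (\<lambda>m. theta_poly (\<lambda>_. 0) Q (\<lambda>x. f x * F m x + g x * F m x))" if "Q \<in> hasse_closure P" for Q
    using that by (simp add: theta_poly_add[OF smooth_inD(1)[OF 1(1)] smooth_inD(1)[OF 1(2)]])
  then show ?case using 1 unfolding tame_def by (auto simp: distrib_right intro: smooth_in_add)
next
  case (mult f g)
  from mult(3)[OF mult(4)[OF mult(5)]] show ?case by (simp add: mult.assoc)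
qed

section \<open>The approximation step\<close>

text \<open>In the application \<open>\<omega>1\<close>, \<open>\<omega>2\<close>,
  \<open>\<omega>3\<close> are consecutive sets of the exhaustion and \<open>\<omega>\<close> is
  what convexity assigns to \<open>\<omega>1\<close>. The estimate is exactly the hypothesis of
  \<open>sandwich_extension\<close>. Two exponents occur because control of \<open>A f\<close> in
  the exponent \<open>c\<close> controls \<open>f\<close> only in a larger exponent
  \<open>b\<close>, the one in which \<open>S\<close> and \<open>T\<close> are bounded.\<close>

lemma approximation_estimate:
  fixes P :: "(('n::finite \<Rightarrow>\<^sub>0 nat) \<Rightarrow>\<^sub>0 complex)" and \<omega>1 \<omega>2 \<omega>3 \<omega> :: "(real^'n) set"
  defines "A \<equiv> theta_poly (\<lambda>_. 0) (lpoly_of P)"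
  assumes P: "P \<noteq> 0" and \<omega>3: "compact (closure \<omega>3)" and sub: "\<omega>1 \<subseteq> \<omega>2" "\<omega>2 \<subseteq> \<omega>3"
    and cw: "compact (closure \<omega>1)"
    and \<omega>: "compact (closure \<omega>)" "closure \<omega> \<subseteq> \<omega>2" and o2: "open \<omega>2"
    and conv: "\<And>f g. f \<in> sobolev0 1 \<omega>3 \<Longrightarrow> g \<in> sobolev0 1 \<omega>1 \<Longrightarrow>
        dist_eq_on UNIV (euler_op_transpose P (dist_of f)) (dist_of g) \<Longrightarrow> f \<in> sobolev0 1 \<omega>"
    and bc: "0 < c" "c < b" "b < 1" and L: "CARD('n) + 1 \<le> L"
    and S: "linear_on_test_functions \<omega>2 S" "\<And>f. f \<in> test_functions \<omega>2 \<Longrightarrow> norm (S f) \<le> C1 * qnorm L b f"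
      "\<And>f. f \<in> test_functions \<omega>2 \<Longrightarrow> S (A f) = T f"
    and T: "linear_on_test_functions \<omega>3 T" "\<And>f. f \<in> test_functions \<omega>3 \<Longrightarrow> norm (T f) \<le> C2 * qnorm L b f"
    and e: "e > 0"
  shows "\<exists>C\<ge>0. \<forall>f\<in>test_functions \<omega>3. \<forall>g\<in>test_functions \<omega>1.
     Re (T f) - Re (S g) \<le> e * qnorm L c g + C * qnorm L c (\<lambda>x. A f x - g x)"
proof (rule ccontr)
  assume neg: "\<not> ?thesis"
  define K where "K = closure \<omega>3"
  have K: "compact K" and cl: "closed K" using \<omega>3 by (auto simp: K_def)
  have inK: "f \<in> smooth_in K" if "f \<in> test_functions U" "U \<subseteq> \<omega>3" for f U
    using that closure_subset[of \<omega>3] unfolding K_def by (intro test_functions_smooth_in[of f U]) auto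
  have inK3: "f \<in> smooth_in K" if "f \<in> test_functions \<omega>3" for f using inK[OF that] by simp
  have inK1: "f \<in> smooth_in K" if "f \<in> test_functions \<omega>1" for f using inK[OF that] sub by simp
  have AK: "A f \<in> smooth_in K" if "f \<in> smooth_in K" for f unfolding A_def by (intro smooth_in_theta_poly cl that)
  have b0: "0 < b" using bc by simp

  \<comment> \<open>Normalised pairs violating the estimate\<close>
  let ?q = "qnorm L c"
  \<comment> \<open>Failure of the estimate with constant \<open>Suc j\<close> gives an element of
    \<open>E j\<close> after scaling. The condition on real parts is affine and those on norms are
    convex, so midpoints stay in \<open>E j\<close>.\<close>
  define E where "E j = {(f, g). f \<in> test_functions \<omega>3 \<and> g \<in> test_functions \<omega>1 \<and> Re (T f) - Re (S g) = 1 \<and>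
      ?q g \<le> 1 / e \<and> ?q (\<lambda>x. A f x - g x) \<le> 1 / real (Suc j)}" for j
  have T12: "g \<in> test_functions \<omega>2" if "g \<in> test_functions \<omega>1" for g using test_functions_mono[OF that sub(1)] .
  have ne: "E j \<noteq> {}" for j
  proof -
    obtain f g where fg: "f \<in> test_functions \<omega>3" "g \<in> test_functions \<omega>1"
      "Re (T f) - Re (S g) > e * ?q g + real (Suc j) * ?q (\<lambda>x. A f x - g x)"
      using neg by (meson not_le of_nat_0_le_iff)
    define r where "r = Re (T f) - Re (S g)"
    have nn: "e * ?q g \<ge> 0" "real (Suc j) * ?q (\<lambda>x. A f x - g x) \<ge> 0" using e by (simp_all add: qnorm_nonneg)
    then have r: "r > 0" "e * ?q g \<le> r" "real (Suc j) * ?q (\<lambda>x. A f x - g x) \<le> r" using fg(3) by (auto simp: r_def)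
    define f' g' where "f' = (\<lambda>x. complex_of_real (1/r) * f x)" "g' = (\<lambda>x. complex_of_real (1/r) * g x)"
    note fg' = this
    have T': "T f' = complex_of_real (1/r) * T f" unfolding fg' by (rule linear_on_test_cmult[OF T(1) fg(1)])
    have S': "S g' = complex_of_real (1/r) * S g" unfolding fg' by (rule linear_on_test_cmult[OF S(1) T12[OF fg(2)]])
    have "Re (T f') - Re (S g') = (1/r) * (Re (T f) - Re (S g))" unfolding T' S' by (simp add: diff_divide_distrib)
    also have "\<dots> = 1" using r(1) by (simp add: r_def)
    finally have 1: "Re (T f') - Re (S g') = 1" .
    have 2: "?q g' \<le> 1 / e"
    proof -
      have 3: "?q g' = ?q g / r" unfolding fg' using r(1) by (simp only: qnorm_cmult[OF test_functions_smooth[OF fg(2)]] norm_of_real) simp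
      have "?q g / r * e \<le> 1" using r by (simp add: pos_divide_le_eq mult.commute)
      then show ?thesis unfolding 3 pos_le_divide_eq[OF e] .
    qed
    have 3: "?q (\<lambda>x. A f' x - g' x) \<le> 1 / real (Suc j)"
    proof -
      have "A f' = (\<lambda>x. complex_of_real (1/r) * A f x)" unfolding A_def fg' by (rule theta_poly_cmult[OF test_functions_smooth[OF fg(1)]])
      then have "(\<lambda>x. A f' x - g' x) = (\<lambda>x. complex_of_real (1/r) * (A f x - g x))" by (simp only: fg' right_diff_distrib)
      moreover have "smooth (\<lambda>x. A f x - g x)"
        using fg unfolding A_def by (intro smooth_diff smooth_theta_poly) (auto intro: test_functions_smooth)
      ultimately have 4: "?q (\<lambda>x. A f' x - g' x) = ?q (\<lambda>x. A f x - g x) / r" using r(1) by (simp only: qnorm_cmult norm_of_real) simp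
      have "?q (\<lambda>x. A f x - g x) / r * real (Suc j) \<le> 1" using r by (simp only: times_divide_eq_left pos_divide_le_eq) (simp add: mult.commute)
      moreover have "real (Suc j) > 0" by simp
      ultimately show ?thesis unfolding 4 by (simp only: pos_le_divide_eq)
    qed
    have "f' \<in> test_functions \<omega>3" "g' \<in> test_functions \<omega>1" unfolding fg' by (intro test_functions_cmult fg)+
    then have "(f', g') \<in> E j" unfolding E_def using 1 2 3 by simp
    then show ?thesis by blast
  qed
  have dec: "E k \<subseteq> E j" if "j \<le> k" for j k
  proof -
    have "1 / real (Suc k) \<le> 1 / real (Suc j)" using that by (intro divide_left_mono) auto
    then show ?thesis unfolding E_def by (auto intro: order_trans)
  qed
  define mid where "mid p q = ((\<lambda>x. (1/2) * (fst p x + fst q x)), (\<lambda>x. (1/2) * (snd p x + snd q x)))" for p q :: "(real^'n \<Rightarrow> complex) \<times> (real^'n \<Rightarrow> complex)"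
  have midE: "mid p q \<in> E j" if "p \<in> E j" "q \<in> E j" for p q j
  proof -
    obtain f g f' g' where pq: "p = (f, g)" "q = (f', g')" by (cases p, cases q) auto
    have h: "f \<in> test_functions \<omega>3" "g \<in> test_functions \<omega>1" "f' \<in> test_functions \<omega>3" "g' \<in> test_functions \<omega>1"
      "Re (T f) - Re (S g) = 1" "Re (T f') - Re (S g') = 1" "?q g \<le> 1 / e" "?q g' \<le> 1 / e"
      "?q (\<lambda>x. A f x - g x) \<le> 1 / real (Suc j)" "?q (\<lambda>x. A f' x - g' x) \<le> 1 / real (Suc j)"
      using that unfolding pq E_def by auto
    have T': "T (\<lambda>x. (1/2) * (f x + f' x)) = (1/2) * (T f + T f')"
      using linear_on_test_cmult[OF T(1) test_functions_add[OF h(1,3)], of "1/2"] linear_on_test_add[OF T(1) h(1,3)] by simp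
    have S': "S (\<lambda>x. (1/2) * (g x + g' x)) = (1/2) * (S g + S g')"
      using linear_on_test_cmult[OF S(1) test_functions_add[OF T12[OF h(2)] T12[OF h(4)]], of "1/2"] linear_on_test_add[OF S(1) T12[OF h(2)] T12[OF h(4)]] by simp
    have half: "?q (\<lambda>x. (1/2) * (u x + v x)) \<le> z" if "u \<in> smooth_in K" "v \<in> smooth_in K" "?q u \<le> z" "?q v \<le> z" for u v z
    proof -
      have "?q (\<lambda>x. (1/2) * (u x + v x)) = (1/2) * ?q (\<lambda>x. u x + v x)"
        using qnorm_cmult[OF smooth_inD(1)[OF smooth_in_add[OF that(1,2)]], of L c "1/2"] by simp
      also have "\<dots> \<le> (1/2) * (?q u + ?q v)" using qnorm_add[OF K that(1,2) bc(1), of L] by simp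
      finally show ?thesis using that by simp
    qed
    have A': "A (\<lambda>x. (1/2) * (f x + f' x)) = (\<lambda>x. (1/2) * (A f x + A f' x))"
      unfolding A_def using test_functions_smooth[OF h(1)] test_functions_smooth[OF h(3)]
      by (simp only: theta_poly_cmult smooth_add theta_poly_add)
    have "(\<lambda>x. A (\<lambda>x. (1/2) * (f x + f' x)) x - (1/2) * (g x + g' x)) = (\<lambda>x. (1/2) * ((A f x - g x) + (A f' x - g' x)))"
      unfolding A' by (auto simp: algebra_simps)
    then have "?q (\<lambda>x. A (\<lambda>x. (1/2) * (f x + f' x)) x - (1/2) * (g x + g' x)) \<le> 1 / real (Suc j)"
      using half[OF smooth_in_diff[OF AK[OF inK3[OF h(1)]] inK1[OF h(2)]] smooth_in_diff[OF AK[OF inK3[OF h(3)]] inK1[OF h(4)]] h(9,10)] by simp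
    moreover have "?q (\<lambda>x. (1/2) * (g x + g' x)) \<le> 1 / e" by (rule half[OF inK1[OF h(2)] inK1[OF h(4)] h(7,8)])
    moreover have "Re (T (\<lambda>x. (1/2) * (f x + f' x))) - Re (S (\<lambda>x. (1/2) * (g x + g' x))) = 1"
      unfolding T' S' using h(5,6) by (simp add: field_simps)
    ultimately show ?thesis unfolding pq mid_def E_def
      using h(1-4) by (auto intro!: test_functions_cmult test_functions_add simp del: times_divide_eq_left)
  qed
  \<comment> \<open>The second components are minimised in \<open>?q\<close>. Minimality and the
    parallelogram law make them a Cauchy sequence, and with them also \<open>A (F j)\<close>, which
    differs from \<open>G j\<close> by a null sequence.\<close>
  obtain s where s: "\<And>j. s j \<in> E j"
    "\<And>\<eta>. \<eta> > 0 \<Longrightarrow> \<exists>N. \<forall>m\<ge>N. \<forall>l\<ge>N. 2 * (?q (snd (s m)))\<^sup>2 + 2 * (?q (snd (s l)))\<^sup>2 - 4 * (?q (snd (mid (s m) (s l))))\<^sup>2 < \<eta>"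
  proof (rule minimizing_sequence[of E mid "\<lambda>p. (?q (snd p))\<^sup>2" "(1/e)\<^sup>2"])
    show "\<And>x. x \<in> E 0 \<Longrightarrow> (?q (snd x))\<^sup>2 \<le> (1 / e)\<^sup>2" by (intro power_mono) (auto simp: E_def qnorm_nonneg)
  qed (use ne dec midE that in auto)
  define F G where "F j = fst (s j)" "G j = snd (s j)" for j
  have FG: "F j \<in> test_functions \<omega>3" "G j \<in> test_functions \<omega>1" "Re (T (F j)) - Re (S (G j)) = 1"
    "?q (\<lambda>x. A (F j) x - G j x) \<le> 1 / real (Suc j)" for j
    using s(1)[of j] by (auto simp: E_def F_G_def)
  have FK: "F j \<in> smooth_in K" and GK: "G j \<in> smooth_in K" for j using inK3[OF FG(1)] inK1[OF FG(2)] by auto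
  have Gc: "qcauchy L c G"
    unfolding qcauchy_def
  proof (intro allI impI)
    fix \<eta> :: real assume \<eta>: "\<eta> > 0"
    then obtain N where N: "\<And>m l. m \<ge> N \<Longrightarrow> l \<ge> N \<Longrightarrow> 2 * (?q (G m))\<^sup>2 + 2 * (?q (G l))\<^sup>2 - 4 * (?q (snd (mid (s m) (s l))))\<^sup>2 < \<eta>\<^sup>2"
      using s(2)[of "\<eta>\<^sup>2"] unfolding F_G_def by auto
    have "?q (\<lambda>x. G m x - G l x) < \<eta>" if "m \<ge> N" "l \<ge> N" for m l
    proof -
      have m: "?q (snd (mid (s m) (s l))) = (1/2) * ?q (\<lambda>x. G m x + G l x)"
        using qnorm_cmult[OF smooth_inD(1)[OF smooth_in_add[OF GK GK]], of L c "1/2" m l] by (simp add: mid_def F_G_def)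
      have "4 * (?q (snd (mid (s m) (s l))))\<^sup>2 = (?q (\<lambda>x. G m x + G l x))\<^sup>2" unfolding m by (simp only: power_mult_distrib) (simp add: power2_eq_square)
      then have "(?q (\<lambda>x. G m x - G l x))\<^sup>2 < \<eta>\<^sup>2"
        using N[OF that] qnorm_parallelogram[OF K GK GK bc(1), of L m l] by linarith
      then show ?thesis using \<eta> by (simp add: power2_less_imp_less)
    qed
    then show "\<exists>N. \<forall>m\<ge>N. \<forall>l\<ge>N. ?q (\<lambda>x. G m x - G l x) < \<eta>" by blast
  qed
  define H where "H j x = A (F j) x - G j x" for j x
  have HF: "H j = (\<lambda>x. A (F j) x - G j x)" for j by (rule ext) (simp add: H_def)
  have HK: "H j \<in> smooth_in K" for j unfolding HF by (intro smooth_in_diff AK FK GK)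
  have Hq: "(\<lambda>j. ?q (H j)) \<longlonglongrightarrow> 0"
  proof (rule tendsto_sandwich[OF _ _ tendsto_const])
    show "(\<lambda>j. 1 / real (Suc j)) \<longlonglongrightarrow> 0" using LIMSEQ_inverse_real_of_nat by (simp add: inverse_eq_divide)
  qed (use FG(4) in \<open>auto simp: qnorm_nonneg HF\<close>)
  have Hc: "qcauchy L c H"
    unfolding qcauchy_def
  proof (intro allI impI)
    fix \<eta> :: real assume "\<eta> > 0"
    then have "\<forall>\<^sub>F j in sequentially. ?q (H j) < \<eta> / 2" by (intro order_tendstoD(2)[OF Hq]) simp
    then obtain N where N: "\<And>j. j \<ge> N \<Longrightarrow> ?q (H j) < \<eta> / 2" by (auto simp: eventually_sequentially)
    have "?q (\<lambda>x. H m x - H l x) < \<eta>" if "m \<ge> N" "l \<ge> N" for m l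
      using qnorm_diff[OF K HK HK bc(1), of L m l] N[OF that(1)] N[OF that(2)] by linarith
    then show "\<exists>N. \<forall>m\<ge>N. \<forall>l\<ge>N. ?q (\<lambda>x. H m x - H l x) < \<eta>" by blast
  qed
  have AFc: "qcauchy L c (\<lambda>j. A (F j))"
    using qcauchy_add[OF K bc(1) HK Hc GK Gc] by (simp add: H_def)
  obtain Q0 c0 where Q0: "Q0 \<in> hasse_closure (lpoly_of P)" "c0 \<noteq> 0" "\<And>u f. theta_poly u Q0 f = (\<lambda>x. c0 * f x)"
    using hasse_closure_constant_lpoly_of[OF P] by metis
  have "qcauchy L b (\<lambda>m. theta_poly (\<lambda>_. 0) Q (F m))" if Q: "Q \<in> hasse_closure (lpoly_of P)" for Q
  proof -
    obtain C where C: "C \<ge> 0" "\<And>f. f \<in> smooth_in K \<Longrightarrow> qnorm L b (theta_poly (\<lambda>_. 0) Q f) \<le> C * qnorm L c (theta_poly (\<lambda>_. 0) (lpoly_of P) f)"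
      using qnorm_hasse_estimate[OF K Q bc(1,2), of L "\<lambda>_. 0"] bc(3) by auto
    show ?thesis
    proof (rule qcauchy_image[OF AFc C(1)])
      show "qnorm L b (\<lambda>x. theta_poly (\<lambda>_. 0) Q (F m) x - theta_poly (\<lambda>_. 0) Q (F l) x) \<le> C * qnorm L c (\<lambda>x. A (F m) x - A (F l) x)" for m l
        using C(2)[OF smooth_in_diff[OF FK FK], of m l] unfolding A_def
        by (simp add: theta_poly_diff[OF smooth_inD(1)[OF FK] smooth_inD(1)[OF FK]])
    qed
  qed
  then have tF: "tame K L b (lpoly_of P) F" using FK by (auto simp: tame_def)
  \<comment> \<open>The member \<open>Q0\<close> of the closure acts as the constant
    \<open>c0\<close>; dividing by it recovers the function.\<close>
  have tame_qcauchy: "qcauchy L b F'" if t: "tame K L b (lpoly_of P) F'" for F'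
  proof -
    have F'K: "F' m \<in> smooth_in K" for m using t by (simp add: tame_def)
    have "qcauchy L b (\<lambda>m x. c0 * F' m x)" using t Q0(1,3) by (auto simp: tame_def)
    from qcauchy_mult[OF K b0 smooth_in_cmult[OF F'K] this smooth_const, of "inverse c0"]
    show ?thesis using Q0(2) by (simp add: mult.assoc[symmetric])
  qed
  have Fc: "qcauchy L b F" by (rule tame_qcauchy[OF tF])
  have bb: "0 < b" "b < 1" and cc: "0 < c" "c < 1" using bc by auto
  \<comment> \<open>\<open>L\<close> exceeds the number of derivatives lost in the supremum bound by
    at least 1, so first derivatives converge uniformly too, as \<open>sobolev0_limit\<close>
    requires.\<close>
  have L0: "length ([] :: 'n list) + CARD('n) \<le> L" and L1: "length [i :: 'n] + CARD('n) \<le> L" for i using L by auto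
  obtain f where f: "uniform_limit UNIV F f sequentially" using qcauchy_uniform[OF K bb FK Fc L0] by auto
  have "\<exists>g. uniform_limit UNIV (\<lambda>m. partial_deriv i (F m)) g sequentially" for i using qcauchy_uniform[OF K bb FK Fc L1[of i]] by auto
  then obtain f1 where f1: "\<And>i. uniform_limit UNIV (\<lambda>m. partial_deriv i (F m)) (f1 i) sequentially" by metis
  obtain g where g: "uniform_limit UNIV G g sequentially" using qcauchy_uniform[OF K cc GK Gc L0] by auto
  have "\<exists>h. uniform_limit UNIV (\<lambda>m. partial_deriv i (G m)) h sequentially" for i using qcauchy_uniform[OF K cc GK Gc L1[of i]] by auto
  then obtain g1 where g1: "\<And>i. uniform_limit UNIV (\<lambda>m. partial_deriv i (G m)) (g1 i) sequentially" by metis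
  have Fcont: "continuous_on UNIV (F m)" and Gcont: "continuous_on UNIV (G m)" for m
    by (rule smooth_in_continuous[OF FK], rule smooth_in_continuous[OF GK])
  have fcont: "continuous_on UNIV f" by (rule uniform_limit_theorem[OF _ f]) (use Fcont in auto)
  have fS: "f \<in> sobolev0 1 \<omega>3" by (rule sobolev0_limit[OF \<omega>3 FG(1) f f1])
  have gS: "g \<in> sobolev0 1 \<omega>1" by (rule sobolev0_limit[OF cw FG(2) g g1])

  \<comment> \<open>The equation for the limit and its support\<close>
  have Hlim: "(\<lambda>m. LINT x|lborel. H m x * h x) \<longlonglongrightarrow> 0" if h: "h \<in> test_functions UNIV" for h
  proof -
    obtain C where C: "C \<ge> 0" "\<And>f x. f \<in> smooth_in K \<Longrightarrow> norm (f x) \<le> C * ?q f"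
      using sup_le_qnorm[OF K cc, of L] L0 by (metis fold_simps(1))
    have "uniform_limit UNIV H (\<lambda>x. 0) sequentially"
      unfolding uniform_limit_iff
    proof (intro allI impI)
      fix \<eta> :: real assume \<eta>: "\<eta> > 0"
      have "\<forall>\<^sub>F j in sequentially. ?q (H j) < \<eta> / (C + 1)" using \<eta> C(1) by (intro order_tendstoD(2)[OF Hq]) simp
      then show "\<forall>\<^sub>F j in sequentially. \<forall>x\<in>UNIV. dist (H j x) 0 < \<eta>"
      proof eventually_elim
        case (elim j)
        have "norm (H j x) < \<eta>" for x
        proof -
          have "norm (H j x) \<le> C * ?q (H j)" by (rule C(2)[OF HK])
          also have "\<dots> \<le> (C + 1) * ?q (H j)" by (simp add: mult_right_mono qnorm_nonneg)
          also have "\<dots> < \<eta>" using elim C(1) by (simp add: pos_less_divide_eq mult.commute)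
          finally show ?thesis .
        qed
        then show ?case by simp
      qed
    qed
    from uniform_limit_integral[OF this smooth_in_continuous[OF HK] h] show ?thesis by simp
  qed
  have deq: "euler_op_transpose P (dist_of f) h = dist_of g h" if h: "h \<in> test_functions UNIV" for h
  proof -
    have i: "integrable lborel (\<lambda>x. u x * h x)" if "u \<in> smooth_in K" for u
      using smooth_in_integrable[OF K smooth_in_mult[OF test_functions_smooth[OF h] that]] by (simp add: mult.commute)
    have e: "euler_op_transpose P (dist_of (F m)) h = (LINT x|lborel. H m x * h x) + (LINT x|lborel. G m x * h x)" for m
    proof -
      have "euler_op_transpose P (dist_of (F m)) h = (LINT x|lborel. A (F m) x * h x)" unfolding A_def by (rule transpose_test[OF K FK h])
      also have "\<dots> = (LINT x|lborel. H m x * h x + G m x * h x)" by (simp add: H_def left_diff_distrib)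
      also have "\<dots> = (LINT x|lborel. H m x * h x) + (LINT x|lborel. G m x * h x)" by (rule Bochner_Integration.integral_add[OF i[OF HK] i[OF GK]])
      finally show ?thesis .
    qed
    have "(\<lambda>m. euler_op_transpose P (dist_of (F m)) h) \<longlonglongrightarrow> 0 + (LINT x|lborel. g x * h x)"
      unfolding e by (intro tendsto_add Hlim h uniform_limit_integral[OF g Gcont])
    moreover have "(\<lambda>m. euler_op_transpose P (dist_of (F m)) h) \<longlonglongrightarrow> euler_op_transpose P (dist_of f) h"
      by (rule transpose_limit[OF f Fcont h])
    ultimately show ?thesis using LIMSEQ_unique by (fastforce simp: dist_of_def)
  qed
  \<comment> \<open>The limit solves the transposed equation with right-hand side \<open>g\<close>
    living on \<open>\<omega>1\<close>; convexity moves its support from \<open>\<omega>3\<close> to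
    \<open>\<omega>\<close>.\<close>
  have "f \<in> sobolev0 1 \<omega>" by (rule conv[OF fS gS]) (use deq in \<open>simp add: dist_eq_on_def\<close>)
  then have fz: "f x = 0" if "x \<notin> closure \<omega>" for x using sobolev0_vanish[OF _ fcont that] by blast

  \<comment> \<open>Cutting the sequence off inside the domain of the old solution\<close>
  obtain \<kappa> K2 where \<kappa>: "\<kappa> \<in> coord_alg" "compact K2" "K2 \<subseteq> \<omega>2" "\<And>x. x \<in> closure \<omega> \<Longrightarrow> \<kappa> x = 1" "\<And>x. x \<notin> K2 \<Longrightarrow> \<kappa> x = 0"
    using cutoff_exists[OF \<omega>(1) o2 \<omega>(2)] by blast
  \<comment> \<open>The cut off sequence has the same limit, because \<open>\<kappa>\<close> is 1
    wherever \<open>f\<close> can be nonzero, but its members are test functions on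
    \<open>\<omega>2\<close>, where \<open>S\<close> solves the equation.\<close>
  define F' where "F' m x = \<kappa> x * F m x" for m x
  have s\<kappa>: "smooth \<kappa>" by (rule coord_alg_smooth[OF \<kappa>(1)])
  have F'K: "F' m \<in> smooth_in K" for m unfolding F'_def by (rule smooth_in_mult[OF s\<kappa> FK])
  have F'2: "F' m \<in> test_functions \<omega>2" for m
    by (rule test_functionsI[OF \<kappa>(2,3)]) (use \<kappa>(5) smooth_inD(1)[OF F'K[of m]] in \<open>auto simp: smooth_in_def F'_def\<close>)
  have tF': "tame K L b (lpoly_of P) F'" unfolding F'_def by (rule tame_coord_alg[OF K b0 \<kappa>(1) tF])
  have F'c: "qcauchy L b F'" by (rule tame_qcauchy[OF tF'])
  have AF'c: "qcauchy L b (\<lambda>m. A (F' m))" using tF' hasse_closure.self[of "lpoly_of P"] by (simp add: tame_def A_def)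
  obtain f' where f': "uniform_limit UNIV F' f' sequentially" using qcauchy_uniform[OF K bb F'K F'c L0] by auto
  have "f' x = f x" for x
  proof -
    have "(\<lambda>m. F' m x) \<longlonglongrightarrow> f' x" by (rule tendsto_uniform_limitI[OF f']) simp
    moreover have "(\<lambda>m. F' m x) \<longlonglongrightarrow> \<kappa> x * f x"
      unfolding F'_def by (intro tendsto_mult_left tendsto_uniform_limitI[OF f]) simp
    ultimately have "f' x = \<kappa> x * f x" by (rule LIMSEQ_unique)
    then show ?thesis using fz[of x] \<kappa>(4)[of x] by (cases "x \<in> closure \<omega>") auto
  qed
  then have F'f: "uniform_limit UNIV F' f sequentially" using f' by (simp add: fun_eq_iff[symmetric] ext[of f' f])
  have minus_q: "qcauchy L b (\<lambda>m x. u m x - v m x)"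
    if "qcauchy L b u" "\<And>m. u m \<in> smooth_in K" "qcauchy L b v" "\<And>m. v m \<in> smooth_in K" for u v
    using qcauchy_add[OF K b0 that(2,1) smooth_in_cmult[OF that(4)] qcauchy_mult[OF K b0 that(4,3) smooth_const], of "-1"] by simp
  have Gcb: "qcauchy L b G"
  proof -
    obtain C where "C \<ge> 0" "\<And>f. f \<in> smooth_in K \<Longrightarrow> qnorm L b f \<le> C * qnorm L c f"
      using qnorm_mono_weight[OF K] bc by (meson less_imp_le)
    then show ?thesis by (intro qcauchy_image[OF Gc]) (auto intro: smooth_in_diff GK)
  qed
  \<comment> \<open>The sequence is Cauchy for the exponent \<open>b\<close> and tends weakly to 0
    by the limit equation; closability turns this into norm convergence, in which \<open>S\<close>
    is continuous. The same reasoning serves \<open>lim2\<close> and \<open>T\<close>.\<close>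
  have lim1: "(\<lambda>m. qnorm L b (\<lambda>x. A (F' m) x - G m x)) \<longlonglongrightarrow> 0"
  proof (rule qnorm_closable[OF K bb])
    show "(\<lambda>x. A (F' j) x - G j x) \<in> smooth_in K" for j by (intro smooth_in_diff AK F'K GK)
    show "qcauchy L b (\<lambda>m x. A (F' m) x - G m x)" by (intro minus_q AF'c AK F'K Gcb GK)
    show "weakly_null (\<lambda>m x. A (F' m) x - G m x)"
      unfolding weakly_null_def
    proof
      fix h :: "real^'n \<Rightarrow> complex" assume h: "h \<in> test_functions UNIV"
      have i: "integrable lborel (\<lambda>x. u x * h x)" if "u \<in> smooth_in K" for u
        using smooth_in_integrable[OF K smooth_in_mult[OF test_functions_smooth[OF h] that]] by (simp add: mult.commute)
      have e: "(LINT x|lborel. (A (F' m) x - G m x) * h x) = euler_op_transpose P (dist_of (F' m)) h - (LINT x|lborel. G m x * h x)" for m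
        using transpose_test[OF K F'K h, of P m] i[OF AK[OF F'K]] i[OF GK] by (simp add: A_def left_diff_distrib)
      have "(\<lambda>m. LINT x|lborel. (A (F' m) x - G m x) * h x) \<longlonglongrightarrow> euler_op_transpose P (dist_of f) h - (LINT x|lborel. g x * h x)"
        unfolding e by (intro tendsto_diff transpose_limit[OF F'f smooth_in_continuous[OF F'K] h] uniform_limit_integral[OF g Gcont h])
      then show "(\<lambda>m. LINT x|lborel. (A (F' m) x - G m x) * h x) \<longlonglongrightarrow> 0" using deq[OF h] by (simp add: dist_of_def)
    qed
  qed
  have lim2: "(\<lambda>m. qnorm L b (\<lambda>x. F' m x - F m x)) \<longlonglongrightarrow> 0"
  proof (rule qnorm_closable[OF K bb])
    show "(\<lambda>x. F' j x - F j x) \<in> smooth_in K" for j by (intro smooth_in_diff F'K FK)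
    show "qcauchy L b (\<lambda>m x. F' m x - F m x)" by (intro minus_q F'c F'K Fc FK)
    have u: "uniform_limit UNIV (\<lambda>m x. F' m x - F m x) (\<lambda>x. f x - f x) sequentially" by (intro uniform_limit_intros F'f f)
    show "weakly_null (\<lambda>m x. F' m x - F m x)"
      unfolding weakly_null_def
      using uniform_limit_integral[OF u smooth_in_continuous[OF smooth_in_diff[OF F'K FK]]] by simp
  qed
  have lin_diff: "U (\<lambda>x. u x - v x) = U u - U v" if "linear_on_test_functions W U" "u \<in> test_functions W" "v \<in> test_functions W" for U W u v
    using linear_on_test_add[OF that(1,2) test_functions_cmult[OF that(3), of "-1"]] linear_on_test_cmult[OF that(1,3), of "-1"] by simp
  have AF'2: "A (F' m) \<in> test_functions \<omega>2" for m unfolding A_def by (rule test_functions_theta_poly[OF F'2])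
  have F'3: "F' m \<in> test_functions \<omega>3" for m by (rule test_functions_mono[OF F'2 sub(2)])
  have "(\<lambda>m. S (\<lambda>x. A (F' m) x - G m x)) \<longlonglongrightarrow> 0"
  proof (rule Lim_null_comparison)
    show "\<forall>\<^sub>F m in sequentially. norm (S (\<lambda>x. A (F' m) x - G m x)) \<le> C1 * qnorm L b (\<lambda>x. A (F' m) x - G m x)"
      by (intro always_eventually allI S(2) test_functions_diff AF'2 T12 FG)
    show "(\<lambda>m. C1 * qnorm L b (\<lambda>x. A (F' m) x - G m x)) \<longlonglongrightarrow> 0" using tendsto_mult_left[OF lim1, of C1] by simp
  qed
  moreover have "(\<lambda>m. T (\<lambda>x. F' m x - F m x)) \<longlonglongrightarrow> 0"
  proof (rule Lim_null_comparison)
    show "\<forall>\<^sub>F m in sequentially. norm (T (\<lambda>x. F' m x - F m x)) \<le> C2 * qnorm L b (\<lambda>x. F' m x - F m x)"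
      by (intro always_eventually allI T(2) test_functions_diff F'3 FG)
    show "(\<lambda>m. C2 * qnorm L b (\<lambda>x. F' m x - F m x)) \<longlonglongrightarrow> 0" using tendsto_mult_left[OF lim2, of C2] by simp
  qed
  ultimately have "(\<lambda>m. S (\<lambda>x. A (F' m) x - G m x) - T (\<lambda>x. F' m x - F m x)) \<longlonglongrightarrow> 0 - 0" by (rule tendsto_diff)
  \<comment> \<open>As \<open>S (A (F' m)) = T (F' m)\<close>, the cut off sequence cancels. What is
    left has real part 1 and yet tends to 0.\<close>
  moreover have "S (\<lambda>x. A (F' m) x - G m x) - T (\<lambda>x. F' m x - F m x) = T (F m) - S (G m)" for m
    using lin_diff[OF S(1) AF'2 T12[OF FG(2)], of m m] lin_diff[OF T(1) F'3 FG(1), of m m] S(3)[OF F'2, of m] by simp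
  ultimately have "(\<lambda>m. T (F m) - S (G m)) \<longlonglongrightarrow> 0" by simp
  then have "(\<lambda>m. Re (T (F m) - S (G m))) \<longlonglongrightarrow> Re 0" by (rule tendsto_Re)
  then show False using FG(3) by (simp add: LIMSEQ_const_iff)
qed

section \<open>Suprema of derivatives and weighted norms\<close>

text \<open>With the next lemma, the dictionary between multi-indices, which define finite order,
  and words, which define \<open>qnorm\<close>. It rests on the symmetry of mixed
  derivatives.\<close>

lemma op_monom_word: "\<exists>w. length w = mdegree \<alpha> \<and> (\<forall>f. smooth f \<longrightarrow> op_monom partial_deriv \<alpha> f = fold partial_deriv w f)"
proof (induction \<alpha> rule: multi_index_induct)
  case zero
  show ?case by (rule exI[of _ "[]"]) simp
next
  case (add \<alpha> i)
  then obtain w where w: "length w = mdegree \<alpha>" "\<And>f. smooth f \<Longrightarrow> op_monom partial_deriv \<alpha> f = fold partial_deriv w f" by blast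
  have "op_monom partial_deriv (\<alpha> + Poly_Mapping.single i 1) f = fold partial_deriv (i # w) f" if "smooth f" for f
    using partial.op_monom_Suc'[of f \<alpha> i] that w(2)[OF smooth_partial_deriv[OF that]] by simp
  then show ?case using w(1) by (intro exI[of _ "i # w"]) (simp add: mdegree_add del: One_nat_def)
qed

lemma word_op_monom: "\<exists>\<alpha>. mdegree \<alpha> = length w \<and> (\<forall>f. smooth f \<longrightarrow> fold partial_deriv w f = op_monom partial_deriv \<alpha> f)"
proof (induction w)
  case Nil
  show ?case by (rule exI[of _ 0]) simp
next
  case (Cons i w)
  then obtain \<alpha> where a: "mdegree \<alpha> = length w" "\<And>f. smooth f \<Longrightarrow> fold partial_deriv w f = op_monom partial_deriv \<alpha> f" by blast
  have "fold partial_deriv (i # w) f = op_monom partial_deriv (\<alpha> + Poly_Mapping.single i 1) f" if "smooth f" for f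
    using partial.op_monom_Suc'[of f \<alpha> i] that a(2)[OF smooth_partial_deriv[OF that]] by simp
  then show ?case using a(1) by (intro exI[of _ "\<alpha> + Poly_Mapping.single i 1"]) (simp add: mdegree_add del: One_nat_def)
qed

text \<open>Passing from suprema to \<open>qnorm\<close> costs \<open>CARD('n)\<close> derivatives;
  the way back in \<open>qnorm_le_sup_sum\<close> costs none.\<close>

lemma sup_sum_le_qnorm:
  fixes K :: "(real^'n::finite) set"
  assumes K: "compact K" and b: "0 < b" "b < 1" and L: "N + CARD('n) \<le> L"
  shows "\<exists>C\<ge>0. \<forall>f\<in>smooth_in K. (\<Sum>\<alpha> | mdegree \<alpha> \<le> N. SUP x. norm (op_monom partial_deriv \<alpha> f x)) \<le> C * qnorm L b f"
proof -
  obtain C where C: "C \<ge> 0" "\<And>f w x. f \<in> smooth_in K \<Longrightarrow> length w + CARD('n) \<le> L \<Longrightarrow> norm (fold partial_deriv w f x) \<le> C * qnorm L b f"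
    using sup_le_qnorm[OF K b, of L] by blast
  have "(\<Sum>\<alpha> | mdegree \<alpha> \<le> N. SUP x. norm (op_monom partial_deriv \<alpha> f x)) \<le> (real (card {\<alpha> :: 'n \<Rightarrow>\<^sub>0 nat. mdegree \<alpha> \<le> N}) * C) * qnorm L b f"
    if f: "f \<in> smooth_in K" for f
  proof -
    have "(SUP x. norm (op_monom partial_deriv \<alpha> f x)) \<le> C * qnorm L b f" if "mdegree \<alpha> \<le> N" for \<alpha>
    proof -
      obtain w where "length w = mdegree \<alpha>" "op_monom partial_deriv \<alpha> f = fold partial_deriv w f"
        using op_monom_word[of \<alpha>] smooth_inD(1)[OF f] by blast
      then show ?thesis using C(2)[OF f, of w] that L by (intro cSUP_least) auto
    qed
    then have "(\<Sum>\<alpha> | mdegree \<alpha> \<le> N. SUP x. norm (op_monom partial_deriv \<alpha> f x)) \<le> (\<Sum>\<alpha> | mdegree (\<alpha> :: 'n \<Rightarrow>\<^sub>0 nat) \<le> N. C * qnorm L b f)"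
      by (intro sum_mono) simp
    then show ?thesis by (simp add: mult.assoc)
  qed
  then show ?thesis using C(1) by (intro exI[of _ "real (card {\<alpha> :: 'n \<Rightarrow>\<^sub>0 nat. mdegree \<alpha> \<le> N}) * C"]) simp
qed

text \<open>\<open>f\<close> is dominated by \<open>s\<close> times a cutoff equal to 1 on
  \<open>K\<close>, so the weighted norm of that cutoff serves as the constant.\<close>

lemma wnorm_le_sup:
  assumes K: "compact K" and a: "\<And>i. a i > 0"
  shows "\<exists>C\<ge>0. \<forall>f\<in>smooth_in K. \<forall>s. (\<forall>x. norm (f x) \<le> s) \<longrightarrow> wnorm a f \<le> C * s"
proof -
  obtain \<kappa> K2 where \<kappa>: "\<kappa> \<in> coord_alg" "compact K2" "\<And>x. x \<in> K \<Longrightarrow> \<kappa> x = 1" "\<And>x. x \<notin> K2 \<Longrightarrow> \<kappa> x = 0"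
    using cutoff_exists[OF K open_UNIV subset_UNIV] by blast
  have \<kappa>K: "\<kappa> \<in> smooth_in K2" using coord_alg_smooth[OF \<kappa>(1)] \<kappa>(4) by (auto simp: smooth_in_def)
  have "wnorm a f \<le> wnorm a \<kappa> * s" if f: "f \<in> smooth_in K" and s: "\<And>x. norm (f x) \<le> s" for f s
  proof -
    have s0: "s \<ge> 0" using order_trans[OF norm_ge_zero s] .
    have "(LINT x|lborel. weight a x * (norm (f x))\<^sup>2) \<le> (LINT x|lborel. weight a x * (norm (of_real s * \<kappa> x))\<^sup>2)"
    proof (intro integral_mono wnorm_integrable[OF K f a] wnorm_integrable[OF \<kappa>(2) smooth_in_cmult[OF \<kappa>K] a])
      fix x
      have "norm (f x) \<le> norm (of_real s * \<kappa> x)"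
      proof (cases "x \<in> K")
        case True
        then show ?thesis using \<kappa>(3) s[of x] s0 by simp
      qed (use smooth_inD(2)[OF f] in simp)
      then show "weight a x * (norm (f x))\<^sup>2 \<le> weight a x * (norm (of_real s * \<kappa> x))\<^sup>2"
        by (intro mult_left_mono power_mono) (auto simp: weight_nonneg)
    qed
    then have "wnorm a f \<le> wnorm a (\<lambda>x. of_real s * \<kappa> x)" unfolding wnorm_def by (rule real_sqrt_le_mono)
    then show ?thesis using s0 by (simp add: wnorm_cmult mult.commute)
  qed
  then show ?thesis using wnorm_nonneg[of a \<kappa>] by blast
qed

text \<open>A real \<open>SUP\<close> is an upper bound only if the range is bounded above; here the
  boundedness comes from \<open>sup_le_qnorm\<close>.\<close>

lemma op_monom_le_sup:
  fixes K :: "(real^'n::finite) set"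
  assumes K: "compact K" and f: "f \<in> smooth_in K"
  shows "norm (op_monom partial_deriv \<alpha> f x) \<le> (SUP x. norm (op_monom partial_deriv \<alpha> f x))"
proof -
  obtain w where w: "op_monom partial_deriv \<alpha> f = fold partial_deriv w f"
    using op_monom_word[of \<alpha>] smooth_inD(1)[OF f] by blast
  have "\<exists>D. \<forall>f\<in>smooth_in K. \<forall>v x. length v + CARD('n) \<le> length w + CARD('n) \<longrightarrow>
      norm (fold partial_deriv v f x) \<le> D * qnorm (length w + CARD('n)) (1/2) f"
    using sup_le_qnorm[OF K, of "1/2" "length w + CARD('n)"] by auto
  then obtain D where "\<And>x. norm (fold partial_deriv w f x) \<le> D * qnorm (length w + CARD('n)) (1/2) f"
    using f by blast
  then have "bdd_above (range (\<lambda>x. norm (op_monom partial_deriv \<alpha> f x)))" unfolding w by (intro bdd_aboveI2)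
  then show ?thesis by (rule cSUP_upper[OF UNIV_I])
qed

lemma sup_sum_nonneg:
  assumes "compact K" "f \<in> smooth_in K"
  shows "0 \<le> (\<Sum>\<alpha> | mdegree \<alpha> \<le> N. SUP x. norm (op_monom partial_deriv \<alpha> f x))"
  by (intro sum_nonneg order_trans[OF norm_ge_zero op_monom_le_sup[OF assms, of _ 0]])

lemma qnorm_le_sup_sum:
  fixes K :: "(real^'n::finite) set"
  assumes K: "compact K" and b: "0 < b" "b < 1"
  shows "\<exists>C\<ge>0. \<forall>f\<in>smooth_in K. qnorm L b f \<le> C * (\<Sum>\<alpha> | mdegree \<alpha> \<le> L. SUP x. norm (op_monom partial_deriv \<alpha> f x))"
proof -
  obtain C where C: "C \<ge> 0" "\<And>f s. f \<in> smooth_in K \<Longrightarrow> (\<forall>x. norm (f x) \<le> s) \<Longrightarrow> wnorm (\<lambda>_. b) f \<le> C * s"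
    using wnorm_le_sup[OF K, of "\<lambda>_. b"] b by blast
  have "qnorm L b f \<le> (real (card (words L :: 'n list set)) * C) * (\<Sum>\<alpha> | mdegree \<alpha> \<le> L. SUP x. norm (op_monom partial_deriv \<alpha> f x))"
    if f: "f \<in> smooth_in K" for f
  proof -
    let ?s = "\<lambda>\<alpha>. SUP x. norm (op_monom partial_deriv \<alpha> f x)"
    have le: "norm (op_monom partial_deriv \<alpha> f x) \<le> ?s \<alpha>" for \<alpha> x
      by (rule op_monom_le_sup[OF K f])
    have s0: "?s \<alpha> \<ge> 0" for \<alpha> using order_trans[OF norm_ge_zero le] .
    have "wnorm (\<lambda>_. b) (fold partial_deriv w f) \<le> C * (\<Sum>\<alpha> | mdegree \<alpha> \<le> L. ?s \<alpha>)" if w: "w \<in> words L" for w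
    proof -
      obtain \<alpha> where \<alpha>: "mdegree \<alpha> = length w" "fold partial_deriv w f = op_monom partial_deriv \<alpha> f"
        using word_op_monom[of w] smooth_inD(1)[OF f] by blast
      have "wnorm (\<lambda>_. b) (fold partial_deriv w f) \<le> C * ?s \<alpha>"
        by (rule C(2)[OF smooth_in_fold[OF compact_imp_closed[OF K] f]]) (simp add: \<alpha>(2) le)
      also have "\<dots> \<le> C * (\<Sum>\<alpha> | mdegree \<alpha> \<le> L. ?s \<alpha>)"
        using w \<alpha>(1) by (intro mult_left_mono C(1) member_le_sum s0 finite_mdegree_le) (auto simp: words_def)
      finally show ?thesis .
    qed
    then have "(\<Sum>w\<in>words L. wnorm (\<lambda>_. b) (fold partial_deriv w f)) \<le> (\<Sum>w\<in>(words L :: 'n list set). C * (\<Sum>\<alpha> | mdegree \<alpha> \<le> L. ?s \<alpha>))"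
      by (rule sum_mono)
    then show ?thesis using qnorm_le_sum[of L b f] by (simp add: mult.assoc)
  qed
  then show ?thesis using C(1) by (intro exI[of _ "real (card (words L :: 'n list set)) * C"]) simp
qed

section \<open>Exhaustions and the construction of a solution\<close>

text \<open>That the closure of \<open>W (U n)\<close> lies in \<open>U (Suc n)\<close> leaves room
  for the cutoff in \<open>approximation_estimate\<close>: between the support of the limit and the
  set on which the previous solution is defined.\<close>

lemma adapted_exhaustion:
  fixes \<Omega> :: "(real^'n::finite) set"
  assumes \<Omega>: "open \<Omega>" and W: "\<And>U. U \<subset>\<subset> \<Omega> \<Longrightarrow> W U \<subset>\<subset> \<Omega>"
  obtains U where "\<And>n. U n \<subset>\<subset> \<Omega>" "\<And>n. U n \<subseteq> U (Suc n)" "\<And>n. closure (W (U n)) \<subseteq> U (Suc n)"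
    "\<And>K. compact K \<Longrightarrow> K \<subseteq> \<Omega> \<Longrightarrow> \<exists>n. K \<subseteq> U n"
proof -
  obtain C :: "nat \<Rightarrow> (real^'n) set" where C: "\<And>n. compact (C n)" "\<And>n. C n \<subseteq> \<Omega>" "\<And>n. C n \<subseteq> interior (C (Suc n))"
    "\<And>K. compact K \<Longrightarrow> K \<subseteq> \<Omega> \<Longrightarrow> \<exists>N. \<forall>n\<ge>N. K \<subseteq> C n"
    using open_Union_compact_subsets[OF \<Omega>] by metis
  have ex: "\<exists>V. V \<subset>\<subset> \<Omega> \<and> K \<subseteq> V" if K: "compact K" "K \<subseteq> \<Omega>" for K
  proof -
    obtain N where N: "K \<subseteq> C N" using C(4)[OF K] by blast
    have "closure (interior (C (Suc N))) \<subseteq> C (Suc N)" by (rule closure_minimal[OF interior_subset compact_imp_closed[OF C(1)]])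
    then have "interior (C (Suc N)) \<subset>\<subset> \<Omega>"
      using C(2)[of "Suc N"] compact_closure bounded_subset[OF compact_imp_bounded[OF C(1)] interior_subset]
      unfolding rel_compact_in_def by auto
    then show ?thesis using N C(3)[of N] by blast
  qed
  have "\<exists>U. \<forall>n. (U n \<subset>\<subset> \<Omega> \<and> C n \<subseteq> U n) \<and> U n \<subseteq> U (Suc n) \<and> closure (W (U n)) \<subseteq> U (Suc n)"
  proof (rule dependent_nat_choice)
    show "\<exists>V. V \<subset>\<subset> \<Omega> \<and> C 0 \<subseteq> V" by (rule ex[OF C(1,2)])
    fix V n assume V: "V \<subset>\<subset> \<Omega> \<and> C n \<subseteq> V"
    let ?K = "closure V \<union> closure (W V) \<union> C (Suc n)"
    have K: "?K \<subseteq> \<Omega>" "compact (closure V)" "compact (closure (W V))"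
      using V W[of V] C(2)[of "Suc n"] unfolding rel_compact_in_def by auto
    from ex[OF compact_Un[OF compact_Un[OF K(2,3)] C(1)] K(1)] obtain V' where "V' \<subset>\<subset> \<Omega>" "?K \<subseteq> V'" by blast
    then show "\<exists>V'. (V' \<subset>\<subset> \<Omega> \<and> C (Suc n) \<subseteq> V') \<and> V \<subseteq> V' \<and> closure (W V) \<subseteq> V'"
      using closure_subset[of V] by (intro exI[of _ V']) auto
  qed
  then obtain U where U: "\<And>n. U n \<subset>\<subset> \<Omega>" "\<And>n. C n \<subseteq> U n" "\<And>n. U n \<subseteq> U (Suc n)" "\<And>n. closure (W (U n)) \<subseteq> U (Suc n)" by blast
  have "\<exists>n. K \<subseteq> U n" if "compact K" "K \<subseteq> \<Omega>" for K
    using C(4)[OF that] U(2) by (meson order_refl subset_trans)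
  from that[where U=U, OF U(1,3,4) this] show ?thesis .
qed

lemma fun_subspace_test_functions: "fun_subspace (test_functions \<Omega>)"
  by (simp add: fun_subspace_def test_functions_zero test_functions_add test_functions_cmult)

lemma linear_on_test_iff: "linear_on_test_functions \<Omega> T \<longleftrightarrow> clinear_on (test_functions \<Omega>) T"
  by (simp add: linear_on_test_functions_def clinear_on_def)

lemma seminorm_on_qnorm:
  assumes "compact (closure U)" "b > 0"
  shows "seminorm_on (test_functions U) (qnorm L b)"
  unfolding seminorm_on_def
  using qnorm_add[OF assms(1) test_functions_smooth_in[OF _ closure_subset] test_functions_smooth_in[OF _ closure_subset] assms(2)]
  by (simp add: qnorm_nonneg qnorm_cmult test_functions_smooth)

text \<open>The constant in \<open>hasse_closure\<close> bounds \<open>f\<close>, and hence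
  \<open>T f\<close>, by \<open>A f\<close>. So \<open>T\<close> defines a bounded functional on the
  range of \<open>A\<close>, which is extended.\<close>

lemma initial_solution:
  fixes P :: "(('n::finite \<Rightarrow>\<^sub>0 nat) \<Rightarrow>\<^sub>0 complex)" and U :: "(real^'n) set"
  defines "A \<equiv> theta_poly (\<lambda>_. 0) (lpoly_of P)"
  assumes P: "P \<noteq> 0" and U: "compact (closure U)" and bc: "0 < c" "c < b" "b \<le> 1"
    and T: "linear_on_test_functions U T" "\<And>f. f \<in> test_functions U \<Longrightarrow> norm (T f) \<le> C1 * qnorm L b f"
  shows "\<exists>S C. linear_on_test_functions U S \<and> (\<forall>f\<in>test_functions U. norm (S f) \<le> C * qnorm L c f) \<and>
    (\<forall>f\<in>test_functions U. S (A f) = T f)"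
proof -
  obtain Q0 c0 where Q0: "Q0 \<in> hasse_closure (lpoly_of P)" "c0 \<noteq> 0" "\<And>u f. theta_poly u Q0 f = (\<lambda>x. c0 * f x)"
    using hasse_closure_constant_lpoly_of[OF P] by metis
  obtain C2 where C2: "C2 \<ge> 0" "\<And>f. f \<in> smooth_in (closure U) \<Longrightarrow> qnorm L b (theta_poly (\<lambda>_. 0) Q0 f) \<le> C2 * qnorm L c (A f)"
    unfolding A_def using qnorm_hasse_estimate[OF U Q0(1) bc, of L "\<lambda>_. 0"] by blast
  have in_cl: "f \<in> smooth_in (closure U)" if "f \<in> test_functions U" for f
    by (rule test_functions_smooth_in[OF that closure_subset])
  define C where "C = \<bar>C1\<bar> * (C2 / norm c0)"
  have C0: "C \<ge> 0" using C2(1) by (simp add: C_def)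
  have le: "norm (T f) \<le> C * qnorm L c (A f)" if f: "f \<in> test_functions U" for f
  proof -
    have "norm c0 * qnorm L b f \<le> C2 * qnorm L c (A f)"
      using C2(2)[OF in_cl[OF f]] unfolding Q0(3) qnorm_cmult[OF test_functions_smooth[OF f]] .
    then have 1: "qnorm L b f \<le> C2 / norm c0 * qnorm L c (A f)" using Q0(2) by (simp add: pos_le_divide_eq mult.commute)
    have "norm (T f) \<le> \<bar>C1\<bar> * qnorm L b f" using T(2)[OF f] mult_right_mono[OF abs_ge_self qnorm_nonneg] by (rule order_trans)
    also have "\<dots> \<le> \<bar>C1\<bar> * (C2 / norm c0 * qnorm L c (A f))" by (rule mult_left_mono[OF 1]) simp
    finally show ?thesis by (simp add: C_def mult.assoc)
  qed
  let ?W = "test_functions U"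
  obtain G where G: "clinear_on ?W G" "\<And>f. f \<in> ?W \<Longrightarrow> norm (G f) \<le> C * qnorm L c f" "\<And>f. f \<in> ?W \<Longrightarrow> G (A f) = T f"
  \<comment> \<open>There is nothing to approximate yet: the subspace \<open>D1\<close> is
    zero.\<close>
  proof (rule sandwich_extension[of ?W "qnorm L c" "{\<lambda>x. 0}" "\<lambda>_. 0" ?W T A C 0])
    show "fun_subspace ?W" "fun_subspace ?W" by (rule fun_subspace_test_functions)+
    show "seminorm_on ?W (qnorm L c)" by (rule seminorm_on_qnorm[OF U bc(1)])
    show "fun_subspace {\<lambda>x. 0 :: complex}" by (simp add: fun_subspace_def)
    show "{\<lambda>x. 0} \<subseteq> ?W" by (simp add: test_functions_zero)
    show "clinear_on {\<lambda>x. 0} (\<lambda>_. 0)" by (simp add: clinear_on_def)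
    show "clinear_on ?W T" using T(1) by (simp add: linear_on_test_iff)
    show "\<And>f. f \<in> ?W \<Longrightarrow> A f \<in> ?W" unfolding A_def by (rule test_functions_theta_poly)
    show "\<And>f g. f \<in> ?W \<Longrightarrow> g \<in> ?W \<Longrightarrow> A (\<lambda>x. f x + g x) = (\<lambda>x. A f x + A g x)"
      unfolding A_def by (intro theta_poly_add test_functions_smooth)
    show "\<And>f c. f \<in> ?W \<Longrightarrow> A (\<lambda>x. c * f x) = (\<lambda>x. c * A f x)"
      unfolding A_def by (intro theta_poly_cmult test_functions_smooth)
    show "Re (T f) - Re 0 \<le> 0 * qnorm L c g + C * qnorm L c (\<lambda>x. A f x - g x)" if "f \<in> ?W" "g \<in> {\<lambda>x. 0}" for f g
      using le[OF that(1)] complex_Re_le_cmod[of "T f"] that(2) by simp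
  qed (use C0 in auto)
  then show ?thesis by (auto simp: linear_on_test_iff)
qed

text \<open>Extends the solution from \<open>\<omega>2\<close> to \<open>\<omega>3\<close> while
  changing it little on the smaller set \<open>\<omega>1\<close>. The error there is measured in the
  same exponent \<open>c\<close> as the new bound.\<close>

lemma solution_step:
  fixes P :: "(('n::finite \<Rightarrow>\<^sub>0 nat) \<Rightarrow>\<^sub>0 complex)" and \<omega>1 \<omega>2 \<omega>3 \<omega> :: "(real^'n) set"
  defines "A \<equiv> theta_poly (\<lambda>_. 0) (lpoly_of P)"
  assumes P: "P \<noteq> 0" and \<omega>3: "compact (closure \<omega>3)" and sub: "\<omega>1 \<subseteq> \<omega>2" "\<omega>2 \<subseteq> \<omega>3"
    and cw: "compact (closure \<omega>1)"
    and \<omega>: "compact (closure \<omega>)" "closure \<omega> \<subseteq> \<omega>2" and o2: "open \<omega>2"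
    and conv: "\<And>f g. f \<in> sobolev0 1 \<omega>3 \<Longrightarrow> g \<in> sobolev0 1 \<omega>1 \<Longrightarrow>
        dist_eq_on UNIV (euler_op_transpose P (dist_of f)) (dist_of g) \<Longrightarrow> f \<in> sobolev0 1 \<omega>"
    and bc: "0 < c" "c < b" "b < 1" and L: "CARD('n) + 1 \<le> L"
    and S: "linear_on_test_functions \<omega>2 S" "\<And>f. f \<in> test_functions \<omega>2 \<Longrightarrow> norm (S f) \<le> C1 * qnorm L b f"
      "\<And>f. f \<in> test_functions \<omega>2 \<Longrightarrow> S (A f) = T f"
    and T: "linear_on_test_functions \<omega>3 T" "\<And>f. f \<in> test_functions \<omega>3 \<Longrightarrow> norm (T f) \<le> C2 * qnorm L b f"
    and e: "e > 0"
  shows "\<exists>S' C. linear_on_test_functions \<omega>3 S' \<and> (\<forall>f\<in>test_functions \<omega>3. norm (S' f) \<le> C * qnorm L c f) \<and>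
    (\<forall>f\<in>test_functions \<omega>3. S' (A f) = T f) \<and> (\<forall>g\<in>test_functions \<omega>1. norm (S' g - S g) \<le> e * qnorm L c g)"
proof -
  have "\<exists>C\<ge>0. \<forall>f\<in>test_functions \<omega>3. \<forall>g\<in>test_functions \<omega>1.
     Re (T f) - Re (S g) \<le> e * qnorm L c g + C * qnorm L c (\<lambda>x. A f x - g x)"
    unfolding A_def
    by (rule approximation_estimate[OF P \<omega>3 sub cw \<omega> o2 conv bc L S(1,2) _ T e]) (use S(3) in \<open>auto simp: A_def\<close>)
  then obtain C where C: "C \<ge> 0" "\<And>f g. f \<in> test_functions \<omega>3 \<Longrightarrow> g \<in> test_functions \<omega>1 \<Longrightarrow>
     Re (T f) - Re (S g) \<le> e * qnorm L c g + C * qnorm L c (\<lambda>x. A f x - g x)" by blast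
  let ?W = "test_functions \<omega>3" and ?V = "test_functions \<omega>1"
  obtain G where G: "clinear_on ?W G" "\<And>f. f \<in> ?W \<Longrightarrow> norm (G f) \<le> C * qnorm L c f" "\<And>f. f \<in> ?W \<Longrightarrow> G (A f) = T f"
    "\<And>g. g \<in> ?V \<Longrightarrow> norm (G g - S g) \<le> e * qnorm L c g"
  proof (rule sandwich_extension[of ?W "qnorm L c" ?V S ?W T A C e])
    show "fun_subspace ?W" "fun_subspace ?W" "fun_subspace ?V" by (rule fun_subspace_test_functions)+
    show "seminorm_on ?W (qnorm L c)" by (rule seminorm_on_qnorm[OF \<omega>3 bc(1)])
    show "?V \<subseteq> ?W" using test_functions_mono[OF _ order_trans[OF sub]] by blast
    show "clinear_on ?V S" using S(1) test_functions_mono[OF _ sub(1)] unfolding linear_on_test_iff clinear_on_def by blast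
    show "clinear_on ?W T" using T(1) by (simp add: linear_on_test_iff)
    show "\<And>f. f \<in> ?W \<Longrightarrow> A f \<in> ?W" unfolding A_def by (rule test_functions_theta_poly)
    show "\<And>f g. f \<in> ?W \<Longrightarrow> g \<in> ?W \<Longrightarrow> A (\<lambda>x. f x + g x) = (\<lambda>x. A f x + A g x)"
      unfolding A_def by (intro theta_poly_add test_functions_smooth)
    show "\<And>f c. f \<in> ?W \<Longrightarrow> A (\<lambda>x. c * f x) = (\<lambda>x. c * A f x)"
      unfolding A_def by (intro theta_poly_cmult test_functions_smooth)
  qed (use C e in auto)
  then show ?thesis unfolding linear_on_test_iff by blast
qed

lemma geometric_steps_limit:
  fixes u :: "nat \<Rightarrow> complex"
  assumes u: "\<And>n. norm (u (Suc n) - u n) \<le> M * (1/2)^n"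
  obtains l where "u \<longlonglongrightarrow> l" "norm (l - u 0) \<le> 2 * M"
proof -
  let ?d = "\<lambda>n. u (Suc n) - u n"
  have g: "(\<lambda>n. M * (1/2)^n) sums (M * 2)" using sums_mult[OF geometric_sums[of "1/2::real"], of M] by simp
  have s: "summable ?d" by (rule summable_comparison_test'[OF sums_summable[OF g]]) (use u in auto)
  have "(\<lambda>n. (\<Sum>i<n. ?d i) + u 0) \<longlonglongrightarrow> suminf ?d + u 0" by (intro tendsto_add summable_LIMSEQ s tendsto_const)
  then have 1: "u \<longlonglongrightarrow> suminf ?d + u 0" by (simp add: sum_lessThan_telescope)
  have "norm (suminf ?d) \<le> suminf (\<lambda>n. M * (1/2)^n)" by (rule norm_suminf_le[OF u sums_summable[OF g]])
  then have "norm (suminf ?d + u 0 - u 0) \<le> 2 * M" using sums_unique[OF g] by simp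
  with 1 show ?thesis by (rule that)
qed

theorem theorem6:
  fixes P :: "('n::finite \<Rightarrow>\<^sub>0 nat) \<Rightarrow>\<^sub>0 complex"
    and \<Omega> :: "(real^'n) set"
  assumes "P \<noteq> 0" and "open \<Omega>" and "euler_convex P \<Omega>"
  shows "\<forall>T\<in>finite_order_distributions \<Omega>. \<exists>S\<in>finite_order_distributions \<Omega>.
           dist_eq_on \<Omega> (euler_op P S) T"
proof
  fix T assume "T \<in> finite_order_distributions \<Omega>"
  then have "linear_on_test_functions \<Omega> T \<and> (\<exists>N. \<forall>K. compact K \<and> K \<subseteq> \<Omega> \<longrightarrow> (\<exists>C. \<forall>\<phi>\<in>test_functions \<Omega>. closure {x. \<phi> x \<noteq> 0} \<subseteq> K \<longrightarrow>
        norm (T \<phi>) \<le> C * (\<Sum>\<alpha> | mdegree \<alpha> \<le> N. SUP x. norm (op_monom partial_deriv \<alpha> \<phi> x))))"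
    by (simp only: finite_order_distributions_def mem_Collect_eq)
  then obtain N where T: "linear_on_test_functions \<Omega> T" and N: "\<forall>K. compact K \<and> K \<subseteq> \<Omega> \<longrightarrow> (\<exists>C. \<forall>\<phi>\<in>test_functions \<Omega>. closure {x. \<phi> x \<noteq> 0} \<subseteq> K \<longrightarrow>
        norm (T \<phi>) \<le> C * (\<Sum>\<alpha> | mdegree \<alpha> \<le> N. SUP x. norm (op_monom partial_deriv \<alpha> \<phi> x)))"
    by (elim conjE exE) (rule that)
  have TN: "\<exists>C. \<forall>\<phi>\<in>test_functions \<Omega>. closure {x. \<phi> x \<noteq> 0} \<subseteq> K \<longrightarrow>
        norm (T \<phi>) \<le> C * (\<Sum>\<alpha> | mdegree \<alpha> \<le> N. SUP x. norm (op_monom partial_deriv \<alpha> \<phi> x))" if "compact K" "K \<subseteq> \<Omega>" for K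
    by (rule N[THEN spec, THEN mp, OF conjI[OF that]])
  \<comment> \<open>\<open>N\<close> for the order of \<open>T\<close>, \<open>CARD('n)\<close> for
    the supremum bound, and 1 for the first derivatives needed by \<open>sobolev0 1\<close>.\<close>
  define L where "L = N + CARD('n) + 1"
  let ?A = "theta_poly (\<lambda>_. 0) (lpoly_of P)"
  \<comment> \<open>Convexity is applied at Sobolev order 1, with \<open>order_refl\<close>
    discharging \<open>k \<ge> 1\<close>. The implication is moved under the existential quantifier
    so that \<open>W\<close> can be chosen as a total function.\<close>
  have "\<forall>U. \<exists>V. U \<subset>\<subset> \<Omega> \<longrightarrow> V \<subset>\<subset> \<Omega> \<and> (\<forall>\<omega>. \<omega> \<subset>\<subset> \<Omega> \<longrightarrow> (\<forall>f\<in>sobolev0 1 \<omega>.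
          (\<exists>g\<in>sobolev0 1 U. dist_eq_on UNIV (euler_op_transpose P (dist_of f)) (dist_of g)) \<longrightarrow> f \<in> sobolev0 1 V))"
    using assms(3)[unfolded euler_convex_def, rule_format, OF order_refl] by blast
  then obtain W where W': "\<forall>U. U \<subset>\<subset> \<Omega> \<longrightarrow> W U \<subset>\<subset> \<Omega> \<and> (\<forall>\<omega>. \<omega> \<subset>\<subset> \<Omega> \<longrightarrow> (\<forall>f\<in>sobolev0 1 \<omega>.
          (\<exists>g\<in>sobolev0 1 U. dist_eq_on UNIV (euler_op_transpose P (dist_of f)) (dist_of g)) \<longrightarrow> f \<in> sobolev0 1 (W U)))"
    by (rule choice[THEN exE])
  have W: "W U \<subset>\<subset> \<Omega>" if "U \<subset>\<subset> \<Omega>" for U using W' that by blast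
  have Wc: "f \<in> sobolev0 1 (W U)" if "U \<subset>\<subset> \<Omega>" "\<omega> \<subset>\<subset> \<Omega>" "f \<in> sobolev0 1 \<omega>" "g \<in> sobolev0 1 U"
    "dist_eq_on UNIV (euler_op_transpose P (dist_of f)) (dist_of g)" for U \<omega> f g
    using W' that by blast
  obtain U where U: "\<And>n. U n \<subset>\<subset> \<Omega>" "\<And>n. U n \<subseteq> U (Suc n)" "\<And>n. closure (W (U n)) \<subseteq> U (Suc n)"
    "\<And>K. compact K \<Longrightarrow> K \<subseteq> \<Omega> \<Longrightarrow> \<exists>n. K \<subseteq> U n"
    by (rule adapted_exhaustion[OF assms(2), of W]) (use W in blast)+
  have Uc: "compact (closure (U n))" and Uo: "open (U n)" and U\<Omega>: "closure (U n) \<subseteq> \<Omega>" for n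
    using U(1)[of n] by (auto simp: rel_compact_in_def)
  have U\<Omega>': "U n \<subseteq> \<Omega>" for n using U\<Omega>[of n] closure_subset[of "U n"] by blast
  have Um: "U m \<subseteq> U n" if "m \<le> n" for m n using lift_Suc_mono_le[of U, OF U(2) that] .
  have in_U: "f \<in> smooth_in (closure (U n))" if "f \<in> test_functions (U n)" for f n
    by (rule test_functions_smooth_in[OF that closure_subset])
  have TU: "linear_on_test_functions (U n) T" for n
    using T test_functions_mono[OF _ U\<Omega>'] unfolding linear_on_test_iff clinear_on_def by blast
  have Tb: "\<exists>C. \<forall>f\<in>test_functions (U n). norm (T f) \<le> C * qnorm L b f" if b: "0 < b" "b < 1" for n b
  proof -
    obtain C where C: "\<And>f. f \<in> test_functions \<Omega> \<Longrightarrow> closure {x. f x \<noteq> 0} \<subseteq> closure (U n) \<Longrightarrow>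
        norm (T f) \<le> C * (\<Sum>\<alpha> | mdegree \<alpha> \<le> N. SUP x. norm (op_monom partial_deriv \<alpha> f x))"
      using TN[OF Uc U\<Omega>] by blast
    obtain C' where C': "C' \<ge> 0" "\<And>f. f \<in> smooth_in (closure (U n)) \<Longrightarrow>
        (\<Sum>\<alpha> | mdegree \<alpha> \<le> N. SUP x. norm (op_monom partial_deriv \<alpha> f x)) \<le> C' * qnorm L b f"
      using sup_sum_le_qnorm[OF Uc b, of N L n] by (auto simp: L_def)
    have "norm (T f) \<le> (\<bar>C\<bar> * C') * qnorm L b f" if f: "f \<in> test_functions (U n)" for f
    proof -
      let ?s = "\<Sum>\<alpha> | mdegree \<alpha> \<le> N. SUP x. norm (op_monom partial_deriv \<alpha> f x)"
      have "norm (T f) \<le> C * ?s"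
        by (intro C test_functions_mono[OF f U\<Omega>'] smooth_in_supp in_U f closed_closure)
      also have "\<dots> \<le> \<bar>C\<bar> * (C' * qnorm L b f)"
        using C'(2)[OF in_U[OF f]] sup_sum_nonneg[OF Uc in_U[OF f]] by (intro mult_mono) auto
      finally show ?thesis by (simp add: mult.assoc)
    qed
    then show ?thesis by blast
  qed
  \<comment> \<open>Starts at 1/2 and decreases strictly to 1/4. Each step has a positive gap to
    lose, and norms with exponent 1/4 dominate all of them.\<close>
  define b where "b n = 1/4 + 1/(4 * real (Suc n))" for n
  have b: "1/4 < b n" "b n \<le> 1/2" "b (Suc n) < b n" for n by (auto simp: b_def field_simps)
  have b01: "0 < b n" "b n < 1" "b n \<le> 1" for n using b(1,2)[of n] by auto
  \<comment> \<open>The \<open>n\<close>-th functional solves the equation on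
    \<open>U (Suc n)\<close>, one set ahead of \<open>U n\<close>, on which it has to stay close to
    its successor.\<close>
  define good where "good n S \<longleftrightarrow> linear_on_test_functions (U (Suc n)) S \<and>
      (\<exists>C. \<forall>f\<in>test_functions (U (Suc n)). norm (S f) \<le> C * qnorm L (b n) f) \<and>
      (\<forall>f\<in>test_functions (U (Suc n)). S (?A f) = T f)" for n S
  have "\<exists>S. \<forall>n. good n (S n) \<and> (\<forall>g\<in>test_functions (U n). norm (S (Suc n) g - S n g) \<le> (1/2)^n * qnorm L (b (Suc n)) g)"
  proof (rule dependent_nat_choice)
    \<comment> \<open>The exponent 3/4 leaves a gap above \<open>b 0 = 1/2\<close> for the first
      solution.\<close>
    obtain C where "\<And>f. f \<in> test_functions (U (Suc 0)) \<Longrightarrow> norm (T f) \<le> C * qnorm L (3/4) f"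
      using Tb[of "3/4" "Suc 0"] by auto
    then show "\<exists>S. good 0 S"
      unfolding good_def
      using initial_solution[OF assms(1) Uc b01(1)[of 0] _ _ TU, of "3/4" "Suc 0" C L] b(2)[of 0] by auto
  next
    fix S n assume S: "good n S"
    obtain C1 where C1: "\<And>f. f \<in> test_functions (U (Suc n)) \<Longrightarrow> norm (S f) \<le> C1 * qnorm L (b n) f"
      using S unfolding good_def by blast
    have S': "linear_on_test_functions (U (Suc n)) S" "\<And>f. f \<in> test_functions (U (Suc n)) \<Longrightarrow> S (?A f) = T f"
      using S unfolding good_def by blast+
    obtain C2 where C2: "\<And>f. f \<in> test_functions (U (Suc (Suc n))) \<Longrightarrow> norm (T f) \<le> C2 * qnorm L (b n) f"
      using Tb[OF b01(1,2), of "Suc (Suc n)"] by blast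
    have e: "(1/2::real)^n > 0" and LL: "CARD('n) + 1 \<le> L" by (simp_all add: L_def)
    have cW: "compact (closure (W (U n)))" using W[OF U(1)] by (simp add: rel_compact_in_def)
    \<comment> \<open>\<open>\<omega>1\<close>, \<open>\<omega>2\<close>, \<open>\<omega>3\<close>
      are \<open>U n\<close>, \<open>U (Suc n)\<close>, \<open>U (Suc (Suc n))\<close>, and
      \<open>\<omega>\<close> is \<open>W (U n)\<close>; the exponent drops from \<open>b n\<close>
      to \<open>b (Suc n)\<close>.\<close>
    have "\<exists>S' C. linear_on_test_functions (U (Suc (Suc n))) S' \<and> (\<forall>f\<in>test_functions (U (Suc (Suc n))). norm (S' f) \<le> C * qnorm L (b (Suc n)) f) \<and>
      (\<forall>f\<in>test_functions (U (Suc (Suc n))). S' (?A f) = T f) \<and> (\<forall>g\<in>test_functions (U n). norm (S' g - S g) \<le> (1/2)^n * qnorm L (b (Suc n)) g)"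
      by (rule solution_step[OF assms(1) Uc U(2) U(2) Uc cW U(3) Uo Wc[OF U(1) U(1)] b01(1) b(3) b01(2) LL S'(1) C1 S'(2) TU C2 e])
    then show "\<exists>S'. good (Suc n) S' \<and> (\<forall>g\<in>test_functions (U n). norm (S' g - S g) \<le> (1/2)^n * qnorm L (b (Suc n)) g)"
      unfolding good_def by blast
  qed
  then obtain S where "\<forall>n. good n (S n) \<and> (\<forall>g\<in>test_functions (U n). norm (S (Suc n) g - S n g) \<le> (1/2)^n * qnorm L (b (Suc n)) g)" by blast
  then have Sg: "\<And>n. good n (S n)" and Sd: "\<And>n g. g \<in> test_functions (U n) \<Longrightarrow> norm (S (Suc n) g - S n g) \<le> (1/2)^n * qnorm L (b (Suc n)) g"
    by blast+
  define S' where "S' f = lim (\<lambda>n. S n f)" for f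
  \<comment> \<open>On \<open>U k\<close> the sequence counts from the index \<open>k\<close> on.
    All exponents being at least 1/4, the corrections are geometric in the single norm
    \<open>qnorm L (1/4)\<close>, which therefore bounds the limit on every
    \<open>U k\<close>.\<close>
  have lim: "\<exists>C\<ge>0. \<forall>f\<in>test_functions (U k). (\<lambda>n. S n f) \<longlonglongrightarrow> S' f \<and> norm (S' f) \<le> C * qnorm L (1/4) f" for k
  proof -
    obtain C where C: "C \<ge> 0" "\<And>f b. f \<in> smooth_in (closure (U k)) \<Longrightarrow> 1/4 \<le> b \<Longrightarrow> b \<le> 1 \<Longrightarrow> qnorm L b f \<le> C * qnorm L (1/4) f"
    proof -
      obtain C where C: "C \<ge> 0" "\<forall>f\<in>smooth_in (closure (U k)). \<forall>b c. 0 < c \<longrightarrow> c \<le> b \<longrightarrow> b \<le> 1 \<longrightarrow> qnorm L b f \<le> C * qnorm L c f"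
        using qnorm_mono_weight[OF Uc] by blast
      show thesis by (rule that[OF C(1)]) (use C(2)[rule_format, of _ "1/4"] in simp)
    qed
    obtain D where D: "\<And>f. f \<in> test_functions (U (Suc k)) \<Longrightarrow> norm (S k f) \<le> D * qnorm L (b k) f"
      using Sg[of k] unfolding good_def by blast
    have "(\<lambda>n. S n f) \<longlonglongrightarrow> S' f \<and> norm (S' f) \<le> (\<bar>D\<bar> * C + 2 * C) * qnorm L (1/4) f" if f: "f \<in> test_functions (U k)" for f
    proof -
      have qb: "qnorm L (b n) f \<le> C * qnorm L (1/4) f" for n using C(2)[OF in_U[OF f]] b(1)[of n] b01(3)[of n] by simp
      have "norm (S (Suc n + k) f - S (n + k) f) \<le> (C * qnorm L (1/4) f) * (1/2)^n" for n
      proof -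
        have "norm (S (Suc (n + k)) f - S (n + k) f) \<le> (1/2)^(n + k) * qnorm L (b (Suc (n + k))) f"
          by (intro Sd test_functions_mono[OF f] Um) simp
        also have "\<dots> \<le> (1/2)^n * (C * qnorm L (1/4) f)"
          by (intro mult_mono qb power_decreasing) (auto simp: qnorm_nonneg)
        finally show ?thesis by (simp add: mult.commute)
      qed
      then obtain l where l: "(\<lambda>n. S (n + k) f) \<longlonglongrightarrow> l" "norm (l - S (0 + k) f) \<le> 2 * (C * qnorm L (1/4) f)"
        using geometric_steps_limit[of "\<lambda>n. S (n + k) f"] by blast
      have 1: "(\<lambda>n. S n f) \<longlonglongrightarrow> l" by (rule LIMSEQ_offset[OF l(1)])
      have 2: "S' f = l" unfolding S'_def by (rule limI[OF 1])
      have "norm (S k f) \<le> \<bar>D\<bar> * qnorm L (b k) f"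
        by (rule order_trans[OF D[OF test_functions_mono[OF f U(2)]] mult_right_mono[OF abs_ge_self qnorm_nonneg]])
      also have "\<dots> \<le> \<bar>D\<bar> * (C * qnorm L (1/4) f)" by (intro mult_left_mono qb) simp
      finally have "norm l \<le> \<bar>D\<bar> * (C * qnorm L (1/4) f) + 2 * (C * qnorm L (1/4) f)"
        using l(2) norm_triangle_sub[of l "S k f"] by simp
      then show ?thesis using 1 2 by (simp add: algebra_simps)
    qed
    then show ?thesis using C(1) by (intro exI[of _ "\<bar>D\<bar> * C + 2 * C"]) auto
  qed
  have test_U: "\<exists>k. f \<in> test_functions (U k) \<and> g \<in> test_functions (U k)" if f: "f \<in> test_functions \<Omega>" and g: "g \<in> test_functions \<Omega>" for f g
  proof -
    obtain K where K: "compact K" "K \<subseteq> \<Omega>" "f \<in> smooth_in K" "g \<in> smooth_in K" by (rule test_functions2[OF f g])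
    then obtain k where "K \<subseteq> U k" using U(4) by blast
    then show ?thesis using K test_functionsI[OF K(1)] by blast
  qed
  have S'lim: "(\<lambda>n. S n f) \<longlonglongrightarrow> S' f" if "f \<in> test_functions \<Omega>" for f
    using test_U[OF that that] lim by blast
  have Slin: "clinear_on (test_functions (U k)) (S n)" if "k \<le> n" for k n
  proof -
    have "clinear_on (test_functions (U (Suc n))) (S n)" using Sg[of n] by (simp add: good_def linear_on_test_iff)
    then show ?thesis using test_functions_mono[OF _ Um[of k "Suc n"]] that unfolding clinear_on_def by (meson le_SucI)
  qed
  have lin: "linear_on_test_functions \<Omega> S'"
    unfolding linear_on_test_functions_def
  proof (intro conjI ballI allI)
    fix f g assume f: "f \<in> test_functions \<Omega>" and g: "g \<in> test_functions \<Omega>"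
    obtain k where k: "f \<in> test_functions (U k)" "g \<in> test_functions (U k)" using test_U[OF f g] by blast
    have "\<forall>\<^sub>F n in sequentially. S n f + S n g = S n (\<lambda>x. f x + g x)"
      using eventually_ge_at_top[of k] by eventually_elim (simp add: clinear_onD(1)[OF Slin k])
    then have "(\<lambda>n. S n (\<lambda>x. f x + g x)) \<longlonglongrightarrow> S' f + S' g"
      by (rule Lim_transform_eventually[OF tendsto_add[OF S'lim[OF f] S'lim[OF g]]])
    then show "S' (\<lambda>x. f x + g x) = S' f + S' g"
      using LIMSEQ_unique[OF S'lim[OF test_functions_add[OF f g]]] by blast
  next
    fix c f assume f: "f \<in> test_functions \<Omega>"
    obtain k where k: "f \<in> test_functions (U k)" using test_U[OF f f] by blast
    have "\<forall>\<^sub>F n in sequentially. c * S n f = S n (\<lambda>x. c * f x)"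
      using eventually_ge_at_top[of k] by eventually_elim (simp add: clinear_onD(2)[OF Slin k])
    then have "(\<lambda>n. S n (\<lambda>x. c * f x)) \<longlonglongrightarrow> c * S' f"
      by (rule Lim_transform_eventually[OF tendsto_mult_left[OF S'lim[OF f]]])
    then show "S' (\<lambda>x. c * f x) = c * S' f"
      using LIMSEQ_unique[OF S'lim[OF test_functions_cmult[OF f]]] by blast
  qed
  \<comment> \<open>The order \<open>L\<close> does not depend on \<open>K\<close>, only the
    constants do: this is finite order.\<close>
  have ord: "\<exists>C. \<forall>f\<in>test_functions \<Omega>. closure {x. f x \<noteq> 0} \<subseteq> K \<longrightarrow>
        norm (S' f) \<le> C * (\<Sum>\<alpha> | mdegree \<alpha> \<le> L. SUP x. norm (op_monom partial_deriv \<alpha> f x))" if K: "compact K" "K \<subseteq> \<Omega>" for K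
  proof -
    obtain k where k: "K \<subseteq> U k" using U(4)[OF K] by blast
    obtain C where C: "C \<ge> 0" "\<And>f. f \<in> test_functions (U k) \<Longrightarrow> norm (S' f) \<le> C * qnorm L (1/4) f" using lim[of k] by blast
    obtain D where D: "\<And>f. f \<in> smooth_in (closure (U k)) \<Longrightarrow> qnorm L (1/4) f \<le> D * (\<Sum>\<alpha> | mdegree \<alpha> \<le> L. SUP x. norm (op_monom partial_deriv \<alpha> f x))"
      using qnorm_le_sup_sum[OF Uc, of "1/4" k L] by auto
    have "norm (S' f) \<le> C * D * (\<Sum>\<alpha> | mdegree \<alpha> \<le> L. SUP x. norm (op_monom partial_deriv \<alpha> f x))"
      if f: "f \<in> test_functions \<Omega>" "closure {x. f x \<noteq> 0} \<subseteq> K" for f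
    proof -
      have fU: "f \<in> test_functions (U k)" using f k by (auto simp: test_functions_def)
      from C(2)[OF fU] mult_left_mono[OF D[OF in_U[OF fU]] C(1)] show ?thesis by (simp add: mult.assoc)
    qed
    then show ?thesis by blast
  qed
  have "S' (?A f) = T f" if f: "f \<in> test_functions \<Omega>" for f
  proof -
    obtain k where k: "f \<in> test_functions (U k)" using test_U[OF f f] by blast
    have SA: "S n (?A f) = T f" if "n \<ge> k" for n
      using Sg[of n] test_functions_mono[OF k Um[of k "Suc n"]] that unfolding good_def by auto
    have "\<forall>\<^sub>F n in sequentially. T f = S n (?A f)" by (rule eventually_sequentiallyI[of k]) (simp add: SA)
    then have "(\<lambda>n. S n (?A f)) \<longlonglongrightarrow> T f" by (rule Lim_transform_eventually[OF tendsto_const])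
    then show ?thesis using LIMSEQ_unique[OF S'lim[OF test_functions_theta_poly[OF f]]] by blast
  qed
  then have "dist_eq_on \<Omega> (euler_op P S') T" by (simp add: dist_eq_on_def euler_op_test[OF lin])
  moreover have "S' \<in> finite_order_distributions \<Omega>" 
    unfolding finite_order_distributions_def mem_Collect_eq by (intro conjI lin exI[of _ L] allI impI ord) simp_all
  ultimately show "\<exists>S\<in>finite_order_distributions \<Omega>. dist_eq_on \<Omega> (euler_op P S) T" by blast
qed

end
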